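(* Let $n\ge 1$ and let $X$ and $Y$ be independent unitarily invariant random $n\times n$ Hermitian matrices with probability densities $f_X$ and $f_Y$, respectively, with respect to the flat Lebesgue measure on $\mathrm{Herm}(n)$. Let $f_{X+Y}$ be the probability density of the sum $X+Y$. Then the spherical transforms satisfy $$\widehat{f}_{X+Y}=\widehat{f}_X\cdot\widehat{f}_Y ,$$ and, as a function of the eigenvalues $x=(x_1,\ldots,x_n)$, $$f_{X+Y}(x)=\frac{(\pi i)^{-n(n-1)/2}}{(2\pi)^n\, n!\,\Delta_n(x)}\int_{\mathbb{R}^n}\widehat{f}_X(s)\,\widehat{f}_Y(s)\,\det\left[e^{i s_j x_k}\right]_{j,k=1}^n\,\Delta_n(s)\,ds .$$
   Context: $\mathrm{Herm}(n)$ is the real vector space of $n\times n$ complex Hermitian matrices, with flat Lebesgue measure $dX=\prod_{j=1}^n dX_{jj}\prod_{j<k}d\,\mathrm{Re}\,X_{j,k}\,d\,\mathrm{Im}\,X_{j,k}$. A random Hermitian matrix with density $f$ (so $f\ge 0$, $\int f(X)\,dX=1$) is unitarily invariant if $f(UXU^* )=f(X)$ for every $U\in\mathrm{U}(n)$, $X\in\mathrm{Herm}(n)$; then $f$ depends only on the eigenvalues $x_1,\ldots,x_n$ of $X$, and one also writes $f(x)=f(x_1,\ldots,x_n)$, a symmetric function of $x\in\mathbb{R}^n$. $\Delta_n(x)=\prod_{j<k}(x_k-x_j)=\det[x_k^{j-1}]_{j,k=1}^n$ is the Vandermonde determinant, and $ds=ds_1\cdots ds_n$. For $s=(s_1,\ldots,s_n)\in\mathbb{R}^n$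 the spherical function is $$\varphi_s(X)=\int_{\mathrm{U}(n)}e^{i\,\mathrm{Tr}(SUXU^* )}\,dU,\qquad S=\mathrm{diag}(s_1,\ldots,s_n),$$ where $dU$ is normalized Haar measure on the unitary group $\mathrm{U}(n)$. The spherical transform of $f$ is $$\widehat f(s)=\int_{\mathrm{Herm}(n)}f(X)\,\varphi_s(-X)\,dX,\qquad s\in\mathbb{R}^n .$$ The integral over $\mathbb{R}^n$ in the second formula is understood in the sense of the multidimensional inverse Fourier transform (Fourier inversion). *)

theory Defs
  imports "HOL-Probability.Probability"
begin

text \<open>
  An \<open>n \<times> n\<close> matrix is indexed by a type \<open>'n\<close> with \<open>CARD('n) = n\<close>; the linear order on
  \<open>'n\<close> is the order of the indices \<open>1, \<dots>, n\<close>.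
\<close>

type_synonym 'n rvector = "real^'n"
type_synonym 'n rmatrix = "real^'n^'n"
type_synonym 'n cmatrix = "complex^'n^'n"

definition conj_transpose :: "complex^'n^'m \<Rightarrow> complex^'m^'n" where
  "conj_transpose A = (\<chi> j k. cnj (A $ k $ j))"

definition hermitian :: "('n::finite) cmatrix \<Rightarrow> bool" where
  "hermitian Z \<longleftrightarrow> conj_transpose Z = Z"

definition unitary :: "('n::finite) cmatrix \<Rightarrow> bool" where
  "unitary U \<longleftrightarrow> conj_transpose U ** U = mat 1 \<and> U ** conj_transpose U = mat 1"

definition diag_matrix :: "('n::finite) rvector \<Rightarrow> 'n cmatrix" where
  "diag_matrix x = (\<chi> j k. if j = k then complex_of_real (x $ j) else 0)"

text \<open>
  The entries of \<open>x\<close> are the eigenvalues of \<open>Z\<close>, with multiplicity and in some order: they are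
  the roots of the characteristic polynomial.
\<close>

definition eigenvalues :: "('n::finite) cmatrix \<Rightarrow> 'n rvector \<Rightarrow> bool" where
  "eigenvalues Z x \<longleftrightarrow> (\<forall>t::complex. det (mat t - Z) = (\<Prod>k\<in>UNIV. t - complex_of_real (x $ k)))"


subsection \<open>Flat Lebesgue measure on the Hermitian matrices\<close>

text \<open>
  The \<open>n\<^sup>2\<close> real coordinates of a Hermitian matrix are stored in a real matrix \<open>A\<close>: the real
  diagonal entries on the diagonal and, for \<open>j < k\<close>, the real part of the \<open>(j,k)\<close> entry
  at \<open>(j,k)\<close> and its imaginary part at \<open>(k,j)\<close>. As \<open>lborel\<close> on real matrices is the product of
  the one-dimensional Lebesgue measures of the entries, its image is \<open>dX\<close>. (The Lebesgue
  measure of the trace inner product is \<open>2^(n(n-1)/2)\<close> times this one.)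
\<close>

definition herm_of_coords :: "('n::{finite,linorder}) rmatrix \<Rightarrow> 'n cmatrix" where
  "herm_of_coords A = (\<chi> j k.
     if j < k then Complex (A $ j $ k) (A $ k $ j)
     else if j = k then Complex (A $ j $ j) 0
     else Complex (A $ k $ j) (- A $ j $ k))"

definition herm_lborel :: "('n::{finite,linorder}) cmatrix measure" where
  "herm_lborel = distr lborel (restrict_space borel {Z. hermitian Z}) herm_of_coords"

lemma bij_betw_herm_of_coords:
  "bij_betw (herm_of_coords :: ('a::{finite,linorder}) rmatrix \<Rightarrow> 'a cmatrix) UNIV {Z. hermitian Z}"
proof -
  let ?h = "herm_of_coords :: 'a rmatrix \<Rightarrow> 'a cmatrix"
  define r :: "'a cmatrix \<Rightarrow> 'a rmatrix"
    where "r Z = (\<chi> j k. if j \<le> k then Re (Z $ j $ k) else Im (Z $ k $ j))" for Z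
  have 1: "r (?h A) = A" for A
    by (auto simp: r_def herm_of_coords_def vec_eq_iff)
  have 2: "?h (r Z) = Z" if "hermitian Z" for Z
  proof -
    have h: "Z $ j $ k = cnj (Z $ k $ j)" for j k
      using that by (simp add: hermitian_def conj_transpose_def vec_eq_iff)
    have re: "Re (Z $ j $ k) = Re (Z $ k $ j)" for j k
      using arg_cong[OF h[of j k], of Re] by simp
    have im: "Im (Z $ j $ k) = - Im (Z $ k $ j)" for j k
      using arg_cong[OF h[of j k], of Im] by simp
    have im0: "Im (Z $ j $ j) = 0" for j
      using im[of j j] by linarith
    show ?thesis
    proof (unfold vec_eq_iff, intro allI)
      fix j k :: 'a
      consider "j < k" | "j = k" | "k < j" by (rule linorder_cases)
      thus "?h (r Z) $ j $ k = Z $ j $ k"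
        using re[of j k] im[of j k] im0[of j]
        by cases (auto simp: r_def herm_of_coords_def complex_eq_iff)
    qed
  qed
  have 3: "hermitian (?h A)" for A
    by (auto simp: herm_of_coords_def hermitian_def conj_transpose_def vec_eq_iff complex_eq_iff)
  show ?thesis
    by (rule bij_betw_byWitness[where f' = r]) (use 1 2 3 in auto)
qed

lemma measurable_herm_of_coords:
  "(herm_of_coords :: ('a::{finite,linorder}) rmatrix \<Rightarrow> 'a cmatrix) \<in> measurable lborel (restrict_space borel {Z. hermitian Z})"
proof (rule measurable_restrict_space2)
  show "herm_of_coords \<in> space lborel \<rightarrow> {Z. hermitian Z}"
    using bij_betw_herm_of_coords by (auto simp: bij_betw_def)
  have "continuous_on UNIV (herm_of_coords :: 'a rmatrix \<Rightarrow> 'a cmatrix)"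
    unfolding herm_of_coords_def
  proof (intro continuous_on_vec_lambda)
    fix j k :: 'a
    show "continuous_on UNIV (\<lambda>A :: 'a rmatrix.
        if j < k then Complex (A $ j $ k) (A $ k $ j)
        else if j = k then Complex (A $ j $ j) 0
        else Complex (A $ k $ j) (- A $ j $ k))"
      by (cases "j < k"; cases "j = k") (auto simp: Complex_eq intro!: continuous_intros)
  qed
  from borel_measurable_continuous_onI[OF this]
  show "(herm_of_coords :: 'a rmatrix \<Rightarrow> 'a cmatrix) \<in> lborel \<rightarrow>\<^sub>M borel"
    by simp
qed


subsection \<open>Spherical functions and the spherical transform\<close>

definition unitarily_invariant :: "(('n::finite) cmatrix \<Rightarrow> 'a) \<Rightarrow> bool" where
  "unitarily_invariant f \<longleftrightarrow>
     (\<forall>U Z. unitary U \<longrightarrow> hermitian Z \<longrightarrow> f (U ** Z ** conj_transpose U) = f Z)"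

text \<open>
  As the unitary group is compact, its left Haar measure is finite and bi-invariant; there is exactly
  one that is normalized to total mass \<open>1\<close>.
\<close>

definition is_normalized_haar :: "('n::finite) cmatrix measure \<Rightarrow> bool" where
  "is_normalized_haar \<mu> \<longleftrightarrow>
     sets \<mu> = sets (restrict_space borel {U. unitary U}) \<and> prob_space \<mu> \<and>
     (\<forall>V. unitary V \<longrightarrow> distr \<mu> \<mu> (\<lambda>U. V ** U) = \<mu>)"

definition haar :: "('n::finite) cmatrix measure" where
  "haar = (THE \<mu>. is_normalized_haar \<mu>)"

definition spherical_function :: "('n::finite) rvector \<Rightarrow> 'n cmatrix \<Rightarrow> complex" where
  "spherical_function s Z =
     (LINT U|haar. exp (\<i> * trace (diag_matrix s ** U ** Z ** conj_transpose U)))"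

definition spherical_transform ::
    "(('n::{finite,linorder}) cmatrix \<Rightarrow> real) \<Rightarrow> 'n rvector \<Rightarrow> complex" where
  "spherical_transform f s =
     (LINT Z|herm_lborel. complex_of_real (f Z) * spherical_function s (- Z))"

definition vandermonde :: "('n::{finite,linorder}) rvector \<Rightarrow> real" where
  "vandermonde x = (\<Prod>(j, k)\<in>{(j, k). j < k}. x $ k - x $ j)"


subsection \<open>Integrals in the sense of Fourier inversion\<close>

text \<open>
  The spherical transform of a probability density need not decay, so the inversion integral need
  not converge absolutely. As in the Fourier inversion theorem for \<open>L\<^sup>1\<close> functions, it is
  understood as the limit of its Gauss means; this is the Lebesgue integral whenever the
  integrand is Lebesgue integrable.
\<close>

definition has_fourier_integral :: "('a::euclidean_space \<Rightarrow> complex) \<Rightarrow> complex \<Rightarrow> bool" where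
  "has_fourier_integral g J \<longleftrightarrow>
     (\<forall>\<epsilon>>0. integrable lborel (\<lambda>s. exp (- \<epsilon> * (norm s)\<^sup>2) *\<^sub>R g s)) \<and>
     ((\<lambda>\<epsilon>. LINT s|lborel. exp (- \<epsilon> * (norm s)\<^sup>2) *\<^sub>R g s) \<longlongrightarrow> J) (at_right 0)"

lemma has_fourier_integral_lebesgue:
  fixes g :: "'a::euclidean_space \<Rightarrow> complex"
  assumes g: "integrable lborel g"
  shows "has_fourier_integral g J \<longleftrightarrow> J = (LINT s|lborel. g s)"
proof -
  have [measurable]: "g \<in> borel_measurable borel" using g by auto
  have le: "norm (exp (- \<epsilon> * (norm s)\<^sup>2) *\<^sub>R g s) \<le> norm (g s)" if "\<epsilon> > 0" for \<epsilon> :: real and s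
    using that by (auto intro!: mult_left_le_one_le)
  have int: "integrable lborel (\<lambda>s. exp (- \<epsilon> * (norm s)\<^sup>2) *\<^sub>R g s)" if "\<epsilon> > 0" for \<epsilon> :: real
    by (rule Bochner_Integration.integrable_bound[OF g]) (use le[OF that] in auto)
  have lim: "((\<lambda>\<epsilon>. LINT s|lborel. exp (- \<epsilon> * (norm s)\<^sup>2) *\<^sub>R g s) \<longlongrightarrow> (LINT s|lborel. g s))
      (at_right 0)"
  proof (rule tendsto_at_right_sequentially[where b = 1])
    fix S :: "nat \<Rightarrow> real"
    assume S: "\<And>n. 0 < S n" "S \<longlonglongrightarrow> 0"
    show "(\<lambda>n. LINT s|lborel. exp (- S n * (norm s)\<^sup>2) *\<^sub>R g s) \<longlonglongrightarrow> (LINT s|lborel. g s)"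
    proof (rule integral_dominated_convergence[where w = "\<lambda>s. norm (g s)"])
      show "AE s in lborel. (\<lambda>n. exp (- S n * (norm s)\<^sup>2) *\<^sub>R g s) \<longlonglongrightarrow> g s"
      proof (rule AE_I2)
        fix s :: 'a
        have "(\<lambda>n. exp (- S n * (norm s)\<^sup>2) *\<^sub>R g s) \<longlonglongrightarrow> exp (- 0 * (norm s)\<^sup>2) *\<^sub>R g s"
          by (intro tendsto_intros S)
        thus "(\<lambda>n. exp (- S n * (norm s)\<^sup>2) *\<^sub>R g s) \<longlonglongrightarrow> g s" by simp
      qed
    qed (use g le[OF S(1)] in auto)
  qed simp
  show ?thesis
    unfolding has_fourier_integral_def
  proof (intro iffI conjI)
    show "J = (LINT s|lborel. g s)"
      if "(\<forall>\<epsilon>>0. integrable lborel (\<lambda>s. exp (- \<epsilon> * (norm s)\<^sup>2) *\<^sub>R g s)) \<and>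
        ((\<lambda>\<epsilon>. LINT s|lborel. exp (- \<epsilon> * (norm s)\<^sup>2) *\<^sub>R g s) \<longlongrightarrow> J) (at_right 0)"
      using tendsto_unique[OF trivial_limit_at_right_real conjunct2[OF that] lim] .
  qed (use int lim in blast)+
qed

end

theory Submission
  imports Defs
begin

text \<open>
  Write \<open>\<Delta>\<close> for the Vandermonde product.

  The product formula. For a unitarily invariant law \<open>\<mu>\<close>, Fubini shows that the orbit average in the spherical function can be dropped:
  the integral of \<open>\<phi>\<^sub>s(-Z)\<close> against \<open>\<mu>\<close> equals that of \<open>exp (- i \<Sum> s\<^sub>k Z\<^sub>k\<^sub>k)\<close> (\<open>integral_spherical_neg\<close>). So the spherical
  transform of \<open>f\<close> is the ordinary characteristic function at \<open>diag(s)\<close>, the law of \<open>X + Y\<close> is again invariant, and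
  independence yields the product (\<open>integral_spherical_neg_add\<close>).

  The inversion formula. Insert the factor \<open>exp (- \<epsilon> \<bar>s\<bar>\<^sup>2)\<close> and expand the determinant over the permutations. By antisymmetry all
  \<open>n!\<close> terms agree, and after integrating over \<open>s\<close> the Gauss mean for a single matrix \<open>Z\<close> becomes a constant times the orbit average of
  \<open>\<Delta>(x - d) exp (- \<bar>x - d\<bar>\<^sup>2 / (4 \<epsilon>))\<close>, where \<open>d\<close> is the diagonal of \<open>U Z U\<^sup>-\<^sup>1\<close>. The heart of the proof is that this
  average equals \<open>\<Delta>(x)\<close> times the average of the full heat kernel \<open>exp (- \<bar>diag(x) - U Z U\<^sup>-\<^sup>1\<bar>\<^sup>2 / (4 \<epsilon>))\<close>
  (\<open>heat_kernel_identity\<close>). It follows from two facts. First, invariance of Haar measure under rotations in coordinate planes gives an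
  identity between orbit averages of \<open>exp (\<Sum> y\<^sub>k d\<^sub>k)\<close> that holds for all complex \<open>y\<close> (\<open>orbit_sum_identity\<close>). Secondly, a Gaussian average
  of \<open>\<Delta>\<close> along an imaginary direction is \<open>\<Delta>\<close> again, as the monic Hermite polynomials have the same determinant as the
  monomials (\<open>gaussian_integral_cvandermonde\<close>). Together they show that a suitable one-parameter family of averages is constant
  (\<open>vandermonde_average_invariant\<close>).

  Consequently the Gauss mean of the inversion integral, with the constants of the formula, is the convolution of the density
  of \<open>X + Y\<close> with the heat kernel on the Hermitian matrices, evaluated at \<open>diag(x)\<close> (\<open>gauss_mean_det\<close>, \<open>inversion_constant\<close>). As \<open>\<epsilon>\<close> tends
  to \<open>0\<close> it converges to the density at every Lebesgue point, hence almost everywhere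
  (\<open>lebesgue_points\<close>, \<open>gaussian_mean_at_lebesgue_point\<close>).

  Null sets. For almost every \<open>Z\<close> the eigenvalues are distinct, because the discriminant is a polynomial with finitely many zeros on
  each line of a suitable direction (\<open>AE_distinct_eigenvalues\<close>). For the formula at almost every \<open>x\<close>, the exceptional null set of matrices has to miss
  some point of the orbit of almost every \<open>x\<close>. This holds because the image of \<open>\<Delta>(x)\<^sup>2 exp (- \<bar>x\<bar>\<^sup>2) dx \<otimes> dU\<close> on the matrices is
  dominated by Lebesgue measure, which follows from the same Gaussian integral with the roles of \<open>x\<close> and \<open>Z\<close> exchanged
  (\<open>heat_kernel_average_bounded\<close>, \<open>AE_orbit_avoids_null\<close>).

  Haar measure is constructed by projecting Lebesgue measure to the unitary group with the polar decomposition
  (\<open>ex_normalized_haar\<close>), and a Fubini argument shows that it is unique and invariant under inversion (\<open>normalized_haar_eq_inverse\<close>). The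
  spectral theorem comes from maximizing a linear functional of the diagonal over the orbit (\<open>spectral_theorem\<close>).
\<close>

section \<open>Differentiation under the integral sign\<close>

lemma has_vector_derivative_iff_quotient:
  "(f has_vector_derivative D) (at x) \<longleftrightarrow> ((\<lambda>t. (1 / (t - x)) *\<^sub>R (f t - f x)) \<longlongrightarrow> D) (at x)"
proof -
  have eq: "norm ((f t - f x) - (t - x) *\<^sub>R D) / norm (t - x) = norm ((1 / (t - x)) *\<^sub>R (f t - f x) - D)"
    if "t \<noteq> x" for t
  proof -
    have "(1 / (t - x)) *\<^sub>R (f t - f x) - D = (1 / (t - x)) *\<^sub>R ((f t - f x) - (t - x) *\<^sub>R D)"
      using that by (simp add: scaleR_diff_right)
    then show ?thesis by simp
  qed
  have "(f has_vector_derivative D) (at x) \<longleftrightarrow>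
      ((\<lambda>t. norm ((f t - f x) - (t - x) *\<^sub>R D) / norm (t - x)) \<longlongrightarrow> 0) (at x)"
    by (simp add: has_vector_derivative_def has_derivative_iff_norm bounded_linear_scaleR_left)
  also have "\<dots> \<longleftrightarrow> ((\<lambda>t. norm ((1 / (t - x)) *\<^sub>R (f t - f x) - D)) \<longlongrightarrow> 0) (at x)"
    by (rule filterlim_cong[OF refl refl]) (use eq in \<open>auto simp: eventually_at_filter\<close>)
  also have "\<dots> \<longleftrightarrow> ((\<lambda>t. (1 / (t - x)) *\<^sub>R (f t - f x)) \<longlongrightarrow> D) (at x)"
    by (simp add: tendsto_norm_zero_iff LIM_zero_iff)
  finally show ?thesis .
qed

text \<open>
  Dominated convergence for the difference quotients: the mean value inequality bounds them by the
  same function \<open>g\<close> that bounds the derivative.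
\<close>

lemma has_vector_derivative_integral:
  fixes f :: "real \<Rightarrow> 'a \<Rightarrow> 'b::{banach,second_countable_topology}"
  assumes x: "a < x" "x < b"
    and f: "\<And>t. a < t \<Longrightarrow> t < b \<Longrightarrow> integrable M (f t)"
    and f': "\<And>t w. a < t \<Longrightarrow> t < b \<Longrightarrow> w \<in> space M \<Longrightarrow>
              ((\<lambda>t. f t w) has_vector_derivative f' t w) (at t)"
    and bound: "\<And>t w. a < t \<Longrightarrow> t < b \<Longrightarrow> w \<in> space M \<Longrightarrow> norm (f' t w) \<le> g w"
    and g: "integrable M g"
  shows "integrable M (f' x)"
    and "((\<lambda>t. \<integral>w. f t w \<partial>M) has_vector_derivative (\<integral>w. f' x w \<partial>M)) (at x)"
proof -
  let ?q = "\<lambda>t w. (1 / (t - x)) *\<^sub>R (f t w - f x w)"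
  have quot: "norm (?q t w) \<le> g w" if t: "a < t" "t < b" and w: "w \<in> space M" for t w
  proof -
    have "norm (f t w - f x w) \<le> g w * norm (t - x)"
    proof -
      have D: "((\<lambda>t. f t w) has_derivative (\<lambda>h. h *\<^sub>R f' u w)) (at u within {a<..<b})"
        if "u \<in> {a<..<b}" for u
        using f'[of u w] that w by (auto simp: has_vector_derivative_def intro: has_derivative_at_withinI)
      have B: "onorm (\<lambda>h. h *\<^sub>R f' u w) \<le> g w" if "u \<in> {a<..<b}" for u
      proof -
        have 0: "0 \<le> g w" by (rule order_trans[OF norm_ge_zero bound[of u w]]) (use that w in auto)
        have 1: "norm (h *\<^sub>R f' u w) \<le> g w * norm h" for h
          using mult_left_mono[OF bound[of u w], of "\<bar>h\<bar>"] that w by (simp add: mult.commute)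
        show ?thesis by (rule onorm_bound[where f="\<lambda>h. h *\<^sub>R f' u w", OF 0]) (rule 1)
      qed
      have "t \<in> {a<..<b}" "x \<in> {a<..<b}" using t x by auto
      from differentiable_bound[where f="\<lambda>t. f t w" and f'="\<lambda>u h. h *\<^sub>R f' u w" and B="g w", OF _ D B this]
      show ?thesis by simp
    qed
    moreover have "0 \<le> g w" by (rule order_trans[OF norm_ge_zero bound[of x w]]) (use x w in auto)
    ultimately show ?thesis by (cases "t = x") (auto simp: divide_simps mult.commute)
  qed
  have lim: "((\<lambda>t. ?q t w) \<longlongrightarrow> f' x w) (at x)" if "w \<in> space M" for w
    using f'[OF x that] by (simp add: has_vector_derivative_iff_quotient)
  \<comment> \<open>Along one sequence of difference quotients \<open>f' x\<close> is a limit of measurable functions.\<close>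
  define X where "X n = x + (b - x) / 2 / (real n + 1)" for n :: nat
  have X: "a < X n" "X n < b" "X n \<noteq> x" for n
  proof -
    have "0 < (b - x) / 2 / (real n + 1)" using x by simp
    have "(b - x) / 2 / (real n + 1) \<le> (b - x) / 2"
      using x divide_left_mono[of 1 "real n + 1" "(b - x) / 2"] by simp
    define h where "h = (b - x) / 2 / (real n + 1)"
    have "X n = x + h" "0 < h" "h \<le> (b - x) / 2"
      using \<open>0 < (b - x) / 2 / (real n + 1)\<close> \<open>(b - x) / 2 / (real n + 1) \<le> (b - x) / 2\<close>
      by (auto simp: X_def h_def)
    then show "a < X n" "X n < b" "X n \<noteq> x" using x by auto
  qed
  have Xlim: "X \<longlonglongrightarrow> x" unfolding X_def by real_asymp
  have meas: "f' x \<in> borel_measurable M"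
  proof (rule borel_measurable_LIMSEQ_metric)
    show "?q (X n) \<in> borel_measurable M" for n
      using f[OF X(1,2)] f[OF x] by (auto intro!: borel_measurable_integrable)
    show "(\<lambda>n. ?q (X n) w) \<longlonglongrightarrow> f' x w" if "w \<in> space M" for w
      using lim[OF that] Xlim X(3) by (auto simp: tendsto_at_iff_sequentially comp_def)
  qed
  show int: "integrable M (f' x)"
    by (rule Bochner_Integration.integrable_bound[OF g meas]) (use order_trans[OF bound[OF x] abs_ge_self] in auto)
  have "((\<lambda>t. \<integral>w. ?q t w \<partial>M) \<longlongrightarrow> (\<integral>w. f' x w \<partial>M)) (at x)"
  proof (rule tendsto_at_iff_sequentially[THEN iffD2], intro allI impI)
    fix Y :: "nat \<Rightarrow> real"
    assume Y: "\<forall>i. Y i \<in> UNIV - {x}" "Y \<longlonglongrightarrow> x"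
    have "eventually (\<lambda>n. Y n \<in> {a<..<b}) sequentially"
      using Y(2) x by (intro topological_tendstoD) auto
    then obtain N where N: "\<And>n. n \<ge> N \<Longrightarrow> Y n \<in> {a<..<b}"
      by (auto simp: eventually_sequentially)
    have "(\<lambda>n. \<integral>w. ?q (Y (n + N)) w \<partial>M) \<longlonglongrightarrow> (\<integral>w. f' x w \<partial>M)"
    proof (rule integral_dominated_convergence[where w=g])
      show "?q (Y (n + N)) \<in> borel_measurable M" for n
        using f[of "Y (n + N)"] N[of "n + N"] f[OF x] by (auto intro!: borel_measurable_integrable)
      show "AE w in M. (\<lambda>n. ?q (Y (n + N)) w) \<longlonglongrightarrow> f' x w"
      proof (rule AE_I2)
        fix w assume "w \<in> space M"
        from lim[OF this] have "(\<lambda>n. ?q (Y n) w) \<longlonglongrightarrow> f' x w"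
          using Y by (auto simp: tendsto_at_iff_sequentially comp_def)
        then show "(\<lambda>n. ?q (Y (n + N)) w) \<longlonglongrightarrow> f' x w" by (rule LIMSEQ_ignore_initial_segment)
      qed
      show "AE w in M. norm (?q (Y (n + N)) w) \<le> g w" for n
        using N[of "n + N"] quot by (intro AE_I2) auto
    qed (use meas g in auto)
    then show "((\<lambda>t. \<integral>w. ?q t w \<partial>M) \<circ> Y) \<longlonglongrightarrow> (\<integral>w. f' x w \<partial>M)"
      unfolding comp_def by (rule LIMSEQ_offset)
  qed
  moreover have "\<forall>\<^sub>F t in at x. (\<integral>w. ?q t w \<partial>M) = (1 / (t - x)) *\<^sub>R ((\<integral>w. f t w \<partial>M) - (\<integral>w. f x w \<partial>M))"
  proof -
    have "\<forall>\<^sub>F t in at x. t \<in> {a<..<b}"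
      using x by (intro eventually_at_in_open') auto
    then show ?thesis
      by eventually_elim (use f f[OF x] in \<open>auto simp: Bochner_Integration.integral_diff\<close>)
  qed
  ultimately have "((\<lambda>t. (1 / (t - x)) *\<^sub>R ((\<integral>w. f t w \<partial>M) - (\<integral>w. f x w \<partial>M))) \<longlongrightarrow> (\<integral>w. f' x w \<partial>M)) (at x)"
    by (rule Lim_transform_eventually)
  then show "((\<lambda>t. \<integral>w. f t w \<partial>M) has_vector_derivative (\<integral>w. f' x w \<partial>M)) (at x)"
    by (simp add: has_vector_derivative_iff_quotient)
qed

section \<open>Linear maps that preserve Lebesgue measure\<close>

text \<open>
  Weil's uniqueness argument for Haar measure. Both sides are evaluations of
  \<open>\<integral>\<integral> 1\<^sub>A(x) 1\<^sub>B(x + y)\<close>: integrate first over \<open>y\<close> on the left, and on the right translate \<open>x\<close> by \<open>-y\<close> and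
  then reflect \<open>y\<close>.
\<close>

lemma translation_invariant_measure_proportional:
  fixes M :: "'a::euclidean_space measure"
  assumes sf: "sigma_finite_measure M" and [measurable_cong]: "sets M = sets borel"
    and inv: "\<And>c. distr M borel (\<lambda>x. c + x) = M"
    and A[measurable]: "A \<in> sets borel" and B[measurable]: "B \<in> sets borel"
  shows "emeasure M A * emeasure lborel B = emeasure lborel A * emeasure M B"
proof -
  interpret M: sigma_finite_measure M by fact
  interpret pair_sigma_finite M "lborel :: 'a measure" by unfold_locales
  have L: "(\<integral>\<^sup>+y. h y \<partial>lborel) = (\<integral>\<^sup>+y. h (x + c *\<^sub>R y) \<partial>lborel)"
    if "h \<in> borel_measurable borel" "c = 1 \<or> c = -1" for h :: "'a \<Rightarrow> ennreal" and x and c :: real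
    using that by (subst lborel_affine[of c x]) (auto simp: nn_integral_density nn_integral_distr)
  have "emeasure M A * emeasure lborel B = (\<integral>\<^sup>+x. indicator A x * (\<integral>\<^sup>+y. indicator B y \<partial>lborel) \<partial>M)"
    by (simp add: nn_integral_multc)
  also have "\<dots> = (\<integral>\<^sup>+x. indicator A x * (\<integral>\<^sup>+y. indicator B (x + 1 *\<^sub>R y) \<partial>lborel) \<partial>M)"
    by (subst L[symmetric]) auto
  also have "\<dots> = (\<integral>\<^sup>+x. (\<integral>\<^sup>+y. indicator A x * indicator B (x + y) \<partial>lborel) \<partial>M)"
    by (simp add: nn_integral_cmult)
  also have "\<dots> = (\<integral>\<^sup>+y. (\<integral>\<^sup>+x. indicator A x * indicator B (x + y) \<partial>M) \<partial>lborel)"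
    by (rule Fubini'[symmetric]) measurable
  also have "\<dots> = (\<integral>\<^sup>+y. (\<integral>\<^sup>+x. indicator A (x - y) * indicator B x \<partial>M) \<partial>lborel)"
  proof (rule nn_integral_cong)
    fix y
    have "(\<integral>\<^sup>+x. indicator A x * indicator B (x + y) \<partial>M)
        = (\<integral>\<^sup>+x. indicator A x * indicator B (x + y) \<partial>distr M borel (\<lambda>x. - y + x))"
      by (subst inv) simp
    also have "\<dots> = (\<integral>\<^sup>+x. indicator A (- y + x) * indicator B (- y + x + y) \<partial>M)"
      by (subst nn_integral_distr) auto
    finally show "(\<integral>\<^sup>+x. indicator A x * indicator B (x + y) \<partial>M)
        = (\<integral>\<^sup>+x. indicator A (x - y) * indicator B x \<partial>M)" by simp
  qed
  also have "\<dots> = (\<integral>\<^sup>+x. (\<integral>\<^sup>+y. indicator A (x - y) * indicator B x \<partial>lborel) \<partial>M)"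
    by (rule Fubini') measurable
  also have "\<dots> = (\<integral>\<^sup>+x. (\<integral>\<^sup>+y. indicator A (x + (-1) *\<^sub>R y) \<partial>lborel) * indicator B x \<partial>M)"
    by (simp add: nn_integral_multc)
  also have "\<dots> = (\<integral>\<^sup>+x. (\<integral>\<^sup>+y. indicator A y \<partial>lborel) * indicator B x \<partial>M)"
    by (subst L[symmetric]) auto
  also have "\<dots> = emeasure lborel A * emeasure M B"
    by (simp add: nn_integral_cmult)
  finally show ?thesis .
qed

text \<open>
  The image of Lebesgue measure under \<open>T\<close> is translation invariant, hence a multiple of Lebesgue
  measure, and the invariant set \<open>S\<close> shows that the factor is \<open>1\<close>. In the applications \<open>S\<close> is a ball of a norm
  that \<open>T\<close> preserves.
\<close>

lemma distr_lborel_linear: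
  fixes T :: "'a::euclidean_space \<Rightarrow> 'a"
  assumes T: "linear T" "bij T"
    and S: "S \<in> sets borel" "emeasure lborel S \<noteq> 0" "emeasure lborel S \<noteq> \<infinity>"
    and TS: "\<And>x. T x \<in> S \<longleftrightarrow> x \<in> S"
  shows "distr lborel borel T = lborel"
proof -
  interpret T: linear T by fact
  have Tc: "continuous_on UNIV T" using T(1) by (rule linear_continuous_on_compose[OF continuous_on_id, unfolded id_def])
  have [measurable]: "T \<in> borel_measurable borel"
    by (rule borel_measurable_continuous_onI[OF Tc])
  let ?M = "distr lborel borel T"
  have em: "emeasure ?M A = emeasure lborel (T -` A)" if "A \<in> sets borel" for A
    using that by (subst emeasure_distr) auto
  have tr: "distr ?M borel (\<lambda>x. c + x) = ?M" for c
  proof -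
    obtain b where b: "T b = c" using T(2) by (metis bij_pointE)
    have "distr ?M borel (\<lambda>x. c + x) = distr lborel borel (\<lambda>x. T (b + x))"
      by (subst distr_distr) (auto simp: comp_def b T.add)
    also have "\<dots> = distr (distr lborel borel (\<lambda>x. b + x)) borel T"
      by (subst distr_distr) (auto simp: comp_def)
    also have "distr lborel borel (\<lambda>x. b + x) = lborel"
      using lborel_affine[of 1 b] by (simp add: density_1)
    finally show ?thesis .
  qed
  have sf: "sigma_finite_measure ?M"
  proof (rule sigma_finite_measure.intro, intro exI[of _ "(\<lambda>n::nat. T ` cball 0 (real n)) ` UNIV"] conjI ballI)
    have cmp: "compact (T ` cball 0 (real n))" for n
      by (intro compact_continuous_image continuous_on_subset[OF Tc]) auto
    then show "(\<lambda>n::nat. T ` cball 0 (real n)) ` UNIV \<subseteq> sets ?M"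
      by (auto intro: borel_compact)
    show "\<Union> ((\<lambda>n::nat. T ` cball 0 (real n)) ` UNIV) = space ?M"
    proof -
      have "\<exists>n. x \<in> T ` cball 0 (real n)" for x
      proof -
        obtain y where y: "T y = x" using T(2) by (metis bij_pointE)
        obtain n where "norm y \<le> real n" using real_arch_simple by blast
        then show ?thesis using y by (intro exI[of _ n] image_eqI[of _ _ y]) auto
      qed
      then show ?thesis by auto
    qed
    show "emeasure ?M A \<noteq> \<infinity>" if "A \<in> (\<lambda>n::nat. T ` cball 0 (real n)) ` UNIV" for A
    proof -
      from that obtain n where A: "A = T ` cball 0 (real n)" by blast
      have "T -` A = cball 0 (real n)" unfolding A using T(2) by (auto simp: bij_def inj_eq)
      then show ?thesis using em[of A] cmp[of n] A emeasure_lborel_cball_finite[of "0::'a" "real n"]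
        by (auto simp: borel_compact)
    qed
  qed auto
  have "T -` S = S" using TS by auto
  then have MS: "emeasure ?M S = emeasure lborel S" using em[OF S(1)] by simp
  show ?thesis
  proof (rule measure_eqI)
    fix A assume "A \<in> sets ?M"
    then have A: "A \<in> sets borel" by simp
    have "emeasure ?M A * emeasure lborel S = emeasure lborel A * emeasure lborel S"
      using translation_invariant_measure_proportional[OF sf _ tr A S(1)] MS by simp
    then show "emeasure ?M A = emeasure lborel A"
      using S(2,3) ennreal_mult_cancel_left[of "emeasure lborel S" "emeasure ?M A" "emeasure lborel A"]
      by (auto simp: mult.commute)
  qed simp
qed

section \<open>Integrability against a Gaussian\<close>

lemma integrable_exp_neg_square:
  assumes "0 < (\<epsilon>::real)"
  shows "integrable lborel (\<lambda>x::real. exp (- \<epsilon> * x\<^sup>2))"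
proof -
  define \<sigma> where "\<sigma> = 1 / sqrt (2 * \<epsilon>)"
  have \<sigma>: "\<sigma>\<^sup>2 = 1 / (2 * \<epsilon>)" using assms by (simp add: \<sigma>_def power_divide)
  have "exp (- \<epsilon> * x\<^sup>2) = sqrt (2 * pi * \<sigma>\<^sup>2) * normal_density 0 \<sigma> x" for x
    using assms by (simp add: normal_density_def \<sigma>)
  moreover have "0 < \<sigma>" using assms by (simp add: \<sigma>_def)
  ultimately show ?thesis by simp
qed

lemma integrable_gaussian:
  assumes "0 < (\<epsilon>::real)"
  shows "integrable lborel (\<lambda>x::'a::euclidean_space. exp (- \<epsilon> * (norm x)\<^sup>2))"
proof (rule integrableI_nonneg)
  have "(norm x)\<^sup>2 = (\<Sum>b\<in>Basis. (x \<bullet> b)\<^sup>2)" for x :: 'a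
    by (simp add: norm_eq_sqrt_inner euclidean_inner[of x x] power2_eq_square sum_nonneg)
  then have "(\<integral>\<^sup>+x. ennreal (exp (- \<epsilon> * (norm (x::'a))\<^sup>2)) \<partial>lborel)
      = (\<integral>\<^sup>+x. (\<Prod>b\<in>Basis. ennreal (exp (- \<epsilon> * ((x::'a) \<bullet> b)\<^sup>2))) \<partial>lborel)"
    by (simp add: sum_distrib_left exp_sum prod_ennreal)
  also have "\<dots> = (\<Prod>b\<in>(Basis::'a set). (\<integral>\<^sup>+x. ennreal (exp (- \<epsilon> * x\<^sup>2)) \<partial>lborel))"
    by (rule nn_integral_lborel_prod) auto
  also have "\<dots> < \<infinity>"
    using integrable_exp_neg_square[OF assms] by (simp add: integrable_iff_bounded power_less_top_ennreal)
  finally show "(\<integral>\<^sup>+x. ennreal (exp (- \<epsilon> * (norm (x::'a))\<^sup>2)) \<partial>lborel) < \<infinity>" .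
qed auto

text \<open>
  A crude bound, but uniform in \<open>x\<close>: it is \<open>x / (m + 1) \<le> exp (x / (m + 1))\<close> raised to the power \<open>m\<close>.
\<close>

lemma power_le_exp:
  assumes "0 \<le> (x::real)"
  shows "x ^ m \<le> (real m + 1) ^ m * exp x"
proof -
  have "x ^ m = (real m + 1) ^ m * (x / (real m + 1)) ^ m"
    by (simp add: power_divide)
  also have "(x / (real m + 1)) ^ m \<le> exp (x / (real m + 1)) ^ m"
  proof (rule power_mono)
    show "x / (real m + 1) \<le> exp (x / (real m + 1))"
      using exp_ge_add_one_self[of "x / (real m + 1)"] by linarith
  qed (use assms in auto)
  also have "exp (x / (real m + 1)) ^ m = exp (x * (real m / (real m + 1)))"
    by (simp flip: exp_of_nat_mult add: mult.commute)
  also have "\<dots> \<le> exp x"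
    using mult_left_mono[of "real m / (real m + 1)" 1 x] assms by simp
  finally show ?thesis by (simp add: mult_left_mono)
qed

text \<open>
  Half of the Gaussian decay absorbs any polynomial factor. This is the source of every
  dominating function below.
\<close>

lemma poly_gaussian_le:
  assumes \<epsilon>: "0 < (\<epsilon>::real)" and r: "0 \<le> r"
  shows "(1 + r) ^ m * exp (- \<epsilon> * r\<^sup>2) \<le> (real m + 1) ^ m * exp (1 + 1 / (2 * \<epsilon>)) * exp (- (\<epsilon> / 2) * r\<^sup>2)"
proof -
  have "(1 + r) ^ m * exp (- \<epsilon> * r\<^sup>2) \<le> ((real m + 1) ^ m * exp (1 + r)) * exp (- \<epsilon> * r\<^sup>2)"
    using r by (intro mult_right_mono power_le_exp) auto
  also have "\<dots> = (real m + 1) ^ m * exp (1 + r - \<epsilon> * r\<^sup>2)"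
    by (simp add: exp_diff exp_minus field_simps)
  also have "\<dots> \<le> (real m + 1) ^ m * exp (1 + 1 / (2 * \<epsilon>) - \<epsilon> / 2 * r\<^sup>2)"
  proof (intro mult_left_mono)
    \<comment> \<open>This square absorbs the linear term \<open>r\<close> into half of the Gaussian exponent.\<close>
    have "0 \<le> (\<epsilon> * r - 1)\<^sup>2 / (2 * \<epsilon>)" using \<epsilon> by simp
    also have "\<dots> = \<epsilon> / 2 * r\<^sup>2 - r + 1 / (2 * \<epsilon>)"
      using \<epsilon> by (simp add: power2_eq_square field_simps)
    finally show "exp (1 + r - \<epsilon> * r\<^sup>2) \<le> exp (1 + 1 / (2 * \<epsilon>) - \<epsilon> / 2 * r\<^sup>2)"
      by simp
  qed auto
  also have "\<dots> = (real m + 1) ^ m * exp (1 + 1 / (2 * \<epsilon>)) * exp (- (\<epsilon> / 2) * r\<^sup>2)"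
    by (simp flip: exp_add)
  finally show ?thesis .
qed

lemma integrable_poly_gaussian:
  assumes \<epsilon>: "0 < (\<epsilon>::real)"
  shows "integrable lborel (\<lambda>x::'a::euclidean_space. (1 + norm x) ^ m * exp (- \<epsilon> * (norm x)\<^sup>2))"
proof (rule Bochner_Integration.integrable_bound)
  let ?C = "(real m + 1) ^ m * exp (1 + 1 / (2 * \<epsilon>))"
  show "integrable lborel (\<lambda>x::'a. ?C * exp (- (\<epsilon> / 2) * (norm x)\<^sup>2))"
    using integrable_gaussian[of "\<epsilon> / 2", where 'a='a] \<epsilon> by simp
  show "AE x::'a in lborel. norm ((1 + norm x) ^ m * exp (- \<epsilon> * (norm x)\<^sup>2))
      \<le> norm (?C * exp (- (\<epsilon> / 2) * (norm x)\<^sup>2))"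
    using poly_gaussian_le[OF \<epsilon> norm_ge_zero, of _ m] by (intro AE_I2) (simp add: abs_mult)
qed simp

text \<open>
  Fubini for products of functions of one coordinate each. Lebesgue measure on \<open>real^'n\<close> is the image of a product
  measure that is indexed by the standard basis, and the basis vectors are reindexed by the coordinates.
\<close>

lemma
  fixes g :: "'n::finite \<Rightarrow> real \<Rightarrow> 'b::{real_normed_field,banach,second_countable_topology}"
  assumes g: "\<And>k. integrable lborel (g k)"
  shows integrable_prod_vec: "integrable lborel (\<lambda>s::real^'n. \<Prod>k\<in>UNIV. g k (s $ k))"
    and integral_prod_vec: "(\<integral>s. (\<Prod>k\<in>UNIV. g k (s $ k)) \<partial>lborel) = (\<Prod>k\<in>UNIV. \<integral>t. g k t \<partial>lborel)"
proof -
  interpret product_sigma_finite "\<lambda>_. lborel :: real measure" by standard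
  let ?e = "\<lambda>k::'n. axis k (1::real)"
  let ?P = "\<Pi>\<^sub>M b\<in>(Basis :: (real^'n) set). (lborel :: real measure)"
  let ?s = "\<lambda>f. \<Sum>b\<in>(Basis :: (real^'n) set). f b *\<^sub>R b"
  have inj: "inj ?e" by (auto simp: inj_def axis_eq_axis)
  have B: "(Basis :: (real^'n) set) = range ?e" by (auto simp: Basis_vec_def)
  let ?h = "\<lambda>b. g (inv ?e b)"
  have nth: "?s f $ k = f (?e k)" for f k
  proof -
    have "?s f $ k = ?s f \<bullet> ?e k" by (simp add: inner_axis)
    also have "\<dots> = f (?e k)" by (subst inner_sum_left_Basis) (auto simp: B)
    finally show ?thesis .
  qed
  have prod: "(\<Prod>k\<in>UNIV. g k (?s f $ k)) = (\<Prod>b\<in>Basis. ?h b (f b))" for f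
    unfolding nth unfolding B by (subst prod.reindex[OF inj]) (simp add: inv_f_f[OF inj])
  have [measurable]: "g k \<in> borel_measurable borel" for k using g[of k] by auto
  have int: "integrable lborel (?h b)" for b by (rule g)
  have [measurable]: "?s \<in> ?P \<rightarrow>\<^sub>M borel" by measurable
  have meas: "(\<lambda>s::real^'n. \<Prod>k\<in>UNIV. g k (s $ k)) \<in> borel_measurable borel" by measurable
  show "integrable lborel (\<lambda>s::real^'n. \<Prod>k\<in>UNIV. g k (s $ k))"
    by (subst lborel_eq, subst integrable_distr_eq[OF _ meas])
       (use product_integrable_prod[OF finite_Basis int] in \<open>auto simp: prod[simplified]\<close>)
  have "(\<integral>s. (\<Prod>k\<in>UNIV. g k (s $ k)) \<partial>lborel) = (\<integral>f. (\<Prod>b\<in>Basis. ?h b (f b)) \<partial>?P)"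
    by (subst lborel_eq, subst integral_distr[OF _ meas]) (auto simp: prod[simplified])
  also have "\<dots> = (\<Prod>b\<in>Basis. \<integral>t. ?h b t \<partial>lborel)"
    by (rule product_integral_prod[OF finite_Basis int])
  also have "\<dots> = (\<Prod>k\<in>UNIV. \<integral>t. g k t \<partial>lborel)"
    unfolding B by (subst prod.reindex[OF inj]) (simp add: inv_f_f[OF inj])
  finally show "(\<integral>s. (\<Prod>k\<in>UNIV. g k (s $ k)) \<partial>lborel) = (\<Prod>k\<in>UNIV. \<integral>t. g k t \<partial>lborel)" .
qed

section \<open>Lebesgue points and Gaussian means\<close>

lemma AE_lborel_not_in_if_small_covers:
  fixes S :: "'a::euclidean_space set"
  assumes "\<And>\<eta>::real. 0 < \<eta> \<Longrightarrow> \<exists>T\<in>sets borel. S \<subseteq> T \<and> emeasure lborel T \<le> ennreal \<eta>"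
  shows "AE x in lborel. x \<notin> S"
proof -
  have "\<exists>T\<in>sets borel. S \<subseteq> T \<and> emeasure lborel T \<le> ennreal (1 / (real n + 1))" for n :: nat
    by (rule assms) simp
  then obtain T where T: "\<And>n::nat. T n \<in> sets borel \<and> S \<subseteq> T n \<and> emeasure lborel (T n) \<le> ennreal (1 / (real n + 1))"
    by metis
  have "(\<Inter>n. T n) \<in> null_sets lborel"
  proof (rule null_setsI)
    have *: "emeasure lborel (\<Inter>n. T n) \<le> ennreal \<eta>" if "\<eta> > 0" for \<eta>
    proof -
      from reals_Archimedean[OF that] obtain n where "1 / (real n + 1) < \<eta>"
        by (auto simp: inverse_eq_divide add.commute)
      have "emeasure lborel (\<Inter>n. T n) \<le> emeasure lborel (T n)"
        using T by (intro emeasure_mono) auto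
      also have "\<dots> \<le> ennreal (1 / (real n + 1))" using T by blast
      also have "\<dots> \<le> ennreal \<eta>" using \<open>1 / (real n + 1) < \<eta>\<close> by (intro ennreal_leI) simp
      finally show ?thesis .
    qed
    have "emeasure lborel (\<Inter>n. T n) \<le> 0"
      by (rule ennreal_le_epsilon) (use * in simp)
    then show "emeasure lborel (\<Inter>n. T n) = 0" by simp
  qed (use T in auto)
  then have "AE x in lborel. x \<notin> (\<Inter>n. T n)" by (rule AE_not_in)
  then show ?thesis by eventually_elim (use T in auto)
qed

text \<open>
  Enclose \<open>A\<close> in an open \<open>G\<close> of small \<open>\<nu>\<close>-measure. The points of \<open>A\<close> with upper density at least \<open>\<alpha>\<close> are covered by
  balls in \<open>G\<close> that carry at least \<open>\<alpha> r^d\<close>; a disjoint subfamily, enlarged by the factor \<open>5\<close>, still covers them by the Vitali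
  covering lemma, so that their Lebesgue measure is at most a constant times \<open>\<nu> G\<close>.
\<close>

lemma measure_null_set_density:
  fixes \<nu> :: "'a::euclidean_space measure"
  assumes fin: "finite_measure \<nu>" and sets[measurable_cong]: "sets \<nu> = sets borel"
    and A: "A \<in> sets borel" "emeasure \<nu> A = 0" and \<alpha>: "0 < (\<alpha>::real)"
  shows "AE x in lborel. x \<in> A \<longrightarrow> (\<exists>\<delta>>0. \<forall>r. 0 < r \<and> r < \<delta> \<longrightarrow> measure \<nu> (cball x r) < \<alpha> * r ^ DIM('a))"
proof -
  interpret finite_measure \<nu> by fact
  let ?D = "DIM('a)"
  define S where "S = {x\<in>A. \<forall>\<delta>>0. \<exists>r. 0 < r \<and> r < \<delta> \<and> \<alpha> * r ^ ?D \<le> measure \<nu> (cball x r)}"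
  have "AE x in lborel. x \<notin> S"
  proof (rule AE_lborel_not_in_if_small_covers)
    fix \<eta> :: real assume \<eta>: "0 < \<eta>"
    define c where "c = unit_ball_vol (real ?D) * 5 ^ ?D"
    have c: "0 < c" by (simp add: c_def)
    have "(INF U \<in> {U. A \<subseteq> U \<and> open U}. emeasure \<nu> U) < ennreal (\<eta> * \<alpha> / c)"
      using outer_regular[of \<nu> A] A sets \<eta> \<alpha> c emeasure_finite by simp
    then obtain G where G: "A \<subseteq> G" "open G" "emeasure \<nu> G < ennreal (\<eta> * \<alpha> / c)"
      by (auto simp: INF_less_iff)
    have "\<exists>r. 0 < r \<and> r \<le> 1 \<and> cball x r \<subseteq> G \<and> \<alpha> * r ^ ?D \<le> measure \<nu> (cball x r)" if "x \<in> S" for x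
    proof -
      have "x \<in> G" using that G(1) by (auto simp: S_def)
      then obtain \<delta> where \<delta>: "\<delta> > 0" "cball x \<delta> \<subseteq> G" using G(2) open_contains_cball by blast
      have "0 < min \<delta> 1" using \<delta>(1) by simp
      with \<open>x \<in> S\<close> obtain r where "0 < r" "r < min \<delta> 1" "\<alpha> * r ^ ?D \<le> measure \<nu> (cball x r)"
        unfolding S_def by blast
      moreover have "cball x r \<subseteq> cball x \<delta>" using calculation by auto
      ultimately show ?thesis using \<delta> by (intro exI[of _ r]) auto
    qed
    then obtain r where r: "\<And>x. x \<in> S \<Longrightarrow> 0 < r x \<and> r x \<le> 1 \<and> cball x (r x) \<subseteq> G \<and>
        \<alpha> * r x ^ ?D \<le> measure \<nu> (cball x (r x))" by metis
    have cov: "S \<subseteq> (\<Union>i\<in>S. cball i (r i))" using r by fastforce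
    obtain C where C: "countable C" "C \<subseteq> S"
      "pairwise (\<lambda>i j. disjnt (cball i (r i)) (cball j (r j))) C" "S \<subseteq> (\<Union>i\<in>C. cball i (5 * r i))"
      using Vitali_covering_lemma_cballs[of S "\<lambda>x. x" r S 1] cov r by (metis (no_types, lifting))
    let ?T = "\<Union>i\<in>C. cball i (5 * r i)"
    have Tb: "?T \<in> sets borel" using C(1) by (intro sets.countable_UN'') auto
    have "emeasure lborel ?T = (\<integral>\<^sup>+y. indicator ?T y \<partial>lborel)" using Tb by simp
    also have "\<dots> \<le> (\<integral>\<^sup>+y. \<integral>\<^sup>+i. indicator (cball i (5 * r i)) y \<partial>count_space C \<partial>lborel)"
    proof (rule nn_integral_mono)
      fix y
      show "indicator ?T y \<le> (\<integral>\<^sup>+i. indicator (cball i (5 * r i)) y \<partial>count_space C)"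
      proof (cases "y \<in> ?T")
        case True
        then obtain j where j: "j \<in> C" "y \<in> cball j (5 * r j)" by auto
        have "(1::ennreal) = (\<integral>\<^sup>+i. indicator {j} i \<partial>count_space C)"
          using j by (simp add: emeasure_count_space_finite)
        also have "\<dots> \<le> (\<integral>\<^sup>+i. indicator (cball i (5 * r i)) y \<partial>count_space C)"
          using j by (intro nn_integral_mono) (auto split: split_indicator)
        finally show ?thesis using True by simp
      qed simp
    qed
    also have "\<dots> = (\<integral>\<^sup>+i. emeasure lborel (cball i (5 * r i)) \<partial>count_space C)"
      by (subst nn_integral_count_space_nn_integral[OF C(1)]) (auto intro!: borel_measurable_indicator)
    also have "\<dots> \<le> (\<integral>\<^sup>+i. ennreal (c / \<alpha>) * emeasure \<nu> (cball i (r i)) \<partial>count_space C)"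
    proof (rule nn_integral_mono)
      fix i assume "i \<in> space (count_space C)"
      then have i: "i \<in> S" using C(2) by auto
      have "emeasure lborel (cball i (5 * r i)) = ennreal (c * r i ^ ?D)"
        using r[OF i] by (subst emeasure_cball) (auto simp: c_def power_mult_distrib mult_ac)
      also have "\<dots> \<le> ennreal (c / \<alpha> * measure \<nu> (cball i (r i)))"
        using mult_left_mono[of "\<alpha> * r i ^ ?D" "measure \<nu> (cball i (r i))" "c / \<alpha>"] r[OF i] c \<alpha>
        by (intro ennreal_leI) simp
      also have "\<dots> = ennreal (c / \<alpha>) * emeasure \<nu> (cball i (r i))"
        unfolding emeasure_eq_measure using c \<alpha> by (intro ennreal_mult) auto
      finally show "emeasure lborel (cball i (5 * r i)) \<le> ennreal (c / \<alpha>) * emeasure \<nu> (cball i (r i))" .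
    qed
    also have "\<dots> = ennreal (c / \<alpha>) * emeasure \<nu> (\<Union>i\<in>C. cball i (r i))"
    proof -
      have "disjoint_family_on (\<lambda>i. cball i (r i)) C"
        using C(3) by (auto simp: disjoint_family_on_def pairwise_def disjnt_def)
      then show ?thesis
        by (subst emeasure_UN_countable) (auto simp: nn_integral_cmult C(1) sets)
    qed
    also have "\<dots> \<le> ennreal (c / \<alpha>) * emeasure \<nu> G"
      using r C(2) G(2) by (intro mult_left_mono emeasure_mono) (auto simp: sets)
    also have "\<dots> \<le> ennreal (c / \<alpha>) * ennreal (\<eta> * \<alpha> / c)"
      using G(3) by (intro mult_left_mono) auto
    also have "\<dots> = ennreal \<eta>"
      using c \<alpha> \<eta> by (subst ennreal_mult[symmetric]) auto
    finally show "\<exists>T\<in>sets borel. S \<subseteq> T \<and> emeasure lborel T \<le> ennreal \<eta>"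
      using Tb C(4) by blast
  qed
  then show ?thesis
  proof eventually_elim
    case (elim x)
    then show ?case unfolding S_def mem_Collect_eq by (metis not_le)
  qed
qed

text \<open>
  Lebesgue's differentiation theorem in its strong form. For rational \<open>q\<close> and small \<open>\<delta>\<close>, the measure whose density is the
  positive part of \<open>\<bar>f - q\<bar> - \<delta>\<close> vanishes on \<open>{x. \<bar>f x - q\<bar> \<le> \<delta>}\<close>, hence has density zero at almost all points of that set. At a
  point that is good for all \<open>q\<close> and \<open>\<delta>\<close>, choosing \<open>q\<close> within \<open>\<delta>\<close> of \<open>f x\<close> bounds the mean of \<open>\<bar>f - f x\<bar>\<close> over small balls by a
  multiple of \<open>\<delta>\<close> plus a quantity that tends to zero.
\<close>

lemma lebesgue_points:
  fixes f :: "'a::euclidean_space \<Rightarrow> real"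
  assumes f: "integrable lborel f"
  shows "AE x in lborel. ((\<lambda>r. (\<integral>y. indicator (cball x r) y * \<bar>f y - f x\<bar> \<partial>lborel) / r ^ DIM('a)) \<longlongrightarrow> 0) (at_right 0)"
proof -
  have [measurable]: "f \<in> borel_measurable borel" using f by auto
  have [measurable]: "indicator (ball c r) \<in> borel_measurable borel"
    "indicator (cball c r) \<in> borel_measurable borel" for c :: 'a and r :: real
    by (auto intro!: borel_measurable_indicator)
  let ?D = "DIM('a)"
  \<comment> \<open>The ball of radius \<open>R\<close> makes the truncated densities integrable.\<close>
  define g where "g q \<delta> R y = max 0 (\<bar>f y - q\<bar> - \<delta>) * indicator (ball 0 R) y" for q \<delta> R and y :: 'a
  define \<nu> where "\<nu> q \<delta> R = density lborel (\<lambda>y. ennreal (g q \<delta> R y))" for q \<delta> R :: real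
  define A where "A q \<delta> R = ball 0 R \<inter> {x. \<bar>f x - q\<bar> \<le> \<delta>}" for q \<delta> R
  have [measurable]: "g q \<delta> R \<in> borel_measurable borel" for q \<delta> R unfolding g_def by measurable
  have gint: "integrable lborel (g q \<delta> R)" if "\<delta> > 0" for q \<delta> R
  proof (rule Bochner_Integration.integrable_bound)
    show "integrable lborel (\<lambda>y. \<bar>f y\<bar> + \<bar>q\<bar> * indicator (ball (0::'a) R) y)"
      using f by (intro Bochner_Integration.integrable_add Bochner_Integration.integrable_abs integrable_mult_right integrable_real_indicator)
        (auto simp: emeasure_lborel_ball_finite[simplified])
    show "AE y in lborel. norm (g q \<delta> R y) \<le> norm (\<bar>f y\<bar> + \<bar>q\<bar> * indicator (ball 0 R) y)"
      using that by (intro AE_I2) (auto simp: g_def split: split_indicator)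
  qed measurable
  have key: "AE x in lborel. x \<in> A q \<delta> R \<longrightarrow> (\<exists>\<eta>>0. \<forall>r. 0 < r \<and> r < \<eta> \<longrightarrow> measure (\<nu> q \<delta> R) (cball x r) < \<alpha> * r ^ ?D)"
    if "\<delta> > 0" "\<alpha> > 0" for q \<delta> R \<alpha>
  proof (rule measure_null_set_density)
    show "finite_measure (\<nu> q \<delta> R)"
    proof (rule finite_measureI)
      have "(\<integral>\<^sup>+y. ennreal (g q \<delta> R y) \<partial>lborel) = ennreal (\<integral>y. g q \<delta> R y \<partial>lborel)"
        by (rule nn_integral_eq_integral[OF gint[OF that(1)]]) (auto simp: g_def)
      then show "emeasure (\<nu> q \<delta> R) (space (\<nu> q \<delta> R)) \<noteq> \<infinity>"
        by (simp add: \<nu>_def emeasure_density)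
    qed
    show A: "A q \<delta> R \<in> sets borel" unfolding A_def by measurable
    have "emeasure (\<nu> q \<delta> R) (A q \<delta> R) = (\<integral>\<^sup>+y. ennreal (g q \<delta> R y) * indicator (A q \<delta> R) y \<partial>lborel)"
      unfolding \<nu>_def using A by (subst emeasure_density) auto
    also have "\<dots> = (\<integral>\<^sup>+y. 0 \<partial>(lborel::'a measure))"
      by (intro nn_integral_cong) (auto simp: g_def A_def split: split_indicator)
    finally show "emeasure (\<nu> q \<delta> R) (A q \<delta> R) = 0" by simp
  qed (use that in \<open>auto simp: \<nu>_def\<close>)
  have "AE x in lborel. \<forall>q\<in>\<rat>. \<forall>n m R::nat. x \<in> A q (1 / (real n + 1)) R \<longrightarrow>
      (\<exists>\<eta>>0. \<forall>r. 0 < r \<and> r < \<eta> \<longrightarrow> measure (\<nu> q (1 / (real n + 1)) R) (cball x r) < 1 / (real m + 1) * r ^ ?D)"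
    by (subst AE_ball_countable[OF countable_rat], intro ballI, unfold AE_all_countable, intro allI key) auto
  then show ?thesis
  proof eventually_elim
    case (elim x)
    define V where "V = unit_ball_vol (real ?D)"
    have V: "0 < V" by (simp add: V_def)
    show ?case
    proof (rule order_tendstoI)
      fix a :: real assume "a < 0"
      have "0 \<le> (\<integral>y. indicator (cball x r) y * \<bar>f y - f x\<bar> \<partial>lborel) / r ^ ?D" if "0 < r" for r
        using that by (intro divide_nonneg_nonneg Bochner_Integration.integral_nonneg) auto
      with \<open>a < 0\<close> have "0 < r \<Longrightarrow> a < (\<integral>y. indicator (cball x r) y * \<bar>f y - f x\<bar> \<partial>lborel) / r ^ ?D" for r
        by (meson less_le_trans)
      then show "\<forall>\<^sub>F r in at_right 0. a < (\<integral>y. indicator (cball x r) y * \<bar>f y - f x\<bar> \<partial>lborel) / r ^ ?D"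
        using eventually_at_right_less[of 0] by (rule eventually_mono[rotated])
    next
      fix a :: real assume a: "0 < a"
      \<comment> \<open>The choices of \<open>n\<close> and \<open>m\<close> split \<open>a\<close> into two halves, one for \<open>2 \<delta>\<close> times the volume of the ball and one for the density of \<open>\<nu>\<close>.\<close>
      obtain n :: nat where n: "1 / (real n + 1) < a / (4 * V)"
        using reals_Archimedean[of "a / (4 * V)"] a V by (auto simp: inverse_eq_divide add.commute)
      obtain m :: nat where m: "1 / (real m + 1) < a / 2"
        using reals_Archimedean[of "a / 2"] a by (auto simp: inverse_eq_divide add.commute)
      define \<delta> where "\<delta> = 1 / (real n + 1)"
      have \<delta>: "0 < \<delta>" by (simp add: \<delta>_def)
      obtain q where q: "q \<in> \<rat>" "f x - \<delta> < q" "q < f x"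
        using Rats_dense_in_real[of "f x - \<delta>" "f x"] \<delta> by auto
      obtain R :: nat where R: "norm x + 1 < real R" using reals_Archimedean2 by blast
      have "x \<in> A q \<delta> R" using q R by (auto simp: A_def)
      then obtain \<eta> where \<eta>: "\<eta> > 0" "\<And>r. 0 < r \<Longrightarrow> r < \<eta> \<Longrightarrow> measure (\<nu> q \<delta> R) (cball x r) < 1 / (real m + 1) * r ^ ?D"
        using elim q(1) unfolding \<delta>_def by blast
      have "(\<integral>y. indicator (cball x r) y * \<bar>f y - f x\<bar> \<partial>lborel) / r ^ ?D < a" if r: "0 < r" "r < min \<eta> 1" for r
      proof -
        have sub: "cball x r \<subseteq> ball 0 (real R)"
        proof
          fix y assume "y \<in> cball x r"
          then have "norm (y - x) \<le> r" by (simp add: dist_norm norm_minus_commute)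
          moreover have "norm y \<le> norm x + norm (y - x)" using norm_triangle_ineq[of x "y - x"] by simp
          ultimately show "y \<in> ball 0 (real R)" using R r by simp
        qed
        have i1: "integrable lborel (\<lambda>y. g q \<delta> R y * indicator (cball x r) y)"
          by (rule Bochner_Integration.integrable_bound[OF gint[OF \<delta>]]) (auto split: split_indicator)
        have i2: "integrable lborel (\<lambda>y. 2 * \<delta> * indicator (cball x r) y)"
          by (intro integrable_mult_right integrable_real_indicator) (auto simp: emeasure_lborel_cball_finite[simplified])
        have "(\<integral>y. indicator (cball x r) y * \<bar>f y - f x\<bar> \<partial>lborel)
            \<le> (\<integral>y. g q \<delta> R y * indicator (cball x r) y + 2 * \<delta> * indicator (cball x r) y \<partial>lborel)"
        proof (rule integral_mono_AE')
          show "AE y in lborel. indicator (cball x r) y * \<bar>f y - f x\<bar>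
              \<le> g q \<delta> R y * indicator (cball x r) y + 2 * \<delta> * indicator (cball x r) y"
          proof (rule AE_I2)
            fix y
            show "indicator (cball x r) y * \<bar>f y - f x\<bar>
              \<le> g q \<delta> R y * indicator (cball x r) y + 2 * \<delta> * indicator (cball x r) y"
              using sub q by (cases "y \<in> cball x r") (auto simp: g_def)
          qed
        qed (use i1 i2 \<delta> in \<open>auto simp: g_def\<close>)
        also have "\<dots> = (\<integral>y. g q \<delta> R y * indicator (cball x r) y \<partial>lborel) + 2 * \<delta> * measure lborel (cball x r)"
          using i1 i2 by simp
        also have "(\<integral>y. g q \<delta> R y * indicator (cball x r) y \<partial>lborel) = measure (\<nu> q \<delta> R) (cball x r)"
          unfolding \<nu>_def measure_def
          by (subst emeasure_density, simp, simp, subst integral_eq_nn_integral)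
             (auto simp: g_def intro!: arg_cong[where f=enn2real] nn_integral_cong split: split_indicator)
        also have "measure lborel (cball x r) = V * r ^ ?D"
          using r by (simp add: V_def content_cball)
        also have "measure (\<nu> q \<delta> R) (cball x r) + 2 * \<delta> * (V * r ^ ?D) < 1 / (real m + 1) * r ^ ?D + 2 * \<delta> * (V * r ^ ?D)"
          using \<eta>(2)[of r] r by simp
        also have "\<dots> = (1 / (real m + 1) + 2 * \<delta> * V) * r ^ ?D"
          by (simp add: algebra_simps)
        also have "\<dots> < a * r ^ ?D"
        proof (rule mult_strict_right_mono)
          have "2 * \<delta> * V < a / 2" using n V by (simp add: \<delta>_def field_simps)
          then show "1 / (real m + 1) + 2 * \<delta> * V < a" using m by linarith
        qed (use r in simp)
        finally show ?thesis using r by (simp add: divide_simps)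
      qed
      then show "\<forall>\<^sub>F r in at_right 0. (\<integral>y. indicator (cball x r) y * \<bar>f y - f x\<bar> \<partial>lborel) / r ^ ?D < a"
        using \<eta>(1) by (auto simp: eventually_at_right_field intro!: exI[of _ "min \<eta> 1"])
    qed
  qed
qed

text \<open>
  On the shell \<open>j \<le> norm (y - x) / h < j + 1\<close> the Gaussian is at most \<open>exp (- \<kappa> j\<^sup>2)\<close>. So the Gaussian mean is at most a
  series of means over the balls of radius \<open>(j + 1) h\<close> with rapidly decreasing weights. Each term tends to zero because \<open>x\<close> is a
  Lebesgue point, and since \<open>f\<close> is integrable the means are bounded uniformly in the radius; Tannery's theorem applies.
\<close>

lemma gaussian_mean_at_lebesgue_point:
  fixes f :: "'a::euclidean_space \<Rightarrow> real"
  assumes f: "integrable lborel f" and \<kappa>: "0 < \<kappa>"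
    and leb: "((\<lambda>r. (\<integral>y. indicator (cball x r) y * \<bar>f y - f x\<bar> \<partial>lborel) / r ^ DIM('a)) \<longlongrightarrow> 0) (at_right 0)"
  shows "((\<lambda>h. (\<integral>y. \<bar>f y - f x\<bar> * exp (- \<kappa> * (norm (y - x) / h)\<^sup>2) \<partial>lborel) / h ^ DIM('a)) \<longlongrightarrow> 0) (at_right 0)"
proof -
  have [measurable]: "f \<in> borel_measurable borel" using f by auto
  have [measurable]: "indicator (ball c r) \<in> borel_measurable borel"
    "indicator (cball c r) \<in> borel_measurable borel" for c :: 'a and r :: real
    by (auto intro!: borel_measurable_indicator)
  let ?D = "DIM('a)"
  define A where "A r = (\<integral>y. indicator (cball x r) y * \<bar>f y - f x\<bar> \<partial>lborel)" for r
  define V where "V = unit_ball_vol (real ?D)"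
  have V: "0 < V" by (simp add: V_def)
  have Aint: "integrable lborel (\<lambda>y. indicator (cball x r) y * \<bar>f y - f x\<bar>)" for r
  proof (rule Bochner_Integration.integrable_bound)
    show "integrable lborel (\<lambda>y. \<bar>f y\<bar> + \<bar>f x\<bar> * indicator (cball x r) y)"
      using f by (intro Bochner_Integration.integrable_add Bochner_Integration.integrable_abs integrable_mult_right integrable_real_indicator)
        (auto simp: emeasure_lborel_cball_finite[simplified])
  qed (auto split: split_indicator)
  have A0: "0 \<le> A r" for r unfolding A_def by (rule Bochner_Integration.integral_nonneg) auto
  have Ale: "A r \<le> (\<integral>y. \<bar>f y\<bar> \<partial>lborel) + \<bar>f x\<bar> * (V * r ^ ?D)" if "0 < r" for r
  proof -
    have "A r \<le> (\<integral>y. \<bar>f y\<bar> + \<bar>f x\<bar> * indicator (cball x r) y \<partial>lborel)"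
      unfolding A_def
    proof (rule integral_mono[OF Aint])
      show "integrable lborel (\<lambda>y. \<bar>f y\<bar> + \<bar>f x\<bar> * indicator (cball x r) y)"
        using f by (intro Bochner_Integration.integrable_add Bochner_Integration.integrable_abs integrable_mult_right integrable_real_indicator)
          (auto simp: emeasure_lborel_cball_finite[simplified])
    qed (auto split: split_indicator)
    also have "\<dots> = (\<integral>y. \<bar>f y\<bar> \<partial>lborel) + \<bar>f x\<bar> * measure lborel (cball x r)"
      using f by (subst Bochner_Integration.integral_add)
        (auto intro!: integrable_mult_right integrable_real_indicator simp: emeasure_lborel_cball_finite[simplified])
    also have "measure lborel (cball x r) = V * r ^ ?D" using that by (simp add: V_def content_cball)
    finally show ?thesis .
  qed
  obtain B where B: "\<And>r. 0 < r \<Longrightarrow> A r / r ^ ?D \<le> B" "0 \<le> B"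
  proof -
    \<comment> \<open>Small radii are controlled by the Lebesgue point, large ones by the integral of \<open>\<bar>f\<bar>\<close>.\<close>
    have "\<forall>\<^sub>F r in at_right 0. A r / r ^ ?D < 1"
      using order_tendstoD(2)[OF leb, of 1] by (simp add: A_def)
    then obtain d where d: "d > 0" "\<And>r. 0 < r \<Longrightarrow> r < d \<Longrightarrow> A r / r ^ ?D < 1"
      by (auto simp: eventually_at_right_field)
    define B where "B = 1 + (\<integral>y. \<bar>f y\<bar> \<partial>lborel) / d ^ ?D + \<bar>f x\<bar> * V"
    have p: "0 \<le> (\<integral>y. \<bar>f y\<bar> \<partial>lborel) / d ^ ?D" "0 \<le> \<bar>f x\<bar> * V" using d V by auto
    show thesis
    proof (rule that)
      fix r :: real assume r: "0 < r"
      show "A r / r ^ ?D \<le> B"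
      proof (cases "r < d")
        case True
        then show ?thesis using d(2)[OF r] p by (simp add: B_def)
      next
        case False
        have "A r / r ^ ?D \<le> ((\<integral>y. \<bar>f y\<bar> \<partial>lborel) + \<bar>f x\<bar> * (V * r ^ ?D)) / r ^ ?D"
          using Ale[OF r] r by (intro divide_right_mono) auto
        also have "\<dots> = (\<integral>y. \<bar>f y\<bar> \<partial>lborel) / r ^ ?D + \<bar>f x\<bar> * V" using r by (simp add: add_divide_distrib)
        also have "\<dots> \<le> (\<integral>y. \<bar>f y\<bar> \<partial>lborel) / d ^ ?D + \<bar>f x\<bar> * V"
          using False d(1) by (intro add_right_mono divide_left_mono power_mono mult_pos_pos zero_less_power) auto
        finally show ?thesis by (simp add: B_def)
      qed
    qed (use p in \<open>simp add: B_def\<close>)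
  qed
  \<comment> \<open>The weight of the shell \<open>j\<close>, times the volume factor of the ball that contains it.\<close>
  define c where "c j = exp (- \<kappa> * (real j)\<^sup>2) * (real j + 1) ^ ?D" for j :: nat
  have c0: "0 \<le> c j" for j by (simp add: c_def)
  have csum: "summable c"
  proof (rule summable_comparison_test')
    let ?C = "(real ?D + 1) ^ ?D * exp (1 + 1 / (2 * \<kappa>))"
    show "summable (\<lambda>j. ?C * exp (- (\<kappa> / 2)) ^ j)"
      using \<kappa> by (intro summable_mult summable_geometric) auto
    show "norm (c j) \<le> ?C * exp (- (\<kappa> / 2)) ^ j" if "0 \<le> j" for j
    proof -
      have "norm (c j) \<le> ?C * exp (- (\<kappa> / 2) * (real j)\<^sup>2)"
        using poly_gaussian_le[OF \<kappa>, of "real j" ?D] by (simp add: c_def mult.commute add.commute)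
      also have "exp (- (\<kappa> / 2) * (real j)\<^sup>2) \<le> exp (- (\<kappa> / 2) * real j)"
      proof -
        have "real j \<le> (real j)\<^sup>2" by (cases j) (auto simp: power2_eq_square)
        then show ?thesis using \<kappa> by simp
      qed
      also have "exp (- (\<kappa> / 2) * real j) = exp (- (\<kappa> / 2)) ^ j"
        by (simp flip: exp_of_nat_mult add: mult.commute)
      finally show ?thesis by (simp add: mult_left_mono)
    qed
  qed
  define a where "a j h = c j * (A ((real j + 1) * h) / ((real j + 1) * h) ^ ?D)" for j :: nat and h :: real
  have a0: "0 \<le> a j h" if "0 < h" for j h using that A0 c0 by (auto simp: a_def)
  have aB: "a j h \<le> B * c j" if "0 < h" for j h
    using mult_left_mono[OF B(1) c0, of "(real j + 1) * h" j] that by (simp add: a_def mult.commute)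
  have asum: "summable (\<lambda>j. a j h)" if "0 < h" for h
    by (rule summable_comparison_test'[OF summable_mult[OF csum, of B]]) (use a0 aB that in auto)
  have lim: "((\<lambda>h. \<Sum>j. a j h) \<longlongrightarrow> (\<Sum>j::nat. 0)) (at_right 0)"
  proof (rule tannerys_theorem[THEN conjunct2, THEN conjunct2])
    show "((\<lambda>h. a j h) \<longlongrightarrow> 0) (at_right 0)" for j
    proof -
      have "filterlim (\<lambda>h. (real j + 1) * h) (at_right 0) (at_right (0::real))"
        by real_asymp
      from filterlim_compose[OF leb this] have "((\<lambda>h. A ((real j + 1) * h) / ((real j + 1) * h) ^ ?D) \<longlongrightarrow> 0) (at_right 0)"
        by (simp add: A_def)
      then show ?thesis unfolding a_def by (rule tendsto_mult_right_zero)
    qed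
    show "\<forall>\<^sub>F (j, h) in sequentially \<times>\<^sub>F at_right 0. norm (a j h) \<le> B * c j"
    proof -
      have "\<forall>\<^sub>F p in sequentially \<times>\<^sub>F at_right (0::real). True \<and> 0 < snd p"
        by (rule eventually_prodI) (auto simp: eventually_at_right_less)
      then show ?thesis by eventually_elim (use a0 aB in auto)
    qed
  qed (use csum in auto)
  have le: "(\<integral>y. \<bar>f y - f x\<bar> * exp (- \<kappa> * (norm (y - x) / h)\<^sup>2) \<partial>lborel) / h ^ ?D \<le> (\<Sum>j. a j h)" if h: "0 < h" for h
  proof -
    let ?t = "\<lambda>j y. exp (- \<kappa> * (real j)\<^sup>2) * (indicator (cball x ((real j + 1) * h)) y * \<bar>f y - f x\<bar>)"
    have eq: "exp (- \<kappa> * (real j)\<^sup>2) * A ((real j + 1) * h) = h ^ ?D * a j h" for j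
      using h by (simp add: a_def c_def power_mult_distrib)
    have "(\<integral>\<^sup>+y. ennreal (\<bar>f y - f x\<bar> * exp (- \<kappa> * (norm (y - x) / h)\<^sup>2)) \<partial>lborel)
        \<le> (\<integral>\<^sup>+y. (\<Sum>j. ennreal (?t j y)) \<partial>lborel)"
    proof (rule nn_integral_mono)
      fix y
      define j where "j = nat \<lfloor>norm (y - x) / h\<rfloor>"
      have j: "real j \<le> norm (y - x) / h" "norm (y - x) / h < real j + 1"
        using h by (auto simp: j_def)
      have "(real j)\<^sup>2 \<le> (norm (y - x) / h)\<^sup>2" using j(1) by (intro power_mono) auto
      then have "\<bar>f y - f x\<bar> * exp (- \<kappa> * (norm (y - x) / h)\<^sup>2) \<le> \<bar>f y - f x\<bar> * exp (- \<kappa> * (real j)\<^sup>2)"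
        using \<kappa> by (intro mult_left_mono) auto
      also have "\<dots> = ?t j y"
        using j(2) h by (auto simp: indicator_def dist_norm norm_minus_commute field_simps)
      finally have "ennreal (\<bar>f y - f x\<bar> * exp (- \<kappa> * (norm (y - x) / h)\<^sup>2)) \<le> ennreal (?t j y)"
        by (rule ennreal_leI)
      also have "\<dots> \<le> (\<Sum>j. ennreal (?t j y))"
      proof -
        have "(\<Sum>j\<in>{j}. ennreal (?t j y)) \<le> (\<Sum>j. ennreal (?t j y))"
          by (rule sum_le_suminf) auto
        then show ?thesis by (simp only: sum.insert[OF finite.emptyI] sum.empty empty_iff not_False_eq_True add_0_right)
      qed
      finally show "ennreal (\<bar>f y - f x\<bar> * exp (- \<kappa> * (norm (y - x) / h)\<^sup>2)) \<le> (\<Sum>j. ennreal (?t j y))" .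
    qed
    also have "\<dots> = (\<Sum>j. \<integral>\<^sup>+y. ennreal (?t j y) \<partial>lborel)"
      by (rule nn_integral_suminf) simp
    also have "(\<lambda>j. \<integral>\<^sup>+y. ennreal (?t j y) \<partial>lborel) = (\<lambda>j. ennreal (h ^ ?D * a j h))"
    proof
      fix j
      have "(\<integral>\<^sup>+y. ennreal (?t j y) \<partial>lborel) = ennreal (\<integral>y. ?t j y \<partial>lborel)"
        by (rule nn_integral_eq_integral) (auto intro!: integrable_mult_right Aint)
      then show "(\<integral>\<^sup>+y. ennreal (?t j y) \<partial>lborel) = ennreal (h ^ ?D * a j h)"
        by (simp flip: eq add: A_def)
    qed
    also have "(\<Sum>j. ennreal (h ^ ?D * a j h)) = ennreal (\<Sum>j. h ^ ?D * a j h)"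
      using a0[OF h] h by (intro suminf_ennreal2 summable_mult asum) auto
    also have "\<dots> = ennreal (h ^ ?D * (\<Sum>j. a j h))"
      using asum[OF h] by (simp add: suminf_mult)
    finally have "(\<integral>y. \<bar>f y - f x\<bar> * exp (- \<kappa> * (norm (y - x) / h)\<^sup>2) \<partial>lborel) \<le> h ^ ?D * (\<Sum>j. a j h)"
      using h suminf_nonneg[OF asum[OF h] a0[OF h]]
      by (subst integral_eq_nn_integral) (auto intro!: enn2real_leI)
    then show ?thesis using h by (simp add: divide_simps mult.commute)
  qed
  show ?thesis
  proof (rule tendsto_sandwich[OF _ _ tendsto_const])
    show "((\<lambda>h. \<Sum>j. a j h) \<longlongrightarrow> 0) (at_right 0)" using lim by simp
    show "\<forall>\<^sub>F h in at_right 0. 0 \<le> (\<integral>y. \<bar>f y - f x\<bar> * exp (- \<kappa> * (norm (y - x) / h)\<^sup>2) \<partial>lborel) / h ^ ?D"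
      by (auto simp: eventually_at_right_field intro!: exI[of _ 1] divide_nonneg_pos Bochner_Integration.integral_nonneg)
    show "\<forall>\<^sub>F h in at_right 0. (\<integral>y. \<bar>f y - f x\<bar> * exp (- \<kappa> * (norm (y - x) / h)\<^sup>2) \<partial>lborel) / h ^ ?D \<le> (\<Sum>j. a j h)"
      using le by (auto simp: eventually_at_right_field intro!: exI[of _ 1])
  qed
qed

section \<open>Conjugate transposes and unitary matrices\<close>

lemma conj_transpose_nth [simp]: "conj_transpose A $ j $ k = cnj (A $ k $ j)"
  by (simp add: conj_transpose_def)

lemma conj_transpose_conj_transpose [simp]: "conj_transpose (conj_transpose A) = A"
  by (simp add: vec_eq_iff)

lemma conj_transpose_mult: "conj_transpose (A ** B) = conj_transpose B ** conj_transpose A"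
  by (simp add: vec_eq_iff matrix_matrix_mult_def mult.commute)

lemma conj_transpose_mat_1 [simp]: "conj_transpose (mat 1) = mat 1"
  by (simp add: vec_eq_iff mat_def)

lemma conj_transpose_add: "conj_transpose (A + B) = conj_transpose A + conj_transpose B"
  by (simp add: vec_eq_iff)

lemma conj_transpose_diff: "conj_transpose (A - B) = conj_transpose A - conj_transpose B"
  by (simp add: vec_eq_iff)

lemma conj_transpose_scaleR: "conj_transpose (c *\<^sub>R A) = c *\<^sub>R conj_transpose A"
  by (simp add: vec_eq_iff)

lemma norm_matrix_squared: "(norm (A::complex^'n^'m))\<^sup>2 = (\<Sum>j\<in>UNIV. \<Sum>k\<in>UNIV. (cmod (A $ j $ k))\<^sup>2)"
  by (simp add: norm_vec_def L2_set_def sum_nonneg)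

lemma norm_matrix_mult_le: "norm (A ** B) \<le> norm A * norm (B::complex^'n^'n)"
proof (rule power2_le_imp_le)
  have "(norm (A ** B))\<^sup>2 \<le> (\<Sum>j\<in>UNIV. \<Sum>k\<in>UNIV. (\<Sum>l\<in>UNIV. (cmod (A $ j $ l))\<^sup>2) * (\<Sum>l\<in>UNIV. (cmod (B $ l $ k))\<^sup>2))"
    unfolding norm_matrix_squared
  proof (intro sum_mono)
    fix j k
    have "cmod ((A ** B) $ j $ k) \<le> (\<Sum>l\<in>UNIV. cmod (A $ j $ l) * cmod (B $ l $ k))"
      unfolding matrix_matrix_mult_def by (simp add: norm_sum[THEN order_trans] norm_mult)
    also have "\<dots> \<le> L2_set (\<lambda>l. cmod (A $ j $ l)) UNIV * L2_set (\<lambda>l. cmod (B $ l $ k)) UNIV"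
      using L2_set_mult_ineq[of "\<lambda>l. cmod (A $ j $ l)" "\<lambda>l. cmod (B $ l $ k)" UNIV] by simp
    finally have "(cmod ((A ** B) $ j $ k))\<^sup>2
        \<le> (L2_set (\<lambda>l. cmod (A $ j $ l)) UNIV * L2_set (\<lambda>l. cmod (B $ l $ k)) UNIV)\<^sup>2"
      by (intro power_mono) auto
    then show "(cmod ((A ** B) $ j $ k))\<^sup>2
        \<le> (\<Sum>l\<in>UNIV. (cmod (A $ j $ l))\<^sup>2) * (\<Sum>l\<in>UNIV. (cmod (B $ l $ k))\<^sup>2)"
      by (simp add: power_mult_distrib L2_set_def sum_nonneg)
  qed
  also have "\<dots> = (norm A)\<^sup>2 * (norm B)\<^sup>2"
    unfolding norm_matrix_squared sum.swap[of "\<lambda>j k. (cmod (B $ j $ k))\<^sup>2" UNIV UNIV]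
    by (simp add: sum_product)
  finally show "(norm (A ** B))\<^sup>2 \<le> (norm A * norm B)\<^sup>2" by (simp add: power_mult_distrib)
qed simp

lemma bounded_bilinear_matrix_mult:
  "bounded_bilinear ((**) :: complex^'n^'n \<Rightarrow> complex^'n^'n \<Rightarrow> complex^'n^'n)"
proof
  show "\<exists>K. \<forall>(A::complex^'n^'n) (B::complex^'n^'n). norm (A ** B) \<le> norm A * norm B * K"
    by (intro exI[of _ 1]) (simp add: norm_matrix_mult_le)
qed (simp_all add: vec_eq_iff matrix_matrix_mult_def sum.distrib distrib_left distrib_right scaleR_sum_right)

lemmas matrix_mult_add_left = bounded_bilinear.add_left[OF bounded_bilinear_matrix_mult]
  and matrix_mult_add_right = bounded_bilinear.add_right[OF bounded_bilinear_matrix_mult]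
  and matrix_mult_diff_left = bounded_bilinear.diff_left[OF bounded_bilinear_matrix_mult]
  and matrix_mult_diff_right = bounded_bilinear.diff_right[OF bounded_bilinear_matrix_mult]
  and matrix_mult_minus_left = bounded_bilinear.minus_left[OF bounded_bilinear_matrix_mult]
  and matrix_mult_minus_right = bounded_bilinear.minus_right[OF bounded_bilinear_matrix_mult]
  and matrix_mult_scaleR_left = bounded_bilinear.scaleR_left[OF bounded_bilinear_matrix_mult]
  and matrix_mult_scaleR_right = bounded_bilinear.scaleR_right[OF bounded_bilinear_matrix_mult]
  and tendsto_matrix_mult = bounded_bilinear.tendsto[OF bounded_bilinear_matrix_mult]
  and continuous_on_matrix_mult [continuous_intros] = bounded_bilinear.continuous_on[OF bounded_bilinear_matrix_mult]

lemma bounded_linear_conj_transpose: "bounded_linear (conj_transpose :: complex^'n^'n \<Rightarrow> complex^'n^'n)"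
proof (rule bounded_linear_intro[where K=1])
  show "norm (conj_transpose A) \<le> norm A * 1" for A :: "complex^'n^'n"
  proof (rule power2_le_imp_le)
    show "(norm (conj_transpose A))\<^sup>2 \<le> (norm A * 1)\<^sup>2"
      unfolding mult_1_right norm_matrix_squared by (subst sum.swap) simp
  qed simp
qed (simp_all add: conj_transpose_add conj_transpose_scaleR)

lemmas tendsto_conj_transpose = bounded_linear.tendsto[OF bounded_linear_conj_transpose]
  and continuous_on_conj_transpose [continuous_intros] =
    bounded_linear.continuous_on[OF bounded_linear_conj_transpose]

lemma borel_measurable_matrix_mult [measurable (raw)]:
  fixes f g :: "'a \<Rightarrow> complex^'n^'n"
  assumes "f \<in> borel_measurable M" "g \<in> borel_measurable M"
  shows "(\<lambda>x. f x ** g x) \<in> borel_measurable M"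
  by (rule borel_measurable_continuous_Pair[OF assms]) (intro continuous_intros)

lemma borel_measurable_conj_transpose [measurable (raw)]:
  fixes f :: "'a \<Rightarrow> complex^'n^'n"
  assumes "f \<in> borel_measurable M"
  shows "(\<lambda>x. conj_transpose (f x)) \<in> borel_measurable M"
  by (rule borel_measurable_continuous_on[OF _ assms]) (intro continuous_intros)

lemma borel_measurable_matrix_nth [measurable (raw)]:
  fixes f :: "'a \<Rightarrow> complex^'n^'m"
  assumes "f \<in> borel_measurable M"
  shows "(\<lambda>x. f x $ j $ k) \<in> borel_measurable M"
  by (rule borel_measurable_continuous_on[OF _ assms]) (intro continuous_intros)

lemma unitary_mat_1 [simp]: "unitary (mat 1)"
  by (simp add: unitary_def)

lemma unitary_mult: "unitary A \<Longrightarrow> unitary B \<Longrightarrow> unitary (A ** B)"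
  unfolding unitary_def conj_transpose_mult
  by (metis matrix_mul_assoc matrix_mul_lid)

lemma unitary_conj_transpose: "unitary A \<Longrightarrow> unitary (conj_transpose A)"
  by (simp add: unitary_def)

lemma unitaryI: "conj_transpose U ** U = mat 1 \<Longrightarrow> unitary U"
  unfolding unitary_def by (metis matrix_left_right_inverse)

lemma unitary_cancel:
  assumes "unitary U"
  shows "conj_transpose U ** (U ** A) = A" "U ** (conj_transpose U ** A) = A"
    "A ** U ** conj_transpose U = A" "A ** conj_transpose U ** U = A"
  using assms unfolding unitary_def by (simp_all add: matrix_mul_assoc) (simp_all flip: matrix_mul_assoc)

lemma hermitian_conjugate: "hermitian Z \<Longrightarrow> hermitian (U ** Z ** conj_transpose U)"
  by (simp add: hermitian_def conj_transpose_mult matrix_mul_assoc)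

lemma trace_mult_conj_transpose: "trace (conj_transpose A ** A) = of_real ((norm A)\<^sup>2)"
proof -
  have *: "cnj a * a = (complex_of_real (cmod a))\<^sup>2" for a
    using complex_norm_square[of a] by (simp add: mult.commute)
  have "trace (conj_transpose A ** A) = (\<Sum>k\<in>UNIV. \<Sum>j\<in>UNIV. of_real ((cmod (A $ j $ k))\<^sup>2))"
    unfolding trace_def matrix_matrix_mult_def
    by (intro sum.cong refl) (auto intro!: sum.cong simp: *)
  also have "\<dots> = of_real ((norm A)\<^sup>2)"
    unfolding norm_matrix_squared of_real_sum by (rule sum.swap)
  finally show ?thesis .
qed

lemma norm_unitary_mult:
  assumes "unitary U"
  shows "norm (U ** A) = norm A" "norm (A ** U) = norm A"
proof -
  have "complex_of_real ((norm (U ** A))\<^sup>2) = of_real ((norm A)\<^sup>2)"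
    using unitary_cancel(1)[OF assms]
    by (simp only: trace_mult_conj_transpose[symmetric] conj_transpose_mult matrix_mul_assoc[symmetric])
  then show "norm (U ** A) = norm A" by (simp flip: of_real_power)
  have "trace (conj_transpose (A ** U) ** (A ** U)) = trace ((A ** U) ** conj_transpose (A ** U))"
    by (rule trace_mul_sym)
  also have "\<dots> = trace (A ** conj_transpose A)"
    using unitary_cancel(2)[OF assms]
    by (simp only: conj_transpose_mult matrix_mul_assoc[symmetric])
  also have "\<dots> = trace (conj_transpose A ** A)" by (rule trace_mul_sym)
  finally have "complex_of_real ((norm (A ** U))\<^sup>2) = of_real ((norm A)\<^sup>2)"
    by (simp only: trace_mult_conj_transpose)
  then show "norm (A ** U) = norm A" by (simp flip: of_real_power)
qed

lemma norm_conjugate: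
  assumes "unitary U"
  shows "norm (U ** Z ** conj_transpose U) = norm Z"
  using assms by (simp add: norm_unitary_mult unitary_conj_transpose)

lemma continuous_on_matrix_nth [continuous_intros]:
  fixes f :: "'a::topological_space \<Rightarrow> complex^'n^'m"
  shows "continuous_on S f \<Longrightarrow> continuous_on S (\<lambda>x. f x $ j $ k)"
  by (intro continuous_intros)

lemma compact_unitary: "compact {U::complex^'n^'n. unitary U}"
proof -
  have "closed {U::complex^'n^'n. unitary U}"
    unfolding unitary_def
    by (intro closed_Collect_conj closed_Collect_eq continuous_intros)
  moreover have "bounded {U::complex^'n^'n. unitary U}"
  proof (rule boundedI)
    fix U :: "complex^'n^'n" assume "U \<in> {U. unitary U}"
    then show "norm U \<le> norm (mat 1 :: complex^'n^'n)"
      using norm_unitary_mult(1)[of U "mat 1"] by simp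
  qed
  ultimately show ?thesis by (simp add: compact_eq_bounded_closed)
qed

section \<open>Haar measure on the unitary group\<close>

text \<open>
  Haar measure is obtained as the image of the uniform measure on a neighbourhood of the unitary group under a retraction
  onto the group that commutes with left multiplication by unitary matrices: the unitary factor of the polar decomposition.
  As the limit of the Newton--Schulz iteration \<open>newton_schulz\<close>, which is polynomial in the matrix and its adjoint, it is
  equivariant and measurable.
\<close>

definition unitary_defect :: "complex^'n^'n \<Rightarrow> complex^'n^'n" where
  "unitary_defect M = mat 1 - conj_transpose M ** M"

definition newton_schulz :: "complex^'n^'n \<Rightarrow> complex^'n^'n" where
  "newton_schulz M = M + (1 / 2) *\<^sub>R (M ** unitary_defect M)"

definition unitary_factor :: "complex^'n^'n \<Rightarrow> complex^'n^'n" where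
  "unitary_factor M = lim (\<lambda>k. (newton_schulz ^^ k) M)"

text \<open>
  The defect has no linear term after one step, which gives quadratic convergence.
\<close>

lemma unitary_defect_newton_schulz:
  "unitary_defect (newton_schulz M) = (3 / 4) *\<^sub>R (unitary_defect M ** unitary_defect M)
     + (1 / 4) *\<^sub>R (unitary_defect M ** unitary_defect M ** unitary_defect M)"
proof -
  let ?E = "unitary_defect M"
  have E: "conj_transpose ?E = ?E"
    by (simp add: unitary_defect_def conj_transpose_diff conj_transpose_mult)
  have MM: "conj_transpose M ** M = mat 1 - ?E" by (simp add: unitary_defect_def)
  have ns: "newton_schulz M = M ** (mat 1 + (1 / 2) *\<^sub>R ?E)"
    by (simp add: newton_schulz_def matrix_mult_add_right matrix_mult_scaleR_right)
  have "conj_transpose (newton_schulz M) ** newton_schulz M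
      = (mat 1 + (1 / 2) *\<^sub>R ?E) ** (conj_transpose M ** M) ** (mat 1 + (1 / 2) *\<^sub>R ?E)"
    by (simp add: ns conj_transpose_mult conj_transpose_add conj_transpose_scaleR E matrix_mul_assoc)
  also have "\<dots> = mat 1 - ((3 / 4) *\<^sub>R (?E ** ?E) + (1 / 4) *\<^sub>R (?E ** ?E ** ?E))"
    unfolding MM
    by (simp add: matrix_mult_add_left matrix_mult_add_right matrix_mult_diff_left matrix_mult_diff_right
        matrix_mult_scaleR_left matrix_mult_scaleR_right matrix_mul_assoc,
      simp add: vec_eq_iff vector_scaleR_component,
      simp add: scaleR_conv_of_real field_simps)
  finally show ?thesis by (simp add: unitary_defect_def[of "newton_schulz M"])
qed

lemma norm_unitary_defect_newton_schulz:
  assumes "norm (unitary_defect M) \<le> 1 / 4"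
  shows "norm (unitary_defect (newton_schulz M)) \<le> norm (unitary_defect M) / 4"
proof -
  let ?E = "unitary_defect M" and ?e = "norm (unitary_defect M)"
  have "norm (unitary_defect (newton_schulz M)) \<le> 3 / 4 * norm (?E ** ?E) + 1 / 4 * norm (?E ** ?E ** ?E)"
    unfolding unitary_defect_newton_schulz by (rule norm_triangle_le) simp
  also have "\<dots> \<le> 3 / 4 * (?e * ?e) + 1 / 4 * (?e * ?e * ?e)"
    using norm_matrix_mult_le[of ?E ?E] norm_matrix_mult_le[of "?E ** ?E" ?E]
      mult_right_mono[OF norm_matrix_mult_le[of ?E ?E], of ?e] by (intro add_mono mult_left_mono) auto
  also have "\<dots> \<le> 3 / 4 * (?e * (1 / 4)) + 1 / 4 * (?e * (1 / 4) * 1)"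
    using assms by (intro add_mono mult_left_mono mult_mono) auto
  finally show ?thesis by simp
qed

lemma norm_le_if_small_defect:
  fixes M :: "complex^'n^'n"
  assumes "norm (unitary_defect M) \<le> 1"
  shows "norm M \<le> sqrt (2 * real CARD('n))"
proof (rule real_le_rsqrt)
  have "(norm M)\<^sup>2 = Re (trace (conj_transpose M ** M))"
    by (simp add: trace_mult_conj_transpose)
  also have "\<dots> = (\<Sum>i\<in>UNIV. Re (mat 1 $ i $ i - unitary_defect M $ i $ i))"
    by (simp add: trace_def unitary_defect_def)
  also have "\<dots> \<le> (\<Sum>i\<in>(UNIV::'n set). 2)"
  proof (rule sum_mono)
    fix i :: 'n
    have "cmod (unitary_defect M $ i $ i) \<le> 1"
      using order_trans[OF Finite_Cartesian_Product.norm_nth_le Finite_Cartesian_Product.norm_nth_le] assms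
      by (rule order_trans)
    then show "Re (mat 1 $ i $ i - unitary_defect M $ i $ i) \<le> 2"
      using abs_Re_le_cmod[of "unitary_defect M $ i $ i"] by (simp add: mat_def)
  qed
  finally show "(norm M)\<^sup>2 \<le> 2 * real CARD('n)" by simp
qed

lemma newton_schulz_converges:
  fixes M :: "complex^'n^'n"
  assumes M: "norm (unitary_defect M) \<le> 1 / 4"
  shows "(\<lambda>k. (newton_schulz ^^ k) M) \<longlonglongrightarrow> unitary_factor M" "unitary (unitary_factor M)"
proof -
  let ?M = "\<lambda>k. (newton_schulz ^^ k) M"
  have defect: "norm (unitary_defect (?M k)) \<le> (1 / 4) ^ Suc k" for k
  proof (induction k)
    case (Suc k)
    have "(1 / 4 :: real) ^ Suc k \<le> 1 / 4" using power_decreasing[of 1 "Suc k" "1 / 4 :: real"] by simp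
    then have "norm (unitary_defect (?M (Suc k))) \<le> norm (unitary_defect (?M k)) / 4"
      using Suc norm_unitary_defect_newton_schulz[of "?M k"] by simp
    with Suc show ?case by simp
  qed (use M in simp)
  have defect1: "norm (unitary_defect (?M k)) \<le> 1" for k
    using defect[of k] power_le_one[of "1 / 4 :: real" "Suc k"] by linarith
  have summ: "summable (\<lambda>k. ?M (Suc k) - ?M k)"
  proof (rule summable_comparison_test')
    show "summable (\<lambda>k. sqrt (2 * real CARD('n)) * (1 / 4) ^ k)"
      by (intro summable_mult summable_geometric) simp
    show "norm (?M (Suc k) - ?M k) \<le> sqrt (2 * real CARD('n)) * (1 / 4) ^ k" if "0 \<le> k" for k
    proof -
      have "norm (?M (Suc k) - ?M k) = 1 / 2 * norm (?M k ** unitary_defect (?M k))"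
        by (simp add: newton_schulz_def)
      also have "\<dots> \<le> 1 * (norm (?M k) * norm (unitary_defect (?M k)))"
        by (intro mult_mono norm_matrix_mult_le) auto
      also have "\<dots> \<le> 1 * (sqrt (2 * real CARD('n)) * (1 / 4) ^ Suc k)"
        by (intro mult_mono norm_le_if_small_defect[OF defect1] defect order_refl) auto
      also have "\<dots> \<le> sqrt (2 * real CARD('n)) * (1 / 4) ^ k"
        by (simp add: mult_left_mono)
      finally show ?thesis .
    qed
  qed
  have eq: "M + (\<Sum>i<k. ?M (Suc i) - ?M i) = ?M k" for k
    by (subst sum_lessThan_telescope) simp
  have "(\<lambda>k. M + (\<Sum>i<k. ?M (Suc i) - ?M i)) \<longlonglongrightarrow> M + (\<Sum>i. ?M (Suc i) - ?M i)"
    by (intro tendsto_intros summable_LIMSEQ summ)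
  then have "convergent ?M" unfolding eq by (rule convergentI)
  then show lim: "?M \<longlonglongrightarrow> unitary_factor M"
    unfolding unitary_factor_def by (simp add: convergent_LIMSEQ_iff)
  have "(\<lambda>k. unitary_defect (?M k)) \<longlonglongrightarrow> unitary_defect (unitary_factor M)"
    unfolding unitary_defect_def
    by (intro tendsto_intros tendsto_matrix_mult tendsto_conj_transpose lim)
  moreover have "(\<lambda>k. unitary_defect (?M k)) \<longlonglongrightarrow> 0"
  proof (rule Lim_null_comparison)
    show "\<forall>\<^sub>F k in sequentially. norm (unitary_defect (?M k)) \<le> (1 / 4) ^ Suc k"
      using defect by (intro always_eventually) blast
    show "(\<lambda>k. (1 / 4 :: real) ^ Suc k) \<longlonglongrightarrow> 0"
      by (intro LIMSEQ_Suc LIMSEQ_realpow_zero) auto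
  qed
  ultimately have "unitary_defect (unitary_factor M) = 0" by (rule LIMSEQ_unique)
  then show "unitary (unitary_factor M)"
    by (intro unitaryI) (simp add: unitary_defect_def)
qed

lemma unitary_defect_unitary_mult:
  assumes "unitary V" shows "unitary_defect (V ** M) = unitary_defect M"
  by (simp add: unitary_defect_def conj_transpose_mult unitary_cancel[OF assms] flip: matrix_mul_assoc)

lemma unitary_factor_unitary_mult:
  assumes V: "unitary V" and M: "norm (unitary_defect M) \<le> 1 / 4"
  shows "unitary_factor (V ** M) = V ** unitary_factor M"
proof -
  have ns: "newton_schulz (V ** A) = V ** newton_schulz A" for A
    by (simp add: newton_schulz_def unitary_defect_unitary_mult[OF V] matrix_mult_add_right
        matrix_mult_scaleR_right matrix_mul_assoc)
  have "(newton_schulz ^^ k) (V ** M) = V ** (newton_schulz ^^ k) M" for k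
    by (induction k) (simp_all add: ns)
  moreover have "(\<lambda>k. V ** (newton_schulz ^^ k) M) \<longlonglongrightarrow> V ** unitary_factor M"
    by (intro tendsto_matrix_mult tendsto_const newton_schulz_converges[OF M])
  ultimately show ?thesis
    using newton_schulz_converges(1)[of "V ** M"] M
    by (simp add: unitary_defect_unitary_mult[OF V]) (rule LIMSEQ_unique)
qed

lemma continuous_on_newton_schulz: "continuous_on UNIV ((newton_schulz ^^ k) :: complex^'n^'n \<Rightarrow> complex^'n^'n)"
proof (induction k)
  case (Suc k)
  have "continuous_on UNIV (newton_schulz :: complex^'n^'n \<Rightarrow> complex^'n^'n)"
    unfolding newton_schulz_def unitary_defect_def by (intro continuous_intros)
  from continuous_on_compose[OF Suc continuous_on_subset[OF this]] show ?case by (simp add: comp_def)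
qed (simp add: id_def continuous_on_id)

text \<open>
  Left multiplication by a unitary matrix preserves the unit ball of the Frobenius norm.
\<close>

lemma lborel_unitary_mult:
  assumes V: "unitary (V :: complex^'n^'n)"
  shows "distr lborel borel (\<lambda>M::complex^'n^'n. V ** M) = lborel"
proof (rule distr_lborel_linear[where S="ball 0 1"])
  show "linear (\<lambda>M::complex^'n^'n. V ** M)"
    by (intro linearI) (simp_all add: matrix_mult_add_right matrix_mult_scaleR_right)
  show "bij (\<lambda>M::complex^'n^'n. V ** M)"
    by (rule o_bij[of "\<lambda>M. conj_transpose V ** M"]) (simp_all add: fun_eq_iff unitary_cancel[OF V])
  have "measure lborel (ball 0 1 :: (complex^'n^'n) set) > 0" by (simp add: content_ball_pos)
  then show "emeasure lborel (ball 0 1 :: (complex^'n^'n) set) \<noteq> 0"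
    by (auto simp: measure_def)
  show "emeasure lborel (ball 0 1 :: (complex^'n^'n) set) \<noteq> \<infinity>"
    using emeasure_lborel_ball_finite[of "0 :: complex^'n^'n" 1] by simp
  show "V ** M \<in> ball 0 1 \<longleftrightarrow> M \<in> ball 0 1" for M :: "complex^'n^'n"
    by (simp add: norm_unitary_mult(1)[OF V])
qed simp

text \<open>
  Since \<open>\<Omega>\<close> and Lebesgue measure are invariant under left multiplication by unitary matrices and the retraction \<open>q\<close>
  commutes with it, the image measure is left invariant.
\<close>

lemma ex_normalized_haar: "\<exists>\<mu>::(complex^'n^'n) measure. is_normalized_haar \<mu>"
proof -
  define \<Omega> where "\<Omega> = {M::complex^'n^'n. norm (unitary_defect M) < 1 / 4}"
  have "open \<Omega>"
    unfolding \<Omega>_def unitary_defect_def by (intro open_Collect_less continuous_intros)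
  then have \<Omega>[measurable]: "\<Omega> \<in> sets borel" by simp
  have "mat 1 \<in> \<Omega>" by (simp add: \<Omega>_def unitary_defect_def)
  with \<open>open \<Omega>\<close> obtain r where r: "r > 0" "ball (mat 1) r \<subseteq> \<Omega>" using open_contains_ball by blast
  have "0 < measure lborel (ball (mat 1 :: complex^'n^'n) r)" using r by (simp add: content_ball_pos)
  then have "0 < emeasure lborel (ball (mat 1 :: complex^'n^'n) r)" by (auto simp: measure_def zero_less_iff_neq_zero)
  also have "\<dots> \<le> emeasure lborel \<Omega>" using r by (intro emeasure_mono) auto
  finally have pos: "emeasure lborel \<Omega> \<noteq> 0" by simp
  have "\<Omega> \<subseteq> cball 0 (sqrt (2 * real CARD('n)))"
    using norm_le_if_small_defect by (force simp: \<Omega>_def)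
  then have "emeasure lborel \<Omega> \<le> emeasure lborel (cball (0::complex^'n^'n) (sqrt (2 * real CARD('n))))"
    by (intro emeasure_mono) auto
  also have "\<dots> < \<infinity>" by (rule emeasure_lborel_cball_finite)
  finally have fin: "emeasure lborel \<Omega> \<noteq> \<infinity>" by simp
  interpret P: prob_space "uniform_measure lborel \<Omega>" by (rule prob_space_uniform_measure[OF pos fin])
  let ?R = "restrict_space borel {U::complex^'n^'n. unitary U}"
  define q where "q M = (if M \<in> \<Omega> then unitary_factor M else mat 1)" for M
  have q_unitary: "unitary (q M)" for M
    using newton_schulz_converges(2)[of M] by (simp add: q_def \<Omega>_def)
  have qm[measurable]: "q \<in> borel_measurable borel"
  proof (rule borel_measurable_LIMSEQ_metric)
    show "(\<lambda>M. if M \<in> \<Omega> then (newton_schulz ^^ k) M else mat 1) \<in> borel_measurable borel" for k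
      using borel_measurable_continuous_onI[OF continuous_on_newton_schulz[of k]] by measurable
    show "(\<lambda>k. if M \<in> \<Omega> then (newton_schulz ^^ k) M else mat 1) \<longlonglongrightarrow> q M" for M
      using newton_schulz_converges(1)[of M] by (simp add: q_def \<Omega>_def)
  qed
  have qR: "q \<in> uniform_measure lborel \<Omega> \<rightarrow>\<^sub>M ?R"
    using q_unitary qm by (intro measurable_restrict_space2) auto
  define \<mu> where "\<mu> = distr (uniform_measure lborel \<Omega>) ?R q"
  have V_meas: "(\<lambda>U. V ** U) \<in> ?R \<rightarrow>\<^sub>M ?R" if "unitary V" for V
    using that by (intro measurable_restrict_space2 measurable_restrict_space1)
      (auto simp: space_restrict_space unitary_mult)
  have "is_normalized_haar \<mu>"
    unfolding is_normalized_haar_def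
  proof (intro conjI allI impI)
    show "sets \<mu> = sets ?R" by (simp add: \<mu>_def)
    show "prob_space \<mu>" unfolding \<mu>_def by (rule P.prob_space_distr[OF qR])
    fix V :: "complex^'n^'n" assume V: "unitary V"
    show "distr \<mu> \<mu> (\<lambda>U. V ** U) = \<mu>"
    proof (rule measure_eqI)
      fix A assume "A \<in> sets (distr \<mu> \<mu> (\<lambda>U. V ** U))"
      then have A: "A \<in> sets ?R" by (simp add: \<mu>_def)
      have pre: "emeasure \<mu> B = emeasure lborel (\<Omega> \<inter> q -` B) / emeasure lborel \<Omega>" if "B \<in> sets ?R" for B
      proof -
        have "q -` B \<in> sets borel"
          using measurable_sets[OF qR that] by simp
        then show ?thesis unfolding \<mu>_def using that qR by (subst emeasure_distr) auto
      qed
      have VA: "(\<lambda>U. V ** U) -` A \<inter> {U. unitary U} \<in> sets ?R"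
        using measurable_sets[OF V_meas[OF V] A] by (simp add: space_restrict_space)
      have "emeasure (distr \<mu> \<mu> (\<lambda>U. V ** U)) A = emeasure \<mu> ((\<lambda>U. V ** U) -` A \<inter> {U. unitary U})"
        using A V_meas[OF V] by (subst emeasure_distr) (auto simp: \<mu>_def space_restrict_space)
      also have "\<dots> = emeasure lborel (\<Omega> \<inter> q -` ((\<lambda>U. V ** U) -` A \<inter> {U. unitary U})) / emeasure lborel \<Omega>"
        by (rule pre[OF VA])
      also have "\<Omega> \<inter> q -` ((\<lambda>U. V ** U) -` A \<inter> {U. unitary U}) = (\<lambda>M. V ** M) -` (\<Omega> \<inter> q -` A)"
        using V q_unitary unitary_factor_unitary_mult[OF V]
        by (auto simp: q_def \<Omega>_def unitary_defect_unitary_mult)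
      also have "emeasure lborel ((\<lambda>M. V ** M) -` (\<Omega> \<inter> q -` A)) = emeasure (distr lborel borel (\<lambda>M. V ** M)) (\<Omega> \<inter> q -` A)"
        using measurable_sets[OF qR A] by (subst emeasure_distr) auto
      also have "\<dots> = emeasure lborel (\<Omega> \<inter> q -` A)"
        by (simp add: lborel_unitary_mult[OF V])
      also have "\<dots> / emeasure lborel \<Omega> = emeasure \<mu> A" by (rule pre[OF A, symmetric])
      finally show "emeasure (distr \<mu> \<mu> (\<lambda>U. V ** U)) A = emeasure \<mu> A" .
    qed simp
  qed
  then show ?thesis by blast
qed

lemma measurable_unitary_mult:
  assumes "f \<in> M \<rightarrow>\<^sub>M restrict_space borel {U::complex^'n^'n. unitary U}"
    and "g \<in> M \<rightarrow>\<^sub>M restrict_space borel {U::complex^'n^'n. unitary U}"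
  shows "(\<lambda>x. f x ** g x) \<in> M \<rightarrow>\<^sub>M restrict_space borel {U. unitary U}"
  using assms unfolding measurable_restrict_space2_iff
  by (auto simp: Pi_iff intro: unitary_mult borel_measurable_matrix_mult)

lemma measurable_unitary_conj_transpose:
  assumes "f \<in> M \<rightarrow>\<^sub>M restrict_space borel {U::complex^'n^'n. unitary U}"
  shows "(\<lambda>x. conj_transpose (f x)) \<in> M \<rightarrow>\<^sub>M restrict_space borel {U. unitary U}"
  using assms unfolding measurable_restrict_space2_iff
  by (auto simp: Pi_iff intro: unitary_conj_transpose borel_measurable_conj_transpose)

lemma nn_integral_normalized_haar_left:
  fixes \<mu> :: "(complex^'n^'n) measure"
  assumes \<mu>: "is_normalized_haar \<mu>" and W: "unitary W" and f: "f \<in> borel_measurable \<mu>"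
  shows "(\<integral>\<^sup>+V. f (W ** V) \<partial>\<mu>) = (\<integral>\<^sup>+V. f V \<partial>\<mu>)"
proof -
  have s[measurable_cong]: "sets \<mu> = sets (restrict_space borel {U. unitary U})" using \<mu> by (simp add: is_normalized_haar_def)
  have "(\<lambda>V. W ** V) \<in> \<mu> \<rightarrow>\<^sub>M restrict_space borel {U. unitary U}"
    using W by (intro measurable_unitary_mult[OF measurable_const measurable_ident_sets[OF s]])
      (simp add: space_restrict_space)
  then have m: "(\<lambda>V. W ** V) \<in> \<mu> \<rightarrow>\<^sub>M \<mu>" by (simp add: measurable_cong_sets[OF refl s])
  have "(\<integral>\<^sup>+V. f V \<partial>\<mu>) = (\<integral>\<^sup>+V. f V \<partial>distr \<mu> \<mu> (\<lambda>V. W ** V))"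
    using \<mu> W by (simp add: is_normalized_haar_def)
  then show ?thesis using m f by (simp add: nn_integral_distr)
qed

text \<open>
  The integral of \<open>1\<^sub>A(U\<^sup>-\<^sup>1 V)\<close> over \<open>\<mu> \<otimes> \<nu>\<close> is computed in both orders. Left invariance of \<open>\<mu>\<close> removes \<open>U\<close>, left invariance of
  \<open>\<nu>\<close> removes \<open>V\<close>. As the right-hand side depends on \<open>\<nu>\<close> only, Haar measure is unique, and with \<open>\<mu> = \<nu>\<close> it is invariant under inversion.
\<close>

lemma normalized_haar_eq_inverse:
  fixes \<mu> \<nu> :: "(complex^'n^'n) measure"
  assumes \<mu>: "is_normalized_haar \<mu>" and \<nu>: "is_normalized_haar \<nu>"
    and A: "A \<in> sets (restrict_space borel {U. unitary U})"
  shows "emeasure \<mu> A = (\<integral>\<^sup>+U. indicator A (conj_transpose U) \<partial>\<nu>)"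
proof -
  interpret \<mu>: prob_space \<mu> using \<mu> by (simp add: is_normalized_haar_def)
  interpret \<nu>: prob_space \<nu> using \<nu> by (simp add: is_normalized_haar_def)
  interpret pair_sigma_finite \<mu> \<nu> by unfold_locales
  have s\<mu>: "sets \<mu> = sets (restrict_space borel {U. unitary U})" using \<mu> by (simp add: is_normalized_haar_def)
  have s\<nu>: "sets \<nu> = sets (restrict_space borel {U. unitary U})" using \<nu> by (simp add: is_normalized_haar_def)
  have sp: "space \<mu> = {U. unitary U}" "space \<nu> = {U. unitary U}"
    using sets_eq_imp_space_eq[OF s\<mu>] sets_eq_imp_space_eq[OF s\<nu>] by (auto simp: space_restrict_space)
  note id = measurable_ident_sets[OF s\<mu>] measurable_ident_sets[OF s\<nu>]
  have joint: "(\<lambda>(V, U). indicator A (conj_transpose U ** V) :: ennreal) \<in> borel_measurable (\<mu> \<Otimes>\<^sub>M \<nu>)"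
  proof -
    have "(\<lambda>p. conj_transpose (snd p) ** fst p) \<in> \<mu> \<Otimes>\<^sub>M \<nu> \<rightarrow>\<^sub>M restrict_space borel {U. unitary U}"
      using measurable_compose[OF measurable_fst[of \<mu> \<nu>] id(1)] measurable_compose[OF measurable_snd[of \<mu> \<nu>] id(2)]
      by (intro measurable_unitary_mult measurable_unitary_conj_transpose)
    from measurable_compose[OF this borel_measurable_indicator[OF A]] show ?thesis
      by (simp add: case_prod_unfold)
  qed
  have f\<mu>: "(\<lambda>V. indicator A V :: ennreal) \<in> borel_measurable \<mu>"
    using A s\<mu> by (intro borel_measurable_indicator) simp
  have f\<nu>: "(\<lambda>U. indicator A (conj_transpose U ** V) :: ennreal) \<in> borel_measurable \<nu>" if "unitary V" for V
    using measurable_compose_Pair1[OF _ joint, of V] that sp by (simp add: case_prod_unfold)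
  have "emeasure \<mu> A = (\<integral>\<^sup>+U. (\<integral>\<^sup>+V. indicator A V \<partial>\<mu>) \<partial>\<nu>)"
    using A s\<mu> by (simp add: \<nu>.emeasure_space_1)
  also have "\<dots> = (\<integral>\<^sup>+U. (\<integral>\<^sup>+V. indicator A (conj_transpose U ** V) \<partial>\<mu>) \<partial>\<nu>)"
    using sp by (intro nn_integral_cong nn_integral_normalized_haar_left[OF \<mu> _ f\<mu>, symmetric])
      (simp add: unitary_conj_transpose)
  also have "\<dots> = (\<integral>\<^sup>+V. (\<integral>\<^sup>+U. indicator A (conj_transpose U ** V) \<partial>\<nu>) \<partial>\<mu>)"
    by (rule Fubini'[OF joint])
  also have "\<dots> = (\<integral>\<^sup>+V. (\<integral>\<^sup>+U. indicator A (conj_transpose U) \<partial>\<nu>) \<partial>\<mu>)"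
  proof (rule nn_integral_cong)
    fix V assume "V \<in> space \<mu>"
    then have V: "unitary V" by (simp add: sp)
    have "(\<integral>\<^sup>+U. indicator A (conj_transpose U ** V) \<partial>\<nu>) = (\<integral>\<^sup>+U. indicator A (conj_transpose (V ** U) ** V) \<partial>\<nu>)"
      by (rule nn_integral_normalized_haar_left[OF \<nu> V f\<nu>[OF V], symmetric])
    also have "\<dots> = (\<integral>\<^sup>+U. indicator A (conj_transpose U) \<partial>\<nu>)"
      by (simp add: conj_transpose_mult unitary_cancel(4)[OF V])
    finally show "(\<integral>\<^sup>+U. indicator A (conj_transpose U ** V) \<partial>\<nu>) = (\<integral>\<^sup>+U. indicator A (conj_transpose U) \<partial>\<nu> :: ennreal)" .
  qed
  also have "\<dots> = (\<integral>\<^sup>+U. indicator A (conj_transpose U) \<partial>\<nu>)"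
    by (simp add: \<mu>.emeasure_space_1)
  finally show ?thesis .
qed

lemma is_normalized_haar_haar: "is_normalized_haar (haar :: (complex^'n^'n) measure)"
proof -
  obtain \<mu> :: "(complex^'n^'n) measure" where \<mu>: "is_normalized_haar \<mu>" using ex_normalized_haar by blast
  have "\<nu> = \<mu>" if \<nu>: "is_normalized_haar \<nu>" for \<nu>
  proof (rule measure_eqI)
    show "sets \<nu> = sets \<mu>" using \<mu> \<nu> by (simp add: is_normalized_haar_def)
    fix A assume "A \<in> sets \<nu>"
    then have "A \<in> sets (restrict_space borel {U. unitary U})" using \<nu> by (simp add: is_normalized_haar_def)
    then show "emeasure \<nu> A = emeasure \<mu> A"
      using normalized_haar_eq_inverse[OF \<nu> \<mu>] normalized_haar_eq_inverse[OF \<mu> \<mu>] by simp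
  qed
  then show ?thesis unfolding haar_def using \<mu> by (rule theI[rotated])
qed

lemma sets_haar: "sets haar = sets (restrict_space borel {U. unitary U})"
  and prob_space_haar: "prob_space (haar :: (complex^'n^'n) measure)"
  using is_normalized_haar_haar by (auto simp: is_normalized_haar_def)

lemma space_haar: "space haar = {U. unitary U}"
  using sets_eq_imp_space_eq[OF sets_haar] by (simp add: space_restrict_space)

lemma borel_measurable_haar: "f \<in> borel_measurable borel \<Longrightarrow> f \<in> borel_measurable haar"
  by (subst measurable_cong_sets[OF sets_haar refl]) (rule measurable_restrict_space1)

lemma measurable_haar_id [measurable]: "(\<lambda>U. U) \<in> haar \<rightarrow>\<^sub>M borel"
  by (rule borel_measurable_haar) simp

lemma integral_haar_left:
  fixes f :: "complex^'n^'n \<Rightarrow> 'b::{banach,second_countable_topology}"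
  assumes W: "unitary W" and f: "f \<in> borel_measurable borel"
  shows "(\<integral>V. f (W ** V) \<partial>haar) = (\<integral>V. f V \<partial>haar)"
proof -
  have "(\<lambda>V. W ** V) \<in> haar \<rightarrow>\<^sub>M restrict_space borel {U. unitary U}"
    using W by (intro measurable_unitary_mult[where f="\<lambda>_. W" and g="\<lambda>V. V"]
        measurable_const measurable_ident_sets[OF sets_haar]) (simp add: space_restrict_space)
  then have m: "(\<lambda>V. W ** V) \<in> haar \<rightarrow>\<^sub>M haar" by (simp add: measurable_cong_sets[OF refl sets_haar])
  have "(\<integral>V. f V \<partial>haar) = (\<integral>V. f V \<partial>distr haar haar (\<lambda>V. W ** V))"
    using is_normalized_haar_haar[where 'n='n] W by (simp add: is_normalized_haar_def)
  then show ?thesis using borel_measurable_haar[OF f] by (simp add: integral_distr[OF m])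
qed

lemma distr_haar_conj_transpose: "distr haar haar conj_transpose = (haar :: (complex^'n^'n) measure)"
proof (rule measure_eqI)
  have "conj_transpose \<in> haar \<rightarrow>\<^sub>M restrict_space borel {U::complex^'n^'n. unitary U}"
    by (intro measurable_unitary_conj_transpose measurable_ident_sets[OF sets_haar])
  then have m: "conj_transpose \<in> haar \<rightarrow>\<^sub>M (haar :: (complex^'n^'n) measure)"
    by (simp add: measurable_cong_sets[OF refl sets_haar])
  fix A :: "(complex^'n^'n) set" assume "A \<in> sets (distr haar haar conj_transpose)"
  then have A: "A \<in> sets haar" by simp
  have "emeasure (distr haar haar conj_transpose) A = (\<integral>\<^sup>+U. indicator A U \<partial>distr haar haar conj_transpose)"
    using A by simp
  also have "\<dots> = (\<integral>\<^sup>+U. indicator A (conj_transpose U) \<partial>haar)"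
    using A by (intro nn_integral_distr[OF m]) simp
  also have "\<dots> = emeasure haar A"
    using A by (intro normalized_haar_eq_inverse[OF is_normalized_haar_haar is_normalized_haar_haar, symmetric])
      (simp add: sets_haar)
  finally show "emeasure (distr haar haar conj_transpose) A = emeasure haar A" .
qed simp

section \<open>Vandermonde determinants\<close>

text \<open>
  The position of an index in the order of \<open>'n\<close>, counted from \<open>0\<close>; it is the exponent in the corresponding column of the
  Vandermonde matrix.
\<close>

definition index_rank :: "'n::{finite,linorder} \<Rightarrow> nat" where
  "index_rank j = card {i. i < j}"

text \<open>
  The Vandermonde product at complex arguments. The arguments are complex because the orbit identities below are integrated
  against a Gaussian along an imaginary direction.
\<close>

definition cvandermonde :: "('n::{finite,linorder} \<Rightarrow> complex) \<Rightarrow> complex" where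
  "cvandermonde y = (\<Prod>p\<in>{p. fst p < snd p}. y (snd p) - y (fst p))"

lemma index_rank_less: "i < j \<Longrightarrow> index_rank i < index_rank (j :: 'n::{finite,linorder})"
  unfolding index_rank_def by (rule psubset_card_mono) (auto dest: less_trans)

lemma bij_index_rank: "bij_betw (index_rank :: 'n::{finite,linorder} \<Rightarrow> nat) UNIV {..<CARD('n)}"
proof -
  have inj: "inj (index_rank :: 'n \<Rightarrow> nat)"
    by (rule injI) (metis index_rank_less less_irrefl linorder_neqE)
  have "index_rank j < CARD('n)" for j :: 'n
    unfolding index_rank_def by (rule psubset_card_mono) auto
  then have "range (index_rank :: 'n \<Rightarrow> nat) \<subseteq> {..<CARD('n)}" by auto
  moreover have "card (range (index_rank :: 'n \<Rightarrow> nat)) = CARD('n)"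
    using inj by (simp add: card_image)
  ultimately have "range (index_rank :: 'n \<Rightarrow> nat) = {..<CARD('n)}"
    by (intro card_subset_eq) auto
  with inj show ?thesis by (simp add: bij_betw_def)
qed

lemma permutes_ge_imp_id:
  assumes p: "p permutes (UNIV :: 'n::{finite,linorder} set)" and ge: "\<And>i. i \<le> p i"
  shows "p = id"
proof
  fix i
  have "(\<Sum>i\<in>UNIV. index_rank (i::'n)) = (\<Sum>i\<in>UNIV. index_rank (p i))"
    using sum.permute[OF p, of index_rank] by (simp add: comp_def)
  moreover have "index_rank i \<le> index_rank (p i)" for i
    using ge[of i] index_rank_less[of i "p i"] by (cases "i = p i") (auto simp: less_le)
  ultimately have "index_rank i = index_rank (p i)"
    by (intro sum_mono_inv[of index_rank UNIV "\<lambda>i. index_rank (p i)"]) auto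
  then show "p i = id i" using bij_index_rank[where 'n='n] by (auto simp: bij_betw_def inj_eq)
qed

lemma det_triangular:
  fixes A :: "'a::comm_ring_1^('n::{finite,linorder})^('n::{finite,linorder})"
  assumes A: "\<And>i j. j < i \<Longrightarrow> A $ i $ j = 0"
  shows "det A = (\<Prod>i\<in>UNIV. A $ i $ i)"
proof -
  have "det A = (\<Sum>p\<in>{id}. of_int (sign p) * (\<Prod>i\<in>UNIV. A $ i $ p i))"
    unfolding det_def
  proof (rule sum.mono_neutral_right)
    show "\<forall>p\<in>{p. p permutes UNIV} - {id}. of_int (sign p) * (\<Prod>i\<in>UNIV. A $ i $ p i) = 0"
    proof
      fix p :: "'n \<Rightarrow> 'n" assume "p \<in> {p. p permutes UNIV} - {id}"
      then have "\<exists>i. \<not> i \<le> p i" using permutes_ge_imp_id[of p] by blast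
      then obtain i where "p i < i" by (auto simp: not_le)
      then have "(\<Prod>i\<in>UNIV. A $ i $ p i) = 0" by (intro prod_zero bexI[of _ i]) (auto simp: A)
      then show "of_int (sign p) * (\<Prod>i\<in>UNIV. A $ i $ p i) = 0" by simp
    qed
  qed (auto simp: permutes_id finite_permutations)
  then show ?thesis by (simp add: sign_id)
qed

text \<open>
  Column operations: the coefficients of monic polynomials of degrees \<open>0, ..., n - 1\<close> form a unitriangular matrix. Hence any such
  family, Newton's or Hermite's, computes the Vandermonde determinant.
\<close>

lemma det_monic_polys:
  fixes p :: "'n::{finite,linorder} \<Rightarrow> complex poly"
  assumes deg: "\<And>j. degree (p j) = index_rank j" and monic: "\<And>j. lead_coeff (p j) = 1"
  shows "det (\<chi> k j. poly (p j) (y k)) = det (\<chi> k j. y k ^ index_rank j)"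
proof -
  have expand: "poly (p j) x = (\<Sum>i\<in>(UNIV::'n set). x ^ index_rank i * coeff (p j) (index_rank i))" for j x
  proof -
    have "degree (p j) < CARD('n)" using bij_index_rank deg by (auto simp: bij_betw_def)
    then have "poly (p j) x = (\<Sum>m\<in>{..<CARD('n)}. x ^ m * coeff (p j) m)"
      unfolding poly_altdef by (intro sum.mono_neutral_cong_left) (auto simp: coeff_eq_0 mult.commute)
    also have "\<dots> = (\<Sum>i\<in>(UNIV::'n set). x ^ index_rank i * coeff (p j) (index_rank i))"
      by (rule sum.reindex_bij_betw[OF bij_index_rank, of "\<lambda>m. x ^ m * coeff (p j) m", symmetric])
    finally show ?thesis .
  qed
  let ?C = "(\<chi> i j. coeff (p j) (index_rank i)) :: 'n cmatrix"
  have "(\<chi> k j. poly (p j) (y k)) = (\<chi> k j. y k ^ index_rank j) ** ?C"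
    by (simp add: vec_eq_iff matrix_matrix_mult_def expand)
  moreover have "det ?C = (\<Prod>i\<in>UNIV. ?C $ i $ i)"
    by (rule det_triangular) (simp add: coeff_eq_0 deg index_rank_less)
  moreover have "(\<Prod>i\<in>UNIV. ?C $ i $ i) = 1" using monic by (simp add: deg)
  ultimately show ?thesis by (simp add: det_mul)
qed

text \<open>
  With the Newton polynomials, whose zeros are the earlier nodes, the matrix is triangular.
\<close>

lemma cvandermonde_eq_det: "cvandermonde y = det (\<chi> k j. y k ^ index_rank j)"
proof -
  define N where "N j = (\<Prod>i\<in>{i. i < j}. [:- y i, 1:])" for j
  have "det (\<chi> k j. poly (N j) (y k)) = det (transpose (\<chi> k j. poly (N j) (y k)))"
    by (simp add: det_transpose)
  also have "\<dots> = (\<Prod>k\<in>UNIV. poly (N k) (y k))"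
    by (subst det_triangular) (auto simp: transpose_def N_def poly_prod intro!: prod_zero)
  also have "\<dots> = (\<Prod>k\<in>UNIV. \<Prod>i\<in>{i. i < k}. y k - y i)"
    by (simp add: N_def poly_prod)
  also have "\<dots> = (\<Prod>p\<in>(SIGMA k:UNIV. {i. i < k}). y (fst p) - y (snd p))"
    by (subst prod.Sigma) (auto simp: case_prod_unfold)
  also have "\<dots> = cvandermonde y"
    unfolding cvandermonde_def
    by (rule prod.reindex_bij_witness[where i=prod.swap and j=prod.swap]) auto
  finally have "cvandermonde y = det (\<chi> k j. poly (N j) (y k))" by simp
  also have "\<dots> = det (\<chi> k j. y k ^ index_rank j)"
  proof (rule det_monic_polys)
    show "degree (N j) = index_rank j" for j
      unfolding N_def index_rank_def by (subst degree_prod_sum_eq) auto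
    show "lead_coeff (N j) = 1" for j
      unfolding N_def by (simp add: lead_coeff_prod)
  qed
  finally show ?thesis .
qed

lemma cvandermonde_expand:
  "cvandermonde y = (\<Sum>p\<in>{p. p permutes UNIV}. of_int (sign p) * (\<Prod>k\<in>UNIV. y k ^ index_rank (p k)))"
  by (simp add: cvandermonde_eq_det det_def)

lemma cvandermonde_permute:
  assumes "\<sigma> permutes UNIV"
  shows "cvandermonde (\<lambda>k. y (\<sigma> k)) = of_int (sign \<sigma>) * cvandermonde y"
  using det_permute_rows[OF assms, of "\<chi> k j. y k ^ index_rank j"]
  by (simp add: cvandermonde_eq_det)

lemma cvandermonde_scale:
  fixes y :: "'n::{finite,linorder} \<Rightarrow> complex"
  shows "cvandermonde (\<lambda>k. c * y k) = c ^ card {p::'n::{finite,linorder}\<times>'n. fst p < snd p} * cvandermonde y"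
  by (simp add: cvandermonde_def prod.distrib flip: right_diff_distrib)

lemma cvandermonde_of_real: "cvandermonde (\<lambda>k. of_real (x $ k)) = of_real (vandermonde x)"
  by (simp add: cvandermonde_def vandermonde_def case_prod_unfold)

lemma card_index_pairs: "card {p::'n::{finite,linorder}\<times>'n. fst p < snd p} = CARD('n) * (CARD('n) - 1) div 2"
proof -
  let ?L = "{p::'n\<times>'n. fst p < snd p}" and ?G = "{p::'n\<times>'n. snd p < fst p}" and ?D = "(\<lambda>i. (i, i)) ` (UNIV::'n set)"
  have "card ?G = card ?L" by (rule bij_betw_same_card[of prod.swap]) (auto simp: bij_betw_def inj_on_def image_iff)
  moreover have "card ?D = CARD('n)" by (intro card_image) (auto simp: inj_on_def)
  moreover have "(UNIV :: ('n\<times>'n) set) = ?L \<union> (?G \<union> ?D)" by auto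
  then have "card (UNIV :: ('n\<times>'n) set) = card (?L \<union> (?G \<union> ?D))" by simp
  moreover have "card (?L \<union> (?G \<union> ?D)) = card ?L + (card ?G + card ?D)"
    by (subst card_Un_disjoint, auto)+
  ultimately have "CARD('n) * CARD('n) = 2 * card ?L + CARD('n)" by simp
  then have "2 * card ?L = CARD('n) * (CARD('n) - 1)" by (simp add: diff_mult_distrib2)
  then show ?thesis by simp
qed

text \<open>
  The derivative of \<open>cvandermonde\<close> at \<open>y\<close> in the direction \<open>d\<close>.
\<close>

definition vandermonde_deriv :: "('n::{finite,linorder} \<Rightarrow> complex) \<Rightarrow> ('n \<Rightarrow> complex) \<Rightarrow> complex" where
  "vandermonde_deriv d y = (\<Sum>p\<in>{p. fst p < snd p}. (d (snd p) - d (fst p)) *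
     (\<Prod>q\<in>{q. fst q < snd q} - {p}. y (snd q) - y (fst q)))"

lemma has_vector_derivative_complex_of_real: "(complex_of_real has_vector_derivative 1) (at t)"
  unfolding has_vector_derivative_def
  using has_derivative_of_real[OF has_derivative_ident, of "at t", where 'a=complex]
  by (simp add: scaleR_conv_of_real)

lemma has_vector_derivative_cvandermonde:
  "((\<lambda>t. cvandermonde (\<lambda>k. y k + of_real t * d k)) has_vector_derivative
     vandermonde_deriv d (\<lambda>k. y k + of_real t * d k)) (at t)"
proof -
  have 1: "((\<lambda>z. \<Prod>p\<in>{p. fst p < snd p}. (y (snd p) + z * d (snd p)) - (y (fst p) + z * d (fst p)))
     has_field_derivative (\<Sum>p\<in>{p. fst p < snd p}. (d (snd p) - d (fst p)) *
       (\<Prod>q\<in>{q. fst q < snd q} - {p}. (y (snd q) + of_real t * d (snd q)) - (y (fst q) + of_real t * d (fst q)))))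
     (at (of_real t))"
    by (rule has_field_derivative_prod) (auto intro!: derivative_eq_intros)
  show ?thesis
    using field_vector_diff_chain_at[where f=of_real and x=t and f'=1, OF has_vector_derivative_complex_of_real 1]
    unfolding cvandermonde_def vandermonde_deriv_def
    by (simp add: o_def)
qed

lemma norm_cvandermonde_le:
  fixes y :: "'n::{finite,linorder} \<Rightarrow> complex"
  assumes "\<And>k. cmod (y k) \<le> B"
  shows "cmod (cvandermonde y) \<le> (2 * B) ^ card {p::'n\<times>'n. fst p < snd p}"
proof -
  have "cmod (cvandermonde y) \<le> (\<Prod>p\<in>{p::'n\<times>'n. fst p < snd p}. 2 * B)"
    unfolding cvandermonde_def prod_norm[symmetric]
  proof (intro prod_mono conjI norm_ge_zero)
    fix q :: "'n \<times> 'n"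
    show "cmod (y (snd q) - y (fst q)) \<le> 2 * B"
      using norm_triangle_ineq4[of "y (snd q)" "y (fst q)"] assms[of "snd q"] assms[of "fst q"] by linarith
  qed
  then show ?thesis by simp
qed

lemma norm_vandermonde_deriv_le:
  fixes y d :: "'n::{finite,linorder} \<Rightarrow> complex"
  assumes y: "\<And>k. cmod (y k) \<le> B" and B: "1 \<le> B" and d: "\<And>k. cmod (d k) \<le> D"
  shows "cmod (vandermonde_deriv d y) \<le>
    real (card {p::'n\<times>'n. fst p < snd p}) * (2 * D) * (2 * B) ^ card {p::'n\<times>'n. fst p < snd p}"
proof -
  let ?P = "{p::'n\<times>'n. fst p < snd p}"
  have D: "0 \<le> D" using order_trans[OF norm_ge_zero d] .
  have "cmod (vandermonde_deriv d y) \<le> (\<Sum>p\<in>?P. (2 * D) * (2 * B) ^ card ?P)"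
    unfolding vandermonde_deriv_def
  proof (intro sum_norm_le)
    fix p assume "p \<in> ?P"
    have "cmod (d (snd p) - d (fst p)) \<le> 2 * D"
      using norm_triangle_ineq4[of "d (snd p)" "d (fst p)"] d[of "snd p"] d[of "fst p"] by linarith
    moreover have "cmod (\<Prod>q\<in>?P - {p}. y (snd q) - y (fst q)) \<le> (\<Prod>q\<in>?P - {p}. 2 * B)"
      unfolding prod_norm[symmetric]
    proof (intro prod_mono conjI norm_ge_zero)
      fix q
      show "cmod (y (snd q) - y (fst q)) \<le> 2 * B"
        using norm_triangle_ineq4[of "y (snd q)" "y (fst q)"] y[of "snd q"] y[of "fst q"] by linarith
    qed
    moreover have "(\<Prod>q\<in>?P - {p}. 2 * B) \<le> (2 * B) ^ card ?P"
      unfolding prod_constant using B by (intro power_increasing card_mono) auto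
    ultimately show "cmod ((d (snd p) - d (fst p)) * (\<Prod>q\<in>?P - {p}. y (snd q) - y (fst q)))
        \<le> (2 * D) * (2 * B) ^ card ?P"
      unfolding norm_mult using D B by (intro mult_mono) auto
  qed
  then show ?thesis by (simp add: mult_ac)
qed

section \<open>Gaussian integrals of Vandermonde determinants\<close>

text \<open>
  With the variance \<open>c\<close>, these are the monic Hermite polynomials; \<open>c = 1\<close> gives the probabilists' ones.
\<close>

fun hermite_poly :: "complex \<Rightarrow> nat \<Rightarrow> complex poly" where
  "hermite_poly c 0 = 1"
| "hermite_poly c (Suc 0) = [:0, 1:]"
| "hermite_poly c (Suc (Suc m)) = [:0, 1:] * hermite_poly c (Suc m) - smult (of_nat (Suc m) * c) (hermite_poly c m)"

lemma hermite_poly_monic: "degree (hermite_poly c m) = m \<and> lead_coeff (hermite_poly c m) = 1"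
proof (induction c m rule: hermite_poly.induct)
  case (3 c m)
  let ?A = "[:0, 1:] * hermite_poly c (Suc m)" and ?B = "smult (of_nat (Suc m) * c) (hermite_poly c m)"
  have A: "?A = pCons 0 (hermite_poly c (Suc m))" by simp
  have d: "degree (hermite_poly c (Suc m)) = Suc m" "degree (hermite_poly c m) = m" using 3 by auto
  have l: "coeff (hermite_poly c (Suc m)) (Suc m) = 1" using 3(1) d by simp
  have "hermite_poly c (Suc m) \<noteq> 0" using l by auto
  then have degA: "degree ?A = Suc (Suc m)" unfolding A using d by (simp add: degree_pCons_eq)
  have degB: "degree ?B < Suc (Suc m)" using d degree_smult_le[of "of_nat (Suc m) * c" "hermite_poly c m"] by linarith
  have "degree (?A - ?B) = Suc (Suc m)"
    using degree_add_eq_left[of "- ?B" ?A] degA degB by simp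
  moreover have "coeff (?A - ?B) (Suc (Suc m)) = 1"
    using coeff_eq_0[OF degB] l by (simp add: A)
  ultimately show ?case by simp
qed auto

lemma integrable_poly_gaussian_bound:
  fixes f :: "'a::euclidean_space \<Rightarrow> 'b::{banach,second_countable_topology}"
  assumes "0 < \<epsilon>" "f \<in> borel_measurable borel"
    and "\<And>s. norm (f s) \<le> C * ((1 + norm s) ^ m * exp (- \<epsilon> * (norm s)\<^sup>2))"
  shows "integrable lborel f"
proof (rule Bochner_Integration.integrable_bound)
  show "integrable lborel (\<lambda>s::'a. C * ((1 + norm s) ^ m * exp (- \<epsilon> * (norm s)\<^sup>2)))"
    by (intro integrable_mult_right integrable_poly_gaussian assms)
  show "AE s in lborel. norm (f s) \<le> norm (C * ((1 + norm s) ^ m * exp (- \<epsilon> * (norm s)\<^sup>2)))"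
    using assms(3) by (intro AE_I2) (metis abs_ge_self order_trans real_norm_def)
qed (use assms in simp)

lemma integral_derivative_eq_0:
  fixes F f :: "real \<Rightarrow> complex"
  assumes "\<And>x. (F has_vector_derivative f x) (at x)" "continuous_on UNIV f" "integrable lborel f"
    and "(F \<longlongrightarrow> 0) at_top" "(F \<longlongrightarrow> 0) at_bot"
  shows "(\<integral>x. f x \<partial>lborel) = 0"
proof -
  have "(LBINT x=-\<infinity>..\<infinity>. f x) = 0 - 0"
  proof (rule interval_integral_FTC_integrable)
    show "set_integrable lborel (einterval (- \<infinity>) \<infinity>) f"
      using assms(3) by (simp add: set_integrable_def einterval_def)
    show "((F \<circ> real_of_ereal) \<longlongrightarrow> 0) (at_right (- \<infinity>))" "((F \<circ> real_of_ereal) \<longlongrightarrow> 0) (at_left \<infinity>)"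
      using assms(4,5) by (simp_all add: ereal_tendsto_simps)
  qed (use assms in \<open>auto simp: continuous_on_eq_continuous_at\<close>)
  then show ?thesis
    by (simp add: interval_lebesgue_integral_def einterval_def set_lebesgue_integral_def)
qed

text \<open>
  Up to normalization, the characteristic function of the normal law with variance \<open>1 / (2 \<epsilon>)\<close>.
\<close>

lemma gaussian_char:
  assumes \<epsilon>: "0 < \<epsilon>"
  shows "(\<integral>u. of_real (exp (- \<epsilon> * u\<^sup>2)) * exp (\<i> * of_real (u * D)) \<partial>lborel)
    = of_real (sqrt (pi / \<epsilon>) * exp (- D\<^sup>2 / (4 * \<epsilon>)))"
proof -
  define \<sigma> where "\<sigma> = 1 / sqrt (2 * \<epsilon>)"
  have \<sigma>: "\<sigma> > 0" "\<sigma>\<^sup>2 = 1 / (2 * \<epsilon>)" using \<epsilon> by (auto simp: \<sigma>_def power_divide)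
  have "(\<integral>u. of_real (exp (- \<epsilon> * u\<^sup>2)) * exp (\<i> * of_real (u * D)) \<partial>lborel)
      = \<bar>\<sigma>\<bar> *\<^sub>R (\<integral>u. of_real (exp (- \<epsilon> * (0 + \<sigma> * u)\<^sup>2)) * exp (\<i> * of_real ((0 + \<sigma> * u) * D)) \<partial>lborel)"
    using \<sigma>(1) by (intro lborel_integral_real_affine) simp
  also have "(\<lambda>u. of_real (exp (- \<epsilon> * (0 + \<sigma> * u)\<^sup>2)) * exp (\<i> * of_real ((0 + \<sigma> * u) * D)))
      = (\<lambda>u. of_real (sqrt (2 * pi)) * (std_normal_density u *\<^sub>R iexp (\<sigma> * D * u)))"
    using \<sigma> \<epsilon> by (auto simp: fun_eq_iff std_normal_density_def power_mult_distrib scaleR_conv_of_real mult_ac)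
  also have "(\<integral>u. of_real (sqrt (2 * pi)) * (std_normal_density u *\<^sub>R iexp (\<sigma> * D * u)) \<partial>lborel)
      = of_real (sqrt (2 * pi)) * (\<integral>u. std_normal_density u *\<^sub>R iexp (\<sigma> * D * u) \<partial>lborel)"
    by (rule integral_mult_right_zero)
  also have "(\<integral>u. std_normal_density u *\<^sub>R iexp (\<sigma> * D * u) \<partial>lborel) = char std_normal_distribution (\<sigma> * D)"
    unfolding char_def by (subst integral_density) auto
  also have "\<dots> = of_real (exp (- (\<sigma> * D)\<^sup>2 / 2))"
    by (simp add: char_std_normal_distribution)
  finally have "(\<integral>u. of_real (exp (- \<epsilon> * u\<^sup>2)) * exp (\<i> * of_real (u * D)) \<partial>lborel)
      = of_real (\<sigma> * sqrt (2 * pi) * exp (- (\<sigma> * D)\<^sup>2 / 2))"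
    using \<sigma>(1) by (simp add: scaleR_conv_of_real)
  moreover have "\<sigma> * sqrt (2 * pi) = sqrt (pi / \<epsilon>)"
    using \<epsilon> by (simp add: \<sigma>_def real_sqrt_divide real_sqrt_mult)
  moreover have "- (\<sigma> * D)\<^sup>2 / 2 = - D\<^sup>2 / (4 * \<epsilon>)" using \<epsilon> by (simp add: power_mult_distrib \<sigma>(2))
  ultimately show ?thesis by simp
qed

text \<open>
  Integrating the derivative of \<open>f m\<close> over the line gives zero, and this is the three-term recurrence of the Hermite
  polynomials. What the determinants below rely on is that the answer is a monic polynomial of degree \<open>m\<close> in \<open>a - D / (2 \<epsilon>)\<close>.
\<close>

lemma
  fixes a :: complex and D :: real
  assumes \<epsilon>: "0 < \<epsilon>"
  defines "f \<equiv> \<lambda>m u. of_real (exp (- \<epsilon> * u\<^sup>2)) * (a + \<i> * of_real u) ^ m * exp (\<i> * of_real (u * D))"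
  shows integrable_gaussian_moment: "integrable lborel (f m)"
    and gaussian_moment: "(\<integral>u. f m u \<partial>lborel) = of_real (sqrt (pi / \<epsilon>) * exp (- D\<^sup>2 / (4 * \<epsilon>))) *
      poly (hermite_poly (of_real (1 / (2 * \<epsilon>))) m) (a - of_real (D / (2 * \<epsilon>)))"
proof -
  have bound: "cmod (f m u) \<le> (1 + cmod a) ^ m * ((1 + norm u) ^ m * exp (- \<epsilon> * (norm u)\<^sup>2))" for m u
  proof -
    have "cmod (a + \<i> * of_real u) \<le> cmod a + \<bar>u\<bar>"
      using norm_triangle_ineq[of a "\<i> * of_real u"] by (simp add: norm_mult)
    also have "\<dots> \<le> (1 + cmod a) * (1 + \<bar>u\<bar>)" by (simp add: algebra_simps)
    finally have "cmod (a + \<i> * of_real u) ^ m \<le> ((1 + cmod a) * (1 + \<bar>u\<bar>)) ^ m"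
      by (intro power_mono) auto
    moreover have "cmod (exp (\<i> * of_real (u * D))) = 1" by (simp only: norm_exp_i_times)
    ultimately show ?thesis
      by (simp add: f_def norm_mult norm_power power_mult_distrib mult_ac mult_left_mono)
  qed
  have int: "integrable lborel (f m)" for m
    by (rule integrable_poly_gaussian_bound[OF \<epsilon> _ bound]) (simp add: f_def)
  then show "integrable lborel (f m)" .
  have lim: "(f m \<longlongrightarrow> 0) F" if "filterlim norm at_top F" for m F
  proof (rule Lim_null_comparison)
    let ?C = "(1 + cmod a) ^ m * ((real m + 1) ^ m * exp (1 + 1 / (2 * \<epsilon>)))"
    show "\<forall>\<^sub>F u in F. norm (f m u) \<le> ?C * exp (- (\<epsilon> / 2) * (norm u)\<^sup>2)"
    proof (intro always_eventually allI)
      fix u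
      show "norm (f m u) \<le> ?C * exp (- (\<epsilon> / 2) * (norm u)\<^sup>2)"
        using order_trans[OF bound[of m u] mult_left_mono[OF poly_gaussian_le[OF \<epsilon> norm_ge_zero, of u m], of "(1 + cmod a) ^ m"]]
        by (simp add: mult_ac)
    qed
    have "((\<lambda>r. ?C * exp (- (\<epsilon> / 2) * r\<^sup>2)) \<longlongrightarrow> 0) at_top"
      using \<epsilon> by real_asymp
    from filterlim_compose[OF this that] show "((\<lambda>u. ?C * exp (- (\<epsilon> / 2) * (norm u)\<^sup>2)) \<longlongrightarrow> 0) F" .
  qed
  have norm_top: "filterlim norm at_top (at_top :: real filter)" "filterlim norm at_top (at_bot :: real filter)"
    unfolding real_norm_def by real_asymp+
  let ?c = "complex_of_real (1 / (2 * \<epsilon>))" and ?v = "a - complex_of_real (D / (2 * \<epsilon>))"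
  define M where "M m = (\<integral>u. f m u \<partial>lborel)" for m
  have fSuc: "f (Suc m) u = a * f m u + \<i> * (of_real u * f m u)" for m u
    by (simp add: f_def algebra_simps)
  have int_u: "integrable lborel (\<lambda>u. of_real u * f m u)" for m
  proof -
    have "integrable lborel (\<lambda>u. - \<i> * (f (Suc m) u - a * f m u))"
      by (intro integrable_mult_right Bochner_Integration.integrable_diff int)
    also have "(\<lambda>u. - \<i> * (f (Suc m) u - a * f m u)) = (\<lambda>u. of_real u * f m u)"
      by (simp add: fSuc fun_eq_iff)
    finally show ?thesis .
  qed
  have stein: "of_real (2 * \<epsilon>) * (\<integral>u. of_real u * f m u \<partial>lborel) = \<i> * of_nat m * M (m - 1) + \<i> * of_real D * M m" for m
  proof -
    define g where "g u = - of_real (2 * \<epsilon>) * (of_real u * f m u) + (\<i> * of_nat m * f (m - 1) u + \<i> * of_real D * f m u)" for u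
    have der: "(f m has_vector_derivative g u) (at u)" for u
    proof -
      have "((\<lambda>u. exp (- of_real \<epsilon> * u\<^sup>2) * (a + \<i> * u) ^ m * exp (\<i> * (u * of_real D))) has_field_derivative
          - of_real (2 * \<epsilon>) * (of_real u * f m u) + (\<i> * of_nat m * f (m - 1) u + \<i> * of_real D * f m u)) (at (of_real u))"
        unfolding f_def
        by (rule derivative_eq_intros refl | simp)+ (simp add: exp_of_real[symmetric] algebra_simps)
      from field_vector_diff_chain_at[where f=of_real and x=u and f'=1, OF has_vector_derivative_complex_of_real this]
      show ?thesis
        by (simp add: o_def f_def g_def exp_of_real[symmetric])
    qed
    have "(\<integral>u. g u \<partial>lborel) = 0"
    proof (rule integral_derivative_eq_0[OF der])
      show "continuous_on UNIV g" unfolding g_def f_def by (intro continuous_intros)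
      show "integrable lborel g"
        unfolding g_def by (intro Bochner_Integration.integrable_add integrable_mult_right int int_u)
    qed (intro lim norm_top)+
    moreover have "(\<integral>u. g u \<partial>lborel) = - of_real (2 * \<epsilon>) * (\<integral>u. of_real u * f m u \<partial>lborel)
        + (\<i> * of_nat m * M (m - 1) + \<i> * of_real D * M m)"
      unfolding g_def M_def
      by (subst Bochner_Integration.integral_add, intro integrable_mult_right int_u,
          intro Bochner_Integration.integrable_add integrable_mult_right int,
          subst Bochner_Integration.integral_add, intro integrable_mult_right int, intro integrable_mult_right int) simp
    ultimately show ?thesis by (simp add: algebra_simps)
  qed
  have rec: "M (Suc m) = ?v * M m - of_nat m * ?c * M (m - 1)" for m
  proof -
    have "M (Suc m) = a * M m + \<i> * (\<integral>u. of_real u * f m u \<partial>lborel)"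
      unfolding M_def fSuc by (subst Bochner_Integration.integral_add) (auto intro!: integrable_mult_right int int_u)
    also have "(\<integral>u. of_real u * f m u \<partial>lborel) = ?c * (\<i> * of_nat m * M (m - 1) + \<i> * of_real D * M m)"
      using stein[of m] \<epsilon> by (simp add: field_simps)
    also have "a * M m + \<i> * \<dots> = ?v * M m - of_nat m * ?c * M (m - 1)"
      using \<epsilon> by (simp add: field_simps)
    finally show ?thesis .
  qed
  let ?K = "of_real (sqrt (pi / \<epsilon>) * exp (- D\<^sup>2 / (4 * \<epsilon>))) :: complex"
  have M0: "M 0 = ?K" using gaussian_char[OF \<epsilon>, of D] by (simp add: M_def f_def)
  have "M m = ?K * poly (hermite_poly ?c m) ?v \<and> M (Suc m) = ?K * poly (hermite_poly ?c (Suc m)) ?v" for m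
  proof (induction m)
    case 0
    show ?case using rec[of 0] M0 by (simp add: mult.commute)
  next
    case (Suc m)
    have "M (Suc (Suc m)) = ?v * M (Suc m) - of_nat (Suc m) * ?c * M m" using rec[of "Suc m"] by simp
    also have "\<dots> = ?K * poly (hermite_poly ?c (Suc (Suc m))) ?v"
      using Suc by (simp add: algebra_simps)
    finally show ?case using Suc by blast
  qed
  then show "(\<integral>u. f m u \<partial>lborel) = ?K * poly (hermite_poly ?c m) ?v" by (simp add: M_def)
qed

text \<open>
  A Gaussian average along the imaginary direction reproduces the Vandermonde determinant. Expand it over the permutations; each
  term factors into one-dimensional moments, which replace the monomials by Hermite polynomials, and these yield the same
  determinant because they are monic.
\<close>

lemma
  fixes a :: "'n::{finite,linorder} \<Rightarrow> complex" and D :: "'n \<Rightarrow> real"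
  assumes \<epsilon>: "0 < \<epsilon>"
  defines "f \<equiv> \<lambda>s::'n rvector. of_real (exp (- \<epsilon> * (norm s)\<^sup>2)) * cvandermonde (\<lambda>k. a k + \<i> * of_real (s $ k)) *
      exp (\<i> * of_real (\<Sum>k\<in>UNIV. s $ k * D k))"
  shows integrable_gaussian_cvandermonde: "integrable lborel f"
    and gaussian_integral_cvandermonde: "(\<integral>s. f s \<partial>lborel) =
      of_real (sqrt (pi / \<epsilon>) ^ CARD('n) * exp (- (\<Sum>k\<in>UNIV. (D k)\<^sup>2) / (4 * \<epsilon>))) *
      cvandermonde (\<lambda>k. a k - of_real (D k / (2 * \<epsilon>)))"
proof -
  \<comment> \<open>The factor of the coordinate \<open>k\<close> in the term of the permutation \<open>p\<close>.\<close>
  define g where "g p k u = of_real (exp (- \<epsilon> * u\<^sup>2)) * (a k + \<i> * of_real u) ^ index_rank (p k :: 'n) *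
      exp (\<i> * of_real (u * D k))" for p :: "'n \<Rightarrow> 'n" and k u
  let ?P = "{p. p permutes (UNIV :: 'n set)}"
  have f: "f s = (\<Sum>p\<in>?P. of_int (sign p) * (\<Prod>k\<in>UNIV. g p k (s $ k)))" for s
  proof -
    have "(norm s)\<^sup>2 = (\<Sum>k\<in>UNIV. (s $ k)\<^sup>2)"
      by (simp add: norm_vec_def L2_set_def sum_nonneg)
    then have e: "complex_of_real (exp (- \<epsilon> * (norm s)\<^sup>2)) = (\<Prod>k\<in>UNIV. of_real (exp (- \<epsilon> * (s $ k)\<^sup>2)))"
      by (simp add: sum_distrib_left exp_sum sum_negf[symmetric])
    have e': "exp (\<i> * of_real (\<Sum>k\<in>UNIV. s $ k * D k)) = (\<Prod>k\<in>UNIV. exp (\<i> * of_real (s $ k * D k)))"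
      by (simp add: sum_distrib_left exp_sum)
    show ?thesis
      unfolding f_def e e' cvandermonde_expand g_def
      by (simp add: sum_distrib_left sum_distrib_right prod.distrib mult_ac)
  qed
  have gint: "integrable lborel (g p k)" for p k
    unfolding g_def by (rule integrable_gaussian_moment[OF \<epsilon>])
  have pint: "integrable lborel (\<lambda>s::'n rvector. \<Prod>k\<in>UNIV. g p k (s $ k))" for p
    by (rule integrable_prod_vec[OF gint])
  show "integrable lborel f"
    unfolding f by (intro Bochner_Integration.integrable_sum integrable_mult_right pint)
  let ?c = "complex_of_real (1 / (2 * \<epsilon>))" and ?v = "\<lambda>k. a k - complex_of_real (D k / (2 * \<epsilon>))"
  let ?K = "\<lambda>k. complex_of_real (sqrt (pi / \<epsilon>) * exp (- (D k)\<^sup>2 / (4 * \<epsilon>)))"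
  have "(\<integral>s. f s \<partial>lborel) = (\<Sum>p\<in>?P. of_int (sign p) * (\<integral>s. (\<Prod>k\<in>UNIV. g p k (s $ k)) \<partial>lborel))"
    unfolding f by (subst Bochner_Integration.integral_sum) (auto intro!: integrable_mult_right pint)
  also have "\<dots> = (\<Sum>p\<in>?P. of_int (sign p) * (\<Prod>k\<in>UNIV. ?K k * poly (hermite_poly ?c (index_rank (p k))) (?v k)))"
  proof -
    have "(\<integral>u. g p k u \<partial>lborel) = ?K k * poly (hermite_poly ?c (index_rank (p k))) (?v k)" for p k
      unfolding g_def by (rule gaussian_moment[OF \<epsilon>])
    then show ?thesis by (simp only: integral_prod_vec[OF gint])
  qed
  also have "\<dots> = (\<Prod>k\<in>UNIV. ?K k) * det (\<chi> k j. poly (hermite_poly ?c (index_rank j)) (?v k))"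
    by (simp add: det_def prod.distrib sum_distrib_left mult_ac)
  also have "det (\<chi> k j. poly (hermite_poly ?c (index_rank j)) (?v k)) = cvandermonde ?v"
    unfolding cvandermonde_eq_det
    by (rule det_monic_polys[OF hermite_poly_monic[THEN conjunct1] hermite_poly_monic[THEN conjunct2]])
  also have "(\<Prod>k\<in>UNIV. ?K k) = of_real (sqrt (pi / \<epsilon>) ^ CARD('n) * exp (- (\<Sum>k\<in>UNIV. (D k)\<^sup>2) / (4 * \<epsilon>)))"
    by (simp add: prod.distrib sum_divide_distrib flip: exp_sum of_real_prod sum_negf)
  finally show "(\<integral>s. f s \<partial>lborel) =
      of_real (sqrt (pi / \<epsilon>) ^ CARD('n) * exp (- (\<Sum>k\<in>UNIV. (D k)\<^sup>2) / (4 * \<epsilon>))) * cvandermonde ?v" .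
qed

text \<open>
  Differentiate the preceding formula in the direction \<open>d\<close>.
\<close>

lemma
  fixes a d :: "'n::{finite,linorder} \<Rightarrow> complex" and D :: "'n \<Rightarrow> real"
  assumes \<epsilon>: "0 < \<epsilon>"
  defines "f \<equiv> \<lambda>s::'n rvector. of_real (exp (- \<epsilon> * (norm s)\<^sup>2)) * vandermonde_deriv d (\<lambda>k. a k + \<i> * of_real (s $ k)) *
      exp (\<i> * of_real (\<Sum>k\<in>UNIV. s $ k * D k))"
  shows integrable_gaussian_vandermonde_deriv: "integrable lborel f"
    and gaussian_integral_vandermonde_deriv: "(\<integral>s. f s \<partial>lborel) =
      of_real (sqrt (pi / \<epsilon>) ^ CARD('n) * exp (- (\<Sum>k\<in>UNIV. (D k)\<^sup>2) / (4 * \<epsilon>))) *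
      vandermonde_deriv d (\<lambda>k. a k - of_real (D k / (2 * \<epsilon>)))"
proof -
  define G where "G t s = of_real (exp (- \<epsilon> * (norm s)\<^sup>2)) * cvandermonde (\<lambda>k. (a k + \<i> * of_real (s $ k)) + of_real t * d k) *
      exp (\<i> * of_real (\<Sum>k\<in>UNIV. s $ k * D k))" for t and s :: "'n rvector"
  define G' where "G' t s = of_real (exp (- \<epsilon> * (norm s)\<^sup>2)) * vandermonde_deriv d (\<lambda>k. (a k + \<i> * of_real (s $ k)) + of_real t * d k) *
      exp (\<i> * of_real (\<Sum>k\<in>UNIV. s $ k * D k))" for t and s :: "'n rvector"
  define A where "A = (\<Sum>k\<in>UNIV. cmod (a k))"
  define \<delta> where "\<delta> = (\<Sum>k\<in>UNIV. cmod (d k))"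
  have A: "cmod (a k) \<le> A" and \<delta>: "cmod (d k) \<le> \<delta>" for k
    unfolding A_def \<delta>_def by (auto intro!: member_le_sum)
  have A0: "0 \<le> A" "0 \<le> \<delta>" unfolding A_def \<delta>_def by (auto intro!: sum_nonneg)
  let ?N = "card {p::'n\<times>'n. fst p < snd p}"
  define B where "B = 1 + A + \<delta>"
  have arg: "cmod ((a k + \<i> * of_real (s $ k)) + of_real t * d k) \<le> B * (1 + norm s)" if "\<bar>t\<bar> \<le> 1" for k t and s :: "'n rvector"
  proof -
    have "cmod ((a k + \<i> * of_real (s $ k)) + of_real t * d k) \<le> cmod (a k) + \<bar>s $ k\<bar> + \<bar>t\<bar> * cmod (d k)"
      by (intro order_trans[OF norm_triangle_ineq] add_mono order_refl) (auto simp: norm_mult intro: order_trans[OF norm_triangle_ineq])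
    also have "\<dots> \<le> A + norm s + 1 * \<delta>"
      using A[of k] \<delta>[of k] that component_le_norm_cart[of s k] by (intro add_mono mult_mono) auto
    also have "\<dots> \<le> B * (1 + norm s)" using A0 by (simp add: B_def algebra_simps)
    finally show ?thesis .
  qed
  have e1: "cmod (exp (\<i> * of_real x)) = 1" for x by simp
  have bound: "cmod (G' t s) \<le> (real ?N * (2 * \<delta>) * (2 * B) ^ ?N) * ((1 + norm s) ^ ?N * exp (- \<epsilon> * (norm s)\<^sup>2))"
    if "\<bar>t\<bar> \<le> 1" for t s
  proof -
    have "1 * 1 \<le> B * (1 + norm s)" using A0 by (intro mult_mono) (auto simp: B_def)
    from norm_vandermonde_deriv_le[OF arg[OF that] _ \<delta>] this
    have "cmod (vandermonde_deriv d (\<lambda>k. (a k + \<i> * of_real (s $ k)) + of_real t * d k))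
        \<le> real ?N * (2 * \<delta>) * (2 * (B * (1 + norm s))) ^ ?N" by simp
    then have le: "cmod (vandermonde_deriv d (\<lambda>k. (a k + \<i> * of_real (s $ k)) + of_real t * d k)) * exp (- \<epsilon> * (norm s)\<^sup>2)
        \<le> real ?N * (2 * \<delta>) * (2 * (B * (1 + norm s))) ^ ?N * exp (- \<epsilon> * (norm s)\<^sup>2)"
      by (intro mult_right_mono) auto
    have pw: "(2 * (B * (1 + norm s))) ^ ?N = (2 * B) ^ ?N * (1 + norm s) ^ ?N"
      by (simp only: mult.assoc[symmetric] power_mult_distrib)
    have "cmod (G' t s) = cmod (vandermonde_deriv d (\<lambda>k. (a k + \<i> * of_real (s $ k)) + of_real t * d k)) * exp (- \<epsilon> * (norm s)\<^sup>2)"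
      unfolding G'_def norm_mult e1 by (simp add: mult.commute)
    also note le
    finally show ?thesis unfolding pw by (simp only: mult.assoc)
  qed
  have G_eq: "G t = (\<lambda>s. of_real (exp (- \<epsilon> * (norm s)\<^sup>2)) * cvandermonde (\<lambda>k. (a k + of_real t * d k) + \<i> * of_real (s $ k)) *
      exp (\<i> * of_real (\<Sum>k\<in>UNIV. s $ k * D k)))" for t
    by (simp add: G_def add_ac fun_eq_iff)
  have "integrable lborel (G' 0) \<and> ((\<lambda>t. \<integral>s. G t s \<partial>lborel) has_vector_derivative (\<integral>s. G' 0 s \<partial>lborel)) (at 0)"
  proof (intro conjI)
    let ?g = "\<lambda>s::'n rvector. (real ?N * (2 * \<delta>) * (2 * B) ^ ?N) * ((1 + norm s) ^ ?N * exp (- \<epsilon> * (norm s)\<^sup>2))"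
    have i: "integrable lborel (G t)" for t unfolding G_eq by (rule integrable_gaussian_cvandermonde[OF \<epsilon>])
    have d: "((\<lambda>t. G t s) has_vector_derivative G' t s) (at t)" for t s
      unfolding G_def G'_def
      by (intro has_vector_derivative_mult_left has_vector_derivative_mult_right has_vector_derivative_cvandermonde)
    have g: "integrable lborel ?g" by (intro integrable_mult_right integrable_poly_gaussian \<epsilon>)
    have b: "cmod (G' t s) \<le> ?g s" if "-1 < t" "t < 1" for t s using bound[of t s] that by simp
    show "integrable lborel (G' 0)" by (rule has_vector_derivative_integral(1)[of "-1" 0 1, OF _ _ i d b g]) auto
    show "((\<lambda>t. \<integral>s. G t s \<partial>lborel) has_vector_derivative (\<integral>s. G' 0 s \<partial>lborel)) (at 0)"
      by (rule has_vector_derivative_integral(2)[of "-1" 0 1, OF _ _ i d b g]) auto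
  qed
  moreover have "G' 0 = f" by (simp add: G'_def f_def fun_eq_iff)
  ultimately have "integrable lborel f" and
    der: "((\<lambda>t. \<integral>s. G t s \<partial>lborel) has_vector_derivative (\<integral>s. f s \<partial>lborel)) (at 0)" by auto
  then show "integrable lborel f" by simp
  let ?K = "complex_of_real (sqrt (pi / \<epsilon>) ^ CARD('n) * exp (- (\<Sum>k\<in>UNIV. (D k)\<^sup>2) / (4 * \<epsilon>)))"
  have "(\<lambda>t. \<integral>s. G t s \<partial>lborel) = (\<lambda>t. ?K * cvandermonde (\<lambda>k. (a k - of_real (D k / (2 * \<epsilon>))) + of_real t * d k))"
    unfolding G_eq gaussian_integral_cvandermonde[OF \<epsilon>] by (simp add: algebra_simps)
  moreover have "((\<lambda>t. ?K * cvandermonde (\<lambda>k. (a k - of_real (D k / (2 * \<epsilon>))) + of_real t * d k)) has_vector_derivative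
      ?K * vandermonde_deriv d (\<lambda>k. (a k - of_real (D k / (2 * \<epsilon>))) + of_real 0 * d k)) (at 0)"
    by (intro has_vector_derivative_mult_right has_vector_derivative_cvandermonde)
  ultimately show "(\<integral>s. f s \<partial>lborel) = ?K * vandermonde_deriv d (\<lambda>k. a k - of_real (D k / (2 * \<epsilon>)))"
    using vector_derivative_unique_at[OF der] by simp
qed

section \<open>Rotations and phases acting on a unitary orbit\<close>

lemma integrable_haar_bounded:
  fixes f :: "complex^'n^'n \<Rightarrow> 'b::{banach,second_countable_topology}"
  assumes "f \<in> borel_measurable borel" "\<And>U. unitary U \<Longrightarrow> norm (f U) \<le> B"
  shows "integrable haar f"
proof -
  interpret prob_space "haar :: (complex^'n^'n) measure" by (rule prob_space_haar)
  show ?thesis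
    by (rule integrable_const_bound[of _ B]) (use assms borel_measurable_haar in \<open>auto simp: space_haar intro!: AE_I2\<close>)
qed

text \<open>
  The rotation by the angle \<open>t\<close> in the plane of the coordinates \<open>j\<close> and \<open>k\<close>.
\<close>

definition givens :: "'n \<Rightarrow> 'n \<Rightarrow> real \<Rightarrow> ('n::finite) cmatrix" where
  "givens j k t = (\<chi> a b. if a = j then (if b = j then of_real (cos t) else if b = k then of_real (sin t) else 0)
     else if a = k then (if b = j then - of_real (sin t) else if b = k then of_real (cos t) else 0)
     else if a = b then 1 else 0)"

lemma givens_mult:
  assumes "j \<noteq> k"
  shows "(givens j k t ** W) $ a $ b =
    (if a = j then of_real (cos t) * W $ j $ b + of_real (sin t) * W $ k $ b
     else if a = k then - of_real (sin t) * W $ j $ b + of_real (cos t) * W $ k $ b else W $ a $ b)"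
proof -
  have "(\<Sum>l\<in>UNIV. givens j k t $ a $ l * W $ l $ b)
      = (\<Sum>l\<in>(if a = j \<or> a = k then {j, k} else {a}). givens j k t $ a $ l * W $ l $ b)"
    by (rule sum.mono_neutral_right) (auto simp: givens_def)
  then show ?thesis using assms
    by (cases "a = j"; cases "a = k") (auto simp: matrix_matrix_mult_def givens_def)
qed

lemma mult_givens:
  assumes "j \<noteq> k"
  shows "(W ** conj_transpose (givens j k t)) $ a $ b =
    (if b = j then of_real (cos t) * W $ a $ j + of_real (sin t) * W $ a $ k
     else if b = k then - of_real (sin t) * W $ a $ j + of_real (cos t) * W $ a $ k else W $ a $ b)"
proof -
  have "W ** conj_transpose (givens j k t) = conj_transpose (givens j k t ** conj_transpose W)"
    by (simp add: conj_transpose_mult)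
  then show ?thesis using assms by (simp add: givens_mult)
qed

lemma unitary_givens:
  assumes "j \<noteq> k"
  shows "unitary (givens j k t)"
proof -
  have sc: "of_real (cos t) * of_real (cos t) + of_real (sin t) * of_real (sin t) = (1 :: complex)"
    by (metis cos_squared_eq diff_add_cancel of_real_1 of_real_add of_real_mult power2_eq_square)
  have "givens j k t ** conj_transpose (givens j k t) = mat 1"
    using assms sc by (auto simp: vec_eq_iff mult_givens) (auto simp: givens_def mat_def algebra_simps)
  then show ?thesis by (metis matrix_left_right_inverse unitaryI)
qed

text \<open>
  Conjugation by this matrix exchanges, up to signs, the real and the imaginary parts of the off-diagonal entries in row and column \<open>k\<close>.
\<close>

definition phase :: "'n \<Rightarrow> ('n::finite) cmatrix" where
  "phase k = (\<chi> a b. if a = b then (if a = k then \<i> else 1) else 0)"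

lemma phase_mult: "(phase k ** W) $ a $ b = (if a = k then \<i> else 1) * W $ a $ b"
proof -
  have "(\<Sum>l\<in>UNIV. phase k $ a $ l * W $ l $ b) = (\<Sum>l\<in>{a}. phase k $ a $ l * W $ l $ b)"
    by (rule sum.mono_neutral_right) (auto simp: phase_def)
  then show ?thesis by (simp add: matrix_matrix_mult_def phase_def)
qed

lemma mult_phase: "(W ** conj_transpose (phase k)) $ a $ b = (if b = k then - \<i> else 1) * W $ a $ b"
proof -
  have "W ** conj_transpose (phase k) = conj_transpose (phase k ** conj_transpose W)"
    by (simp add: conj_transpose_mult)
  then show ?thesis by (simp add: phase_mult)
qed

lemma unitary_phase: "unitary (phase k)"
proof -
  have "phase k ** conj_transpose (phase k) = mat 1"
    by (auto simp: vec_eq_iff mult_phase) (auto simp: phase_def mat_def)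
  then show ?thesis by (metis matrix_left_right_inverse unitaryI)
qed

lemma hermitian_nth: "hermitian W \<Longrightarrow> W $ k $ j = cnj (W $ j $ k)"
  unfolding hermitian_def by (metis conj_transpose_nth)

lemma hermitian_diag: "hermitian W \<Longrightarrow> W $ k $ k = of_real (Re (W $ k $ k))"
  using hermitian_nth[of W k k] by (simp add: complex_eq_iff)

lemma norm_hermitian_squared:
  fixes W :: "('n::{finite,linorder}) cmatrix"
  assumes "hermitian W"
  shows "(norm W)\<^sup>2 = (\<Sum>k\<in>UNIV. (Re (W $ k $ k))\<^sup>2) + 2 * (\<Sum>p\<in>{p. fst p < snd p}. (cmod (W $ fst p $ snd p))\<^sup>2)"
proof -
  let ?h = "\<lambda>p. (cmod (W $ fst p $ snd p))\<^sup>2"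
  let ?L = "{p::'n\<times>'n. fst p < snd p}" and ?G = "{p::'n\<times>'n. snd p < fst p}" and ?D = "(\<lambda>i. (i, i)) ` (UNIV::'n set)"
  have "(norm W)\<^sup>2 = (\<Sum>p\<in>UNIV. ?h p)"
    by (simp add: norm_matrix_squared sum.cartesian_product case_prod_unfold)
  also have "(UNIV :: ('n\<times>'n) set) = ?D \<union> (?L \<union> ?G)" by auto
  also have "(\<Sum>p\<in>?D \<union> (?L \<union> ?G). ?h p) = (\<Sum>p\<in>?D. ?h p) + ((\<Sum>p\<in>?L. ?h p) + (\<Sum>p\<in>?G. ?h p))"
    by (subst sum.union_disjoint, simp, simp, force)+ simp
  also have "(\<Sum>p\<in>?G. ?h p) = (\<Sum>p\<in>?L. ?h p)"
    by (rule sum.reindex_bij_witness[where i=prod.swap and j=prod.swap]) (auto simp: hermitian_nth[OF assms, of "snd _" "fst _"])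
  also have "(\<Sum>p\<in>?D. ?h p) = (\<Sum>k\<in>UNIV. (Re (W $ k $ k))\<^sup>2)"
    by (subst sum.reindex) (auto simp: inj_on_def intro!: sum.cong, metis hermitian_diag[OF assms] norm_of_real power2_abs)
  finally show ?thesis by simp
qed

text \<open>
  The point of the orbit of \<open>Z\<close> that belongs to \<open>U\<close> is \<open>U ** Z ** conj_transpose U\<close>; its diagonal is real when \<open>Z\<close> is Hermitian.
\<close>

definition orbit_diag :: "('n::finite) cmatrix \<Rightarrow> 'n cmatrix \<Rightarrow> 'n \<Rightarrow> real" where
  "orbit_diag Z U k = Re ((U ** Z ** conj_transpose U) $ k $ k)"

definition orbit_entry :: "('n::finite) cmatrix \<Rightarrow> 'n cmatrix \<Rightarrow> 'n \<Rightarrow> 'n \<Rightarrow> complex" where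
  "orbit_entry Z U j k = (U ** Z ** conj_transpose U) $ j $ k"

lemma norm_matrix_nth_le: "cmod (A $ j $ k) \<le> norm (A :: complex^'n^'m)"
  using order_trans[OF Finite_Cartesian_Product.norm_nth_le Finite_Cartesian_Product.norm_nth_le] .

lemma abs_orbit_diag_le: "unitary U \<Longrightarrow> \<bar>orbit_diag Z U k\<bar> \<le> norm Z"
  unfolding orbit_diag_def
  using order_trans[OF abs_Re_le_cmod norm_matrix_nth_le[of "U ** Z ** conj_transpose U" k k]] by (simp add: norm_conjugate)

lemma norm_orbit_entry_le: "unitary U \<Longrightarrow> cmod (orbit_entry Z U j k) \<le> norm Z"
  unfolding orbit_entry_def using norm_matrix_nth_le[of "U ** Z ** conj_transpose U" j k] by (simp add: norm_conjugate)

lemma measurable_orbit [measurable (raw)]: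
  fixes f g :: "'a \<Rightarrow> ('n::finite) cmatrix"
  assumes [measurable]: "f \<in> borel_measurable M" "g \<in> borel_measurable M"
  shows "(\<lambda>x. orbit_diag (f x) (g x) k) \<in> borel_measurable M"
    and "(\<lambda>x. orbit_entry (f x) (g x) j k) \<in> borel_measurable M"
  unfolding orbit_diag_def orbit_entry_def by measurable

lemma hermitian_orbit_entry: "hermitian Z \<Longrightarrow> orbit_entry Z U k j = cnj (orbit_entry Z U j k)"
  unfolding orbit_entry_def by (intro hermitian_nth hermitian_conjugate)

lemma orbit_entry_diag: "hermitian Z \<Longrightarrow> orbit_entry Z U k k = of_real (orbit_diag Z U k)"
  unfolding orbit_entry_def orbit_diag_def by (intro hermitian_diag hermitian_conjugate)

lemma norm_orbit_squared:
  fixes Z :: "('n::{finite,linorder}) cmatrix"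
  assumes "hermitian Z" "unitary U"
  shows "(norm Z)\<^sup>2 = (\<Sum>k\<in>UNIV. (orbit_diag Z U k)\<^sup>2) + 2 * (\<Sum>p\<in>{p. fst p < snd p}. (cmod (orbit_entry Z U (fst p) (snd p)))\<^sup>2)"
  using norm_hermitian_squared[OF hermitian_conjugate[OF assms(1)], of U] norm_conjugate[OF assms(2), of Z]
  by (simp add: orbit_diag_def orbit_entry_def)

lemma orbit_entry_left:
  "orbit_entry Z (V ** U) a b = ((V ** (U ** Z ** conj_transpose U)) ** conj_transpose V) $ a $ b"
  by (simp add: orbit_entry_def conj_transpose_mult matrix_mul_assoc)

lemma orbit_diag_entry: "orbit_diag Z U k = Re (orbit_entry Z U k k)"
  by (simp add: orbit_diag_def orbit_entry_def)

lemma orbit_entry_phase: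
  "orbit_entry Z (phase k ** U) a b = (if b = k then - \<i> else 1) * ((if a = k then \<i> else 1) * orbit_entry Z U a b)"
  unfolding orbit_entry_left mult_phase phase_mult by (simp add: orbit_entry_def)

lemma orbit_givens:
  fixes Z U :: "('n::finite) cmatrix" and t :: real
  assumes Z: "hermitian Z" and jk: "j \<noteq> k"
  defines "h \<equiv> (sin t)\<^sup>2 * (orbit_diag Z U k - orbit_diag Z U j) + 2 * cos t * sin t * Re (orbit_entry Z U j k)"
  shows "orbit_diag Z (givens j k t ** U) l = orbit_diag Z U l + (if l = j then h else if l = k then - h else 0)"
    and "Re (orbit_entry Z (givens j k t ** U) j k)
      = cos t * sin t * (orbit_diag Z U k - orbit_diag Z U j) + ((cos t)\<^sup>2 - (sin t)\<^sup>2) * Re (orbit_entry Z U j k)"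
proof -
  let ?e = "orbit_entry Z U"
  have e: "orbit_entry Z (givens j k t ** U) a b =
    (let r = (\<lambda>b. if a = j then of_real (cos t) * ?e j b + of_real (sin t) * ?e k b
       else if a = k then - of_real (sin t) * ?e j b + of_real (cos t) * ?e k b else ?e a b)
     in if b = j then of_real (cos t) * r j + of_real (sin t) * r k
       else if b = k then - of_real (sin t) * r j + of_real (cos t) * r k else r b)" for a b
    unfolding orbit_entry_left mult_givens[OF jk] givens_mult[OF jk] by (simp add: orbit_entry_def Let_def)
  have kj: "?e k j = cnj (?e j k)" by (rule hermitian_orbit_entry[OF Z])
  have c: "cos t * (cos t * r) + sin t * (sin t * r) = r" for r
  proof -
    have "cos t * (cos t * r) + sin t * (sin t * r) = ((sin t)\<^sup>2 + (cos t)\<^sup>2) * r"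
      by (simp only: power2_eq_square distrib_right mult.assoc add.commute)
    then show ?thesis by (simp only: sin_cos_squared_add mult_1)
  qed
  show "orbit_diag Z (givens j k t ** U) l = orbit_diag Z U l + (if l = j then h else if l = k then - h else 0)"
    using jk unfolding orbit_diag_entry e h_def Let_def kj
    by (auto simp: power2_eq_square algebra_simps c)
  show "Re (orbit_entry Z (givens j k t ** U) j k)
      = cos t * sin t * (orbit_diag Z U k - orbit_diag Z U j) + ((cos t)\<^sup>2 - (sin t)\<^sup>2) * Re (?e j k)"
    using jk unfolding orbit_diag_entry e Let_def kj
    by (auto simp: power2_eq_square algebra_simps)
qed

definition orbit_exp :: "('n::finite \<Rightarrow> complex) \<Rightarrow> 'n cmatrix \<Rightarrow> 'n cmatrix \<Rightarrow> complex" where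
  "orbit_exp y Z U = exp (\<Sum>l\<in>UNIV. y l * of_real (orbit_diag Z U l))"

lemma measurable_orbit_exp [measurable (raw)]:
  fixes f g :: "'a \<Rightarrow> ('n::finite) cmatrix"
  assumes [measurable]: "f \<in> borel_measurable M" "g \<in> borel_measurable M" "\<And>l. (\<lambda>x. y x l) \<in> borel_measurable M"
  shows "(\<lambda>x. orbit_exp (y x) (f x) (g x)) \<in> borel_measurable M"
  unfolding orbit_exp_def by measurable

lemma norm_orbit_exp_le:
  assumes "unitary U"
  shows "cmod (orbit_exp y Z U) \<le> exp ((\<Sum>l\<in>UNIV. \<bar>Re (y l)\<bar>) * norm Z)"
proof -
  have "Re (\<Sum>l\<in>UNIV. y l * of_real (orbit_diag Z U l)) = (\<Sum>l\<in>UNIV. Re (y l) * orbit_diag Z U l)" by simp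
  also have "\<dots> \<le> (\<Sum>l\<in>UNIV. \<bar>Re (y l)\<bar> * norm Z)"
  proof (rule sum_mono)
    fix l
    have "\<bar>Re (y l) * orbit_diag Z U l\<bar> \<le> \<bar>Re (y l)\<bar> * norm Z"
      unfolding abs_mult by (intro mult_left_mono abs_orbit_diag_le[OF assms]) auto
    then show "Re (y l) * orbit_diag Z U l \<le> \<bar>Re (y l)\<bar> * norm Z" by linarith
  qed
  finally show ?thesis by (simp add: orbit_exp_def norm_exp_eq_Re sum_distrib_right)
qed

section \<open>Averages of Vandermonde determinants over a unitary orbit\<close>

text \<open>
  The average of \<open>Re w\<^sub>j\<^sub>k exp (\<Sum> y\<^sub>l d\<^sub>l)\<close> over the orbit does not change when the orbit is rotated in the \<open>(j,k)\<close> plane by the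
  angle \<open>t\<close>, where \<open>d\<close> is the diagonal and \<open>w\<close> the orbit point. The derivative of the rotated integrand at \<open>t = 0\<close> therefore has
  average zero. The functions \<open>g\<close> and \<open>h\<close> are the rotated real part of \<open>w\<^sub>j\<^sub>k\<close> and the displacement of \<open>d\<^sub>j\<close>; they satisfy
  \<open>h' = 2 g\<close>.
\<close>

lemma orbit_pair_identity_Re:
  fixes Z :: "('n::finite) cmatrix"
  assumes Z: "hermitian Z" and jk: "j \<noteq> k"
  shows "(\<integral>U. of_real (orbit_diag Z U k - orbit_diag Z U j) * orbit_exp y Z U \<partial>haar)
    = 2 * (y k - y j) * (\<integral>U. of_real ((Re (orbit_entry Z U j k))\<^sup>2) * orbit_exp y Z U \<partial>haar)"
proof -
  let ?d = "orbit_diag Z" and ?E = "orbit_exp y Z"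
  let ?X = "\<lambda>U. Re (orbit_entry Z U j k)"
  define h where "h t U = (sin t)\<^sup>2 * (?d U k - ?d U j) + 2 * cos t * sin t * ?X U" for t U
  define g where "g t U = cos t * sin t * (?d U k - ?d U j) + ((cos t)\<^sup>2 - (sin t)\<^sup>2) * ?X U" for t U
  define g' where "g' t U = ((cos t)\<^sup>2 - (sin t)\<^sup>2) * (?d U k - ?d U j) - 4 * cos t * sin t * ?X U" for t U
  define q where "q t U = of_real (g t U) * (?E U * exp ((y j - y k) * of_real (h t U)))" for t U
  define q' where "q' t U = of_real (g' t U) * (?E U * exp ((y j - y k) * of_real (h t U)))
     + of_real (g t U) * (?E U * (((y j - y k) * of_real (2 * g t U)) * exp ((y j - y k) * of_real (h t U))))" for t U
  have q: "of_real (?X (givens j k t ** U)) * ?E (givens j k t ** U) = q t U" for t U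
  proof -
    have og: "?d (givens j k t ** U) l = ?d U l + (if l = j then h t U else if l = k then - h t U else 0)" for l
      unfolding h_def by (rule orbit_givens(1)[OF Z jk])
    have "(\<Sum>l\<in>UNIV. y l * of_real (?d (givens j k t ** U) l))
        = (\<Sum>l\<in>UNIV. y l * of_real (?d U l)) + (\<Sum>l\<in>UNIV. y l * of_real (if l = j then h t U else if l = k then - h t U else 0))"
      by (simp add: og distrib_left sum.distrib)
    also have "(\<Sum>l\<in>UNIV. y l * of_real (if l = j then h t U else if l = k then - h t U else 0))
        = (\<Sum>l\<in>{j, k}. y l * of_real (if l = j then h t U else if l = k then - h t U else 0))"
      by (rule sum.mono_neutral_right) auto
    also have "\<dots> = (y j - y k) * of_real (h t U)" using jk by (simp add: algebra_simps)
    finally show ?thesis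
      by (simp add: q_def orbit_exp_def exp_add orbit_givens(2)[OF Z jk] g_def)
  qed
  have der: "((\<lambda>t. q t U) has_vector_derivative q' t U) (at t)" for t U
  proof -
    have 1: "((\<lambda>t. g t U) has_vector_derivative g' t U) (at t)"
      unfolding g_def g'_def has_real_derivative_iff_has_vector_derivative[symmetric]
      by (auto intro!: derivative_eq_intros simp: algebra_simps power2_eq_square)
    have 2: "((\<lambda>t. h t U) has_vector_derivative 2 * g t U) (at t)"
      unfolding g_def h_def has_real_derivative_iff_has_vector_derivative[symmetric]
      by (auto intro!: derivative_eq_intros simp: algebra_simps power2_eq_square)
    have 3: "((\<lambda>t. exp ((y j - y k) * of_real (h t U))) has_vector_derivative
        ((y j - y k) * of_real (2 * g t U)) * exp ((y j - y k) * of_real (h t U))) (at t)"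
    proof -
      have "((\<lambda>t. (y j - y k) * of_real (h t U)) has_vector_derivative (y j - y k) * of_real (2 * g t U)) (at t)"
        using 2 by (intro has_vector_derivative_mult_right has_vector_derivative_of_real)
          (simp add: has_real_derivative_iff_has_vector_derivative)
      from field_vector_diff_chain_at[OF this DERIV_exp] show ?thesis by (simp add: o_def)
    qed
    show ?thesis
      unfolding q_def q'_def
      using has_vector_derivative_mult[OF has_vector_derivative_of_real has_vector_derivative_mult_right[OF 3]] 1
      by (fastforce simp: has_real_derivative_iff_has_vector_derivative add.commute)
  qed
  have [measurable]: "h t \<in> borel_measurable borel" "g t \<in> borel_measurable borel" "g' t \<in> borel_measurable borel" for t
    unfolding h_def g_def g'_def by measurable
  have [measurable]: "?E \<in> borel_measurable borel" by measurable
  have [measurable]: "q t \<in> borel_measurable borel" "q' t \<in> borel_measurable borel" for t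
    unfolding q_def q'_def by measurable
  let ?N = "norm Z"
  have tb: "\<bar>cos t * sin t\<bar> \<le> 1" "\<bar>(cos t)\<^sup>2 - (sin t)\<^sup>2\<bar> \<le> 1" "(sin t)\<^sup>2 \<le> 1" for t :: real
  proof -
    show "\<bar>cos t * sin t\<bar> \<le> 1" unfolding abs_mult by (intro mult_le_one) auto
    show "\<bar>(cos t)\<^sup>2 - (sin t)\<^sup>2\<bar> \<le> 1" using abs_cos_le_one[of "2 * t"] by (simp add: cos_double)
    show "(sin t)\<^sup>2 \<le> 1" by (simp add: abs_square_le_1)
  qed
  have b: "\<bar>g t U\<bar> \<le> 3 * ?N" "\<bar>g' t U\<bar> \<le> 6 * ?N" "\<bar>h t U\<bar> \<le> 4 * ?N" if U: "unitary U" for t U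
  proof -
    have d: "\<bar>?d U k - ?d U j\<bar> \<le> 2 * ?N" using abs_orbit_diag_le[OF U, of Z k] abs_orbit_diag_le[OF U, of Z j] by linarith
    have X: "\<bar>?X U\<bar> \<le> ?N" using order_trans[OF abs_Re_le_cmod norm_orbit_entry_le[OF U]] .
    have m: "\<bar>a * b\<bar> \<le> B" if "\<bar>a\<bar> \<le> 1" "\<bar>b\<bar> \<le> B" for a b B :: real
      using mult_mono[OF that] by (simp add: abs_mult)
    note m1 = m[OF tb(1)[of t] d] m[OF tb(1)[of t] X] m[OF tb(2)[of t] d] m[OF tb(2)[of t] X]
    have m2: "\<bar>(sin t)\<^sup>2 * (?d U k - ?d U j)\<bar> \<le> 2 * ?N" using m[OF _ d, of "(sin t)\<^sup>2"] tb(3)[of t] by simp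
    show "\<bar>g t U\<bar> \<le> 3 * ?N" unfolding g_def using m1 by linarith
    show "\<bar>g' t U\<bar> \<le> 6 * ?N" unfolding g'_def using m1 by (simp add: mult.assoc)
    show "\<bar>h t U\<bar> \<le> 4 * ?N" unfolding h_def using m1 m2 by (simp add: mult.assoc)
  qed
  define C where "C = exp ((\<Sum>l\<in>UNIV. \<bar>Re (y l)\<bar>) * ?N) * exp (cmod (y j - y k) * (4 * ?N))"
  have C: "cmod (?E U * exp ((y j - y k) * of_real (h t U))) \<le> C" if U: "unitary U" for t U
  proof -
    have "cmod (exp ((y j - y k) * of_real (h t U))) \<le> exp (cmod ((y j - y k) * of_real (h t U)))"
      by (rule norm_exp)
    also have "\<dots> \<le> exp (cmod (y j - y k) * (4 * ?N))"
      using b(3)[OF U, of t] by (auto simp: norm_mult intro!: mult_left_mono)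
    finally show ?thesis unfolding C_def norm_mult by (intro mult_mono norm_orbit_exp_le[OF U]) auto
  qed
  have qb: "cmod (q t U) \<le> 3 * ?N * C" if U: "unitary U" for t U
    unfolding q_def norm_mult[of "of_real _"] using b(1)[OF U] C[OF U] by (intro mult_mono) auto
  define B where "B = 6 * ?N * C + (3 * ?N * (cmod (y j - y k) * (2 * (3 * ?N)))) * C"
  have q'b: "cmod (q' t U) \<le> B" if U: "unitary U" for t U
  proof -
    let ?e = "?E U * exp ((y j - y k) * of_real (h t U))"
    have "q' t U = of_real (g' t U) * ?e + (of_real (g t U) * ((y j - y k) * of_real (2 * g t U))) * ?e"
      by (simp add: q'_def mult_ac)
    also have "cmod \<dots> \<le> \<bar>g' t U\<bar> * cmod ?e + (\<bar>g t U\<bar> * (cmod (y j - y k) * (2 * \<bar>g t U\<bar>))) * cmod ?e"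
      by (rule order_trans[OF norm_triangle_ineq]) (simp add: norm_mult abs_mult)
    also have "\<dots> \<le> B"
      unfolding B_def using b(1,2)[OF U, of t] C[OF U, of t] by (intro add_mono mult_mono) (auto intro!: mult_nonneg_nonneg)
    finally show ?thesis .
  qed
  have int: "integrable haar (q t)" for t by (rule integrable_haar_bounded[OF _ qb]) auto
  have const: "(\<integral>U. q t U \<partial>haar) = (\<integral>U. of_real (?X U) * ?E U \<partial>haar)" for t
    unfolding q[symmetric]
    by (rule integral_haar_left[OF unitary_givens[OF jk], of "\<lambda>U. of_real (?X U) * ?E U" t]) measurable
  interpret prob_space "haar :: 'n cmatrix measure" by (rule prob_space_haar)
  have q'b': "cmod (q' t U) \<le> B" if "U \<in> space haar" for t U using q'b that by (simp add: space_haar)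
  have "((\<lambda>t. \<integral>U. q t U \<partial>haar) has_vector_derivative (\<integral>U. q' 0 U \<partial>haar)) (at 0)"
    by (rule has_vector_derivative_integral(2)[of "-1" 0 1 haar q q' "\<lambda>_. B", OF _ _ int der q'b']) auto
  moreover have "((\<lambda>t. \<integral>U. q t U \<partial>haar) has_vector_derivative 0) (at 0)"
    unfolding const by simp
  ultimately have "(\<integral>U. q' 0 U \<partial>haar) = 0" by (rule vector_derivative_unique_at)
  moreover have "q' 0 U = of_real (?d U k - ?d U j) * ?E U - 2 * (y k - y j) * (of_real ((?X U)\<^sup>2) * ?E U)" for U
    by (simp add: q'_def g'_def g_def h_def algebra_simps power2_eq_square)
  moreover have "integrable haar (\<lambda>U. of_real (?d U k - ?d U j) * ?E U)"
  proof (rule integrable_haar_bounded)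
    fix U :: "'n cmatrix" assume U: "unitary U"
    show "norm (of_real (?d U k - ?d U j) * ?E U) \<le> (2 * ?N) * exp ((\<Sum>l\<in>UNIV. \<bar>Re (y l)\<bar>) * ?N)"
      unfolding norm_mult norm_of_real
      using abs_orbit_diag_le[OF U, of Z k] abs_orbit_diag_le[OF U, of Z j] norm_orbit_exp_le[OF U] by (intro mult_mono) auto
  qed measurable
  moreover have "integrable haar (\<lambda>U. of_real ((?X U)\<^sup>2) * ?E U)"
  proof (rule integrable_haar_bounded)
    fix U :: "'n cmatrix" assume U: "unitary U"
    have "\<bar>?X U\<bar> \<le> ?N" using order_trans[OF abs_Re_le_cmod norm_orbit_entry_le[OF U]] .
    then have "(?X U)\<^sup>2 \<le> ?N\<^sup>2" by (metis abs_ge_zero power2_abs power_mono)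
    then show "norm (of_real ((?X U)\<^sup>2) * ?E U) \<le> ?N\<^sup>2 * exp ((\<Sum>l\<in>UNIV. \<bar>Re (y l)\<bar>) * ?N)"
      unfolding norm_mult norm_of_real using norm_orbit_exp_le[OF U] by (intro mult_mono) auto
  qed measurable
  ultimately show ?thesis by (simp add: Bochner_Integration.integral_diff)
qed

text \<open>
  A phase matrix exchanges the real and imaginary parts of the \<open>(j,k)\<close> entry and fixes the diagonal, so that both squares have the same
  average.
\<close>

lemma orbit_pair_identity:
  fixes Z :: "('n::finite) cmatrix"
  assumes Z: "hermitian Z" and jk: "j \<noteq> k"
  shows "(\<integral>U. of_real (orbit_diag Z U k - orbit_diag Z U j) * orbit_exp y Z U \<partial>haar)
    = (y k - y j) * (\<integral>U. of_real ((cmod (orbit_entry Z U j k))\<^sup>2) * orbit_exp y Z U \<partial>haar)"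
proof -
  let ?E = "orbit_exp y Z" and ?w = "\<lambda>U. orbit_entry Z U j k"
  have d: "orbit_diag Z (phase k ** U) l = orbit_diag Z U l" for U l
    unfolding orbit_diag_entry orbit_entry_phase by (simp add: orbit_entry_diag[OF Z])
  have im: "(\<integral>U. of_real ((Im (?w U))\<^sup>2) * ?E U \<partial>haar) = (\<integral>U. of_real ((Re (?w U))\<^sup>2) * ?E U \<partial>haar)"
  proof -
    have "(\<integral>U. of_real ((Re (?w (phase k ** U)))\<^sup>2) * ?E (phase k ** U) \<partial>haar) = (\<integral>U. of_real ((Re (?w U))\<^sup>2) * ?E U \<partial>haar)"
      by (rule integral_haar_left[OF unitary_phase, of "\<lambda>U. of_real ((Re (?w U))\<^sup>2) * ?E U"]) measurable
    moreover have "?E (phase k ** U) = ?E U" for U by (simp add: orbit_exp_def d)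
    moreover have "Re (?w (phase k ** U)) = Im (?w U)" for U using jk by (simp add: orbit_entry_phase)
    ultimately show ?thesis by simp
  qed
  have int: "integrable haar (\<lambda>U. of_real ((Re (?w U))\<^sup>2) * ?E U)" "integrable haar (\<lambda>U. of_real ((Im (?w U))\<^sup>2) * ?E U)"
  proof -
    have b: "cmod (of_real (r\<^sup>2) * ?E U) \<le> (norm Z)\<^sup>2 * exp ((\<Sum>l\<in>UNIV. \<bar>Re (y l)\<bar>) * norm Z)"
      if "unitary U" "\<bar>r\<bar> \<le> cmod (?w U)" for U r
    proof -
      have "r\<^sup>2 \<le> (norm Z)\<^sup>2"
        using that norm_orbit_entry_le[OF that(1), of Z j k] by (intro abs_le_square_iff[THEN iffD1]) simp
      then show ?thesis
        unfolding norm_mult norm_of_real using norm_orbit_exp_le[OF that(1)] by (intro mult_mono) auto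
    qed
    show "integrable haar (\<lambda>U. of_real ((Re (?w U))\<^sup>2) * ?E U)"
      by (rule integrable_haar_bounded[OF _ b]) (measurable, simp_all add: abs_Re_le_cmod)
    show "integrable haar (\<lambda>U. of_real ((Im (?w U))\<^sup>2) * ?E U)"
      by (rule integrable_haar_bounded[OF _ b]) (measurable, simp_all add: abs_Im_le_cmod)
  qed
  have "(\<integral>U. of_real ((cmod (?w U))\<^sup>2) * ?E U \<partial>haar) = 2 * (\<integral>U. of_real ((Re (?w U))\<^sup>2) * ?E U \<partial>haar)"
    unfolding cmod_power2 of_real_add distrib_right by (subst Bochner_Integration.integral_add[OF int]) (use im in simp)
  then show ?thesis using orbit_pair_identity_Re[OF Z jk, of y] by simp
qed

text \<open>
  Half the squared norm of the off-diagonal part.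
\<close>

definition orbit_offdiag :: "('n::{finite,linorder}) cmatrix \<Rightarrow> 'n cmatrix \<Rightarrow> real" where
  "orbit_offdiag Z U = (\<Sum>p\<in>{p. fst p < snd p}. (cmod (orbit_entry Z U (fst p) (snd p)))\<^sup>2)"

lemma orbit_offdiag_nonneg: "0 \<le> orbit_offdiag Z U"
  unfolding orbit_offdiag_def by (intro sum_nonneg) auto

lemma measurable_orbit_offdiag [measurable (raw)]:
  fixes f g :: "'a \<Rightarrow> ('n::{finite,linorder}) cmatrix"
  assumes [measurable]: "f \<in> borel_measurable M" "g \<in> borel_measurable M"
  shows "(\<lambda>x. orbit_offdiag (f x) (g x)) \<in> borel_measurable M"
  unfolding orbit_offdiag_def by measurable

lemma norm_orbit_squared':
  assumes "hermitian Z" "unitary U"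
  shows "(norm Z)\<^sup>2 = (\<Sum>k\<in>UNIV. (orbit_diag Z U k)\<^sup>2) + 2 * orbit_offdiag Z U"
  using norm_orbit_squared[OF assms] by (simp add: orbit_offdiag_def)

lemma orbit_offdiag_le:
  assumes "hermitian Z" "unitary U"
  shows "orbit_offdiag Z U \<le> (norm Z)\<^sup>2"
proof -
  have "0 \<le> (\<Sum>k\<in>UNIV. (orbit_diag Z U k)\<^sup>2)" by (intro sum_nonneg) auto
  then show ?thesis using norm_orbit_squared'[OF assms] orbit_offdiag_nonneg[of Z U] by linarith
qed

lemma borel_measurable_cvandermonde [measurable (raw)]:
  "(\<And>k. (\<lambda>x. y x k) \<in> borel_measurable M) \<Longrightarrow> (\<lambda>x. cvandermonde (y x)) \<in> borel_measurable M"
  unfolding cvandermonde_def by measurable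

lemma borel_measurable_vandermonde_deriv [measurable (raw)]:
  "(\<And>k. (\<lambda>x. d x k) \<in> borel_measurable M) \<Longrightarrow> (\<And>k. (\<lambda>x. y x k) \<in> borel_measurable M) \<Longrightarrow>
     (\<lambda>x. vandermonde_deriv (d x) (y x)) \<in> borel_measurable M"
  unfolding vandermonde_deriv_def
  by (intro borel_measurable_sum borel_measurable_times borel_measurable_prod borel_measurable_diff)

text \<open>
  Expand the derivative of the Vandermonde product over the pairs \<open>(j,k)\<close>. In the term of a pair the missing factor is
  \<open>y\<^sub>k - y\<^sub>j\<close>, and this is the factor on the right-hand side of the identity for that pair.
\<close>

lemma orbit_sum_identity:
  fixes Z :: "('n::{finite,linorder}) cmatrix"
  assumes Z: "hermitian Z"
  shows "(\<integral>U. (vandermonde_deriv (\<lambda>k. of_real (orbit_diag Z U k)) y - of_real (orbit_offdiag Z U) * cvandermonde y)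
     * orbit_exp y Z U \<partial>haar) = 0"
proof -
  let ?E = "orbit_exp y Z" and ?P = "{p::'n\<times>'n. fst p < snd p}"
  let ?V = "\<lambda>p. \<Prod>q\<in>?P - {p}. y (snd q) - y (fst q)"
  let ?a = "\<lambda>p U. of_real (orbit_diag Z U (snd p) - orbit_diag Z U (fst p)) * ?E U"
  let ?b = "\<lambda>p U. of_real ((cmod (orbit_entry Z U (fst p) (snd p)))\<^sup>2) * ?E U"
  have V: "cvandermonde y = (y (snd p) - y (fst p)) * ?V p" if "p \<in> ?P" for p
    unfolding cvandermonde_def using that by (subst prod.remove[of _ p]) auto
  have inta: "integrable haar (?a p)" for p
  proof (rule integrable_haar_bounded)
    fix U :: "'n cmatrix" assume U: "unitary U"
    show "norm (?a p U) \<le> (2 * norm Z) * exp ((\<Sum>l\<in>UNIV. \<bar>Re (y l)\<bar>) * norm Z)"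
      unfolding norm_mult norm_of_real
      using abs_orbit_diag_le[OF U, of Z "snd p"] abs_orbit_diag_le[OF U, of Z "fst p"] norm_orbit_exp_le[OF U]
      by (intro mult_mono) auto
  qed measurable
  have intb: "integrable haar (?b p)" for p
  proof (rule integrable_haar_bounded)
    fix U :: "'n cmatrix" assume U: "unitary U"
    have "(cmod (orbit_entry Z U (fst p) (snd p)))\<^sup>2 \<le> (norm Z)\<^sup>2"
      by (intro power_mono norm_orbit_entry_le[OF U]) auto
    then show "norm (?b p U) \<le> (norm Z)\<^sup>2 * exp ((\<Sum>l\<in>UNIV. \<bar>Re (y l)\<bar>) * norm Z)"
      unfolding norm_mult norm_of_real using norm_orbit_exp_le[OF U] by (intro mult_mono) auto
  qed measurable
  have "(vandermonde_deriv (\<lambda>k. of_real (orbit_diag Z U k)) y - of_real (orbit_offdiag Z U) * cvandermonde y) * ?E U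
      = (\<Sum>p\<in>?P. ?V p * (?a p U - (y (snd p) - y (fst p)) * ?b p U))" for U
  proof -
    have "of_real (orbit_offdiag Z U) * cvandermonde y * ?E U = (\<Sum>p\<in>?P. cvandermonde y * ?b p U)"
      by (simp add: orbit_offdiag_def sum_distrib_left sum_distrib_right mult_ac)
    also have "\<dots> = (\<Sum>p\<in>?P. ?V p * ((y (snd p) - y (fst p)) * ?b p U))"
      by (intro sum.cong refl) (simp add: V mult_ac)
    finally show ?thesis
      unfolding vandermonde_deriv_def left_diff_distrib
      by (simp add: sum_distrib_left sum_distrib_right sum_subtractf right_diff_distrib mult_ac)
  qed
  then have "(\<integral>U. (vandermonde_deriv (\<lambda>k. of_real (orbit_diag Z U k)) y - of_real (orbit_offdiag Z U) * cvandermonde y)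
     * ?E U \<partial>haar) = (\<integral>U. (\<Sum>p\<in>?P. ?V p * (?a p U - (y (snd p) - y (fst p)) * ?b p U)) \<partial>haar)" by simp
  also have "\<dots> = (\<Sum>p\<in>?P. \<integral>U. ?V p * (?a p U - (y (snd p) - y (fst p)) * ?b p U) \<partial>haar)"
    by (intro Bochner_Integration.integral_sum integrable_mult_right Bochner_Integration.integrable_diff inta intb)
  also have "\<dots> = (\<Sum>p\<in>?P. ?V p * ((\<integral>U. ?a p U \<partial>haar) - (y (snd p) - y (fst p)) * (\<integral>U. ?b p U \<partial>haar)))"
  proof (rule sum.cong[OF refl])
    fix p
    have "(\<integral>U. ?V p * (?a p U - (y (snd p) - y (fst p)) * ?b p U) \<partial>haar) = ?V p * (\<integral>U. ?a p U - (y (snd p) - y (fst p)) * ?b p U \<partial>haar)"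
      by (rule integral_mult_right_zero)
    also have "(\<integral>U. ?a p U - (y (snd p) - y (fst p)) * ?b p U \<partial>haar) = (\<integral>U. ?a p U \<partial>haar) - (\<integral>U. (y (snd p) - y (fst p)) * ?b p U \<partial>haar)"
      by (intro Bochner_Integration.integral_diff inta integrable_mult_right intb)
    also have "(\<integral>U. (y (snd p) - y (fst p)) * ?b p U \<partial>haar) = (y (snd p) - y (fst p)) * (\<integral>U. ?b p U \<partial>haar)"
      by (rule integral_mult_right_zero)
    finally show "(\<integral>U. ?V p * (?a p U - (y (snd p) - y (fst p)) * ?b p U) \<partial>haar)
      = ?V p * ((\<integral>U. ?a p U \<partial>haar) - (y (snd p) - y (fst p)) * (\<integral>U. ?b p U \<partial>haar))" .
  qed
  also have "\<dots> = 0"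
    using orbit_pair_identity[OF Z, of "fst _" "snd _" y] by (intro sum.neutral) auto
  finally show ?thesis .
qed

lemma integral_swap_dominated:
  fixes f :: "'a \<times> 'b \<Rightarrow> 'c::{banach,second_countable_topology}"
  assumes M: "sigma_finite_measure M" and N: "sigma_finite_measure N"
    and f[measurable]: "f \<in> borel_measurable (M \<Otimes>\<^sub>M N)"
    and bound: "\<And>x y. x \<in> space M \<Longrightarrow> y \<in> space N \<Longrightarrow> norm (f (x, y)) \<le> g x * h y"
    and g: "integrable M g" and h: "integrable N h"
  shows "(\<integral>x. (\<integral>y. f (x, y) \<partial>N) \<partial>M) = (\<integral>y. (\<integral>x. f (x, y) \<partial>M) \<partial>N)"
proof -
  interpret M: sigma_finite_measure M by fact
  interpret N: sigma_finite_measure N by fact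
  interpret pair_sigma_finite M N by unfold_locales
  have i: "integrable N (\<lambda>y. f (x, y))" if "x \<in> space M" for x
  proof (rule Bochner_Integration.integrable_bound)
    show "integrable N (\<lambda>y. g x * h y)" using h by simp
    show "AE y in N. norm (f (x, y)) \<le> norm (g x * h y)"
      using order_trans[OF bound[OF that] abs_ge_self] by (intro AE_I2) simp
  qed (use that in measurable)
  have int: "integrable (M \<Otimes>\<^sub>M N) f"
  proof (rule Fubini_integrable[OF f])
    show "AE x in M. integrable N (\<lambda>y. f (x, y))" using i by (rule AE_I2)
    show "integrable M (\<lambda>x. \<integral>y. norm (f (x, y)) \<partial>N)"
    proof (rule Bochner_Integration.integrable_bound)
      show "integrable M (\<lambda>x. g x * (\<integral>y. h y \<partial>N))" using g by simp
      show "AE x in M. norm (\<integral>y. norm (f (x, y)) \<partial>N) \<le> norm (g x * (\<integral>y. h y \<partial>N))"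
      proof (rule AE_I2)
        fix x assume x: "x \<in> space M"
        have "(\<integral>y. norm (f (x, y)) \<partial>N) \<le> (\<integral>y. g x * h y \<partial>N)"
          by (rule integral_mono[OF integrable_norm[OF i[OF x]]]) (use x bound h in auto)
        moreover have "0 \<le> (\<integral>y. norm (f (x, y)) \<partial>N)" by (rule Bochner_Integration.integral_nonneg) auto
        ultimately show "norm (\<integral>y. norm (f (x, y)) \<partial>N) \<le> norm (g x * (\<integral>y. h y \<partial>N))" by simp
      qed
    qed measurable
  qed
  show ?thesis
    using Fubini_integral[of "\<lambda>x y. f (x, y)"] int by simp
qed

lemma integral_swap_prob_dominated:
  fixes f :: "'a \<times> 'b \<Rightarrow> 'c::{banach,second_countable_topology}"
  assumes M: "prob_space M" and N: "sigma_finite_measure N"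
    and f: "f \<in> borel_measurable (M \<Otimes>\<^sub>M N)"
    and bound: "\<And>x y. x \<in> space M \<Longrightarrow> y \<in> space N \<Longrightarrow> norm (f (x, y)) \<le> h y"
    and h: "integrable N h"
  shows "(\<integral>x. (\<integral>y. f (x, y) \<partial>N) \<partial>M) = (\<integral>y. (\<integral>x. f (x, y) \<partial>M) \<partial>N)"
proof -
  interpret prob_space M by fact
  show ?thesis
    by (rule integral_swap_dominated[OF _ N f _ _ h, where g="\<lambda>_. 1"])
      (use bound in \<open>auto intro: sigma_finite_measure_axioms\<close>)
qed

text \<open>
  The central identity. Let \<open>d\<close> be the diagonal and \<open>o\<close> the off-diagonal weight of the orbit point, and let \<open>E\<close> be the exponential of
  \<open>\<Sum> \<xi>\<^sub>k d\<^sub>k\<close>. The average \<open>R(t)\<close> of \<open>\<Delta>(\<xi> + t d) E exp (- t o)\<close> is constant for \<open>t \<le> 0\<close>, and the claim compares \<open>t = - 1 / (2 \<epsilon>)\<close> with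
  \<open>t = 0\<close>. The derivative of the integrand is \<open>w(\<xi> + t d) E exp (- t o)\<close>, where \<open>w(y)\<close> is the derivative of \<open>\<Delta>\<close> at \<open>y\<close> in the
  direction \<open>d\<close>, minus \<open>o \<Delta>(y)\<close>. At \<open>t = 0\<close> its average vanishes by the preceding lemma. For \<open>t < 0\<close> it is a Gaussian average of
  such identities: the norm of the orbit point is constant, so \<open>exp (- t o)\<close> is, up to a constant, a Gaussian in \<open>d\<close>, namely the
  factor that appears when \<open>w(y) exp (\<Sum> y\<^sub>k d\<^sub>k)\<close> at \<open>y = \<xi> + i s\<close> is averaged over \<open>s\<close> with the weight
  \<open>exp (- \<eta> \<bar>s\<bar>\<^sup>2)\<close>, \<open>\<eta> = - 1 / (2 t)\<close>; the same average turns \<open>w(\<xi> + i s)\<close> into \<open>w(\<xi> + t d)\<close>.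
\<close>

lemma vandermonde_average_invariant:
  fixes Z :: "('n::{finite,linorder}) cmatrix" and \<xi> :: "'n \<Rightarrow> complex"
  assumes Z: "hermitian Z" and \<epsilon>: "0 < \<epsilon>"
  shows "(\<integral>U. cvandermonde (\<lambda>k. \<xi> k - of_real (orbit_diag Z U k / (2 * \<epsilon>))) *
      (orbit_exp \<xi> Z U * of_real (exp (orbit_offdiag Z U / (2 * \<epsilon>)))) \<partial>haar)
    = cvandermonde \<xi> * (\<integral>U. orbit_exp \<xi> Z U \<partial>haar)"
proof -
  let ?d = "orbit_diag Z" and ?E = "orbit_exp \<xi> Z" and ?o = "orbit_offdiag Z"
  let ?N = "card {p::'n\<times>'n. fst p < snd p}"
  let ?z = "norm Z"
  define A where "A = (\<Sum>k\<in>UNIV. cmod (\<xi> k))"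
  have A: "cmod (\<xi> k) \<le> A" for k unfolding A_def by (auto intro!: member_le_sum)
  have A0: "0 \<le> A" unfolding A_def by (auto intro!: sum_nonneg)
  \<comment> \<open>The integrand of \<open>R(t)\<close>, with its derivative \<open>r'\<close>.\<close>
  define r where "r t U = cvandermonde (\<lambda>k. \<xi> k + of_real t * of_real (?d U k)) * (?E U * exp (of_real (- t * ?o U)))" for t U
  define w where "w y U = vandermonde_deriv (\<lambda>k. of_real (?d U k)) y - of_real (?o U) * cvandermonde y" for y U
  define r' where "r' t U = w (\<lambda>k. \<xi> k + of_real t * of_real (?d U k)) U * (?E U * exp (of_real (- t * ?o U)))" for t U
  define W where "W B = real ?N * (2 * ?z) * (2 * B) ^ ?N + ?z\<^sup>2 * (2 * B) ^ ?N" for B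
  have wb: "cmod (w y U) \<le> W B" if U: "unitary U" and "\<And>k. cmod (y k) \<le> B" "1 \<le> B" for y U B
  proof -
    have "cmod (w y U) \<le> cmod (vandermonde_deriv (\<lambda>k. of_real (?d U k)) y) + \<bar>?o U\<bar> * cmod (cvandermonde y)"
      unfolding w_def by (rule order_trans[OF norm_triangle_ineq4]) (simp add: norm_mult)
    also have "\<dots> \<le> W B"
      unfolding W_def using that orbit_offdiag_le[OF Z U] orbit_offdiag_nonneg[of Z U] abs_orbit_diag_le[OF U, of Z]
      by (intro add_mono mult_mono norm_vandermonde_deriv_le norm_cvandermonde_le) auto
    finally show ?thesis .
  qed
  have der: "((\<lambda>t. r t U) has_vector_derivative r' t U) (at t)" for t U
  proof -
    have e: "((\<lambda>t. exp (of_real (- t * ?o U)) :: complex) has_vector_derivative - of_real (?o U) * exp (of_real (- t * ?o U))) (at t)"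
    proof -
      have "((\<lambda>t. of_real (- t * ?o U) :: complex) has_vector_derivative of_real (- ?o U)) (at t)"
        by (rule has_vector_derivative_of_real) (auto intro!: derivative_eq_intros)
      from field_vector_diff_chain_at[OF this DERIV_exp] show ?thesis by (simp add: o_def)
    qed
    from has_vector_derivative_mult[OF has_vector_derivative_cvandermonde[of \<xi> "\<lambda>k. of_real (?d U k)" t] has_vector_derivative_mult_right[OF e, of "?E U"]]
    show ?thesis by (simp add: r_def r'_def w_def algebra_simps)
  qed
  define B where "B T = 1 + A + T * ?z" for T
  have arg: "cmod (\<xi> k + of_real t * of_real (?d U k)) \<le> B T" if U: "unitary U" and t: "\<bar>t\<bar> \<le> T" for t U k T
  proof -
    have "cmod (\<xi> k + of_real t * of_real (?d U k)) \<le> cmod (\<xi> k) + \<bar>t\<bar> * \<bar>?d U k\<bar>"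
      by (rule order_trans[OF norm_triangle_ineq]) (simp add: norm_mult)
    also have "\<dots> \<le> A + T * ?z"
      using t by (intro add_mono mult_mono A abs_orbit_diag_le[OF U]) auto
    finally show ?thesis by (simp add: B_def)
  qed
  have B1: "1 \<le> B T" if "0 \<le> T" for T using that A0 by (simp add: B_def)
  define C where "C T = exp ((\<Sum>l\<in>UNIV. \<bar>Re (\<xi> l)\<bar>) * ?z) * exp (T * ?z\<^sup>2)" for T
  have eb: "cmod (?E U * exp (of_real (- t * ?o U))) \<le> C T" if U: "unitary U" and t: "\<bar>t\<bar> \<le> T" for t U T
  proof -
    have "- t * ?o U \<le> \<bar>t\<bar> * ?o U" using orbit_offdiag_nonneg[of Z U] by (intro mult_right_mono) auto
    also have "\<dots> \<le> T * ?z\<^sup>2" using t orbit_offdiag_le[OF Z U] orbit_offdiag_nonneg[of Z U] by (intro mult_mono) auto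
    finally show ?thesis unfolding C_def norm_mult using norm_orbit_exp_le[OF U] by (intro mult_mono) auto
  qed
  have [measurable]: "?E \<in> borel_measurable borel" "?o \<in> borel_measurable borel" "\<And>k. (\<lambda>U. ?d U k) \<in> borel_measurable borel"
    by measurable
  have r_meas: "r t \<in> borel_measurable borel" for t unfolding r_def by measurable
  have int: "integrable haar (r t)" for t
  proof (rule integrable_haar_bounded[OF r_meas])
    show "cmod (r t U) \<le> (2 * B \<bar>t\<bar>) ^ ?N * C \<bar>t\<bar>" if U: "unitary U" for U
      unfolding r_def norm_mult[of "cvandermonde _"] using B1[of "\<bar>t\<bar>"]
      by (intro mult_mono norm_cvandermonde_le eb[OF U] arg[OF U]) auto
  qed
  interpret prob_space "haar :: 'n cmatrix measure" by (rule prob_space_haar)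
  have Rder: "((\<lambda>t. \<integral>U. r t U \<partial>haar) has_vector_derivative (\<integral>U. r' t U \<partial>haar)) (at t)" for t
  proof (rule has_vector_derivative_integral(2)[of "t - 1" t "t + 1" haar r r' "\<lambda>_. W (B (\<bar>t\<bar> + 1)) * C (\<bar>t\<bar> + 1)", OF _ _ int der])
    fix u U assume u: "t - 1 < u" "u < t + 1" and "U \<in> space (haar :: 'n cmatrix measure)"
    then have U: "unitary U" by (simp add: space_haar)
    have u': "\<bar>u\<bar> \<le> \<bar>t\<bar> + 1" using u by linarith
    show "cmod (r' u U) \<le> W (B (\<bar>t\<bar> + 1)) * C (\<bar>t\<bar> + 1)"
      unfolding r'_def norm_mult[of "w _ _"]
      using wb[OF U arg[OF U u'] B1] eb[OF U u'] by (intro mult_mono) (auto intro: order_trans[OF norm_ge_zero])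
  qed auto
  have zero: "(\<integral>U. r' t U \<partial>haar) = 0" if t: "t \<le> 0" for t
  proof (cases "t = 0")
    case True
    then show ?thesis using orbit_sum_identity[OF Z, of \<xi>] by (simp add: r'_def w_def)
  next
    case False
    \<comment> \<open>The width for which the Gaussian average shifts \<open>\<xi>\<close> by \<open>- d / (2 \<eta>) = t d\<close>.\<close>
    define \<eta> where "\<eta> = - 1 / (2 * t)"
    have \<eta>: "0 < \<eta>" "t = - 1 / (2 * \<eta>)" using t False by (auto simp: \<eta>_def divide_simps)
    define y where "y s k = \<xi> k + \<i> * of_real (s $ k)" for s :: "'n rvector" and k
    let ?g = "\<lambda>s::'n rvector. complex_of_real (exp (- \<eta> * (norm s)\<^sup>2))"
    define F where "F p = ?g (snd p) * (w (y (snd p)) (fst p) * orbit_exp (y (snd p)) Z (fst p))" for p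
    define K where "K = complex_of_real (sqrt (pi / \<eta>) ^ CARD('n))"
    have K: "K \<noteq> 0" using \<eta>(1) by (simp add: K_def)
    have Ey: "orbit_exp (y s) Z U = ?E U * exp (\<i> * of_real (\<Sum>k\<in>UNIV. s $ k * ?d U k))" for s U
      by (simp add: orbit_exp_def y_def distrib_right sum.distrib exp_add sum_distrib_left mult.assoc)
    have inner: "(\<integral>s. F (U, s) \<partial>lborel) = K * of_real (exp (- ?z\<^sup>2 / (4 * \<eta>))) * r' t U" if U: "unitary U" for U
    proof -
      let ?ex = "\<lambda>s::'n rvector. exp (\<i> * of_real (\<Sum>k\<in>UNIV. s $ k * ?d U k))"
      let ?f1 = "\<lambda>s. ?g s * vandermonde_deriv (\<lambda>k. of_real (?d U k)) (y s) * ?ex s"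
      let ?f2 = "\<lambda>s. ?g s * cvandermonde (y s) * ?ex s"
      let ?G = "K * of_real (exp (- (\<Sum>k\<in>UNIV. (?d U k)\<^sup>2) / (4 * \<eta>)))"
      let ?v = "\<lambda>k. \<xi> k + of_real t * of_real (?d U k)"
      have v: "(\<lambda>k. \<xi> k - of_real (?d U k / (2 * \<eta>))) = ?v" using \<eta> by (auto simp: fun_eq_iff)
      have i: "integrable lborel ?f1" "integrable lborel ?f2"
        unfolding y_def by (rule integrable_gaussian_vandermonde_deriv[OF \<eta>(1)] integrable_gaussian_cvandermonde[OF \<eta>(1)])+
      have "F (U, s) = ?E U * (?f1 s - of_real (?o U) * ?f2 s)" for s
        by (simp add: F_def w_def Ey algebra_simps)
      then have "(\<integral>s. F (U, s) \<partial>lborel) = ?E U * (\<integral>s. ?f1 s - of_real (?o U) * ?f2 s \<partial>lborel)" by simp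
      also have "(\<integral>s. ?f1 s - of_real (?o U) * ?f2 s \<partial>lborel) = (\<integral>s. ?f1 s \<partial>lborel) - of_real (?o U) * (\<integral>s. ?f2 s \<partial>lborel)"
        using i by (subst Bochner_Integration.integral_diff) auto
      also have "(\<integral>s. ?f1 s \<partial>lborel) = ?G * vandermonde_deriv (\<lambda>k. of_real (?d U k)) ?v"
        unfolding y_def gaussian_integral_vandermonde_deriv[OF \<eta>(1)] v by (simp add: K_def)
      also have "(\<integral>s. ?f2 s \<partial>lborel) = ?G * cvandermonde ?v"
        unfolding y_def gaussian_integral_cvandermonde[OF \<eta>(1)] v by (simp add: K_def)
      finally have 1: "(\<integral>s. F (U, s) \<partial>lborel) = K * of_real (exp (- (\<Sum>k\<in>UNIV. (?d U k)\<^sup>2) / (4 * \<eta>))) * (w ?v U * ?E U)"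
        by (simp add: w_def algebra_simps)
      have "- (\<Sum>k\<in>UNIV. (?d U k)\<^sup>2) / (4 * \<eta>) = - ?z\<^sup>2 / (4 * \<eta>) + (- t * ?o U)"
      proof -
        have "- t * ?o U = ?o U / (2 * \<eta>)" using \<eta>(2) by simp
        then show ?thesis unfolding norm_orbit_squared'[OF Z U] using \<eta>(1) by (simp add: field_simps)
      qed
      then have "complex_of_real (exp (- (\<Sum>k\<in>UNIV. (?d U k)\<^sup>2) / (4 * \<eta>)))
          = of_real (exp (- ?z\<^sup>2 / (4 * \<eta>))) * of_real (exp (- t * ?o U))"
        by (simp only: exp_add of_real_mult)
      then show ?thesis unfolding 1 r'_def exp_of_real by (simp only: mult_ac)
    qed
    have "K * of_real (exp (- ?z\<^sup>2 / (4 * \<eta>))) * (\<integral>U. r' t U \<partial>haar) = (\<integral>U. (\<integral>s. F (U, s) \<partial>lborel) \<partial>haar)"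
      by (subst integral_mult_right_zero[symmetric], rule Bochner_Integration.integral_cong) (auto simp: inner space_haar)
    also have "\<dots> = (\<integral>s. (\<integral>U. F (U, s) \<partial>haar) \<partial>lborel)"
    proof (rule integral_swap_prob_dominated[OF prob_space_haar sigma_finite_lborel])
      have fst_m[measurable]: "fst \<in> haar \<Otimes>\<^sub>M (lborel :: 'n rvector measure) \<rightarrow>\<^sub>M (borel :: 'n cmatrix measure)"
        by (rule measurable_compose[OF measurable_fst measurable_haar_id])
      have [measurable]: "(\<lambda>p. snd p $ k) \<in> borel_measurable (haar \<Otimes>\<^sub>M (lborel :: 'n rvector measure))" for k
        by (rule measurable_compose[OF measurable_snd])
          (subst measurable_cong_sets[OF sets_lborel refl], intro borel_measurable_continuous_onI continuous_intros)
      have [measurable]: "(\<lambda>p. orbit_exp (y (snd p)) Z (fst p)) \<in> borel_measurable (haar \<Otimes>\<^sub>M (lborel :: 'n rvector measure))"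
        unfolding y_def by measurable
      show "F \<in> borel_measurable (haar \<Otimes>\<^sub>M lborel)"
        unfolding F_def w_def y_def by measurable
      let ?C = "(real ?N * (2 * ?z) * (2 * (1 + A)) ^ ?N + ?z\<^sup>2 * (2 * (1 + A)) ^ ?N) * exp ((\<Sum>l\<in>UNIV. \<bar>Re (\<xi> l)\<bar>) * ?z)"
      show "integrable lborel (\<lambda>s::'n rvector. ?C * ((1 + norm s) ^ ?N * exp (- \<eta> * (norm s)\<^sup>2)))"
        by (intro integrable_mult_right integrable_poly_gaussian \<eta>)
      fix U :: "'n cmatrix" and s :: "'n rvector" assume "U \<in> space haar"
      then have U: "unitary U" by (simp add: space_haar)
      have yb: "cmod (y s k) \<le> (1 + A) * (1 + norm s)" for k
      proof -
        have "cmod (y s k) \<le> cmod (\<xi> k) + \<bar>s $ k\<bar>"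
          unfolding y_def by (rule order_trans[OF norm_triangle_ineq]) (simp add: norm_mult)
        also have "\<dots> \<le> A + norm s" by (intro add_mono A component_le_norm_cart)
        also have "\<dots> \<le> (1 + A) * (1 + norm s)" using A0 by (simp add: algebra_simps)
        finally show ?thesis .
      qed
      have "1 * 1 \<le> (1 + A) * (1 + norm s)" using A0 by (intro mult_mono) auto
      then have w1: "cmod (w (y s) U) \<le> W ((1 + A) * (1 + norm s))" by (intro wb[OF U yb]) simp
      have pw: "(2 * ((1 + A) * (1 + norm s))) ^ ?N = (2 * (1 + A)) ^ ?N * (1 + norm s) ^ ?N"
        by (simp only: mult.assoc[symmetric] power_mult_distrib)
      have W: "W ((1 + A) * (1 + norm s)) = (real ?N * (2 * ?z) * (2 * (1 + A)) ^ ?N + ?z\<^sup>2 * (2 * (1 + A)) ^ ?N) * (1 + norm s) ^ ?N"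
        unfolding W_def pw by (simp only: distrib_right mult.assoc)
      have e1: "cmod (orbit_exp (y s) Z U) \<le> exp ((\<Sum>l\<in>UNIV. \<bar>Re (\<xi> l)\<bar>) * ?z)"
        using norm_orbit_exp_le[OF U, of "y s" Z] by (simp add: y_def)
      have "cmod (F (U, s)) = exp (- \<eta> * (norm s)\<^sup>2) * (cmod (w (y s) U) * cmod (orbit_exp (y s) Z U))"
        by (simp add: F_def norm_mult)
      also have "\<dots> \<le> exp (- \<eta> * (norm s)\<^sup>2) * (W ((1 + A) * (1 + norm s)) * exp ((\<Sum>l\<in>UNIV. \<bar>Re (\<xi> l)\<bar>) * ?z))"
        by (intro mult_left_mono mult_mono w1 e1 order_trans[OF norm_ge_zero w1]) auto
      also have "\<dots> = ?C * ((1 + norm s) ^ ?N * exp (- \<eta> * (norm s)\<^sup>2))" unfolding W by (simp only: mult_ac)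
      finally show "cmod (F (U, s)) \<le> ?C * ((1 + norm s) ^ ?N * exp (- \<eta> * (norm s)\<^sup>2))" .
    qed
    also have "\<dots> = (\<integral>s. ?g s * (\<integral>U. w (y s) U * orbit_exp (y s) Z U \<partial>haar) \<partial>lborel)"
      unfolding F_def by simp
    also have "\<dots> = 0"
      using orbit_sum_identity[OF Z] by (simp add: w_def)
    finally show ?thesis using K by simp
  qed
  have "((\<lambda>t. \<integral>U. r t U \<partial>haar) has_derivative (\<lambda>h. 0)) (at t within {..0})" if "t \<in> {..0}" for t
    using Rder[of t] zero[of t] that
    by (auto simp: has_vector_derivative_def intro: has_derivative_at_withinI)
  then obtain c where c: "\<And>t. t \<in> {..0} \<Longrightarrow> (\<integral>U. r t U \<partial>haar) = c"
    using has_derivative_zero_constant[of "{..0::real}" "\<lambda>t. \<integral>U. r t U \<partial>haar"] by blast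
  have "(\<integral>U. r (- 1 / (2 * \<epsilon>)) U \<partial>haar) = (\<integral>U. r 0 U \<partial>haar)"
    using c[of "- 1 / (2 * \<epsilon>)"] c[of 0] \<epsilon> by simp
  moreover have "r 0 U = cvandermonde \<xi> * ?E U" for U by (simp add: r_def)
  moreover have "r (- 1 / (2 * \<epsilon>)) U = cvandermonde (\<lambda>k. \<xi> k - of_real (?d U k / (2 * \<epsilon>))) * (?E U * of_real (exp (?o U / (2 * \<epsilon>))))" for U
    by (simp add: r_def flip: exp_of_real)
  ultimately show ?thesis by simp
qed

lemma norm_diag_matrix_minus_orbit:
  fixes Z :: "('n::{finite,linorder}) cmatrix"
  assumes Z: "hermitian Z"
  shows "(norm (diag_matrix x - U ** Z ** conj_transpose U))\<^sup>2 = (\<Sum>k\<in>UNIV. (x $ k - orbit_diag Z U k)\<^sup>2) + 2 * orbit_offdiag Z U"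
proof -
  have "hermitian (diag_matrix x - U ** Z ** conj_transpose U)"
    using hermitian_conjugate[OF Z, of U]
    by (simp add: hermitian_def conj_transpose_diff) (simp add: vec_eq_iff diag_matrix_def)
  from norm_hermitian_squared[OF this] show ?thesis
    by (simp add: diag_matrix_def orbit_diag_def orbit_offdiag_def orbit_entry_def) (auto intro!: sum.cong)
qed

text \<open>
  The case \<open>\<xi> = x / (2 \<epsilon>)\<close> of the preceding lemma: completing the squares, and using that the norm is constant on the orbit, turns
  the exponential weights into heat kernels. The left-hand side involves the diagonal of the orbit point only; it is what the Gaussian Fourier
  integral over \<open>s\<close> produces.
\<close>

lemma heat_kernel_identity:
  fixes Z :: "('n::{finite,linorder}) cmatrix" and x :: "'n rvector"
  assumes Z: "hermitian Z" and \<epsilon>: "0 < \<epsilon>"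
  shows "(\<integral>U. cvandermonde (\<lambda>k. of_real (x $ k - orbit_diag Z U k)) *
      of_real (exp (- (\<Sum>k\<in>UNIV. (x $ k - orbit_diag Z U k)\<^sup>2) / (4 * \<epsilon>))) \<partial>haar)
    = of_real (vandermonde x) * (\<integral>U. of_real (exp (- (norm (diag_matrix x - U ** Z ** conj_transpose U))\<^sup>2 / (4 * \<epsilon>))) \<partial>haar)"
proof -
  let ?N = "card {p::'n\<times>'n. fst p < snd p}"
  let ?c = "complex_of_real (1 / (2 * \<epsilon>))"
  define \<xi> where "\<xi> k = complex_of_real (x $ k / (2 * \<epsilon>))" for k
  let ?d = "orbit_diag Z" and ?E = "orbit_exp \<xi> Z" and ?o = "orbit_offdiag Z"
  \<comment> \<open>The part of both exponential weights that is constant on the orbit.\<close>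
  let ?q = "complex_of_real (exp (- ((\<Sum>k\<in>UNIV. (x $ k)\<^sup>2) + (norm Z)\<^sup>2) / (4 * \<epsilon>)))"
  have sq: "(\<Sum>k\<in>UNIV. (x $ k - ?d U k)\<^sup>2) = (\<Sum>k\<in>UNIV. (x $ k)\<^sup>2) - 2 * (\<Sum>k\<in>UNIV. x $ k * ?d U k) + (\<Sum>k\<in>UNIV. (?d U k)\<^sup>2)" for U
    by (simp add: power2_diff sum.distrib sum_subtractf sum_distrib_left algebra_simps)
  have E: "?E U = of_real (exp ((\<Sum>k\<in>UNIV. x $ k * ?d U k) / (2 * \<epsilon>)))" for U
    by (simp add: orbit_exp_def \<xi>_def sum_divide_distrib flip: exp_of_real)
  have e1: "complex_of_real (exp (- (\<Sum>k\<in>UNIV. (x $ k - ?d U k)\<^sup>2) / (4 * \<epsilon>))) = ?q * (?E U * of_real (exp (?o U / (2 * \<epsilon>))))"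
    if U: "unitary U" for U
  proof -
    have "- (\<Sum>k\<in>UNIV. (x $ k - ?d U k)\<^sup>2) / (4 * \<epsilon>)
        = - ((\<Sum>k\<in>UNIV. (x $ k)\<^sup>2) + (norm Z)\<^sup>2) / (4 * \<epsilon>) + ((\<Sum>k\<in>UNIV. x $ k * ?d U k) / (2 * \<epsilon>) + ?o U / (2 * \<epsilon>))"
      unfolding sq norm_orbit_squared'[OF Z U] using \<epsilon> by (simp add: field_simps)
    then show ?thesis unfolding E by (simp only: exp_add of_real_mult)
  qed
  have e2: "complex_of_real (exp (- (norm (diag_matrix x - U ** Z ** conj_transpose U))\<^sup>2 / (4 * \<epsilon>))) = ?q * ?E U"
    if U: "unitary U" for U
  proof -
    have "- (norm (diag_matrix x - U ** Z ** conj_transpose U))\<^sup>2 / (4 * \<epsilon>)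
        = - ((\<Sum>k\<in>UNIV. (x $ k)\<^sup>2) + (norm Z)\<^sup>2) / (4 * \<epsilon>) + (\<Sum>k\<in>UNIV. x $ k * ?d U k) / (2 * \<epsilon>)"
      unfolding norm_diag_matrix_minus_orbit[OF Z] sq norm_orbit_squared'[OF Z U] using \<epsilon> by (simp add: field_simps)
    then show ?thesis unfolding E by (simp only: exp_add of_real_mult)
  qed
  have v: "?c ^ ?N * cvandermonde (\<lambda>k. of_real (x $ k - ?d U k)) = cvandermonde (\<lambda>k. \<xi> k - of_real (?d U k / (2 * \<epsilon>)))" for U
    unfolding cvandermonde_scale[symmetric] by (simp add: \<xi>_def diff_divide_distrib)
  have v': "?c ^ ?N * of_real (vandermonde x) = cvandermonde \<xi>"
  proof -
    have "\<xi> = (\<lambda>k. ?c * of_real (x $ k))" by (simp add: \<xi>_def fun_eq_iff)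
    then show ?thesis unfolding cvandermonde_of_real[symmetric] cvandermonde_scale[symmetric] by simp
  qed
  have "?c ^ ?N * (\<integral>U. cvandermonde (\<lambda>k. of_real (x $ k - ?d U k)) * of_real (exp (- (\<Sum>k\<in>UNIV. (x $ k - ?d U k)\<^sup>2) / (4 * \<epsilon>))) \<partial>haar)
      = (\<integral>U. ?q * (cvandermonde (\<lambda>k. \<xi> k - of_real (?d U k / (2 * \<epsilon>))) * (?E U * of_real (exp (?o U / (2 * \<epsilon>))))) \<partial>haar)"
    unfolding integral_mult_right_zero[symmetric]
  proof (rule Bochner_Integration.integral_cong[OF refl])
    fix U assume "U \<in> space (haar :: 'n cmatrix measure)"
    then have U: "unitary U" by (simp add: space_haar)
    show "?c ^ ?N * (cvandermonde (\<lambda>k. of_real (x $ k - ?d U k)) * of_real (exp (- (\<Sum>k\<in>UNIV. (x $ k - ?d U k)\<^sup>2) / (4 * \<epsilon>))))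
      = ?q * (cvandermonde (\<lambda>k. \<xi> k - of_real (?d U k / (2 * \<epsilon>))) * (?E U * of_real (exp (?o U / (2 * \<epsilon>)))))"
      unfolding e1[OF U] v[symmetric] by (simp only: mult_ac)
  qed
  also have "\<dots> = ?q * (cvandermonde \<xi> * (\<integral>U. ?E U \<partial>haar))"
    unfolding integral_mult_right_zero vandermonde_average_invariant[OF Z \<epsilon>] ..
  also have "\<dots> = ?c ^ ?N * (of_real (vandermonde x) * (\<integral>U. ?q * ?E U \<partial>haar))"
    unfolding integral_mult_right_zero v'[symmetric] by (simp only: mult_ac)
  also have "(\<integral>U. ?q * ?E U \<partial>haar) = (\<integral>U. of_real (exp (- (norm (diag_matrix x - U ** Z ** conj_transpose U))\<^sup>2 / (4 * \<epsilon>))) \<partial>haar)"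
    by (rule Bochner_Integration.integral_cong[OF refl]) (simp only: e2 space_haar mem_Collect_eq)
  finally show ?thesis using \<epsilon> by simp
qed

section \<open>The spectral theorem\<close>

lemma conjugate_mult:
  "(V ** U) ** Z ** conj_transpose (V ** U) = V ** (U ** Z ** conj_transpose U) ** conj_transpose V"
  by (simp add: conj_transpose_mult matrix_mul_assoc)

text \<open>
  On the orbit of \<open>Z\<close>, maximize a linear functional of the diagonal with pairwise distinct coefficients; \<open>index_rank\<close> supplies
  these. At the maximum, stationarity under rotations in the \<open>(j,k)\<close> plane forces \<open>Re w\<^sub>j\<^sub>k = 0\<close>. A phase matrix does
  not change the functional, so the imaginary part vanishes as well.
\<close>

lemma spectral_theorem:
  fixes Z :: "('n::{finite,linorder}) cmatrix"
  assumes Z: "hermitian Z"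
  shows "\<exists>U x. unitary U \<and> U ** Z ** conj_transpose U = diag_matrix x"
proof -
  \<comment> \<open>Any pairwise distinct coefficients would do.\<close>
  define f where "f U = (\<Sum>k\<in>UNIV. real (index_rank k) * orbit_diag Z U k)" for U
  have "continuous_on {U. unitary U} f"
    unfolding f_def orbit_diag_def by (intro continuous_intros)
  then obtain U where U: "unitary U" and max: "\<And>V. unitary V \<Longrightarrow> f V \<le> f U"
    using continuous_attains_sup[OF compact_unitary, of f] unitary_mat_1 by blast
  have re0: "Re (orbit_entry Z V j k) = 0" if V: "unitary V" "f V = f U" and jk: "j \<noteq> k" for V j k
  proof -
    let ?h = "\<lambda>t. (sin t)\<^sup>2 * (orbit_diag Z V k - orbit_diag Z V j) + 2 * cos t * sin t * Re (orbit_entry Z V j k)"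
    let ?c = "\<lambda>k. real (index_rank (k::'n))"
    have g: "f (givens j k t ** V) = f V + (?c j - ?c k) * ?h t" for t
    proof -
      have "f (givens j k t ** V) = f V + (\<Sum>l\<in>UNIV. ?c l * (if l = j then ?h t else if l = k then - ?h t else 0))"
        unfolding f_def orbit_givens(1)[OF Z jk] by (simp only: distrib_left sum.distrib)
      also have "(\<Sum>l\<in>UNIV. ?c l * (if l = j then ?h t else if l = k then - ?h t else 0))
          = (\<Sum>l\<in>{j, k}. ?c l * (if l = j then ?h t else if l = k then - ?h t else 0))"
        by (rule sum.mono_neutral_right) auto
      also have "\<dots> = (?c j - ?c k) * ?h t" using jk by (simp add: algebra_simps)
      finally show ?thesis .
    qed
    have D: "DERIV (\<lambda>t. f (givens j k t ** V)) 0 :> (?c j - ?c k) * (2 * Re (orbit_entry Z V j k))"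
      unfolding g by (auto intro!: derivative_eq_intros)
    have L: "\<forall>t. \<bar>0 - t\<bar> < 1 \<longrightarrow> f (givens j k t ** V) \<le> f (givens j k 0 ** V)"
    proof (intro allI impI)
      fix t
      have "f (givens j k t ** V) \<le> f U" by (intro max unitary_mult unitary_givens jk V)
      also have "f U = f (givens j k 0 ** V)" using V(2) by (simp add: g)
      finally show "f (givens j k t ** V) \<le> f (givens j k 0 ** V)" .
    qed
    have "(?c j - ?c k) * (2 * Re (orbit_entry Z V j k)) = 0"
      by (rule DERIV_local_max[OF D zero_less_one L])
    moreover have "?c j \<noteq> ?c k" using jk bij_index_rank[where 'n='n] by (auto simp: bij_betw_def inj_eq)
    ultimately show ?thesis by simp
  qed
  have off: "orbit_entry Z U j k = 0" if jk: "j \<noteq> k" for j k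
  proof -
    have "orbit_diag Z (phase k ** U) l = orbit_diag Z U l" for l
      unfolding orbit_diag_entry orbit_entry_phase by (simp add: orbit_entry_diag[OF Z])
    then have "f (phase k ** U) = f U" by (simp add: f_def)
    then have "Re (orbit_entry Z (phase k ** U) j k) = 0"
      by (intro re0 unitary_mult unitary_phase U jk)
    then have "Im (orbit_entry Z U j k) = 0" using jk by (simp add: orbit_entry_phase)
    then show ?thesis using re0[OF U refl jk] by (simp add: complex_eq_iff)
  qed
  have "U ** Z ** conj_transpose U = diag_matrix (\<chi> k. orbit_diag Z U k)"
    unfolding vec_eq_iff orbit_entry_def[symmetric]
    using off orbit_entry_diag[OF Z, of U] by (simp add: diag_matrix_def)
  with U show ?thesis by blast
qed

definition perm_matrix :: "('n \<Rightarrow> 'n) \<Rightarrow> ('n::finite) cmatrix" where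
  "perm_matrix \<sigma> = (\<chi> a b. if b = \<sigma> a then 1 else 0)"

lemma perm_matrix_mult: "(perm_matrix \<sigma> ** W) $ a $ b = W $ \<sigma> a $ b"
proof -
  have "(\<Sum>l\<in>UNIV. perm_matrix \<sigma> $ a $ l * W $ l $ b) = (\<Sum>l\<in>{\<sigma> a}. perm_matrix \<sigma> $ a $ l * W $ l $ b)"
    by (rule sum.mono_neutral_right) (auto simp: perm_matrix_def)
  then show ?thesis by (simp add: matrix_matrix_mult_def perm_matrix_def)
qed

lemma mult_perm_matrix: "(W ** conj_transpose (perm_matrix \<sigma>)) $ a $ b = W $ a $ \<sigma> b"
proof -
  have "W ** conj_transpose (perm_matrix \<sigma>) = conj_transpose (perm_matrix \<sigma> ** conj_transpose W)"
    by (simp add: conj_transpose_mult)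
  then show ?thesis by (simp add: perm_matrix_mult)
qed

lemma unitary_perm_matrix:
  assumes "\<sigma> permutes UNIV"
  shows "unitary (perm_matrix \<sigma>)"
proof -
  have "perm_matrix \<sigma> ** conj_transpose (perm_matrix \<sigma>) = mat 1"
    using permutes_inj[OF assms] by (auto simp: vec_eq_iff mult_perm_matrix) (auto simp: perm_matrix_def mat_def inj_eq)
  then show ?thesis by (metis matrix_left_right_inverse unitaryI)
qed

lemma perm_matrix_diag:
  assumes "\<sigma> permutes UNIV"
  shows "perm_matrix \<sigma> ** diag_matrix x ** conj_transpose (perm_matrix \<sigma>) = diag_matrix (\<chi> k. x $ \<sigma> k)"
  using permutes_inj[OF assms]
  by (auto simp: vec_eq_iff mult_perm_matrix perm_matrix_mult diag_matrix_def inj_eq)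

lemma hermitian_diag_matrix [simp]: "hermitian (diag_matrix x)"
  by (simp add: hermitian_def vec_eq_iff diag_matrix_def)

lemma equal_linear_products_permute:
  fixes w x :: "'n::finite \<Rightarrow> complex"
  assumes "\<And>t. (\<Prod>k\<in>UNIV. t - w k) = (\<Prod>k\<in>UNIV. t - x k)"
  obtains \<sigma> where "\<sigma> permutes UNIV" "\<And>k. x k = w (\<sigma> k)"
proof -
  have roots: "proots (\<Prod>k\<in>UNIV. [:- v k, 1:]) = image_mset v (mset_set UNIV)" for v :: "'n \<Rightarrow> complex"
    by (subst proots_prod) (auto simp: sum_unfold_sum_mset)
  have "(\<Prod>k\<in>UNIV. [:- w k, 1:]) = (\<Prod>k\<in>UNIV. [:- x k, 1:])"
    unfolding poly_eq_poly_eq_iff[symmetric] using assms by (simp add: fun_eq_iff poly_prod)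
  then have "image_mset x (mset_set UNIV) = image_mset w (mset_set UNIV)"
    by (metis roots)
  then show ?thesis using image_mset_eq_implies_permutes[of UNIV x w] that by auto
qed

lemma det_mat_minus_unitary_conjugate:
  fixes Z :: "('n::finite) cmatrix"
  assumes U: "unitary U"
  shows "det (mat t - U ** Z ** conj_transpose U) = det (mat t - Z)"
proof -
  have "U ** mat t ** conj_transpose U = mat t"
  proof -
    have "U ** mat t = mat t ** U" by (simp add: vec_eq_iff matrix_matrix_mult_def mat_def if_distrib if_distribR cong: if_cong)
    then have "U ** mat t ** conj_transpose U = mat t ** (U ** conj_transpose U)" by (simp add: matrix_mul_assoc)
    also have "\<dots> = mat t" using U by (simp add: unitary_def)
    finally show ?thesis .
  qed
  then have "mat t - U ** Z ** conj_transpose U = U ** (mat t - Z) ** conj_transpose U"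
    by (simp add: matrix_mult_diff_right matrix_mult_diff_left)
  then have "det (mat t - U ** Z ** conj_transpose U) = det (mat t - Z) * (det U * det (conj_transpose U))"
    by (simp add: det_mul)
  also have "det U * det (conj_transpose U) = 1"
    using U by (simp add: unitary_def flip: det_mul)
  finally show ?thesis by simp
qed

lemma eigenvalues_diag_matrix: "eigenvalues (diag_matrix x) x" for x :: "('n::{finite,linorder}) rvector"
  unfolding eigenvalues_def by (subst det_triangular) (auto simp: mat_def diag_matrix_def)

lemma eigenvalues_unitary_conjugate:
  "unitary U \<Longrightarrow> eigenvalues (U ** Z ** conj_transpose U) x \<longleftrightarrow> eigenvalues Z x"
  by (simp add: eigenvalues_def det_mat_minus_unitary_conjugate)

text \<open>
  A permutation matrix puts the eigenvalues into the prescribed order.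
\<close>

lemma diagonalize_with_eigenvalues:
  fixes Z :: "('n::{finite,linorder}) cmatrix"
  assumes Z: "hermitian Z" and x: "eigenvalues Z x"
  obtains U where "unitary U" "U ** Z ** conj_transpose U = diag_matrix x"
proof -
  obtain U w where U: "unitary U" "U ** Z ** conj_transpose U = diag_matrix w"
    using spectral_theorem[OF Z] by blast
  have "eigenvalues Z w"
    using eigenvalues_unitary_conjugate[OF U(1), of Z w] eigenvalues_diag_matrix[of w] by (simp add: U(2))
  with x have "(\<Prod>k\<in>UNIV. t - complex_of_real (w $ k)) = (\<Prod>k\<in>UNIV. t - complex_of_real (x $ k))" for t
    unfolding eigenvalues_def by metis
  then obtain \<sigma> where \<sigma>: "\<sigma> permutes UNIV" "\<And>k. complex_of_real (x $ k) = of_real (w $ \<sigma> k)"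
    by (rule equal_linear_products_permute) blast
  have "(perm_matrix \<sigma> ** U) ** Z ** conj_transpose (perm_matrix \<sigma> ** U) = diag_matrix (\<chi> k. w $ \<sigma> k)"
    unfolding conjugate_mult U(2) by (rule perm_matrix_diag[OF \<sigma>(1)])
  moreover have "(\<chi> k. w $ \<sigma> k) = x" using \<sigma>(2) by (simp add: vec_eq_iff)
  moreover have "unitary (perm_matrix \<sigma> ** U)" by (intro unitary_mult unitary_perm_matrix \<sigma> U)
  ultimately show ?thesis using that by metis
qed

section \<open>The discriminant of a Hermitian matrix\<close>

definition matrix_pow :: "('n::finite) cmatrix \<Rightarrow> nat \<Rightarrow> 'n cmatrix" where
  "matrix_pow Z m = (((**) Z) ^^ m) (mat 1)"

lemma matrix_pow_simps [simp]: "matrix_pow Z 0 = mat 1" "matrix_pow Z (Suc m) = Z ** matrix_pow Z m"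
  by (simp_all add: matrix_pow_def)

text \<open>
  The Hankel determinant of the power sums of the eigenvalues, which is the square of their Vandermonde determinant. Unlike the
  eigenvalues it is visibly polynomial in the entries.
\<close>

definition discriminant :: "('n::{finite,linorder}) cmatrix \<Rightarrow> complex" where
  "discriminant Z = det (\<chi> i j::'n. trace (matrix_pow Z (index_rank i + index_rank j)))"

lemma matrix_pow_diag:
  fixes x :: "('n::finite) rvector"
  shows "matrix_pow (diag_matrix x) m = (\<chi> j k. if j = k then of_real (x $ j) ^ m else 0)"
proof (induction m)
  case 0
  show ?case by (simp add: vec_eq_iff mat_def)
next
  case (Suc m)
  have "(diag_matrix x ** W) $ a $ b = of_real (x $ a) * W $ a $ b" for W :: "'n cmatrix" and a b
  proof -
    have "(\<Sum>l\<in>UNIV. diag_matrix x $ a $ l * W $ l $ b) = (\<Sum>l\<in>{a}. diag_matrix x $ a $ l * W $ l $ b)"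
      by (rule sum.mono_neutral_right) (auto simp: diag_matrix_def)
    then show ?thesis by (simp add: matrix_matrix_mult_def diag_matrix_def)
  qed
  then show ?case by (simp add: Suc vec_eq_iff)
qed

lemma trace_matrix_pow_conjugate:
  assumes U: "unitary U"
  shows "trace (matrix_pow (U ** Z ** conj_transpose U) m) = trace (matrix_pow Z m)"
proof -
  have "matrix_pow (U ** Z ** conj_transpose U) m = U ** matrix_pow Z m ** conj_transpose U"
  proof (induction m)
    case 0
    show ?case using U by (simp add: unitary_def)
  next
    case (Suc m)
    have "U ** Z ** conj_transpose U ** (U ** matrix_pow Z m ** conj_transpose U)
        = U ** Z ** (conj_transpose U ** (U ** (matrix_pow Z m ** conj_transpose U)))"
      by (simp only: matrix_mul_assoc)
    then show ?case by (simp add: Suc unitary_cancel[OF U] matrix_mul_assoc)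
  qed
  then have "trace (matrix_pow (U ** Z ** conj_transpose U) m) = trace (U ** (matrix_pow Z m ** conj_transpose U))"
    by (simp add: matrix_mul_assoc)
  also have "\<dots> = trace ((matrix_pow Z m ** conj_transpose U) ** U)" by (rule trace_mul_sym)
  also have "\<dots> = trace (matrix_pow Z m)" by (simp add: unitary_cancel[OF U])
  finally show ?thesis .
qed

lemma discriminant_eq:
  fixes Z :: "('n::{finite,linorder}) cmatrix"
  assumes "hermitian Z" "eigenvalues Z x"
  shows "discriminant Z = of_real ((vandermonde x)\<^sup>2)"
proof -
  obtain U where U: "unitary U" "U ** Z ** conj_transpose U = diag_matrix x"
    using diagonalize_with_eigenvalues[OF assms] .
  let ?V = "(\<chi> k j. complex_of_real (x $ k) ^ index_rank j) :: 'n cmatrix"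
  have "trace (matrix_pow Z m) = (\<Sum>k\<in>UNIV. of_real (x $ k) ^ m)" for m
    using trace_matrix_pow_conjugate[OF U(1), of Z m] by (simp add: U(2) matrix_pow_diag trace_def)
  then have "discriminant Z = det (transpose ?V ** ?V)"
    unfolding discriminant_def
    by (intro arg_cong[where f=det]) (simp add: vec_eq_iff matrix_matrix_mult_def transpose_def power_add)
  also have "\<dots> = (cvandermonde (\<lambda>k. of_real (x $ k)))\<^sup>2"
    by (simp add: det_mul cvandermonde_eq_det power2_eq_square)
  finally show ?thesis by (simp add: cvandermonde_of_real)
qed

lemma hermitian_scaleR: "hermitian Z \<Longrightarrow> hermitian (c *\<^sub>R Z)"
  by (simp add: hermitian_def conj_transpose_scaleR)

lemma hermitian_add: "hermitian A \<Longrightarrow> hermitian B \<Longrightarrow> hermitian (A + B)"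
  by (simp add: hermitian_def conj_transpose_add)

lemma discriminant_scaleR_eq_0:
  fixes Z :: "('n::{finite,linorder}) cmatrix"
  assumes Z: "hermitian Z" and 0: "discriminant Z = 0"
  shows "discriminant (c *\<^sub>R Z) = 0"
proof -
  obtain U x where U: "unitary U" "U ** Z ** conj_transpose U = diag_matrix x" using spectral_theorem[OF Z] by blast
  have x: "eigenvalues Z x" using U eigenvalues_unitary_conjugate[of U Z x] eigenvalues_diag_matrix[of x] by auto
  have "U ** (c *\<^sub>R Z) ** conj_transpose U = diag_matrix (c *\<^sub>R x)"
    unfolding matrix_mult_scaleR_left matrix_mult_scaleR_right U(2)
    by (simp add: vec_eq_iff diag_matrix_def) (simp add: scaleR_conv_of_real)
  then have "eigenvalues (c *\<^sub>R Z) (c *\<^sub>R x)"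
    using U(1) eigenvalues_unitary_conjugate[of U "c *\<^sub>R Z" "c *\<^sub>R x"] eigenvalues_diag_matrix[of "c *\<^sub>R x"] by auto
  from discriminant_eq[OF hermitian_scaleR[OF Z] this] have "discriminant (c *\<^sub>R Z) = of_real ((vandermonde (c *\<^sub>R x))\<^sup>2)" .
  moreover have "vandermonde x = 0" using discriminant_eq[OF Z x] 0 by simp
  then have "cvandermonde (\<lambda>k. of_real c * of_real (x $ k)) = 0"
    unfolding cvandermonde_scale by (simp add: cvandermonde_of_real)
  then have "vandermonde (c *\<^sub>R x) = 0"
    using cvandermonde_of_real[of "c *\<^sub>R x"] by simp
  ultimately show ?thesis by simp
qed

definition real_polynomial :: "(real \<Rightarrow> complex) \<Rightarrow> bool" where
  "real_polynomial g \<longleftrightarrow> (\<exists>p. \<forall>t. g t = poly p (of_real t))"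

lemma real_polynomial_const: "real_polynomial (\<lambda>t. c)"
  unfolding real_polynomial_def by (intro exI[of _ "[:c:]"]) simp

lemma real_polynomial_ident: "real_polynomial (\<lambda>t. of_real t)"
  unfolding real_polynomial_def by (intro exI[of _ "[:0, 1:]"]) simp

lemma real_polynomial_add: "real_polynomial f \<Longrightarrow> real_polynomial g \<Longrightarrow> real_polynomial (\<lambda>t. f t + g t)"
  unfolding real_polynomial_def by (metis poly_add)

lemma real_polynomial_mult: "real_polynomial f \<Longrightarrow> real_polynomial g \<Longrightarrow> real_polynomial (\<lambda>t. f t * g t)"
  unfolding real_polynomial_def by (metis poly_mult)

lemma real_polynomial_sum: "(\<And>i. i \<in> I \<Longrightarrow> real_polynomial (f i)) \<Longrightarrow> real_polynomial (\<lambda>t. \<Sum>i\<in>I. f i t)"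
  by (induction I rule: infinite_finite_induct) (auto intro: real_polynomial_const real_polynomial_add)

lemma real_polynomial_prod: "(\<And>i. i \<in> I \<Longrightarrow> real_polynomial (f i)) \<Longrightarrow> real_polynomial (\<lambda>t. \<Prod>i\<in>I. f i t)"
  by (induction I rule: infinite_finite_induct) (auto intro: real_polynomial_const real_polynomial_mult)

lemma real_polynomial_discriminant_line:
  fixes A B :: "('n::{finite,linorder}) cmatrix"
  shows "real_polynomial (\<lambda>t. discriminant (A + t *\<^sub>R B))"
proof -
  have entry: "real_polynomial (\<lambda>t. (A + t *\<^sub>R B) $ a $ b)" for a b
    unfolding vector_add_component vector_scaleR_component unfolding scaleR_conv_of_real
    by (intro real_polynomial_add real_polynomial_mult real_polynomial_const real_polynomial_ident)
  have "real_polynomial (\<lambda>t. matrix_pow (A + t *\<^sub>R B) m $ a $ b)" for m a b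
  proof (induction m arbitrary: a b)
    case (Suc m)
    show ?case unfolding matrix_pow_simps matrix_matrix_mult_def vec_lambda_beta
      by (intro real_polynomial_sum real_polynomial_mult entry Suc)
  qed (simp add: real_polynomial_const)
  then show ?thesis
    unfolding discriminant_def det_def trace_def vec_lambda_beta
    by (intro real_polynomial_sum real_polynomial_mult real_polynomial_prod real_polynomial_const)
qed

lemma continuous_on_matrix_pow [continuous_intros]:
  "continuous_on S f \<Longrightarrow> continuous_on S (\<lambda>x. matrix_pow (f x) m)"
  by (induction m) (auto intro!: continuous_intros)

lemma continuous_on_discriminant:
  fixes f :: "'a::topological_space \<Rightarrow> ('n::{finite,linorder}) cmatrix"
  shows "continuous_on S f \<Longrightarrow> continuous_on S (\<lambda>x. discriminant (f x))"
  unfolding discriminant_def det_def trace_def by (simp, intro continuous_intros)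

text \<open>
  Along the line the discriminant is a polynomial in \<open>t\<close>. It does not vanish identically: for large \<open>t\<close>, after rescaling, the
  matrix is close to the diagonal direction, which has distinct eigenvalues.
\<close>

lemma finite_discriminant_zeros_line:
  fixes A :: "('n::{finite,linorder}) cmatrix"
  assumes A: "hermitian A"
  shows "finite {t::real. discriminant (A + t *\<^sub>R diag_matrix (\<chi> k. real (index_rank k))) = 0}"
proof -
  let ?D = "diag_matrix (\<chi> k::'n. real (index_rank k))"
  have D0: "discriminant ?D \<noteq> 0"
  proof -
    have "vandermonde (\<chi> k::'n. real (index_rank k)) \<noteq> 0"
      unfolding vandermonde_def using index_rank_less by (force simp: case_prod_unfold)
    then show ?thesis using discriminant_eq[OF hermitian_diag_matrix eigenvalues_diag_matrix, of "\<chi> k::'n. real (index_rank k)"] by simp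
  qed
  obtain p where p: "\<And>t::real. discriminant (A + t *\<^sub>R ?D) = poly p (of_real t)"
    using real_polynomial_discriminant_line[of A ?D] unfolding real_polynomial_def by blast
  have "p \<noteq> 0"
  proof
    assume "p = 0"
    have z: "discriminant (?D + s *\<^sub>R A) = 0" if "s \<noteq> 0" for s :: real
    proof -
      have "discriminant (A + (1 / s) *\<^sub>R ?D) = 0" using p \<open>p = 0\<close> by simp
      then have "discriminant (s *\<^sub>R (A + (1 / s) *\<^sub>R ?D)) = 0"
        by (intro discriminant_scaleR_eq_0 hermitian_add hermitian_scaleR A hermitian_diag_matrix)
      then show ?thesis using that by (simp add: scaleR_add_right add.commute)
    qed
    have "continuous_on UNIV (\<lambda>s::real. discriminant (?D + s *\<^sub>R A))"
      by (intro continuous_on_discriminant continuous_intros)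
    then have "((\<lambda>s::real. discriminant (?D + s *\<^sub>R A)) \<longlongrightarrow> discriminant (?D + 0 *\<^sub>R A)) (at 0)"
      unfolding continuous_on_def by blast
    moreover have "((\<lambda>s::real. discriminant (?D + s *\<^sub>R A)) \<longlongrightarrow> 0) (at 0)"
      by (rule tendsto_eventually) (auto simp: eventually_at_filter z)
    ultimately have "discriminant (?D + 0 *\<^sub>R A) = 0" using tendsto_unique[OF trivial_limit_at] by blast
    then show False using D0 by simp
  qed
  then have "finite {z. poly p z = 0}" by (rule poly_roots_finite)
  then have "finite (complex_of_real -` {z. poly p z = 0})" by (rule finite_vimageI) (auto simp: inj_on_def)
  then show ?thesis by (rule finite_subset[rotated]) (auto simp: p)
qed

section \<open>Coordinates of Hermitian matrices\<close>

definition herm_coords :: "('n::{finite,linorder}) cmatrix \<Rightarrow> 'n rmatrix" where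
  "herm_coords Z = (\<chi> j k. if j \<le> k then Re (Z $ j $ k) else Im (Z $ k $ j))"

lemma herm_coords_herm_of_coords [simp]: "herm_coords (herm_of_coords A) = A"
  by (auto simp: herm_coords_def herm_of_coords_def vec_eq_iff)

lemma hermitian_herm_of_coords [simp]: "hermitian (herm_of_coords A)"
  using bij_betw_herm_of_coords by (auto simp: bij_betw_def)

lemma herm_of_coords_herm_coords:
  assumes "hermitian Z"
  shows "herm_of_coords (herm_coords Z) = Z"
proof -
  obtain A where "Z = herm_of_coords A"
    using bij_betw_herm_of_coords assms by (auto simp: bij_betw_def)
  then show ?thesis by simp
qed

lemma herm_of_coords_add: "herm_of_coords (A + B) = herm_of_coords A + herm_of_coords B"
  by (auto simp: herm_of_coords_def vec_eq_iff complex_eq_iff)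

lemma herm_of_coords_scaleR: "herm_of_coords (c *\<^sub>R A) = c *\<^sub>R herm_of_coords A"
  by (auto simp: herm_of_coords_def vec_eq_iff complex_eq_iff)

lemma herm_of_coords_diff: "herm_of_coords (A - B) = herm_of_coords A - herm_of_coords B"
  by (auto simp: herm_of_coords_def vec_eq_iff complex_eq_iff)

lemma continuous_on_herm_coords: "continuous_on UNIV (herm_coords :: ('n::{finite,linorder}) cmatrix \<Rightarrow> _)"
  unfolding herm_coords_def
proof (intro continuous_on_vec_lambda)
  fix j k :: 'n
  show "continuous_on UNIV (\<lambda>Z::'n cmatrix. if j \<le> k then Re (Z $ j $ k) else Im (Z $ k $ j))"
    by (cases "j \<le> k") (auto intro!: continuous_intros)
qed

lemma borel_measurable_diag_matrix [measurable]: "(diag_matrix :: ('n::finite) rvector \<Rightarrow> _) \<in> borel_measurable borel"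
proof (rule borel_measurable_continuous_onI)
  show "continuous_on UNIV (diag_matrix :: 'n rvector \<Rightarrow> 'n cmatrix)"
    unfolding diag_matrix_def
  proof (intro continuous_on_vec_lambda)
    fix j k :: 'n
    show "continuous_on UNIV (\<lambda>x::'n rvector. if j = k then complex_of_real (x $ j) else 0)"
      by (cases "j = k") (auto intro!: continuous_intros)
  qed
qed

lemma borel_measurable_herm_coords [measurable]: "herm_coords \<in> borel_measurable borel"
  by (rule borel_measurable_continuous_onI[OF continuous_on_herm_coords])

lemma borel_measurable_herm_of_coords [measurable]: "herm_of_coords \<in> borel_measurable borel"
  using measurable_herm_of_coords by (simp add: measurable_restrict_space2_iff)

lemma sum_matrix_split:
  fixes g :: "'n::{finite,linorder} \<Rightarrow> 'n \<Rightarrow> 'a::comm_monoid_add"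
  shows "(\<Sum>j\<in>UNIV. \<Sum>k\<in>UNIV. g j k) = (\<Sum>k\<in>UNIV. g k k) + (\<Sum>p\<in>{p. fst p < snd p}. g (fst p) (snd p) + g (snd p) (fst p))"
proof -
  let ?h = "\<lambda>p. g (fst p) (snd p)"
  let ?L = "{p::'n\<times>'n. fst p < snd p}" and ?G = "{p::'n\<times>'n. snd p < fst p}" and ?D = "(\<lambda>i. (i, i)) ` (UNIV::'n set)"
  have "(\<Sum>j\<in>UNIV. \<Sum>k\<in>UNIV. g j k) = (\<Sum>p\<in>UNIV. ?h p)"
    by (simp add: sum.cartesian_product case_prod_unfold)
  also have "(UNIV :: ('n\<times>'n) set) = ?D \<union> (?L \<union> ?G)" by auto
  also have "(\<Sum>p\<in>?D \<union> (?L \<union> ?G). ?h p) = (\<Sum>p\<in>?D. ?h p) + ((\<Sum>p\<in>?L. ?h p) + (\<Sum>p\<in>?G. ?h p))"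
    by (subst sum.union_disjoint, simp, simp, force)+ simp
  also have "(\<Sum>p\<in>?G. ?h p) = (\<Sum>p\<in>?L. g (snd p) (fst p))"
    by (rule sum.reindex_bij_witness[where i=prod.swap and j=prod.swap]) auto
  also have "(\<Sum>p\<in>?D. ?h p) = (\<Sum>k\<in>UNIV. g k k)"
    by (subst sum.reindex) (auto simp: inj_on_def)
  finally show ?thesis by (simp add: sum.distrib)
qed

lemma norm_herm_of_coords_squared:
  "(norm (herm_of_coords A))\<^sup>2 = (\<Sum>j\<in>UNIV. \<Sum>k\<in>UNIV. (if j = k then 1 else 2) * (A $ j $ k)\<^sup>2)"
  unfolding sum_matrix_split norm_hermitian_squared[OF hermitian_herm_of_coords]
  by (simp add: herm_of_coords_def sum_distrib_left cmod_power2) (auto intro!: sum.cong)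

lemma norm_coords_squared: "(norm A)\<^sup>2 = (\<Sum>j\<in>UNIV. \<Sum>k\<in>UNIV. (A $ j $ k)\<^sup>2)" for A :: "real^'n^'m"
  by (simp add: norm_vec_def L2_set_def sum_nonneg)

lemma norm_le_norm_herm_of_coords: "norm A \<le> norm (herm_of_coords A)"
proof (rule power2_le_imp_le)
  show "(norm A)\<^sup>2 \<le> (norm (herm_of_coords A))\<^sup>2"
    unfolding norm_herm_of_coords_squared norm_coords_squared by (intro sum_mono) simp
qed simp

lemma sets_herm_lborel: "sets herm_lborel = sets (restrict_space borel {Z. hermitian Z})"
  by (simp add: herm_lborel_def)

lemma space_herm_lborel [simp]: "space herm_lborel = {Z. hermitian Z}"
  by (simp add: herm_lborel_def space_restrict_space)

lemma measurable_to_herm_lborel: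
  "f \<in> M \<rightarrow>\<^sub>M herm_lborel \<longleftrightarrow> f \<in> M \<rightarrow>\<^sub>M borel \<and> (\<forall>x\<in>space M. hermitian (f x))"
  unfolding measurable_cong_sets[OF refl sets_herm_lborel] measurable_restrict_space2_iff by auto

lemma measurable_from_herm_lborel:
  "f \<in> borel \<rightarrow>\<^sub>M M \<Longrightarrow> f \<in> herm_lborel \<rightarrow>\<^sub>M M"
  unfolding measurable_cong_sets[OF sets_herm_lborel refl] by (rule measurable_restrict_space1)

lemma measurable_herm_of_coords': "herm_of_coords \<in> lborel \<rightarrow>\<^sub>M herm_lborel"
  by (simp add: measurable_to_herm_lborel)

lemma herm_lborel_eq_distr: "herm_lborel = distr lborel herm_lborel herm_of_coords"
  unfolding herm_lborel_def by (rule distr_cong) (simp_all)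

text \<open>
  In coordinates, conjugation is a linear map that preserves the Frobenius norm of the Hermitian matrix.
\<close>

lemma distr_herm_lborel_conjugate:
  fixes U :: "('n::{finite,linorder}) cmatrix"
  assumes U: "unitary U"
  shows "distr herm_lborel herm_lborel (\<lambda>Z. U ** Z ** conj_transpose U) = herm_lborel"
proof -
  define T where "T A = herm_coords (U ** herm_of_coords A ** conj_transpose U)" for A
  have hT: "herm_of_coords (T A) = U ** herm_of_coords A ** conj_transpose U" for A
    unfolding T_def by (intro herm_of_coords_herm_coords hermitian_conjugate) simp
  have inj: "herm_of_coords A = herm_of_coords B \<Longrightarrow> A = B" for A B :: "'n rmatrix"
    by (metis herm_coords_herm_of_coords)
  let ?S = "{A::'n rmatrix. norm (herm_of_coords A) < 1}"
  have cont: "continuous_on UNIV (herm_of_coords :: 'n rmatrix \<Rightarrow> _)"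
    by (intro linear_continuous_on_compose[OF continuous_on_id, unfolded id_def] linearI herm_of_coords_add herm_of_coords_scaleR)
  have S_open: "open ?S" by (intro open_Collect_less continuous_intros cont)
  have distrT: "distr lborel borel T = lborel"
  proof (rule distr_lborel_linear[where S="?S"])
    show "linear T"
    proof (rule linearI)
      show "T (A + B) = T A + T B" for A B
        by (rule inj) (simp add: hT herm_of_coords_add matrix_mult_add_left matrix_mult_add_right)
      show "T (c *\<^sub>R A) = c *\<^sub>R T A" for c A
        by (rule inj) (simp add: hT herm_of_coords_scaleR matrix_mult_scaleR_left matrix_mult_scaleR_right)
    qed
    define T' where "T' A = herm_coords (conj_transpose U ** herm_of_coords A ** U)" for A
    have hT': "herm_of_coords (T' A) = conj_transpose U ** herm_of_coords A ** U" for A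
      unfolding T'_def using hermitian_conjugate[of "herm_of_coords A" "conj_transpose U"]
      by (intro herm_of_coords_herm_coords) simp
    show "bij T"
    proof (rule o_bij[of T'])
      show "T' \<circ> T = id"
      proof
        fix A
        have "conj_transpose U ** (U ** herm_of_coords A ** conj_transpose U) ** U = herm_of_coords A"
          by (simp only: matrix_mul_assoc[symmetric] unitary_cancel(1)[OF U]) (simp only: matrix_mul_assoc unitary_cancel(4)[OF U])
        then show "(T' \<circ> T) A = id A" by (intro inj) (simp add: hT hT')
      qed
      show "T \<circ> T' = id"
      proof
        fix A
        have "U ** (conj_transpose U ** herm_of_coords A ** U) ** conj_transpose U = herm_of_coords A"
          by (simp only: matrix_mul_assoc[symmetric] unitary_cancel(2)[OF U]) (simp only: matrix_mul_assoc unitary_cancel(3)[OF U])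
        then show "(T \<circ> T') A = id A" by (intro inj) (simp add: hT hT')
      qed
    qed
    show "?S \<in> sets borel" using S_open by simp
    have "0 \<in> ?S" using herm_of_coords_scaleR[of 0 "0::'n rmatrix"] by simp
    then obtain e where e: "e > 0" "ball 0 e \<subseteq> ?S" using S_open open_contains_ball by blast
    have "0 < measure lborel (ball (0::'n rmatrix) e)" using e by (simp add: content_ball_pos)
    then have "0 < emeasure lborel (ball (0::'n rmatrix) e)" by (auto simp: measure_def zero_less_iff_neq_zero)
    also have "\<dots> \<le> emeasure lborel ?S" using e S_open by (intro emeasure_mono) auto
    finally show "emeasure lborel ?S \<noteq> 0" by simp
    have "emeasure lborel ?S \<le> emeasure lborel (cball (0::'n rmatrix) 1)"
    proof (rule emeasure_mono)
      show "?S \<subseteq> cball 0 1"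
      proof
        fix A assume "A \<in> ?S"
        then show "A \<in> cball 0 1" using norm_le_norm_herm_of_coords[of A] by simp
      qed
    qed simp
    also have "\<dots> < \<infinity>" by (rule emeasure_lborel_cball_finite)
    finally show "emeasure lborel ?S \<noteq> \<infinity>" by simp
    show "T A \<in> ?S \<longleftrightarrow> A \<in> ?S" for A by (simp add: hT norm_conjugate[OF U])
  qed
  have cm: "(\<lambda>Z. U ** Z ** conj_transpose U) \<in> herm_lborel \<rightarrow>\<^sub>M (herm_lborel :: 'n cmatrix measure)"
    unfolding measurable_to_herm_lborel
    by (auto intro!: measurable_from_herm_lborel hermitian_conjugate)
  have Tm: "T \<in> lborel \<rightarrow>\<^sub>M borel" unfolding T_def by simp
  have "distr herm_lborel herm_lborel (\<lambda>Z. U ** Z ** conj_transpose U)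
      = distr lborel herm_lborel (\<lambda>A. herm_of_coords (T A))"
    by (subst herm_lborel_eq_distr, subst distr_distr[OF cm measurable_herm_of_coords']) (simp add: comp_def hT)
  also have "\<dots> = distr (distr lborel borel T) herm_lborel herm_of_coords"
    using measurable_herm_of_coords' Tm by (subst distr_distr) (auto simp: comp_def)
  also have "\<dots> = herm_lborel" unfolding distrT by (rule herm_lborel_eq_distr[symmetric])
  finally show ?thesis .
qed

lemma AE_herm_lborelI:
  assumes "AE A in lborel. P (herm_of_coords A)"
  shows "AE Z in herm_lborel. P Z"
proof -
  obtain N where N: "N \<in> null_sets lborel" "{A. \<not> P (herm_of_coords A)} \<subseteq> N"
    using assms by (auto elim!: AE_E simp: null_sets_def)
  let ?N = "herm_coords -` N \<inter> {Z. hermitian Z}"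
  have "herm_coords \<in> herm_lborel \<rightarrow>\<^sub>M borel" by (rule measurable_from_herm_lborel) simp
  from measurable_sets[OF this, of N] have m: "?N \<in> sets herm_lborel" using N(1) by (auto simp: null_sets_def)
  then have "emeasure herm_lborel ?N = emeasure lborel (herm_of_coords -` ?N \<inter> space lborel)"
    by (subst herm_lborel_eq_distr, intro emeasure_distr measurable_herm_of_coords')
  also have "herm_of_coords -` ?N \<inter> space lborel = N" by auto
  also have "emeasure lborel N = 0" using N(1) by (simp add: null_sets_def)
  finally have "?N \<in> null_sets herm_lborel" using m by (simp add: null_sets_def)
  moreover have "{Z\<in>space herm_lborel. \<not> P Z} \<subseteq> ?N"
    using N(2) by (auto simp: subset_iff) (metis herm_of_coords_herm_coords)
  ultimately show ?thesis by (rule AE_I')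
qed

section \<open>Almost all Hermitian matrices have distinct eigenvalues\<close>

text \<open>
  Translating \<open>S\<close> by \<open>t b\<close> with \<open>t\<close> uniform in \<open>[0,1]\<close> does not change its measure; by Fubini the result is an integral of the
  lengths of the sections \<open>{t. a + t b \<in> S}\<close>, which are zero.
\<close>

lemma AE_lborel_if_finite_on_lines:
  fixes S :: "'a::euclidean_space set"
  assumes S[measurable]: "S \<in> sets borel" and fin: "\<And>a. finite {t::real. a + t *\<^sub>R b \<in> S}"
  shows "AE x in lborel. x \<notin> S"
proof -
  let ?I = "{0..1::real}"
  have "emeasure lborel S = (\<integral>\<^sup>+t. indicator ?I t * emeasure lborel S \<partial>lborel)"
    by (subst nn_integral_multc) auto
  also have "\<dots> = (\<integral>\<^sup>+t. (\<integral>\<^sup>+a. indicator ?I t * indicator S (a + t *\<^sub>R b) \<partial>lborel) \<partial>lborel)"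
  proof (rule nn_integral_cong)
    fix t :: real
    have "emeasure lborel S = (\<integral>\<^sup>+a. indicator S a \<partial>distr lborel borel ((+) (t *\<^sub>R b)))"
      by (simp add: lborel_distr_plus)
    also have "\<dots> = (\<integral>\<^sup>+a. indicator S (a + t *\<^sub>R b) \<partial>lborel)"
      by (subst nn_integral_distr) (auto simp: add.commute)
    finally show "indicator ?I t * emeasure lborel S = (\<integral>\<^sup>+a. indicator ?I t * indicator S (a + t *\<^sub>R b) \<partial>lborel)"
      by (subst nn_integral_cmult) auto
  qed
  also have "\<dots> = (\<integral>\<^sup>+a. (\<integral>\<^sup>+t. indicator ?I t * indicator S (a + t *\<^sub>R b) \<partial>lborel) \<partial>(lborel :: 'a measure))"
    by (rule lborel_pair.Fubini') measurable
  also have "\<dots> = (\<integral>\<^sup>+a. 0 \<partial>(lborel :: 'a measure))"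
  proof (rule nn_integral_cong)
    fix a :: 'a
    have "{t. a + t *\<^sub>R b \<in> S} \<in> null_sets lborel" by (rule finite_imp_null_set_lborel[OF fin])
    then have "AE t in lborel. t \<notin> {t. a + t *\<^sub>R b \<in> S}" by (rule AE_not_in)
    then have "AE t in lborel. indicator ?I t * indicator S (a + t *\<^sub>R b) = (0::ennreal)"
      by eventually_elim auto
    then show "(\<integral>\<^sup>+t. indicator ?I t * indicator S (a + t *\<^sub>R b) \<partial>lborel) = (0::ennreal)"
      by (subst nn_integral_cong_AE) auto
  qed
  finally have "S \<in> null_sets lborel" by (simp add: null_sets_def)
  then show ?thesis by (rule AE_not_in)
qed

lemma AE_distinct_eigenvalues:
  "AE Z in (herm_lborel :: ('n::{finite,linorder}) cmatrix measure). \<forall>x. eigenvalues Z x \<longrightarrow> vandermonde x \<noteq> 0"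
proof -
  let ?S = "{A::'n rmatrix. discriminant (herm_of_coords A) = 0}"
  let ?D = "diag_matrix (\<chi> k::'n. real (index_rank k))"
  have "AE A in lborel. A \<notin> ?S"
  \<comment> \<open>Lines in the direction of a diagonal matrix with distinct entries.\<close>
  proof (rule AE_lborel_if_finite_on_lines[where b="herm_coords ?D"])
    have cont: "continuous_on UNIV (herm_of_coords :: 'n rmatrix \<Rightarrow> _)"
      by (intro linear_continuous_on_compose[OF continuous_on_id, unfolded id_def] linearI herm_of_coords_add herm_of_coords_scaleR)
    show "?S \<in> sets borel"
      by (intro borel_closed closed_Collect_eq continuous_on_discriminant cont continuous_intros)
    show "finite {t. A + t *\<^sub>R herm_coords ?D \<in> ?S}" for A
      using finite_discriminant_zeros_line[of "herm_of_coords A"]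
      by (simp add: herm_of_coords_add herm_of_coords_scaleR herm_of_coords_herm_coords)
  qed
  then have "AE A in lborel. discriminant (herm_of_coords (A :: 'n rmatrix)) \<noteq> 0" by simp
  then have "AE Z in (herm_lborel :: 'n cmatrix measure). discriminant Z \<noteq> 0" by (rule AE_herm_lborelI)
  moreover have "AE Z in (herm_lborel :: 'n cmatrix measure). hermitian Z" by (rule AE_I2) simp
  ultimately show ?thesis
    by eventually_elim (auto simp: discriminant_eq)
qed

section \<open>The heat kernel on Hermitian matrices\<close>

text \<open>
  The factor that normalizes \<open>exp (- \<bar>Z\<bar>\<^sup>2 / (4 \<epsilon>))\<close> with respect to \<open>herm_lborel\<close>. In the squared Frobenius norm each of the
  \<open>n (n - 1)\<close> off-diagonal coordinates counts twice, whence the two kinds of factors.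
\<close>

definition heat_norm :: "'n::{finite,linorder} itself \<Rightarrow> real \<Rightarrow> real" where
  "heat_norm T \<epsilon> = 1 / ((2 * pi * \<epsilon>) ^ card {p::'n\<times>'n. fst p < snd p} * sqrt (4 * pi * \<epsilon>) ^ CARD('n))"

lemma nn_integral_exp_neg_square:
  assumes "0 < a"
  shows "(\<integral>\<^sup>+u. ennreal (exp (- a * u\<^sup>2)) \<partial>lborel) = ennreal (sqrt (pi / a))"
proof -
  have "(\<integral>u. complex_of_real (exp (- a * u\<^sup>2)) \<partial>lborel) = of_real (sqrt (pi / a))"
    using gaussian_char[OF assms, of 0] by simp
  then have "(\<integral>u. exp (- a * u\<^sup>2) \<partial>lborel) = sqrt (pi / a)"
    by (simp only: integral_complex_of_real of_real_eq_iff)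
  then show ?thesis
    using nn_integral_eq_integral[OF integrable_exp_neg_square[OF assms]] by simp
qed

lemma
  assumes \<epsilon>: "0 < \<epsilon>"
  shows integrable_heat_kernel: "integrable lborel (\<lambda>A::('n::{finite,linorder}) rmatrix. exp (- (norm (herm_of_coords A))\<^sup>2 / (4 * \<epsilon>)))"
    and integral_heat_kernel: "heat_norm TYPE('n) \<epsilon> * (\<integral>A. exp (- (norm (herm_of_coords (A :: 'n rmatrix)))\<^sup>2 / (4 * \<epsilon>)) \<partial>lborel) = 1"
proof -
  let ?N = "card {p::'n\<times>'n. fst p < snd p}"
  let ?f = "\<lambda>A::'n rmatrix. exp (- (norm (herm_of_coords A))\<^sup>2 / (4 * \<epsilon>))"
  define w where "w j k = (if j = k then 1 else 2 :: real)" for j k :: 'n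
  let ?e = "\<lambda>p. axis (fst p) (axis (snd p) (1::real)) :: 'n rmatrix"
  have inj: "inj ?e" by (auto simp: inj_def axis_eq_axis prod_eq_iff)
  have B: "(Basis :: 'n rmatrix set) = range ?e" by (force simp: Basis_vec_def image_iff)
  define v where "v b = (case inv ?e b of (j, k) \<Rightarrow> w j k)" for b
  have v: "v (?e p) = w (fst p) (snd p)" for p by (simp add: v_def inv_f_f[OF inj] case_prod_unfold)
  have nth: "A \<bullet> ?e p = A $ fst p $ snd p" for A :: "'n rmatrix" and p by (simp add: inner_axis)
  have pos: "0 < v b" for b by (simp add: v_def w_def split: prod.splits)
  have f: "ennreal (?f A) = (\<Prod>b\<in>Basis. ennreal (exp (- (v b / (4 * \<epsilon>)) * (A \<bullet> b)\<^sup>2)))" for A :: "'n rmatrix"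
  proof -
    have "(\<Prod>b\<in>Basis. ennreal (exp (- (v b / (4 * \<epsilon>)) * (A \<bullet> b)\<^sup>2)))
        = (\<Prod>p\<in>UNIV. ennreal (exp (- (w (fst p) (snd p) / (4 * \<epsilon>)) * (A $ fst p $ snd p)\<^sup>2)))"
      unfolding B by (subst prod.reindex[OF inj]) (simp only: comp_def v nth)
    also have "\<dots> = ennreal (exp (\<Sum>p\<in>UNIV. - (w (fst p) (snd p) / (4 * \<epsilon>)) * (A $ fst p $ snd p)\<^sup>2))"
      by (simp add: prod_ennreal exp_sum)
    also have "(\<Sum>p\<in>UNIV. - (w (fst p) (snd p) / (4 * \<epsilon>)) * (A $ fst p $ snd p)\<^sup>2) = - (norm (herm_of_coords A))\<^sup>2 / (4 * \<epsilon>)"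
      unfolding norm_herm_of_coords_squared
      by (simp add: sum.cartesian_product case_prod_unfold w_def sum_divide_distrib sum_negf)
    finally show ?thesis by simp
  qed
  have "(\<integral>\<^sup>+A. ennreal (?f A) \<partial>lborel) = (\<Prod>b\<in>(Basis :: 'n rmatrix set). \<integral>\<^sup>+u. ennreal (exp (- (v b / (4 * \<epsilon>)) * u\<^sup>2)) \<partial>lborel)"
    unfolding f by (rule nn_integral_lborel_prod) auto
  also have "\<dots> = (\<Prod>b\<in>(Basis :: 'n rmatrix set). ennreal (sqrt (pi / (v b / (4 * \<epsilon>)))))"
    using pos \<epsilon> by (intro prod.cong refl nn_integral_exp_neg_square) auto
  also have "\<dots> = (\<Prod>p\<in>(UNIV :: ('n\<times>'n) set). ennreal (sqrt (pi / (w (fst p) (snd p) / (4 * \<epsilon>)))))"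
    unfolding B by (subst prod.reindex[OF inj]) (simp only: comp_def v)
  also have "\<dots> = ennreal (\<Prod>p\<in>(UNIV :: ('n\<times>'n) set). sqrt (pi / (w (fst p) (snd p) / (4 * \<epsilon>))))"
    using \<epsilon> by (intro prod_ennreal) (auto simp: w_def)
  also have "(\<Prod>p\<in>(UNIV :: ('n\<times>'n) set). sqrt (pi / (w (fst p) (snd p) / (4 * \<epsilon>)))) = sqrt (4 * pi * \<epsilon>) ^ CARD('n) * (2 * pi * \<epsilon>) ^ ?N"
  proof -
    let ?g = "\<lambda>p::'n\<times>'n. sqrt (pi / (w (fst p) (snd p) / (4 * \<epsilon>)))"
    let ?L = "{p::'n\<times>'n. fst p < snd p}" and ?G = "{p::'n\<times>'n. snd p < fst p}" and ?D = "(\<lambda>i. (i, i)) ` (UNIV::'n set)"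
    have u: "(UNIV :: ('n\<times>'n) set) = ?D \<union> (?L \<union> ?G)" by auto
    have "(\<Prod>p\<in>UNIV. ?g p) = (\<Prod>p\<in>?D. ?g p) * ((\<Prod>p\<in>?L. ?g p) * (\<Prod>p\<in>?G. ?g p))"
      unfolding u by (subst prod.union_disjoint, simp, simp, force)+ simp
    also have "(\<Prod>p\<in>?G. ?g p) = (\<Prod>p\<in>?L. ?g p)"
      by (rule prod.reindex_bij_witness[where i=prod.swap and j=prod.swap]) (auto simp: w_def)
    also have "(\<Prod>p\<in>?D. ?g p) = sqrt (4 * pi * \<epsilon>) ^ CARD('n)"
      by (subst prod.reindex) (auto simp: inj_on_def w_def mult_ac)
    also have "(\<Prod>p\<in>?L. ?g p) = (\<Prod>p\<in>?L. sqrt (2 * pi * \<epsilon>))"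
      by (rule prod.cong) (auto simp: w_def mult_ac)
    finally show ?thesis using \<epsilon> by (simp flip: power_mult_distrib)
  qed
  finally have nn: "(\<integral>\<^sup>+A. ennreal (?f A) \<partial>lborel) = ennreal (sqrt (4 * pi * \<epsilon>) ^ CARD('n) * (2 * pi * \<epsilon>) ^ ?N)" .
  show int: "integrable lborel ?f"
  proof (rule integrableI_nonneg)
    show "(\<integral>\<^sup>+A. ennreal (?f A) \<partial>lborel) < \<infinity>" unfolding nn by simp
  qed auto
  have "ennreal (\<integral>A. ?f A \<partial>lborel) = ennreal (sqrt (4 * pi * \<epsilon>) ^ CARD('n) * (2 * pi * \<epsilon>) ^ ?N)"
    using nn_integral_eq_integral[OF int] nn by simp
  then have "(\<integral>A. ?f A \<partial>lborel) = sqrt (4 * pi * \<epsilon>) ^ CARD('n) * (2 * pi * \<epsilon>) ^ ?N"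
    using \<epsilon> by (subst (asm) ennreal_inj) (auto intro!: Bochner_Integration.integral_nonneg)
  then show "heat_norm TYPE('n) \<epsilon> * (\<integral>A. ?f A \<partial>lborel) = 1"
    using \<epsilon> by (simp add: heat_norm_def)
qed

lemma heat_norm_scaling:
  assumes "0 < \<epsilon>"
  shows "heat_norm TYPE('n::{finite,linorder}) \<epsilon> = heat_norm TYPE('n) 1 / sqrt \<epsilon> ^ DIM('n rmatrix)"
proof -
  let ?N = "card {p::'n\<times>'n. fst p < snd p}"
  have "even (CARD('n) * (CARD('n) - 1))" by (cases "CARD('n)") auto
  then have "2 * ?N = CARD('n) * (CARD('n) - 1)" by (simp add: card_index_pairs)
  then have "DIM('n rmatrix) = 2 * ?N + CARD('n)" by (simp add: diff_mult_distrib2)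
  then have "sqrt \<epsilon> ^ DIM('n rmatrix) = \<epsilon> ^ ?N * sqrt \<epsilon> ^ CARD('n)"
    using assms by (simp add: power_add power_mult)
  then show ?thesis by (simp add: heat_norm_def real_sqrt_mult power_mult_distrib mult_ac)
qed

text \<open>
  The heat kernel in coordinates is dominated by the rotation invariant Gaussian of the coordinates, for which the preceding results on
  Lebesgue points apply.
\<close>

lemma heat_kernel_tendsto_at_lebesgue_point:
  fixes F :: "('n::{finite,linorder}) rmatrix \<Rightarrow> real"
  assumes F: "integrable lborel F"
    and leb: "((\<lambda>r. (\<integral>y. indicator (cball A r) y * \<bar>F y - F A\<bar> \<partial>lborel) / r ^ DIM('n rmatrix)) \<longlongrightarrow> 0) (at_right 0)"
  shows "((\<lambda>\<epsilon>. heat_norm TYPE('n) \<epsilon> * (\<integral>y. F y * exp (- (norm (herm_of_coords (y - A)))\<^sup>2 / (4 * \<epsilon>)) \<partial>lborel)) \<longlongrightarrow> F A) (at_right 0)"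
proof -
  have [measurable]: "F \<in> borel_measurable borel" using F by auto
  let ?k = "\<lambda>\<epsilon> y. exp (- (norm (herm_of_coords (y - A)))\<^sup>2 / (4 * \<epsilon>))"
  let ?H = "\<lambda>h. (\<integral>y. \<bar>F y - F A\<bar> * exp (- (1 / 4) * (norm (y - A) / h)\<^sup>2) \<partial>lborel) / h ^ DIM('n rmatrix)"
  have "filterlim sqrt (at_right 0) (at_right (0::real))" by real_asymp
  from filterlim_compose[OF gaussian_mean_at_lebesgue_point[OF F _ leb, of "1 / 4"] this]
  have lim: "((\<lambda>\<epsilon>. heat_norm TYPE('n) 1 * ?H (sqrt \<epsilon>)) \<longlongrightarrow> 0) (at_right 0)"
    by (intro tendsto_mult_right_zero) simp
  have ev: "\<forall>\<^sub>F \<epsilon> in at_right 0. norm (heat_norm TYPE('n) \<epsilon> * (\<integral>y. F y * ?k \<epsilon> y \<partial>lborel) - F A) \<le> heat_norm TYPE('n) 1 * ?H (sqrt \<epsilon>)"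
    using eventually_at_right_less[of 0]
  proof eventually_elim
    case (elim \<epsilon>)
    have pos: "0 < heat_norm TYPE('n) \<epsilon>" using elim by (simp add: heat_norm_def)
    have kint: "integrable lborel (?k \<epsilon>)"
    proof -
      have "integrable (distr lborel borel ((+) (- A))) (\<lambda>y::'n rmatrix. exp (- (norm (herm_of_coords y))\<^sup>2 / (4 * \<epsilon>)))"
        unfolding lborel_distr_plus by (rule integrable_heat_kernel[OF elim])
      then show ?thesis by (subst (asm) integrable_distr_eq) auto
    qed
    have kI: "heat_norm TYPE('n) \<epsilon> * (\<integral>y. ?k \<epsilon> y \<partial>lborel) = 1"
    proof -
      have "(\<integral>y. exp (- (norm (herm_of_coords (y::'n rmatrix)))\<^sup>2 / (4 * \<epsilon>)) \<partial>distr lborel borel ((+) (- A))) = (\<integral>y. ?k \<epsilon> y \<partial>lborel)"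
        by (subst integral_distr) auto
      then show ?thesis using integral_heat_kernel[OF elim, where 'n='n] by (simp add: lborel_distr_plus)
    qed
    have k1: "?k \<epsilon> y \<le> 1" for y using elim by simp
    have Fk: "integrable lborel (\<lambda>y. F y * ?k \<epsilon> y)"
      by (rule Bochner_Integration.integrable_bound[OF F]) (use k1 in \<open>auto simp: abs_mult intro!: mult_left_le\<close>)
    have dint: "integrable lborel (\<lambda>y. (F y - F A) * ?k \<epsilon> y)"
      using Bochner_Integration.integrable_diff[OF Fk integrable_mult_right[OF kint, of "F A"]] by (simp add: left_diff_distrib)
    have gint: "integrable lborel (\<lambda>y. \<bar>F y - F A\<bar> * exp (- (1 / 4) * (norm (y - A) / sqrt \<epsilon>)\<^sup>2))"
    proof (rule Bochner_Integration.integrable_bound)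
      have "integrable (distr lborel borel ((+) (- A))) (\<lambda>y::'n rmatrix. exp (- (1 / (4 * \<epsilon>)) * (norm y)\<^sup>2))"
        unfolding lborel_distr_plus using elim by (intro integrable_gaussian) simp
      then have "integrable lborel (\<lambda>y. exp (- (1 / (4 * \<epsilon>)) * (norm (- A + y))\<^sup>2))"
        by (subst (asm) integrable_distr_eq) auto
      then show "integrable lborel (\<lambda>y. \<bar>F y\<bar> + \<bar>F A\<bar> * exp (- (1 / (4 * \<epsilon>)) * (norm (- A + y))\<^sup>2))"
        using F by auto
      show "AE y in lborel. norm (\<bar>F y - F A\<bar> * exp (- (1 / 4) * (norm (y - A) / sqrt \<epsilon>)\<^sup>2))
          \<le> norm (\<bar>F y\<bar> + \<bar>F A\<bar> * exp (- (1 / (4 * \<epsilon>)) * (norm (- A + y))\<^sup>2))"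
      proof (rule AE_I2)
        fix y
        let ?x = "exp (- (1 / 4) * (norm (y - A) / sqrt \<epsilon>)\<^sup>2)"
        have x: "?x = exp (- (1 / (4 * \<epsilon>)) * (norm (- A + y))\<^sup>2)" using elim by (simp add: power_divide)
        have "?x \<le> 1" by simp
        have "\<bar>F y - F A\<bar> * ?x \<le> (\<bar>F y\<bar> + \<bar>F A\<bar>) * ?x" by (intro mult_right_mono) auto
        also have "\<dots> \<le> \<bar>F y\<bar> + \<bar>F A\<bar> * ?x" using \<open>?x \<le> 1\<close> by (simp add: distrib_right mult_left_le)
        finally show "norm (\<bar>F y - F A\<bar> * ?x) \<le> norm (\<bar>F y\<bar> + \<bar>F A\<bar> * exp (- (1 / (4 * \<epsilon>)) * (norm (- A + y))\<^sup>2))"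
          unfolding x by simp
      qed
    qed measurable
    have "heat_norm TYPE('n) \<epsilon> * (\<integral>y. F y * ?k \<epsilon> y \<partial>lborel) - F A
        = heat_norm TYPE('n) \<epsilon> * (\<integral>y. F y * ?k \<epsilon> y \<partial>lborel) - F A * (heat_norm TYPE('n) \<epsilon> * (\<integral>y. ?k \<epsilon> y \<partial>lborel))"
      by (simp only: kI mult_1_right)
    also have "\<dots> = heat_norm TYPE('n) \<epsilon> * ((\<integral>y. F y * ?k \<epsilon> y \<partial>lborel) - (\<integral>y. F A * ?k \<epsilon> y \<partial>lborel))"
      by (simp add: algebra_simps)
    also have "(\<integral>y. F y * ?k \<epsilon> y \<partial>lborel) - (\<integral>y. F A * ?k \<epsilon> y \<partial>lborel) = (\<integral>y. (F y - F A) * ?k \<epsilon> y \<partial>lborel)"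
      using Fk kint by (subst Bochner_Integration.integral_diff[symmetric]) (auto simp: left_diff_distrib)
    finally have "norm (heat_norm TYPE('n) \<epsilon> * (\<integral>y. F y * ?k \<epsilon> y \<partial>lborel) - F A)
        = heat_norm TYPE('n) \<epsilon> * norm (\<integral>y. (F y - F A) * ?k \<epsilon> y \<partial>lborel)"
      using pos by (simp add: abs_mult)
    also have "\<dots> \<le> heat_norm TYPE('n) \<epsilon> * (\<integral>y. \<bar>F y - F A\<bar> * exp (- (1 / 4) * (norm (y - A) / sqrt \<epsilon>)\<^sup>2) \<partial>lborel)"
    proof (intro mult_left_mono Bochner_Integration.integral_norm_bound_integral dint gint)
      fix y
      have "(norm (y - A))\<^sup>2 \<le> (norm (herm_of_coords (y - A)))\<^sup>2"
        by (intro power_mono norm_le_norm_herm_of_coords) simp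
      then have "?k \<epsilon> y \<le> exp (- (1 / 4) * (norm (y - A) / sqrt \<epsilon>)\<^sup>2)"
        using elim by (simp add: power_divide divide_right_mono)
      then show "norm ((F y - F A) * ?k \<epsilon> y) \<le> \<bar>F y - F A\<bar> * exp (- (1 / 4) * (norm (y - A) / sqrt \<epsilon>)\<^sup>2)"
        by (simp add: abs_mult mult_left_mono)
    qed (use pos in auto)
    also have "\<dots> = heat_norm TYPE('n) 1 * ?H (sqrt \<epsilon>)"
      unfolding heat_norm_scaling[OF elim] by simp
    finally show ?case .
  qed
  show ?thesis
    by (rule LIM_zero_cancel, rule Lim_null_comparison[OF ev lim])
qed

section \<open>Spherical functions as characters of the orbit diagonal\<close>

text \<open>
  For Hermitian \<open>Z\<close> this is the spherical function \<open>\<phi>\<^sub>s(-Z)\<close>; the trace has been written out as a sum over the diagonal of the orbit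
  point.
\<close>

definition spherical_neg :: "('n::{finite,linorder}) rvector \<Rightarrow> 'n cmatrix \<Rightarrow> complex" where
  "spherical_neg s Z = (\<integral>U. orbit_exp (\<lambda>k. - \<i> * of_real (s $ k)) Z U \<partial>haar)"

lemma norm_orbit_exp_imaginary [simp]: "cmod (orbit_exp (\<lambda>k. - \<i> * of_real (s $ k)) Z U) = 1"
  by (simp add: orbit_exp_def norm_exp_eq_Re)

lemma norm_orbit_exp_imaginary' [simp]: "cmod (orbit_exp (\<lambda>k. - (\<i> * of_real (s $ k))) Z U) = 1"
  using norm_orbit_exp_imaginary[of s Z U] by (simp only: mult_minus_left)

lemma trace_diag_matrix_mult: "trace (diag_matrix s ** W) = (\<Sum>k\<in>UNIV. of_real (s $ k) * W $ k $ k)"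
proof -
  have "(\<Sum>l\<in>UNIV. diag_matrix s $ a $ l * W $ l $ a) = (\<Sum>l\<in>{a}. diag_matrix s $ a $ l * W $ l $ a)" for a
    by (rule sum.mono_neutral_right) (auto simp: diag_matrix_def)
  then show ?thesis by (simp add: trace_def matrix_matrix_mult_def diag_matrix_def)
qed

lemma spherical_function_uminus:
  fixes Z :: "('n::{finite,linorder}) cmatrix"
  assumes Z: "hermitian Z"
  shows "spherical_function s (- Z) = spherical_neg s Z"
proof -
  have "\<i> * trace (diag_matrix s ** U ** - Z ** conj_transpose U) = (\<Sum>l\<in>UNIV. - \<i> * of_real (s $ l) * of_real (orbit_diag Z U l))" for U
  proof -
    have "diag_matrix s ** U ** - Z ** conj_transpose U = - (diag_matrix s ** (U ** Z ** conj_transpose U))"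
      by (simp add: matrix_mult_minus_left matrix_mult_minus_right matrix_mul_assoc)
    then have "\<i> * trace (diag_matrix s ** U ** - Z ** conj_transpose U) = - \<i> * trace (diag_matrix s ** (U ** Z ** conj_transpose U))"
      by (simp add: trace_def sum_negf)
    also have "\<dots> = (\<Sum>l\<in>UNIV. - \<i> * of_real (s $ l) * orbit_entry Z U l l)"
      unfolding trace_diag_matrix_mult orbit_entry_def by (simp add: sum_distrib_left mult.assoc sum_negf)
    finally show ?thesis by (simp add: orbit_entry_diag[OF Z])
  qed
  then show ?thesis by (simp add: spherical_function_def spherical_neg_def orbit_exp_def)
qed

lemma borel_measurable_rvector_nth [measurable (raw)]:
  fixes f :: "'a \<Rightarrow> real^'n"
  assumes "f \<in> borel_measurable M"
  shows "(\<lambda>x. f x $ k) \<in> borel_measurable M"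
  by (rule borel_measurable_continuous_on[OF _ assms]) (intro continuous_intros)

lemma borel_measurable_spherical_neg [measurable (raw)]:
  fixes f :: "'a \<Rightarrow> ('n::{finite,linorder}) rvector" and g :: "'a \<Rightarrow> 'n cmatrix"
  assumes [measurable]: "f \<in> borel_measurable M" "g \<in> borel_measurable M"
  shows "(\<lambda>x. spherical_neg (f x) (g x)) \<in> borel_measurable M"
proof -
  interpret prob_space "haar :: 'n cmatrix measure" by (rule prob_space_haar)
  have [measurable]: "snd \<in> M \<Otimes>\<^sub>M haar \<rightarrow>\<^sub>M (borel :: 'n cmatrix measure)"
    by (rule measurable_compose[OF measurable_snd measurable_haar_id])
  have "(\<lambda>(x, U). orbit_exp (\<lambda>k. - \<i> * of_real (f x $ k)) (g x) U) \<in> borel_measurable (M \<Otimes>\<^sub>M haar)"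
    unfolding case_prod_unfold by measurable
  then show ?thesis unfolding spherical_neg_def by (rule borel_measurable_lebesgue_integral)
qed

lemma norm_spherical_neg_le: "cmod (spherical_neg s Z) \<le> 1"
proof -
  interpret prob_space "haar :: ('n::{finite,linorder}) cmatrix measure" by (rule prob_space_haar)
  have "cmod (spherical_neg s Z) \<le> (\<integral>U. cmod (orbit_exp (\<lambda>k. - \<i> * of_real (s $ k)) Z U) \<partial>haar)"
    unfolding spherical_neg_def by (rule integral_norm_bound)
  then show ?thesis by (simp add: prob_space)
qed

section \<open>Unitarily invariant laws and the product formula\<close>

definition invariant_law :: "('n::{finite,linorder}) cmatrix measure \<Rightarrow> bool" where
  "invariant_law \<mu> \<longleftrightarrow> prob_space \<mu> \<and> sets \<mu> = sets herm_lborel \<and>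
     (\<forall>U. unitary U \<longrightarrow> distr \<mu> herm_lborel (\<lambda>Z. U ** Z ** conj_transpose U) = \<mu>)"

lemma measurable_conjugate_herm:
  fixes U :: "('n::{finite,linorder}) cmatrix"
  shows "(\<lambda>Z. U ** Z ** conj_transpose U) \<in> herm_lborel \<rightarrow>\<^sub>M (herm_lborel :: 'n cmatrix measure)"
  unfolding measurable_to_herm_lborel
  by (auto intro!: measurable_from_herm_lborel hermitian_conjugate borel_measurable_matrix_mult)

lemma invariant_lawD:
  assumes "invariant_law \<mu>"
  shows "prob_space \<mu>" "sets \<mu> = sets herm_lborel" "space \<mu> = {Z. hermitian Z}"
  using assms sets_eq_imp_space_eq[of \<mu> herm_lborel] by (auto simp: invariant_law_def)

lemma borel_measurable_invariant_law:
  "invariant_law \<mu> \<Longrightarrow> f \<in> borel \<rightarrow>\<^sub>M N \<Longrightarrow> f \<in> \<mu> \<rightarrow>\<^sub>M N"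
  using measurable_cong_sets[OF invariant_lawD(2) refl, of \<mu> N] measurable_from_herm_lborel by blast

lemma integral_invariant_law:
  fixes g :: "('n::{finite,linorder}) cmatrix \<Rightarrow> 'b::{banach,second_countable_topology}"
  assumes \<mu>: "invariant_law \<mu>" and U: "unitary U" and g: "g \<in> borel_measurable borel"
  shows "(\<integral>Z. g (U ** Z ** conj_transpose U) \<partial>\<mu>) = (\<integral>Z. g Z \<partial>\<mu>)"
proof -
  have m: "(\<lambda>Z. U ** Z ** conj_transpose U) \<in> \<mu> \<rightarrow>\<^sub>M herm_lborel"
    using measurable_conjugate_herm measurable_cong_sets[OF invariant_lawD(2)[OF \<mu>] refl, of herm_lborel] by blast
  have "(\<integral>Z. g Z \<partial>\<mu>) = (\<integral>Z. g Z \<partial>distr \<mu> herm_lborel (\<lambda>Z. U ** Z ** conj_transpose U))"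
    using \<mu> U by (simp add: invariant_law_def)
  also have "\<dots> = (\<integral>Z. g (U ** Z ** conj_transpose U) \<partial>\<mu>)"
    by (rule integral_distr[OF m measurable_from_herm_lborel[OF g]])
  finally show ?thesis by simp
qed

lemma invariant_law_density:
  fixes f :: "('n::{finite,linorder}) cmatrix \<Rightarrow> real"
  assumes f: "unitarily_invariant f" and m: "(\<lambda>Z. ennreal (f Z)) \<in> borel_measurable herm_lborel"
    and p: "prob_space (density herm_lborel (\<lambda>Z. ennreal (f Z)))"
  shows "invariant_law (density herm_lborel (\<lambda>Z. ennreal (f Z)))"
  unfolding invariant_law_def
proof (intro conjI allI impI p)
  fix U :: "'n cmatrix" assume U: "unitary U"
  let ?c = "\<lambda>Z. U ** Z ** conj_transpose U" and ?N = "herm_lborel :: 'n cmatrix measure"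
  let ?\<mu> = "density ?N (\<lambda>Z. ennreal (f Z))"
  note c = measurable_conjugate_herm[of U]
  show "distr ?\<mu> ?N ?c = ?\<mu>"
  proof (rule measure_eqI)
    fix A assume "A \<in> sets (distr ?\<mu> ?N ?c)"
    then have A: "A \<in> sets ?N" by simp
    have cA: "?c -` A \<inter> space ?N \<in> sets ?N" by (rule measurable_sets[OF c A])
    have "emeasure (distr ?\<mu> ?N ?c) A = emeasure ?\<mu> (?c -` A \<inter> space ?N)"
      using c A by (subst emeasure_distr) auto
    also have "\<dots> = (\<integral>\<^sup>+Z. ennreal (f Z) * indicator (?c -` A \<inter> space ?N) Z \<partial>?N)"
      by (rule emeasure_density[OF m cA])
    also have "\<dots> = (\<integral>\<^sup>+Z. ennreal (f (?c Z)) * indicator A (?c Z) \<partial>?N)"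
      using f U by (intro nn_integral_cong) (auto simp: unitarily_invariant_def split: split_indicator)
    also have "\<dots> = (\<integral>\<^sup>+Z. ennreal (f Z) * indicator A Z \<partial>distr ?N ?N ?c)"
      using m A by (intro nn_integral_distr[symmetric] c) auto
    also have "\<dots> = emeasure ?\<mu> A"
      unfolding distr_herm_lborel_conjugate[OF U] by (rule emeasure_density[OF m A, symmetric])
    finally show "emeasure (distr ?\<mu> ?N ?c) A = emeasure ?\<mu> A" .
  qed simp
qed simp

lemma measurable_add_herm:
  "(\<lambda>(A, B). A + B) \<in> herm_lborel \<Otimes>\<^sub>M herm_lborel \<rightarrow>\<^sub>M (herm_lborel :: ('n::{finite,linorder}) cmatrix measure)"
proof -
  have [measurable]: "fst \<in> herm_lborel \<Otimes>\<^sub>M herm_lborel \<rightarrow>\<^sub>M (borel :: 'n cmatrix measure)"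
    "snd \<in> herm_lborel \<Otimes>\<^sub>M herm_lborel \<rightarrow>\<^sub>M (borel :: 'n cmatrix measure)"
    by (rule measurable_compose[OF measurable_fst measurable_from_herm_lborel] measurable_compose[OF measurable_snd measurable_from_herm_lborel], simp)+
  show ?thesis
    unfolding measurable_to_herm_lborel case_prod_unfold by (auto simp: space_pair_measure intro: hermitian_add)
qed

lemma invariant_law_add:
  fixes X Y :: "'w \<Rightarrow> ('n::{finite,linorder}) cmatrix"
  assumes M: "prob_space M" and ind: "prob_space.indep_var M herm_lborel X herm_lborel Y"
    and X: "invariant_law (distr M herm_lborel X)" and Y: "invariant_law (distr M herm_lborel Y)"
  shows "invariant_law (distr M herm_lborel (\<lambda>\<omega>. X \<omega> + Y \<omega>))"
proof -
  interpret M: prob_space M by fact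
  let ?N = "herm_lborel :: 'n cmatrix measure"
  let ?\<mu>X = "distr M ?N X" and ?\<mu>Y = "distr M ?N Y"
  have Xm: "X \<in> M \<rightarrow>\<^sub>M ?N" and Ym: "Y \<in> M \<rightarrow>\<^sub>M ?N"
    using M.indep_var_rv1[OF ind] M.indep_var_rv2[OF ind] by auto
  have joint: "?\<mu>X \<Otimes>\<^sub>M ?\<mu>Y = distr M (?N \<Otimes>\<^sub>M ?N) (\<lambda>\<omega>. (X \<omega>, Y \<omega>))"
    using ind unfolding M.indep_var_distribution_eq by simp
  have XYm: "(\<lambda>\<omega>. (X \<omega>, Y \<omega>)) \<in> M \<rightarrow>\<^sub>M ?N \<Otimes>\<^sub>M ?N" using Xm Ym by simp
  have sum: "distr M ?N (\<lambda>\<omega>. X \<omega> + Y \<omega>) = distr (?\<mu>X \<Otimes>\<^sub>M ?\<mu>Y) ?N (\<lambda>(A, B). A + B)"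
    unfolding joint by (subst distr_distr[OF measurable_add_herm XYm]) (simp add: comp_def)
  have addm: "(\<lambda>\<omega>. X \<omega> + Y \<omega>) \<in> M \<rightarrow>\<^sub>M ?N"
    using measurable_compose[OF XYm measurable_add_herm] by simp
  show ?thesis
    unfolding invariant_law_def
  proof (intro conjI allI impI)
    show "prob_space (distr M ?N (\<lambda>\<omega>. X \<omega> + Y \<omega>))" by (rule M.prob_space_distr[OF addm])
    show "sets (distr M ?N (\<lambda>\<omega>. X \<omega> + Y \<omega>)) = sets ?N" by simp
    fix U :: "'n cmatrix" assume U: "unitary U"
    let ?c = "\<lambda>Z. U ** Z ** conj_transpose U"
    note c = measurable_conjugate_herm[of U]
    have c': "?c \<in> ?\<mu>X \<rightarrow>\<^sub>M ?N" "?c \<in> ?\<mu>Y \<rightarrow>\<^sub>M ?N" using c by simp_all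
    have inv: "distr ?\<mu>X ?N ?c = ?\<mu>X" "distr ?\<mu>Y ?N ?c = ?\<mu>Y" using X Y U by (auto simp: invariant_law_def)
    interpret PY: prob_space ?\<mu>Y by (rule M.prob_space_distr[OF Ym])
    have cc: "(\<lambda>(A, B). (?c A, ?c B)) \<in> ?\<mu>X \<Otimes>\<^sub>M ?\<mu>Y \<rightarrow>\<^sub>M ?N \<Otimes>\<^sub>M ?N"
      unfolding case_prod_unfold
      by (intro measurable_Pair measurable_compose[OF measurable_fst c'(1)] measurable_compose[OF measurable_snd c'(2)])
    have addm': "(\<lambda>(A, B). A + B) \<in> ?\<mu>X \<Otimes>\<^sub>M ?\<mu>Y \<rightarrow>\<^sub>M ?N"
      using measurable_add_herm by (simp cong: measurable_cong_sets sets_pair_measure_cong)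
    have "distr (distr M ?N (\<lambda>\<omega>. X \<omega> + Y \<omega>)) ?N ?c = distr (?\<mu>X \<Otimes>\<^sub>M ?\<mu>Y) ?N (\<lambda>(A, B). ?c A + ?c B)"
      unfolding sum by (subst distr_distr[OF c addm'])
        (simp add: comp_def case_prod_unfold matrix_mult_add_left matrix_mult_add_right)
    also have "\<dots> = distr (distr (?\<mu>X \<Otimes>\<^sub>M ?\<mu>Y) (?N \<Otimes>\<^sub>M ?N) (\<lambda>(A, B). (?c A, ?c B))) ?N (\<lambda>(A, B). A + B)"
      by (subst distr_distr[OF measurable_add_herm cc]) (simp add: comp_def case_prod_unfold)
    also have "distr (?\<mu>X \<Otimes>\<^sub>M ?\<mu>Y) (?N \<Otimes>\<^sub>M ?N) (\<lambda>(A, B). (?c A, ?c B)) = distr ?\<mu>X ?N ?c \<Otimes>\<^sub>M distr ?\<mu>Y ?N ?c"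
      using PY.sigma_finite_measure_axioms by (intro pair_measure_distr[symmetric] c') (simp only: inv)
    also have "\<dots> = ?\<mu>X \<Otimes>\<^sub>M ?\<mu>Y" unfolding inv ..
    finally show "distr (distr M ?N (\<lambda>\<omega>. X \<omega> + Y \<omega>)) ?N ?c = distr M ?N (\<lambda>\<omega>. X \<omega> + Y \<omega>)"
      unfolding sum .
  qed
qed

text \<open>
  Fubini and the invariance of \<open>\<mu>\<close>: averaging a function over orbits does not change its integral.
\<close>

lemma integral_orbit_average:
  fixes g :: "('n::{finite,linorder}) cmatrix \<Rightarrow> 'b::{banach,second_countable_topology}"
  assumes \<mu>: "invariant_law \<mu>" and g[measurable]: "g \<in> borel_measurable borel" and B: "\<And>Z. norm (g Z) \<le> B"
  shows "(\<integral>Z. (\<integral>U. g (U ** Z ** conj_transpose U) \<partial>haar) \<partial>\<mu>) = (\<integral>Z. g Z \<partial>\<mu>)"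
proof -
  interpret H: prob_space "haar :: 'n cmatrix measure" by (rule prob_space_haar)
  interpret prob_space \<mu> by (rule invariant_lawD[OF \<mu>])
  have [measurable]: "fst \<in> \<mu> \<Otimes>\<^sub>M haar \<rightarrow>\<^sub>M (borel :: 'n cmatrix measure)"
    by (rule measurable_compose[OF measurable_fst borel_measurable_invariant_law[OF \<mu>]]) simp
  have [measurable]: "snd \<in> \<mu> \<Otimes>\<^sub>M haar \<rightarrow>\<^sub>M (borel :: 'n cmatrix measure)"
    by (rule measurable_compose[OF measurable_snd measurable_haar_id])
  let ?f = "\<lambda>p. g (snd p ** fst p ** conj_transpose (snd p))"
  have "(\<integral>Z. (\<integral>U. ?f (Z, U) \<partial>haar) \<partial>\<mu>) = (\<integral>U. (\<integral>Z. ?f (Z, U) \<partial>\<mu>) \<partial>haar)"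
    by (rule integral_swap_prob_dominated[where h="\<lambda>_. B"]) (use B in \<open>auto intro: prob_space_axioms H.sigma_finite_measure_axioms\<close>)
  also have "\<dots> = (\<integral>U. (\<integral>Z. g Z \<partial>\<mu>) \<partial>(haar :: 'n cmatrix measure))"
    by (rule Bochner_Integration.integral_cong[OF refl]) (simp add: integral_invariant_law[OF \<mu> _ g] space_haar)
  finally show ?thesis by (simp add: H.prob_space)
qed

lemma orbit_exp_conjugate: "orbit_exp y Z U = orbit_exp y (U ** Z ** conj_transpose U) (mat 1)"
  by (simp add: orbit_exp_def orbit_diag_def)

text \<open>
  The spherical transform of an invariant law is its characteristic function at the diagonal matrix of \<open>s\<close>. This is why it is
  multiplicative for independent sums.
\<close>

lemma integral_spherical_neg:
  fixes \<mu> :: "('n::{finite,linorder}) cmatrix measure"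
  assumes \<mu>: "invariant_law \<mu>"
  shows "(\<integral>Z. spherical_neg s Z \<partial>\<mu>) = (\<integral>Z. orbit_exp (\<lambda>k. - \<i> * of_real (s $ k)) Z (mat 1) \<partial>\<mu>)"
proof -
  let ?g = "\<lambda>Z. orbit_exp (\<lambda>k. - \<i> * of_real (s $ k)) Z (mat 1)"
  have "spherical_neg s Z = (\<integral>U. ?g (U ** Z ** conj_transpose U) \<partial>haar)" for Z
    unfolding spherical_neg_def by (rule Bochner_Integration.integral_cong[OF refl]) (rule orbit_exp_conjugate)
  then show ?thesis
    using integral_orbit_average[OF \<mu>, of ?g 1] by simp
qed

lemma integral_spherical_neg_add:
  fixes X Y :: "'w \<Rightarrow> ('n::{finite,linorder}) cmatrix"
  assumes M: "prob_space M" and ind: "prob_space.indep_var M herm_lborel X herm_lborel Y"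
    and X: "invariant_law (distr M herm_lborel X)" and Y: "invariant_law (distr M herm_lborel Y)"
  shows "(\<integral>Z. spherical_neg s Z \<partial>distr M herm_lborel (\<lambda>\<omega>. X \<omega> + Y \<omega>))
    = (\<integral>Z. spherical_neg s Z \<partial>distr M herm_lborel X) * (\<integral>Z. spherical_neg s Z \<partial>distr M herm_lborel Y)"
proof -
  interpret M: prob_space M by fact
  let ?N = "herm_lborel :: 'n cmatrix measure"
  let ?g = "\<lambda>Z::'n cmatrix. orbit_exp (\<lambda>k. - \<i> * of_real (s $ k)) Z (mat 1)"
  have Xm: "X \<in> M \<rightarrow>\<^sub>M ?N" and Ym: "Y \<in> M \<rightarrow>\<^sub>M ?N"
    using M.indep_var_rv1[OF ind] M.indep_var_rv2[OF ind] by auto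
  have XYm: "(\<lambda>\<omega>. X \<omega> + Y \<omega>) \<in> M \<rightarrow>\<^sub>M ?N"
    using measurable_compose[OF measurable_Pair[OF Xm Ym] measurable_add_herm] by simp
  have g: "?g \<in> borel_measurable ?N" by (rule measurable_from_herm_lborel) measurable
  have ga: "?g (A + B) = ?g A * ?g B" for A B
  proof -
    have "orbit_diag (A + B) (mat 1) l = orbit_diag A (mat 1) l + orbit_diag B (mat 1) l" for l
      by (simp add: orbit_diag_def)
    then show ?thesis by (simp only: orbit_exp_def of_real_add distrib_left sum.distrib exp_add)
  qed
  have int: "integrable M (\<lambda>\<omega>. ?g (X \<omega>))" "integrable M (\<lambda>\<omega>. ?g (Y \<omega>))"
    using measurable_compose[OF Xm g] measurable_compose[OF Ym g]
    by (auto intro!: M.integrable_const_bound[where B=1])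
  have "(\<integral>Z. spherical_neg s Z \<partial>distr M ?N (\<lambda>\<omega>. X \<omega> + Y \<omega>)) = (\<integral>\<omega>. ?g (X \<omega>) * ?g (Y \<omega>) \<partial>M)"
    unfolding integral_spherical_neg[OF invariant_law_add[OF assms]] integral_distr[OF XYm g] ga ..
  also have "\<dots> = (\<integral>\<omega>. ?g (X \<omega>) \<partial>M) * (\<integral>\<omega>. ?g (Y \<omega>) \<partial>M)"
    using M.indep_var_lebesgue_integral[OF M.indep_var_compose[OF ind g g, unfolded comp_def] int] by simp
  also have "\<dots> = (\<integral>Z. spherical_neg s Z \<partial>distr M ?N X) * (\<integral>Z. spherical_neg s Z \<partial>distr M ?N Y)"
    unfolding integral_spherical_neg[OF X] integral_spherical_neg[OF Y] integral_distr[OF Xm g] integral_distr[OF Ym g] ..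
  finally show ?thesis .
qed

section \<open>Gauss means of the inversion integral\<close>

text \<open>
  The constant in the Gaussian integral of \<open>\<Delta>(s) exp (i \<Sum> s\<^sub>k x\<^sub>k)\<close>: each of the factors of \<open>\<Delta>\<close> contributes
  \<open>i / (2 \<epsilon>)\<close>.
\<close>

definition gauss_const :: "'n::{finite,linorder} itself \<Rightarrow> real \<Rightarrow> complex" where
  "gauss_const T \<epsilon> = (\<i> / (2 * of_real \<epsilon>)) ^ card {p::'n\<times>'n. fst p < snd p} * of_real (sqrt (pi / \<epsilon>) ^ CARD('n))"

lemma gaussian_integral_vandermonde:
  fixes D :: "('n::{finite,linorder}) rvector"
  assumes \<epsilon>: "0 < \<epsilon>"
  defines "f \<equiv> \<lambda>s. of_real (exp (- \<epsilon> * (norm s)\<^sup>2) * vandermonde s) * exp (\<i> * of_real (\<Sum>k\<in>UNIV. s $ k * D $ k))"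
  shows "(\<integral>s. f s \<partial>lborel) =
      gauss_const TYPE('n) \<epsilon> * of_real (vandermonde D * exp (- (\<Sum>k\<in>UNIV. (D $ k)\<^sup>2) / (4 * \<epsilon>)))"
proof -
  let ?N = "card {p::'n\<times>'n. fst p < snd p}"
  have v: "complex_of_real (vandermonde s) = (- \<i>) ^ ?N * cvandermonde (\<lambda>k. 0 + \<i> * of_real (s $ k))" for s :: "'n rvector"
    unfolding cvandermonde_scale[symmetric] by (simp add: cvandermonde_of_real)
  have f: "f = (\<lambda>s. (- \<i>) ^ ?N * (of_real (exp (- \<epsilon> * (norm s)\<^sup>2)) * cvandermonde (\<lambda>k. 0 + \<i> * of_real (s $ k)) *
      exp (\<i> * of_real (\<Sum>k\<in>UNIV. s $ k * D $ k))))"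
    unfolding f_def of_real_mult v by (simp only: mult_ac)
  have "(\<integral>s. f s \<partial>lborel) = (- \<i>) ^ ?N * (of_real (sqrt (pi / \<epsilon>) ^ CARD('n) * exp (- (\<Sum>k\<in>UNIV. (D $ k)\<^sup>2) / (4 * \<epsilon>))) *
      cvandermonde (\<lambda>k. 0 - of_real (D $ k / (2 * \<epsilon>))))"
    unfolding f integral_mult_right_zero gaussian_integral_cvandermonde[OF \<epsilon>] ..
  also have "(\<lambda>k. 0 - complex_of_real (D $ k / (2 * \<epsilon>))) = (\<lambda>k. (- 1 / (2 * of_real \<epsilon>)) * of_real (D $ k))" by auto
  also have "cvandermonde (\<lambda>k. (- 1 / (2 * of_real \<epsilon>)) * of_real (D $ k)) = (- 1 / (2 * of_real \<epsilon>)) ^ ?N * of_real (vandermonde D)"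
    unfolding cvandermonde_scale cvandermonde_of_real ..
  also have "(- \<i>) ^ ?N * (of_real (sqrt (pi / \<epsilon>) ^ CARD('n) * exp (- (\<Sum>k\<in>UNIV. (D $ k)\<^sup>2) / (4 * \<epsilon>))) *
      ((- 1 / (2 * of_real \<epsilon>)) ^ ?N * of_real (vandermonde D)))
      = ((- \<i>) * (- 1 / (2 * of_real \<epsilon>))) ^ ?N * of_real (sqrt (pi / \<epsilon>) ^ CARD('n)) *
        of_real (vandermonde D * exp (- (\<Sum>k\<in>UNIV. (D $ k)\<^sup>2) / (4 * \<epsilon>)))"
    unfolding power_mult_distrib of_real_mult by (simp only: mult_ac)
  also have "(- \<i>) * (- 1 / (2 * of_real \<epsilon>)) = \<i> / (2 * of_real \<epsilon>)" by simp
  finally show "(\<integral>s. f s \<partial>lborel) =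
      gauss_const TYPE('n) \<epsilon> * of_real (vandermonde D * exp (- (\<Sum>k\<in>UNIV. (D $ k)\<^sup>2) / (4 * \<epsilon>)))"
    unfolding gauss_const_def .
qed

lemma abs_vandermonde_le:
  fixes s :: "('n::{finite,linorder}) rvector"
  shows "\<bar>vandermonde s\<bar> \<le> 2 ^ card {p::'n\<times>'n. fst p < snd p} * (1 + norm s) ^ card {p::'n\<times>'n. fst p < snd p}"
proof -
  have "cmod (cvandermonde (\<lambda>k. of_real (s $ k))) \<le> (2 * (1 + norm s)) ^ card {p::'n\<times>'n. fst p < snd p}"
  proof (rule norm_cvandermonde_le)
    show "cmod (of_real (s $ k)) \<le> 1 + norm s" for k using component_le_norm_cart[of s k] by simp
  qed
  then show ?thesis by (simp only: cvandermonde_of_real norm_of_real power_mult_distrib)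
qed

lemma borel_measurable_vandermonde [measurable (raw)]:
  fixes f :: "'a \<Rightarrow> ('n::{finite,linorder}) rvector"
  assumes [measurable]: "f \<in> borel_measurable M"
  shows "(\<lambda>x. vandermonde (f x)) \<in> borel_measurable M"
  unfolding vandermonde_def case_prod_unfold by measurable

text \<open>
  The Gauss mean of the inversion integral for a point mass on the orbit of \<open>Z\<close>. Integrating over \<open>s\<close> first leaves an orbit average of
  \<open>\<Delta>(x - d) exp (- \<bar>x - d\<bar>\<^sup>2 / (4 \<epsilon>))\<close> with the diagonal \<open>d\<close> of the orbit point, and \<open>heat_kernel_identity\<close> evaluates it.
\<close>

lemma gaussian_integral_spherical_neg:
  fixes Z :: "('n::{finite,linorder}) cmatrix" and x :: "'n rvector"
  assumes Z: "hermitian Z" and \<epsilon>: "0 < \<epsilon>"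
  shows "(\<integral>s. of_real (exp (- \<epsilon> * (norm s)\<^sup>2) * vandermonde s) * exp (\<i> * of_real (\<Sum>k\<in>UNIV. s $ k * x $ k)) * spherical_neg s Z \<partial>lborel)
    = gauss_const TYPE('n) \<epsilon> * of_real (vandermonde x) *
      (\<integral>U. of_real (exp (- (norm (diag_matrix x - U ** Z ** conj_transpose U))\<^sup>2 / (4 * \<epsilon>))) \<partial>haar)"
proof -
  interpret H: prob_space "haar :: 'n cmatrix measure" by (rule prob_space_haar)
  let ?N = "card {p::'n\<times>'n. fst p < snd p}"
  let ?g = "\<lambda>s::'n rvector. complex_of_real (exp (- \<epsilon> * (norm s)\<^sup>2) * vandermonde s)"
  let ?e = "\<lambda>s::'n rvector. exp (\<i> * of_real (\<Sum>k\<in>UNIV. s $ k * x $ k))"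
  let ?o = "\<lambda>s U. orbit_exp (\<lambda>k. - \<i> * of_real (s $ k)) Z U"
  define f where "f p = ?g (snd p) * ?e (snd p) * ?o (snd p) (fst p)" for p
  have [measurable]: "fst \<in> haar \<Otimes>\<^sub>M (lborel :: 'n rvector measure) \<rightarrow>\<^sub>M (borel :: 'n cmatrix measure)"
    by (rule measurable_compose[OF measurable_fst measurable_haar_id])
  have fm: "f \<in> borel_measurable (haar \<Otimes>\<^sub>M lborel)" unfolding f_def by measurable
  have "(\<integral>s. ?g s * ?e s * spherical_neg s Z \<partial>lborel) = (\<integral>s. (\<integral>U. f (U, s) \<partial>haar) \<partial>lborel)"
    by (simp add: spherical_neg_def f_def)
  also have "\<dots> = (\<integral>U. (\<integral>s. f (U, s) \<partial>lborel) \<partial>haar)"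
  proof (rule integral_swap_prob_dominated[OF prob_space_haar sigma_finite_lborel fm, symmetric])
    show "integrable lborel (\<lambda>s::'n rvector. 2 ^ ?N * ((1 + norm s) ^ ?N * exp (- \<epsilon> * (norm s)\<^sup>2)))"
      by (intro integrable_mult_right integrable_poly_gaussian \<epsilon>)
    show "cmod (f (U, s)) \<le> 2 ^ ?N * ((1 + norm s) ^ ?N * exp (- \<epsilon> * (norm s)\<^sup>2))" for U s
      using mult_right_mono[OF abs_vandermonde_le[of s], of "exp (- \<epsilon> * (norm s)\<^sup>2)"]
      by (simp add: f_def norm_mult abs_mult mult_ac)
  qed
  also have "\<dots> = (\<integral>U. gauss_const TYPE('n) \<epsilon> * (cvandermonde (\<lambda>k. of_real (x $ k - orbit_diag Z U k)) *
      of_real (exp (- (\<Sum>k\<in>UNIV. (x $ k - orbit_diag Z U k)\<^sup>2) / (4 * \<epsilon>)))) \<partial>haar)"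
  proof (rule Bochner_Integration.integral_cong[OF refl])
    fix U
    let ?D = "\<chi> k. x $ k - orbit_diag Z U k"
    have "f (U, s) = ?g s * exp (\<i> * of_real (\<Sum>k\<in>UNIV. s $ k * ?D $ k))" for s
      by (simp add: f_def orbit_exp_def sum_distrib_left right_diff_distrib sum_subtractf sum_negf exp_diff exp_minus divide_inverse mult_ac)
    then have "(\<integral>s. f (U, s) \<partial>lborel) = gauss_const TYPE('n) \<epsilon> * of_real (vandermonde ?D * exp (- (\<Sum>k\<in>UNIV. (?D $ k)\<^sup>2) / (4 * \<epsilon>)))"
      using gaussian_integral_vandermonde[OF \<epsilon>, of ?D] by simp
    then show "(\<integral>s. f (U, s) \<partial>lborel) = gauss_const TYPE('n) \<epsilon> * (cvandermonde (\<lambda>k. of_real (x $ k - orbit_diag Z U k)) *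
      of_real (exp (- (\<Sum>k\<in>UNIV. (x $ k - orbit_diag Z U k)\<^sup>2) / (4 * \<epsilon>))))"
      using cvandermonde_of_real[of ?D] by simp
  qed
  also have "\<dots> = gauss_const TYPE('n) \<epsilon> * (of_real (vandermonde x) *
      (\<integral>U. of_real (exp (- (norm (diag_matrix x - U ** Z ** conj_transpose U))\<^sup>2 / (4 * \<epsilon>))) \<partial>haar))"
    unfolding integral_mult_right_zero heat_kernel_identity[OF Z \<epsilon>] ..
  finally show ?thesis by (simp only: mult.assoc)
qed

text \<open>
  Multiplied by \<open>heat_norm\<close>, this is the density at \<open>W\<close> of \<open>\<mu>\<close> convolved with the heat kernel.
\<close>

definition heat_mean :: "('n::{finite,linorder}) cmatrix measure \<Rightarrow> real \<Rightarrow> 'n cmatrix \<Rightarrow> real" where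
  "heat_mean \<mu> \<epsilon> W = (\<integral>Z. exp (- (norm (W - Z))\<^sup>2 / (4 * \<epsilon>)) \<partial>\<mu>)"

text \<open>
  The norm and the law are both invariant under conjugation.
\<close>

lemma heat_mean_conjugate:
  fixes \<mu> :: "('n::{finite,linorder}) cmatrix measure"
  assumes \<mu>: "invariant_law \<mu>" and U: "unitary U"
  shows "heat_mean \<mu> \<epsilon> (U ** W ** conj_transpose U) = heat_mean \<mu> \<epsilon> W"
proof -
  have "heat_mean \<mu> \<epsilon> (U ** W ** conj_transpose U)
      = (\<integral>Z. exp (- (norm (U ** W ** conj_transpose U - U ** Z ** conj_transpose U))\<^sup>2 / (4 * \<epsilon>)) \<partial>\<mu>)"
    unfolding heat_mean_def by (rule integral_invariant_law[OF \<mu> U, symmetric]) measurable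
  also have "\<dots> = heat_mean \<mu> \<epsilon> W"
    unfolding heat_mean_def
    by (simp add: norm_conjugate[OF U] flip: matrix_mult_diff_left matrix_mult_diff_right)
  finally show ?thesis .
qed

lemma
  fixes \<mu> :: "('n::{finite,linorder}) cmatrix measure" and x :: "'n rvector"
  assumes \<mu>: "invariant_law \<mu>" and \<epsilon>: "0 < \<epsilon>"
  defines "f \<equiv> \<lambda>s. of_real (exp (- \<epsilon> * (norm s)\<^sup>2) * vandermonde s) * exp (\<i> * of_real (\<Sum>k\<in>UNIV. s $ k * x $ k)) * (\<integral>Z. spherical_neg s Z \<partial>\<mu>)"
  shows integrable_gauss_mean: "integrable lborel f"
    and gauss_mean: "(\<integral>s. f s \<partial>lborel) = gauss_const TYPE('n) \<epsilon> * of_real (vandermonde x * heat_mean \<mu> \<epsilon> (diag_matrix x))"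
proof -
  interpret prob_space \<mu> by (rule invariant_lawD[OF \<mu>])
  let ?N = "card {p::'n\<times>'n. fst p < snd p}"
  let ?g = "\<lambda>s::'n rvector. complex_of_real (exp (- \<epsilon> * (norm s)\<^sup>2) * vandermonde s) * exp (\<i> * of_real (\<Sum>k\<in>UNIV. s $ k * x $ k))"
  have g: "cmod (?g s) \<le> 2 ^ ?N * ((1 + norm s) ^ ?N * exp (- \<epsilon> * (norm s)\<^sup>2))" for s
    using mult_right_mono[OF abs_vandermonde_le[of s], of "exp (- \<epsilon> * (norm s)\<^sup>2)"]
    by (simp add: norm_mult abs_mult mult_ac)
  have gs: "cmod (?g s * z) \<le> 2 ^ ?N * ((1 + norm s) ^ ?N * exp (- \<epsilon> * (norm s)\<^sup>2))" if "cmod z \<le> 1" for s z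
    using mult_mono[OF g[of s] that] by (simp add: norm_mult)
  have fst_m[measurable]: "fst \<in> \<mu> \<Otimes>\<^sub>M (lborel :: 'n rvector measure) \<rightarrow>\<^sub>M (borel :: 'n cmatrix measure)"
    by (rule measurable_compose[OF measurable_fst borel_measurable_invariant_law[OF \<mu>]]) simp
  have snd_m[measurable]: "snd \<in> (lborel :: 'n rvector measure) \<Otimes>\<^sub>M \<mu> \<rightarrow>\<^sub>M (borel :: 'n cmatrix measure)"
    by (rule measurable_compose[OF measurable_snd borel_measurable_invariant_law[OF \<mu>]]) simp
  have hat_m[measurable]: "(\<lambda>s::'n rvector. \<integral>Z. spherical_neg s Z \<partial>\<mu>) \<in> borel_measurable lborel"
    by (rule borel_measurable_lebesgue_integral) (simp only: case_prod_unfold, measurable)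
  have hat_le: "cmod (\<integral>Z. spherical_neg s Z \<partial>\<mu>) \<le> 1" for s :: "'n rvector"
  proof -
    have "cmod (\<integral>Z. spherical_neg s Z \<partial>\<mu>) \<le> (\<integral>Z. cmod (spherical_neg s Z) \<partial>\<mu>)" by (rule integral_norm_bound)
    also have "\<dots> \<le> (\<integral>Z. 1 \<partial>\<mu>)"
      by (rule integral_mono') (auto simp: norm_spherical_neg_le)
    finally show ?thesis by (simp add: prob_space)
  qed
  show "integrable lborel f"
    unfolding f_def
  proof (rule integrable_poly_gaussian_bound[OF \<epsilon>])
    show "(\<lambda>s. ?g s * (\<integral>Z. spherical_neg s Z \<partial>\<mu>)) \<in> borel_measurable borel" using hat_m by simp
  qed (rule gs[OF hat_le])
  have "(\<integral>s. f s \<partial>lborel) = (\<integral>s. (\<integral>Z. ?g s * spherical_neg s Z \<partial>\<mu>) \<partial>lborel)"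
    unfolding f_def by simp
  also have "\<dots> = (\<integral>Z. (\<integral>s. ?g s * spherical_neg s Z \<partial>lborel) \<partial>\<mu>)"
  proof -
    let ?h = "\<lambda>p. ?g (snd p) * spherical_neg (snd p) (fst p)"
    have "(\<integral>Z. (\<integral>s. ?h (Z, s) \<partial>lborel) \<partial>\<mu>) = (\<integral>s. (\<integral>Z. ?h (Z, s) \<partial>\<mu>) \<partial>lborel)"
    proof (rule integral_swap_prob_dominated[OF prob_space_axioms sigma_finite_lborel])
      show "integrable lborel (\<lambda>s::'n rvector. 2 ^ ?N * ((1 + norm s) ^ ?N * exp (- \<epsilon> * (norm s)\<^sup>2)))"
        by (intro integrable_mult_right integrable_poly_gaussian \<epsilon>)
      show "?h \<in> borel_measurable (\<mu> \<Otimes>\<^sub>M lborel)" by measurable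
    qed (simp only: fst_conv snd_conv, rule gs[OF norm_spherical_neg_le])
    then show ?thesis by simp
  qed
  also have "\<dots> = (\<integral>Z. gauss_const TYPE('n) \<epsilon> * of_real (vandermonde x) *
      (\<integral>U. of_real (exp (- (norm (diag_matrix x - U ** Z ** conj_transpose U))\<^sup>2 / (4 * \<epsilon>))) \<partial>haar) \<partial>\<mu>)"
    by (rule Bochner_Integration.integral_cong[OF refl], rule gaussian_integral_spherical_neg[OF _ \<epsilon>])
      (simp add: invariant_lawD(3)[OF \<mu>])
  also have "\<dots> = gauss_const TYPE('n) \<epsilon> * of_real (vandermonde x) * of_real (heat_mean \<mu> \<epsilon> (diag_matrix x))"
    using integral_orbit_average[OF \<mu>, of "\<lambda>Z. complex_of_real (exp (- (norm (diag_matrix x - Z))\<^sup>2 / (4 * \<epsilon>)))" 1] \<epsilon>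
    by (simp add: heat_mean_def)
  finally show "(\<integral>s. f s \<partial>lborel) = gauss_const TYPE('n) \<epsilon> * of_real (vandermonde x * heat_mean \<mu> \<epsilon> (diag_matrix x))"
    by (simp only: mult.assoc of_real_mult)
qed

text \<open>
  The constant of the inversion formula and the constant of the Gauss mean combine to the normalization of the heat kernel on matrices.
\<close>

lemma inversion_constant:
  assumes \<epsilon>: "0 < \<epsilon>"
  shows "(of_real pi * \<i>) powi (- int (CARD('n::{finite,linorder}) * (CARD('n) - 1) div 2)) / (2 * of_real pi) ^ CARD('n) *
    gauss_const TYPE('n) \<epsilon> = of_real (heat_norm TYPE('n) \<epsilon>)"
proof -
  let ?N = "card {p::'n\<times>'n. fst p < snd p}"
  have 1: "inverse ((of_real pi * \<i>) ^ ?N) * (\<i> / (2 * of_real \<epsilon>)) ^ ?N = complex_of_real (1 / (2 * pi * \<epsilon>) ^ ?N)"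
  proof -
    have "inverse (of_real pi * \<i>) * (\<i> / (2 * of_real \<epsilon>)) = complex_of_real (1 / (2 * pi * \<epsilon>))"
      using \<epsilon> by (simp add: field_simps)
    then have "(inverse (of_real pi * \<i>) * (\<i> / (2 * of_real \<epsilon>))) ^ ?N = complex_of_real ((1 / (2 * pi * \<epsilon>)) ^ ?N)"
      by (simp only: of_real_power)
    then show ?thesis by (simp only: power_mult_distrib power_inverse power_one_over)
  qed
  have "sqrt (pi / \<epsilon>) * sqrt (4 * pi * \<epsilon>) = 2 * pi"
    using \<epsilon> by (simp add: real_sqrt_mult[symmetric] real_sqrt_mult_self) (simp add: real_sqrt_mult)
  then have "sqrt (pi / \<epsilon>) / (2 * pi) = 1 / sqrt (4 * pi * \<epsilon>)"
    using \<epsilon> by (simp add: divide_simps)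
  then have "(sqrt (pi / \<epsilon>) / (2 * pi)) ^ CARD('n) = 1 / sqrt (4 * pi * \<epsilon>) ^ CARD('n)"
    by (simp only: power_one_over)
  then have 2: "sqrt (pi / \<epsilon>) ^ CARD('n) / (2 * pi) ^ CARD('n) = 1 / sqrt (4 * pi * \<epsilon>) ^ CARD('n)"
    by (simp only: power_divide)
  have split: "P / of_real d * (Q * of_real c) = P * Q * complex_of_real (c / d)" for P Q :: complex and c d :: real
    by simp
  have d: "(2 * complex_of_real pi) ^ CARD('n) = of_real ((2 * pi) ^ CARD('n))" by simp
  have "(of_real pi * \<i>) powi (- int (CARD('n) * (CARD('n) - 1) div 2)) / (2 * of_real pi) ^ CARD('n) * gauss_const TYPE('n) \<epsilon>
     = (inverse ((of_real pi * \<i>) ^ ?N) * (\<i> / (2 * of_real \<epsilon>)) ^ ?N) * of_real (sqrt (pi / \<epsilon>) ^ CARD('n) / (2 * pi) ^ CARD('n))"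
    unfolding gauss_const_def card_index_pairs[symmetric] power_int_minus power_int_of_nat d by (rule split)
  also have "\<dots> = of_real (heat_norm TYPE('n) \<epsilon>)"
    unfolding 1 2 heat_norm_def by simp
  finally show ?thesis .
qed

text \<open>
  All \<open>n!\<close> terms of the determinant have the same Gauss mean: a permutation of \<open>x\<close> changes \<open>\<Delta>(x)\<close> by its sign and does not change the
  heat mean at the diagonal matrix, which is conjugated by a permutation matrix.
\<close>

lemma gauss_mean_det:
  fixes \<mu> :: "('n::{finite,linorder}) cmatrix measure" and x :: "'n rvector"
  assumes \<mu>: "invariant_law \<mu>" and \<epsilon>: "0 < \<epsilon>"
  defines "g \<equiv> \<lambda>s :: 'n rvector. exp (- \<epsilon> * (norm s)\<^sup>2) *\<^sub>R ((\<integral>Z. spherical_neg s Z \<partial>\<mu>) *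
     det ((\<chi> j k. exp (\<i> * complex_of_real (s $ j * x $ k))) :: 'n cmatrix) * complex_of_real (vandermonde s))"
  shows "integrable lborel g"
    and "(\<integral>s. g s \<partial>lborel) = fact CARD('n) * gauss_const TYPE('n) \<epsilon> * of_real (vandermonde x * heat_mean \<mu> \<epsilon> (diag_matrix x))"
proof -
  let ?P = "{p. p permutes (UNIV :: 'n set)}"
  define x' where "x' p = (\<chi> k::'n. x $ p k)" for p :: "'n \<Rightarrow> 'n"
  define f where "f p s = of_real (exp (- \<epsilon> * (norm s)\<^sup>2) * vandermonde s) * exp (\<i> * of_real (\<Sum>k\<in>UNIV. s $ k * x' p $ k)) * (\<integral>Z. spherical_neg s Z \<partial>\<mu>)" for p :: "'n \<Rightarrow> 'n" and s :: "'n rvector"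
  have g: "g s = (\<Sum>p\<in>?P. of_int (sign p) * f p s)" for s
    by (simp add: g_def f_def x'_def det_def scaleR_conv_of_real sum_distrib_left sum_distrib_right exp_sum mult_ac)
  have int: "integrable lborel (f p)" for p unfolding f_def by (rule integrable_gauss_mean[OF \<mu> \<epsilon>])
  show "integrable lborel g" unfolding g by (intro Bochner_Integration.integrable_sum integrable_mult_right int)
  have val: "of_int (sign p) * (\<integral>s. f p s \<partial>lborel) = gauss_const TYPE('n) \<epsilon> * of_real (vandermonde x * heat_mean \<mu> \<epsilon> (diag_matrix x))"
    if p: "p \<in> ?P" for p
  proof -
    have "complex_of_real (vandermonde (x' p)) = of_int (sign p) * of_real (vandermonde x)"
      using cvandermonde_permute[of p "\<lambda>k. of_real (x $ k)"] p cvandermonde_of_real[of "x' p"] cvandermonde_of_real[of x]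
      by (simp add: x'_def)
    moreover have "heat_mean \<mu> \<epsilon> (diag_matrix (x' p)) = heat_mean \<mu> \<epsilon> (diag_matrix x)"
      using heat_mean_conjugate[OF \<mu> unitary_perm_matrix, of p \<epsilon> "diag_matrix x"] p
      by (simp add: perm_matrix_diag x'_def)
    moreover have "of_int (sign p) * of_int (sign p) = (1::complex)" by (simp add: sign_def)
    moreover have "\<sigma> * (c * (\<sigma> * v * h)) = c * (v * h)" if "\<sigma> * \<sigma> = 1" for \<sigma> c v h :: complex
      using that by (metis (no_types, lifting) mult.assoc mult.commute mult_1)
    moreover have "(\<integral>s. f p s \<partial>lborel) = gauss_const TYPE('n) \<epsilon> * of_real (vandermonde (x' p) * heat_mean \<mu> \<epsilon> (diag_matrix (x' p)))"
      unfolding f_def by (rule gauss_mean[OF \<mu> \<epsilon>])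
    ultimately show ?thesis by (simp only: of_real_mult)
  qed
  have "(\<integral>s. g s \<partial>lborel) = (\<Sum>p\<in>?P. of_int (sign p) * (\<integral>s. f p s \<partial>lborel))"
    unfolding g by (subst Bochner_Integration.integral_sum) (auto intro!: integrable_mult_right int)
  also have "\<dots> = of_nat (card ?P) * (gauss_const TYPE('n) \<epsilon> * of_real (vandermonde x * heat_mean \<mu> \<epsilon> (diag_matrix x)))"
    by (simp only: val sum_constant cong: sum.cong)
  also have "card ?P = fact CARD('n)" by (rule card_permutations) auto
  finally show "(\<integral>s. g s \<partial>lborel) = fact CARD('n) * gauss_const TYPE('n) \<epsilon> * of_real (vandermonde x * heat_mean \<mu> \<epsilon> (diag_matrix x))"
    by (simp add: mult.assoc)
qed

text \<open>
  With the constants of the formula, the Gauss mean of the inversion integral is \<open>heat_norm\<close> times the heat mean of \<open>\<mu>\<close> at the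
  diagonal matrix; so a limit of the one is a limit of the other.
\<close>

lemma inversion_formula_if_heat_mean_tendsto:
  fixes \<mu> :: "('n::{finite,linorder}) cmatrix measure" and x :: "'n rvector"
  assumes \<mu>: "invariant_law \<mu>" and x: "vandermonde x \<noteq> 0"
    and lim: "((\<lambda>\<epsilon>. heat_norm TYPE('n) \<epsilon> * heat_mean \<mu> \<epsilon> (diag_matrix x)) \<longlongrightarrow> v) (at_right 0)"
  shows "\<exists>J. has_fourier_integral (\<lambda>s :: 'n rvector. (\<integral>Z. spherical_neg s Z \<partial>\<mu>) *
       det ((\<chi> j k. exp (\<i> * complex_of_real (s $ j * x $ k))) :: 'n cmatrix) * complex_of_real (vandermonde s)) J \<and>
     complex_of_real v = (complex_of_real pi * \<i>) powi (- int (CARD('n) * (CARD('n) - 1) div 2)) /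
       ((2 * complex_of_real pi) ^ CARD('n) * fact CARD('n) * complex_of_real (vandermonde x)) * J"
proof -
  let ?c = "(complex_of_real pi * \<i>) powi (- int (CARD('n) * (CARD('n) - 1) div 2))"
  let ?q = "?c / ((2 * complex_of_real pi) ^ CARD('n) * fact CARD('n) * complex_of_real (vandermonde x))"
  let ?g = "\<lambda>s :: 'n rvector. (\<integral>Z. spherical_neg s Z \<partial>\<mu>) *
       det ((\<chi> j k. exp (\<i> * complex_of_real (s $ j * x $ k))) :: 'n cmatrix) * complex_of_real (vandermonde s)"
  have q: "?q \<noteq> 0" using x by simp
  have val: "(\<integral>s. exp (- \<epsilon> * (norm s)\<^sup>2) *\<^sub>R ?g s \<partial>lborel) = of_real (heat_norm TYPE('n) \<epsilon> * heat_mean \<mu> \<epsilon> (diag_matrix x)) / ?q"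
    if \<epsilon>: "0 < \<epsilon>" for \<epsilon>
  proof -
    have cancel: "c / (a * n * v) * (n * g * (v * h)) = c / a * g * h" if "n \<noteq> 0" "v \<noteq> 0" for a c g h n v :: complex
      using that by simp
    have "?q * (\<integral>s. exp (- \<epsilon> * (norm s)\<^sup>2) *\<^sub>R ?g s \<partial>lborel)
        = (?c / (2 * complex_of_real pi) ^ CARD('n) * gauss_const TYPE('n) \<epsilon>) * of_real (heat_mean \<mu> \<epsilon> (diag_matrix x))"
      by (subst gauss_mean_det(2)[OF \<mu> \<epsilon>], subst of_real_mult, rule cancel) (use x in simp_all)
    also have "\<dots> = of_real (heat_norm TYPE('n) \<epsilon> * heat_mean \<mu> \<epsilon> (diag_matrix x))"
      unfolding inversion_constant[OF \<epsilon>] by simp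
    finally show ?thesis by (rule nonzero_eq_divide_eq[OF q, THEN iffD2, OF trans[OF mult.commute]])
  qed
  have "((\<lambda>\<epsilon>. of_real (heat_norm TYPE('n) \<epsilon> * heat_mean \<mu> \<epsilon> (diag_matrix x)) / ?q) \<longlongrightarrow> of_real v / ?q) (at_right 0)"
    by (rule tendsto_divide[OF tendsto_of_real[OF lim] tendsto_const q])
  then have "((\<lambda>\<epsilon>. \<integral>s. exp (- \<epsilon> * (norm s)\<^sup>2) *\<^sub>R ?g s \<partial>lborel) \<longlongrightarrow> of_real v / ?q) (at_right 0)"
  proof (rule Lim_transform_eventually)
    show "\<forall>\<^sub>F \<epsilon> in at_right 0. of_real (heat_norm TYPE('n) \<epsilon> * heat_mean \<mu> \<epsilon> (diag_matrix x)) / ?q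
        = (\<integral>s. exp (- \<epsilon> * (norm s)\<^sup>2) *\<^sub>R ?g s \<partial>lborel)"
      using eventually_at_right_less[of 0] by eventually_elim (rule val[symmetric])
  qed
  then have "has_fourier_integral ?g (of_real v / ?q)"
    unfolding has_fourier_integral_def using gauss_mean_det(1)[OF \<mu>] by blast
  moreover have "of_real v = ?q * (of_real v / ?q)"
    by (subst times_divide_eq_right, rule nonzero_mult_div_cancel_left[OF q, symmetric])
  ultimately show ?thesis by blast
qed

section \<open>Almost every orbit avoids a given null set\<close>

lemma integral_haar_conj_transpose:
  fixes f :: "complex^'n^'n \<Rightarrow> 'b::{banach,second_countable_topology}"
  assumes f: "f \<in> borel_measurable borel"
  shows "(\<integral>U. f (conj_transpose U) \<partial>haar) = (\<integral>U. f U \<partial>haar)"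
proof -
  have "conj_transpose \<in> haar \<rightarrow>\<^sub>M restrict_space borel {U::complex^'n^'n. unitary U}"
    by (intro measurable_unitary_conj_transpose measurable_ident_sets[OF sets_haar])
  then have m: "conj_transpose \<in> haar \<rightarrow>\<^sub>M (haar :: (complex^'n^'n) measure)"
    by (simp add: measurable_cong_sets[OF refl sets_haar])
  have "(\<integral>U. f U \<partial>distr haar haar conj_transpose) = (\<integral>U. f (conj_transpose U) \<partial>haar)"
    by (rule integral_distr[OF m borel_measurable_haar[OF f]])
  then show ?thesis by (simp add: distr_haar_conj_transpose)
qed

lemma integrable_vandermonde_squared_gaussian:
  assumes "0 < a"
  shows "integrable lborel (\<lambda>s::('n::{finite,linorder}) rvector. (vandermonde s)\<^sup>2 * exp (- a * (norm s)\<^sup>2))"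
proof (rule integrable_poly_gaussian_bound[OF assms])
  let ?N = "card {p::'n\<times>'n. fst p < snd p}"
  fix s :: "'n rvector"
  have "(vandermonde s)\<^sup>2 \<le> (2 ^ ?N * (1 + norm s) ^ ?N)\<^sup>2"
    using power_mono[OF abs_vandermonde_le[of s], of 2] by simp
  also have "\<dots> = (2 ^ ?N)\<^sup>2 * (1 + norm s) ^ (2 * ?N)" by (simp add: power_mult_distrib power_mult[symmetric] mult.commute)
  finally have "(vandermonde s)\<^sup>2 * exp (- a * (norm s)\<^sup>2) \<le> (2 ^ ?N)\<^sup>2 * (1 + norm s) ^ (2 * ?N) * exp (- a * (norm s)\<^sup>2)"
    by (intro mult_right_mono) auto
  then show "norm ((vandermonde s)\<^sup>2 * exp (- a * (norm s)\<^sup>2)) \<le> (2 ^ ?N)\<^sup>2 * ((1 + norm s) ^ (2 * ?N) * exp (- a * (norm s)\<^sup>2))"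
    by (simp only: real_norm_def abs_mult abs_exp_cancel abs_power2 mult.assoc)
qed measurable

text \<open>
  The push-forward of \<open>\<Delta>(x)\<^sup>2 exp (- \<bar>x\<bar>\<^sup>2) dx \<otimes> dU\<close> under \<open>(x, U) \<mapsto> U diag(x) U\<^sup>-\<^sup>1\<close> has a bounded density: its heat means are bounded
  by a constant that depends neither on the time \<open>\<epsilon>\<close> nor on the matrix \<open>Z\<close>. By the Gaussian integral of the spherical function, a heat
  mean is an integral over \<open>s\<close> of a bounded function times \<open>\<Delta>(s) exp (- \<epsilon> \<bar>s\<bar>\<^sup>2)\<close> times the Fourier transform of
  \<open>\<Delta>(x) exp (- \<bar>x\<bar>\<^sup>2)\<close>, and the latter is \<open>\<Delta>(s) exp (- \<bar>s\<bar>\<^sup>2 / 4)\<close> up to a constant. So the integrand is dominated by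
  \<open>\<Delta>(s)\<^sup>2 exp (- \<bar>s\<bar>\<^sup>2 / 4)\<close> for all \<open>\<epsilon>\<close>.
\<close>

lemma heat_kernel_average_bounded:
  "\<exists>C. \<forall>\<epsilon>>0. \<forall>Z. hermitian Z \<longrightarrow>
    (\<integral>\<^sup>+x. ennreal ((vandermonde (x :: ('n::{finite,linorder}) rvector))\<^sup>2 * exp (- 1 * (norm x)\<^sup>2)) *
       (\<integral>\<^sup>+U. ennreal (heat_norm TYPE('n) \<epsilon> * exp (- (norm (Z - U ** diag_matrix x ** conj_transpose U))\<^sup>2 / (4 * \<epsilon>))) \<partial>haar) \<partial>lborel) \<le> ennreal C"
proof -
  let ?N = "card {p::'n\<times>'n. fst p < snd p}"
  define q where "q = (of_real pi * \<i>) powi (- int (CARD('n) * (CARD('n) - 1) div 2)) / (2 * complex_of_real pi) ^ CARD('n)"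
  define C where "C = cmod q * (\<integral>s. cmod (gauss_const TYPE('n) 1) * ((vandermonde (s :: 'n rvector))\<^sup>2 * exp (- (1 / 4) * (norm s)\<^sup>2)) \<partial>lborel)"
  have "(\<integral>\<^sup>+x. ennreal ((vandermonde (x :: 'n rvector))\<^sup>2 * exp (- 1 * (norm x)\<^sup>2)) *
       (\<integral>\<^sup>+U. ennreal (heat_norm TYPE('n) \<epsilon> * exp (- (norm (Z - U ** diag_matrix x ** conj_transpose U))\<^sup>2 / (4 * \<epsilon>))) \<partial>haar) \<partial>lborel) \<le> ennreal C"
    if \<epsilon>: "0 < \<epsilon>" and Z: "hermitian Z" for \<epsilon> and Z :: "'n cmatrix"
  proof -
    interpret H: prob_space "haar :: 'n cmatrix measure" by (rule prob_space_haar)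
    have pos: "0 < heat_norm TYPE('n) \<epsilon>" using \<epsilon> by (simp add: heat_norm_def)
    define k where "k x = (\<integral>U. exp (- (norm (diag_matrix x - U ** Z ** conj_transpose U))\<^sup>2 / (4 * \<epsilon>)) \<partial>haar)" for x :: "'n rvector"
    define r where "r x = (vandermonde x)\<^sup>2 * exp (- 1 * (norm x)\<^sup>2) * (heat_norm TYPE('n) \<epsilon> * k x)" for x :: "'n rvector"
    have k_m[measurable]: "k \<in> borel_measurable borel"
    proof -
      have [measurable]: "snd \<in> borel \<Otimes>\<^sub>M haar \<rightarrow>\<^sub>M (borel :: 'n cmatrix measure)"
        by (rule measurable_compose[OF measurable_snd measurable_haar_id])
      have [measurable]: "(\<lambda>p. diag_matrix (fst p) :: 'n cmatrix) \<in> borel \<Otimes>\<^sub>M (haar :: 'n cmatrix measure) \<rightarrow>\<^sub>M borel"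
        by (rule measurable_compose[OF measurable_fst borel_measurable_diag_matrix])
      show ?thesis unfolding k_def
        by (rule H.borel_measurable_lebesgue_integral) (simp only: case_prod_unfold, measurable)
    qed
    have k01: "0 \<le> k x" "k x \<le> 1" for x
    proof -
      show "0 \<le> k x" unfolding k_def by (rule Bochner_Integration.integral_nonneg) simp
      have "k x \<le> (\<integral>U. 1 \<partial>(haar :: 'n cmatrix measure))"
        unfolding k_def using \<epsilon> by (intro integral_mono') auto
      then show "k x \<le> 1" by (simp add: H.prob_space)
    qed
    have inner: "(\<integral>\<^sup>+U. ennreal (heat_norm TYPE('n) \<epsilon> * exp (- (norm (Z - U ** diag_matrix x ** conj_transpose U))\<^sup>2 / (4 * \<epsilon>))) \<partial>haar)
        = ennreal (heat_norm TYPE('n) \<epsilon> * k x)" for x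
    proof -
      have int: "integrable haar (\<lambda>U. heat_norm TYPE('n) \<epsilon> * exp (- (norm (Z - U ** diag_matrix x ** conj_transpose U))\<^sup>2 / (4 * \<epsilon>)))"
        using \<epsilon> pos by (intro integrable_mult_right integrable_haar_bounded[where B=1]) auto
      have "(\<integral>U. exp (- (norm (Z - U ** diag_matrix x ** conj_transpose U))\<^sup>2 / (4 * \<epsilon>)) \<partial>haar)
          = (\<integral>U. exp (- (norm (diag_matrix x - conj_transpose U ** Z ** conj_transpose (conj_transpose U)))\<^sup>2 / (4 * \<epsilon>)) \<partial>haar)"
      proof (rule Bochner_Integration.integral_cong[OF refl])
        fix U :: "'n cmatrix" assume "U \<in> space haar"
        then have U: "unitary U" by (simp add: space_haar)
        have "Z - U ** diag_matrix x ** conj_transpose U = - (U ** (diag_matrix x - conj_transpose U ** Z ** U) ** conj_transpose U)"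
          by (simp add: matrix_mult_diff_left matrix_mult_diff_right matrix_mul_assoc unitary_cancel[OF U])
            (use U in \<open>simp add: unitary_def\<close>)
        then have "norm (Z - U ** diag_matrix x ** conj_transpose U) = norm (diag_matrix x - conj_transpose U ** Z ** U)"
          by (simp add: norm_conjugate[OF U])
        then show "exp (- (norm (Z - U ** diag_matrix x ** conj_transpose U))\<^sup>2 / (4 * \<epsilon>))
          = exp (- (norm (diag_matrix x - conj_transpose U ** Z ** conj_transpose (conj_transpose U)))\<^sup>2 / (4 * \<epsilon>))" by simp
      qed
      also have "\<dots> = k x"
        unfolding k_def by (rule integral_haar_conj_transpose[of "\<lambda>U. exp (- (norm (diag_matrix x - U ** Z ** conj_transpose U))\<^sup>2 / (4 * \<epsilon>))"]) measurable
      finally show ?thesis using nn_integral_eq_integral[OF int] pos by simp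
    qed
    have r0: "0 \<le> r x" for x using pos k01[of x] by (simp add: r_def)
    have r_m[measurable]: "r \<in> borel_measurable borel" unfolding r_def by measurable
    have rint: "integrable lborel r"
    proof (rule Bochner_Integration.integrable_bound)
      show "integrable lborel (\<lambda>x::'n rvector. heat_norm TYPE('n) \<epsilon> * ((vandermonde x)\<^sup>2 * exp (- 1 * (norm x)\<^sup>2)))"
        by (intro integrable_mult_right integrable_vandermonde_squared_gaussian) simp
      show "AE x in lborel. norm (r x) \<le> norm (heat_norm TYPE('n) \<epsilon> * ((vandermonde x)\<^sup>2 * exp (- 1 * (norm x)\<^sup>2)))"
      proof (rule AE_I2)
        fix x :: "'n rvector"
        have "r x = k x * (heat_norm TYPE('n) \<epsilon> * ((vandermonde x)\<^sup>2 * exp (- 1 * (norm x)\<^sup>2)))" by (simp add: r_def)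
        also have "\<dots> \<le> 1 * (heat_norm TYPE('n) \<epsilon> * ((vandermonde x)\<^sup>2 * exp (- 1 * (norm x)\<^sup>2)))"
          using pos by (intro mult_right_mono k01) auto
        finally show "norm (r x) \<le> norm (heat_norm TYPE('n) \<epsilon> * ((vandermonde x)\<^sup>2 * exp (- 1 * (norm x)\<^sup>2)))"
          using r0[of x] pos by simp
      qed
    qed simp
    have "(\<integral>\<^sup>+x. ennreal ((vandermonde x)\<^sup>2 * exp (- 1 * (norm x)\<^sup>2)) *
       (\<integral>\<^sup>+U. ennreal (heat_norm TYPE('n) \<epsilon> * exp (- (norm (Z - U ** diag_matrix x ** conj_transpose U))\<^sup>2 / (4 * \<epsilon>))) \<partial>haar) \<partial>lborel)
       = (\<integral>\<^sup>+x. ennreal (r x) \<partial>lborel)"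
      unfolding inner r_def using pos k01 by (intro nn_integral_cong) (simp add: ennreal_mult'[symmetric])
    also have "\<dots> = ennreal (\<integral>x. r x \<partial>lborel)"
      using r0 by (intro nn_integral_eq_integral rint) auto
    also have "\<dots> \<le> ennreal C"
    proof (rule ennreal_leI)
      let ?a = "\<lambda>x::'n rvector. complex_of_real (exp (- 1 * (norm x)\<^sup>2) * vandermonde x)"
      let ?b = "\<lambda>s::'n rvector. complex_of_real (exp (- \<epsilon> * (norm s)\<^sup>2) * vandermonde s)"
      let ?e = "\<lambda>(s::'n rvector) x::'n rvector. exp (\<i> * of_real (\<Sum>k\<in>UNIV. s $ k * x $ k))"
      define f where "f p = ?a (fst p) * (?b (snd p) * ?e (snd p) (fst p) * spherical_neg (snd p) Z)" for p
      have bnd: "cmod (complex_of_real (exp (- a * (norm s)\<^sup>2) * vandermonde s)) \<le> 2 ^ ?N * ((1 + norm s) ^ ?N * exp (- a * (norm s)\<^sup>2))"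
        for a and s :: "'n rvector"
        using mult_right_mono[OF abs_vandermonde_le[of s], of "exp (- a * (norm s)\<^sup>2)"]
        by (simp add: norm_mult abs_mult mult_ac)
      have r_eq: "of_real (r x) = q * (\<integral>s. f (x, s) \<partial>lborel)" for x
      proof -
        have "(\<integral>s. f (x, s) \<partial>lborel) = ?a x * (gauss_const TYPE('n) \<epsilon> * of_real (vandermonde x) * of_real (k x))"
          using gaussian_integral_spherical_neg[OF Z \<epsilon>, of x] by (simp add: f_def k_def)
        then have "q * (\<integral>s. f (x, s) \<partial>lborel) = (q * gauss_const TYPE('n) \<epsilon>) * (?a x * of_real (vandermonde x) * of_real (k x))"
          by (simp only: mult_ac)
        also have "q * gauss_const TYPE('n) \<epsilon> = of_real (heat_norm TYPE('n) \<epsilon>)"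
          unfolding q_def by (rule inversion_constant[OF \<epsilon>])
        finally show ?thesis by (simp add: r_def power2_eq_square mult_ac)
      qed
      have "complex_of_real (\<integral>x. r x \<partial>lborel) = (\<integral>x. q * (\<integral>s. f (x, s) \<partial>lborel) \<partial>lborel)"
        unfolding r_eq[symmetric] by simp
      also have "\<dots> = q * (\<integral>x. (\<integral>s. f (x, s) \<partial>lborel) \<partial>lborel)" by simp
      also have "(\<integral>x. (\<integral>s. f (x, s) \<partial>lborel) \<partial>lborel) = (\<integral>s. (\<integral>x. f (x, s) \<partial>lborel) \<partial>lborel)"
      proof (rule integral_swap_dominated[OF sigma_finite_lborel sigma_finite_lborel])
        have [measurable]: "fst \<in> (lborel :: 'n rvector measure) \<Otimes>\<^sub>M (lborel :: 'n rvector measure) \<rightarrow>\<^sub>M borel"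
          "snd \<in> (lborel :: 'n rvector measure) \<Otimes>\<^sub>M (lborel :: 'n rvector measure) \<rightarrow>\<^sub>M borel"
          by (rule measurable_compose[OF measurable_fst] measurable_compose[OF measurable_snd], simp)+
        show "f \<in> borel_measurable (lborel \<Otimes>\<^sub>M lborel)" unfolding f_def by measurable
        show "integrable lborel (\<lambda>s::'n rvector. 2 ^ ?N * ((1 + norm s) ^ ?N * exp (- 1 * (norm s)\<^sup>2)))"
          by (intro integrable_mult_right integrable_poly_gaussian) simp
        show "integrable lborel (\<lambda>s::'n rvector. 2 ^ ?N * ((1 + norm s) ^ ?N * exp (- \<epsilon> * (norm s)\<^sup>2)))"
          by (intro integrable_mult_right integrable_poly_gaussian \<epsilon>)
        fix x s :: "'n rvector"
        have "cmod (f (x, s)) = cmod (?a x) * (cmod (?b s) * cmod (spherical_neg s Z))"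
          unfolding f_def fst_conv snd_conv norm_mult norm_exp_i_times by simp
        also have "\<dots> \<le> (2 ^ ?N * ((1 + norm x) ^ ?N * exp (- 1 * (norm x)\<^sup>2))) *
            ((2 ^ ?N * ((1 + norm s) ^ ?N * exp (- \<epsilon> * (norm s)\<^sup>2))) * 1)"
          by (intro mult_mono bnd norm_spherical_neg_le) auto
        finally show "cmod (f (x, s)) \<le> (2 ^ ?N * ((1 + norm x) ^ ?N * exp (- 1 * (norm x)\<^sup>2))) *
            (2 ^ ?N * ((1 + norm s) ^ ?N * exp (- \<epsilon> * (norm s)\<^sup>2)))" by simp
      qed
      also have "\<dots> = (\<integral>s. ?b s * spherical_neg s Z * (gauss_const TYPE('n) 1 * of_real (vandermonde s * exp (- (1 / 4) * (norm s)\<^sup>2))) \<partial>lborel)"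
      proof (rule Bochner_Integration.integral_cong[OF refl])
        fix s :: "'n rvector"
        have ns: "(\<Sum>k\<in>UNIV. (s $ k)\<^sup>2) = (norm s)\<^sup>2" by (simp add: norm_vec_def L2_set_def sum_nonneg)
        have "(\<lambda>x. f (x, s)) = (\<lambda>x. (?b s * spherical_neg s Z) * (?a x * ?e x s))"
          by (simp add: f_def fun_eq_iff mult_ac)
        then have "(\<integral>x. f (x, s) \<partial>lborel) = (?b s * spherical_neg s Z) * (\<integral>x. ?a x * ?e x s \<partial>lborel)" by simp
        also have "(\<integral>x. ?a x * ?e x s \<partial>lborel) = gauss_const TYPE('n) 1 * of_real (vandermonde s * exp (- (1 / 4) * (norm s)\<^sup>2))"
          using gaussian_integral_vandermonde[of 1 s] by (simp add: ns)
        finally show "(\<integral>x. f (x, s) \<partial>lborel) = ?b s * spherical_neg s Z * (gauss_const TYPE('n) 1 * of_real (vandermonde s * exp (- (1 / 4) * (norm s)\<^sup>2)))" .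
      qed
      finally have R: "complex_of_real (\<integral>x. r x \<partial>lborel) = q * (\<integral>s. ?b s * spherical_neg s Z * (gauss_const TYPE('n) 1 * of_real (vandermonde s * exp (- (1 / 4) * (norm s)\<^sup>2))) \<partial>lborel)" .
      have "(\<integral>x. r x \<partial>lborel) \<le> cmod (of_real (\<integral>x. r x \<partial>lborel))" by simp
      also have "\<dots> = cmod q * cmod (\<integral>s. ?b s * spherical_neg s Z * (gauss_const TYPE('n) 1 * of_real (vandermonde s * exp (- (1 / 4) * (norm s)\<^sup>2))) \<partial>lborel)"
        unfolding R by (rule norm_mult)
      also have "\<dots> \<le> C"
        unfolding C_def
      proof (intro mult_left_mono)
        let ?h = "\<lambda>s::'n rvector. cmod (gauss_const TYPE('n) 1) * ((vandermonde s)\<^sup>2 * exp (- (1 / 4) * (norm s)\<^sup>2))"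
        have hint: "integrable lborel ?h"
          by (intro integrable_mult_right integrable_vandermonde_squared_gaussian) simp
        let ?t = "\<lambda>s::'n rvector. ?b s * spherical_neg s Z * (gauss_const TYPE('n) 1 * of_real (vandermonde s * exp (- (1 / 4) * (norm s)\<^sup>2)))"
        have le: "cmod (?t s) \<le> ?h s" for s
        proof -
          have "cmod (?t s) = exp (- \<epsilon> * (norm s)\<^sup>2) * cmod (spherical_neg s Z) * ?h s"
            by (simp add: norm_mult abs_mult power2_eq_square)
          also have "\<dots> \<le> 1 * 1 * ?h s"
            using \<epsilon> by (intro mult_right_mono mult_mono norm_spherical_neg_le) auto
          finally show ?thesis by simp
        qed
        have tint: "integrable lborel ?t"
          by (rule Bochner_Integration.integrable_bound[OF hint])
            (use le in \<open>auto intro!: AE_I2 order_trans[OF le abs_ge_self]\<close>)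
        show "cmod (\<integral>s. ?t s \<partial>lborel) \<le> (\<integral>s. ?h s \<partial>lborel)"
          by (rule Bochner_Integration.integral_norm_bound_integral[OF tint hint le])
      qed simp
      finally show "(\<integral>x. r x \<partial>lborel) \<le> C" .
    qed
    finally show ?thesis .
  qed
  then show ?thesis by blast
qed

text \<open>
  Each hyperplane \<open>x\<^sub>j = x\<^sub>k\<close> meets every line in the direction of the \<open>j\<close>-th coordinate axis in one point.
\<close>

lemma AE_vandermonde_nonzero: "AE x in lborel. vandermonde (x :: ('n::{finite,linorder}) rvector) \<noteq> 0"
proof -
  have "AE x in lborel. x \<notin> {x :: 'n rvector. x $ fst p = x $ snd p}" if "fst p < snd p" for p
  proof (rule AE_lborel_if_finite_on_lines[where b="axis (fst p) 1"])
    show "{x :: 'n rvector. x $ fst p = x $ snd p} \<in> sets borel"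
      by (intro borel_closed closed_Collect_eq continuous_intros)
    fix a :: "'n rvector"
    have "{t. a + t *\<^sub>R axis (fst p) 1 \<in> {x. x $ fst p = x $ snd p}} \<subseteq> {a $ snd p - a $ fst p}"
      using that by (auto simp: axis_def)
    then show "finite {t. a + t *\<^sub>R axis (fst p) 1 \<in> {x. x $ fst p = x $ snd p}}" by (rule finite_subset) simp
  qed
  then have "AE x in lborel. \<forall>p\<in>{p. fst p < snd p}. x \<notin> {x :: 'n rvector. x $ fst p = x $ snd p}"
    by (subst AE_ball_countable) auto
  then show ?thesis by eventually_elim (fastforce simp: vandermonde_def)
qed

text \<open>
  Every point of \<open>G\<close> is a Lebesgue point of the indicator of a ball around it inside \<open>G\<close>.
\<close>

lemma indicator_open_le_liminf_heat_mean:
  fixes G :: "('n::{finite,linorder}) rmatrix set" and A :: "'n rmatrix"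
  assumes "open G"
  defines "\<epsilon> \<equiv> \<lambda>m. 1 / (real m + 1)"
  shows "indicator G A \<le> liminf (\<lambda>m. \<integral>\<^sup>+y. indicator G y *
    ennreal (heat_norm TYPE('n) (\<epsilon> m) * exp (- (norm (herm_of_coords y - herm_of_coords A))\<^sup>2 / (4 * \<epsilon> m))) \<partial>lborel)"
proof (cases "A \<in> G")
  case True
  then obtain e where e: "0 < e" "ball A e \<subseteq> G" using assms(1) open_contains_ball by blast
  let ?F = "indicator (ball A e) :: 'n rmatrix \<Rightarrow> real"
  let ?k = "\<lambda>\<epsilon> y. exp (- (norm (herm_of_coords (y - A)))\<^sup>2 / (4 * \<epsilon>))"
  have [measurable]: "ball A e \<in> sets borel" "G \<in> sets borel" using assms(1) by auto
  have F: "integrable lborel ?F"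
    by (rule integrable_real_indicator) (simp_all add: emeasure_lborel_ball_finite[unfolded infinity_ennreal_def])
  have leb: "((\<lambda>r. (\<integral>y. indicator (cball A r) y * \<bar>?F y - ?F A\<bar> \<partial>lborel) / r ^ DIM('n rmatrix)) \<longlongrightarrow> 0) (at_right 0)"
  proof (rule tendsto_eventually, rule eventually_at_rightI[OF _ e(1)])
    fix r assume r: "r \<in> {0<..<e}"
    have "(\<lambda>y. indicator (cball A r) y * \<bar>?F y - ?F A\<bar>) = (\<lambda>y. 0)"
      using r e(1) by (auto simp: fun_eq_iff indicator_def)
    then show "(\<integral>y. indicator (cball A r) y * \<bar>?F y - ?F A\<bar> \<partial>lborel) / r ^ DIM('n rmatrix) = 0" by simp
  qed
  have pos: "0 < \<epsilon> m" for m by (simp add: \<epsilon>_def)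
  have hpos: "0 < heat_norm TYPE('n) (\<epsilon> m)" for m using pos[of m] by (simp add: heat_norm_def)
  have "filterlim \<epsilon> (at_right 0) sequentially" unfolding \<epsilon>_def by real_asymp
  from filterlim_compose[OF heat_kernel_tendsto_at_lebesgue_point[OF F leb] this]
  have "((\<lambda>m. ennreal (heat_norm TYPE('n) (\<epsilon> m) * (\<integral>y. ?F y * ?k (\<epsilon> m) y \<partial>lborel))) \<longlongrightarrow> ennreal (?F A)) sequentially"
    by (rule tendsto_ennrealI)
  then have "liminf (\<lambda>m. ennreal (heat_norm TYPE('n) (\<epsilon> m) * (\<integral>y. ?F y * ?k (\<epsilon> m) y \<partial>lborel))) = ennreal (?F A)"
    by (rule lim_imp_Liminf[rotated]) simp
  moreover have "ennreal (heat_norm TYPE('n) (\<epsilon> m) * (\<integral>y. ?F y * ?k (\<epsilon> m) y \<partial>lborel)) \<le> (\<integral>\<^sup>+y. indicator G y *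
      ennreal (heat_norm TYPE('n) (\<epsilon> m) * exp (- (norm (herm_of_coords y - herm_of_coords A))\<^sup>2 / (4 * \<epsilon> m))) \<partial>lborel)" for m
  proof -
    have int: "integrable lborel (\<lambda>y. heat_norm TYPE('n) (\<epsilon> m) * (?F y * ?k (\<epsilon> m) y))"
    proof (intro integrable_mult_right Bochner_Integration.integrable_bound[OF F])
      show "AE y in lborel. norm (?F y * ?k (\<epsilon> m) y) \<le> norm (?F y)"
        using pos[of m] by (intro AE_I2) (simp add: indicator_def)
    qed measurable
    have "ennreal (heat_norm TYPE('n) (\<epsilon> m) * (\<integral>y. ?F y * ?k (\<epsilon> m) y \<partial>lborel))
        = ennreal (\<integral>y. heat_norm TYPE('n) (\<epsilon> m) * (?F y * ?k (\<epsilon> m) y) \<partial>lborel)" by simp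
    also have "\<dots> = (\<integral>\<^sup>+y. ennreal (heat_norm TYPE('n) (\<epsilon> m) * (?F y * ?k (\<epsilon> m) y)) \<partial>lborel)"
      using hpos[of m] by (intro nn_integral_eq_integral[symmetric] int AE_I2) simp
    also have "\<dots> \<le> (\<integral>\<^sup>+y. indicator G y *
      ennreal (heat_norm TYPE('n) (\<epsilon> m) * exp (- (norm (herm_of_coords y - herm_of_coords A))\<^sup>2 / (4 * \<epsilon> m))) \<partial>lborel)"
      using e(2) by (intro nn_integral_mono) (auto simp: herm_of_coords_diff split: split_indicator)
    finally show ?thesis .
  qed
  ultimately have "ennreal (?F A) \<le> liminf (\<lambda>m. \<integral>\<^sup>+y. indicator G y *
      ennreal (heat_norm TYPE('n) (\<epsilon> m) * exp (- (norm (herm_of_coords y - herm_of_coords A))\<^sup>2 / (4 * \<epsilon> m))) \<partial>lborel)"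
    by (metis (no_types, lifting) Liminf_mono always_eventually)
  then show ?thesis using True e(1) by simp
qed simp

text \<open>
  The push-forward \<open>\<pi>\<close> of \<open>\<Delta>(x)\<^sup>2 exp (- \<bar>x\<bar>\<^sup>2) dx \<otimes> dU\<close> to the matrices is bounded by a multiple of Lebesgue measure on open sets,
  by Fatou's lemma and the bound for its heat means, hence on all Borel sets by outer regularity. So it does not charge \<open>B\<close>, and the
  density \<open>\<Delta>(x)\<^sup>2 exp (- \<bar>x\<bar>\<^sup>2)\<close> is positive almost everywhere.
\<close>

lemma AE_orbit_avoids_null:
  fixes B :: "('n::{finite,linorder}) rmatrix set"
  assumes B: "B \<in> null_sets lborel"
  shows "AE x in lborel. AE U in haar. herm_coords (U ** diag_matrix x ** conj_transpose U) \<notin> B"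
proof -
  interpret H: prob_space "haar :: 'n cmatrix measure" by (rule prob_space_haar)
  interpret LH: pair_sigma_finite "lborel :: 'n rvector measure" "haar :: 'n cmatrix measure" ..
  let ?LH = "(lborel :: 'n rvector measure) \<Otimes>\<^sub>M (haar :: 'n cmatrix measure)"
  interpret P: sigma_finite_measure ?LH ..
  interpret PL: pair_sigma_finite ?LH "lborel :: 'n rmatrix measure" ..
  obtain C where C: "\<And>\<epsilon> Z. 0 < \<epsilon> \<Longrightarrow> hermitian Z \<Longrightarrow>
    (\<integral>\<^sup>+x. ennreal ((vandermonde (x :: 'n rvector))\<^sup>2 * exp (- 1 * (norm x)\<^sup>2)) *
       (\<integral>\<^sup>+U. ennreal (heat_norm TYPE('n) \<epsilon> * exp (- (norm (Z - U ** diag_matrix x ** conj_transpose U))\<^sup>2 / (4 * \<epsilon>))) \<partial>haar) \<partial>lborel) \<le> ennreal C"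
    using heat_kernel_average_bounded[where 'n='n] by blast
  define \<epsilon> where "\<epsilon> m = 1 / (real m + 1)" for m
  have \<epsilon>: "0 < \<epsilon> m" for m by (simp add: \<epsilon>_def)
  \<comment> \<open>The squared Vandermonde determinant is the weight for which the heat means are bounded; the Gaussian makes it integrable.\<close>
  define w where "w x = ennreal ((vandermonde (x :: 'n rvector))\<^sup>2 * exp (- 1 * (norm x)\<^sup>2))" for x
  define orb where "orb p = snd p ** diag_matrix (fst p) ** conj_transpose (snd p)" for p :: "'n rvector \<times> 'n cmatrix"
  define \<Phi> where "\<Phi> p = herm_coords (orb p)" for p
  define K where "K m y p = ennreal (heat_norm TYPE('n) (\<epsilon> m) * exp (- (norm (herm_of_coords y - orb p))\<^sup>2 / (4 * \<epsilon> m)))" for m y p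
  have h\<Phi>: "herm_of_coords (\<Phi> p) = orb p" for p
    unfolding \<Phi>_def orb_def by (intro herm_of_coords_herm_coords hermitian_conjugate) simp
  have [measurable]: "snd \<in> ?LH \<rightarrow>\<^sub>M borel" by (rule measurable_compose[OF measurable_snd measurable_haar_id])
  have [measurable]: "fst \<in> ?LH \<rightarrow>\<^sub>M borel" by (rule measurable_compose[OF measurable_fst]) simp
  have orb_m[measurable]: "orb \<in> borel_measurable ?LH" unfolding orb_def by measurable
  have \<Phi>_m[measurable]: "\<Phi> \<in> borel_measurable ?LH" unfolding \<Phi>_def by measurable
  have w_m: "w \<in> borel_measurable borel" unfolding w_def by measurable
  have wf_m[measurable]: "(\<lambda>p. w (fst p)) \<in> borel_measurable ?LH" using w_m by (rule measurable_compose[rotated]) measurable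
  define N where "N = density ?LH (\<lambda>p. w (fst p))"
  have sN[measurable_cong]: "sets N = sets ?LH" by (simp add: N_def)
  define \<pi> where "\<pi> = distr N borel \<Phi>"
  have open_bound: "emeasure \<pi> G \<le> ennreal C * emeasure lborel G" if G: "open G" for G
  proof -
    have [measurable]: "G \<in> sets borel" using G by simp
    have K_m: "(\<lambda>q. indicator G (snd q) * K m (snd q) (fst q)) \<in> borel_measurable (?LH \<Otimes>\<^sub>M lborel)" for m
      unfolding K_def by measurable
    have g_m: "(\<lambda>p. \<integral>\<^sup>+y. indicator G y * K m y p \<partial>lborel) \<in> borel_measurable ?LH" for m
      using lborel.borel_measurable_nn_integral_fst[OF K_m[of m]] by simp
    have "emeasure \<pi> G = (\<integral>\<^sup>+p. indicator G (\<Phi> p) \<partial>N)"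
      by (simp add: \<pi>_def nn_integral_distr flip: nn_integral_indicator)
    also have "\<dots> \<le> (\<integral>\<^sup>+p. liminf (\<lambda>m. \<integral>\<^sup>+y. indicator G y * K m y p \<partial>lborel) \<partial>N)"
      using indicator_open_le_liminf_heat_mean[OF G, of "\<Phi> _"] by (intro nn_integral_mono) (simp only: h\<Phi> K_def \<epsilon>_def)
    also have "\<dots> \<le> liminf (\<lambda>m. \<integral>\<^sup>+p. (\<integral>\<^sup>+y. indicator G y * K m y p \<partial>lborel) \<partial>N)"
      using g_m by (intro nn_integral_liminf) (simp add: N_def)
    also have "\<dots> \<le> ennreal C * emeasure lborel G"
    proof (rule order_trans[OF Liminf_mono[OF always_eventually] eq_refl[OF Liminf_const]], rule allI)
      fix m
      have "(\<integral>\<^sup>+p. (\<integral>\<^sup>+y. indicator G y * K m y p \<partial>lborel) \<partial>N)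
          = (\<integral>\<^sup>+p. w (fst p) * (\<integral>\<^sup>+y. indicator G y * K m y p \<partial>lborel) \<partial>?LH)"
        unfolding N_def by (rule nn_integral_density[OF wf_m g_m])
      also have "\<dots> = (\<integral>\<^sup>+p. (\<integral>\<^sup>+y. w (fst p) * (indicator G y * K m y p) \<partial>lborel) \<partial>?LH)"
        using measurable_compose[OF measurable_Pair1' K_m[of m]] by (intro nn_integral_cong nn_integral_cmult[symmetric]) simp
      also have "\<dots> = (\<integral>\<^sup>+y. (\<integral>\<^sup>+p. w (fst p) * (indicator G y * K m y p) \<partial>?LH) \<partial>lborel)"
      proof -
        have "(\<lambda>(p, y). w (fst p) * (indicator G y * K m y p)) \<in> borel_measurable (?LH \<Otimes>\<^sub>M lborel)"
          using K_m[of m] measurable_compose[OF measurable_fst wf_m, of lborel]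
          unfolding case_prod_unfold by (rule borel_measurable_times_ennreal[rotated])
        from PL.Fubini'[OF this] show ?thesis by simp
      qed
      also have "\<dots> \<le> (\<integral>\<^sup>+y. ennreal C * indicator G y \<partial>lborel)"
      proof (rule nn_integral_mono)
        fix y :: "'n rmatrix"
        have Ky: "(\<lambda>p. w (fst p) * K m y p) \<in> borel_measurable ?LH" unfolding K_def by measurable
        have "(\<integral>\<^sup>+p. w (fst p) * (indicator G y * K m y p) \<partial>?LH) = (\<integral>\<^sup>+p. indicator G y * (w (fst p) * K m y p) \<partial>?LH)"
          by (simp add: mult_ac)
        also have "\<dots> = indicator G y * (\<integral>\<^sup>+p. w (fst p) * K m y p \<partial>?LH)"
          by (rule nn_integral_cmult[OF Ky])
        also have "(\<integral>\<^sup>+p. w (fst p) * K m y p \<partial>?LH) = (\<integral>\<^sup>+x. (\<integral>\<^sup>+U. w x * K m y (x, U) \<partial>haar) \<partial>lborel)"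
          using H.nn_integral_fst[OF Ky] by simp
        also have "\<dots> = (\<integral>\<^sup>+x. w x * (\<integral>\<^sup>+U. K m y (x, U) \<partial>haar) \<partial>lborel)"
        proof (intro nn_integral_cong nn_integral_cmult)
          fix x :: "'n rvector"
          have "K m y \<in> borel_measurable ?LH" unfolding K_def by measurable
          from measurable_compose[OF measurable_Pair1' this]
          show "(\<lambda>U. K m y (x, U)) \<in> borel_measurable haar" by simp
        qed
        also have "\<dots> \<le> ennreal C"
          unfolding w_def K_def orb_def fst_conv snd_conv by (rule C[OF \<epsilon> hermitian_herm_of_coords])
        finally show "(\<integral>\<^sup>+p. w (fst p) * (indicator G y * K m y p) \<partial>?LH) \<le> ennreal C * indicator G y"
          by (auto split: split_indicator)
      qed
      also have "\<dots> = ennreal C * emeasure lborel G" by (subst nn_integral_cmult) auto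
      finally show "(\<integral>\<^sup>+p. (\<integral>\<^sup>+y. indicator G y * K m y p \<partial>lborel) \<partial>N) \<le> ennreal C * emeasure lborel G" .
    qed simp
    finally show ?thesis .
  qed
  have B': "B \<in> sets borel" "emeasure lborel B = 0" using B by auto
  have "emeasure \<pi> B \<le> 0"
  proof (rule ennreal_le_epsilon)
    fix \<delta> :: real assume \<delta>: "0 < \<delta>"
    \<comment> \<open>Chosen so that \<open>\<bar>C\<bar> e \<le> \<delta>\<close>, also when \<open>C = 0\<close>.\<close>
    define e where "e = \<delta> / (\<bar>C\<bar> + 1)"
    have e: "0 < e" using \<delta> by (simp add: e_def)
    obtain G where G: "open G" "B \<subseteq> G" "emeasure lborel (G - B) < ennreal e"
      using outer_regular_lborel[of B e] B' e by auto
    have "emeasure lborel G \<le> emeasure lborel (G - B) + emeasure lborel B"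
      using G(1,2) B'(1) by (subst plus_emeasure) (auto intro!: emeasure_mono)
    then have "emeasure lborel G \<le> ennreal e" using G(3) B'(2) by simp
    then have "ennreal C * emeasure lborel G \<le> ennreal \<bar>C\<bar> * ennreal e" by (intro mult_mono ennreal_leI) auto
    also have "\<dots> \<le> ennreal \<delta>"
      using \<delta> by (simp add: e_def field_simps flip: ennreal_mult')
    finally have "ennreal C * emeasure lborel G \<le> ennreal \<delta>" .
    moreover have "emeasure \<pi> B \<le> emeasure \<pi> G" using G by (intro emeasure_mono) (auto simp: \<pi>_def)
    ultimately show "emeasure \<pi> B \<le> 0 + ennreal \<delta>" using open_bound[OF G(1)] by simp
  qed
  then have "B \<in> null_sets \<pi>" using B'(1) by (simp add: null_sets_def \<pi>_def)
  then have "AE A in \<pi>. A \<notin> B" by (rule AE_not_in)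
  then have "AE p in N. \<Phi> p \<notin> B"
    unfolding \<pi>_def by (subst (asm) AE_distr_iff) (use B'(1) in \<open>auto simp: N_def\<close>)
  then have "AE p in ?LH. 0 < w (fst p) \<longrightarrow> \<Phi> p \<notin> B"
    unfolding N_def by (subst (asm) AE_density[OF wf_m])
  then have "AE x in lborel. AE U in haar. 0 < w (fst (x, U)) \<longrightarrow> \<Phi> (x, U) \<notin> B"
    by (rule LH.AE_pair)
  with AE_vandermonde_nonzero show ?thesis
    by eventually_elim (simp add: w_def \<Phi>_def orb_def)
qed

section \<open>The inversion formula\<close>

lemma borel_measurable_if_ennreal:
  fixes f :: "('n::{finite,linorder}) cmatrix \<Rightarrow> real"
  assumes f0: "\<And>Z. hermitian Z \<Longrightarrow> 0 \<le> f Z" and m: "(\<lambda>Z. ennreal (f Z)) \<in> borel_measurable herm_lborel"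
  shows "f \<in> borel_measurable herm_lborel"
proof -
  have "(\<lambda>Z. enn2real (ennreal (f Z))) \<in> borel_measurable herm_lborel" using m by measurable
  then show ?thesis by (subst (asm) measurable_cong[where g=f]) (auto simp: f0)
qed

text \<open>
  At a Lebesgue point of the density, expressed in coordinates, the heat means converge to its value.
\<close>

lemma AE_heat_mean_tendsto_density:
  fixes f :: "('n::{finite,linorder}) cmatrix \<Rightarrow> real"
  assumes f0: "\<And>Z. hermitian Z \<Longrightarrow> 0 \<le> f Z"
    and m: "(\<lambda>Z. ennreal (f Z)) \<in> borel_measurable herm_lborel"
    and p: "prob_space (density herm_lborel (\<lambda>Z. ennreal (f Z)))"
  shows "AE A in lborel. ((\<lambda>\<epsilon>. heat_norm TYPE('n) \<epsilon> * heat_mean (density herm_lborel (\<lambda>Z. ennreal (f Z))) \<epsilon> (herm_of_coords A))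
    \<longlongrightarrow> f (herm_of_coords A)) (at_right 0)"
proof -
  interpret prob_space "density herm_lborel (\<lambda>Z. ennreal (f Z))" by fact
  have fm: "f \<in> borel_measurable herm_lborel" by (rule borel_measurable_if_ennreal[OF f0 m])
  define F where "F A = f (herm_of_coords A)" for A
  have Fm: "F \<in> borel_measurable lborel"
    unfolding F_def by (rule measurable_compose[OF measurable_herm_of_coords' fm])
  have "(\<integral>\<^sup>+A. ennreal (F A) \<partial>lborel) = (\<integral>\<^sup>+Z. ennreal (f Z) \<partial>herm_lborel)"
    unfolding F_def by (subst herm_lborel_eq_distr, rule nn_integral_distr[symmetric]) (use m measurable_herm_of_coords' in auto)
  also have "\<dots> = emeasure (density herm_lborel (\<lambda>Z. ennreal (f Z))) (space herm_lborel)"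
    by (subst emeasure_density[OF m sets.top]) (auto intro!: nn_integral_cong)
  also have "\<dots> = 1" using emeasure_space_1 by simp
  finally have int: "integrable lborel F"
    using Fm by (intro integrableI_nonneg) (auto simp: F_def f0)
  have hm: "heat_mean (density herm_lborel (\<lambda>Z. ennreal (f Z))) \<epsilon> (herm_of_coords A)
      = (\<integral>y. F y * exp (- (norm (herm_of_coords (y - A)))\<^sup>2 / (4 * \<epsilon>)) \<partial>lborel)" for \<epsilon> A
  proof -
    let ?e = "\<lambda>Z. exp (- (norm (herm_of_coords A - Z))\<^sup>2 / (4 * \<epsilon>))"
    have em: "?e \<in> borel_measurable herm_lborel" by (rule measurable_from_herm_lborel) measurable
    have "heat_mean (density herm_lborel (\<lambda>Z. ennreal (f Z))) \<epsilon> (herm_of_coords A) = (\<integral>Z. f Z *\<^sub>R ?e Z \<partial>herm_lborel)"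
      unfolding heat_mean_def by (rule integral_density) (use em fm f0 in auto)
    also have "\<dots> = (\<integral>y. f (herm_of_coords y) *\<^sub>R ?e (herm_of_coords y) \<partial>lborel)"
      by (subst herm_lborel_eq_distr, rule integral_distr[OF measurable_herm_of_coords']) (use em fm in measurable)
    finally show ?thesis by (simp add: F_def herm_of_coords_diff norm_minus_commute)
  qed
  show ?thesis
    using lebesgue_points[OF int]
  proof eventually_elim
    case (elim A)
    show ?case unfolding hm using heat_kernel_tendsto_at_lebesgue_point[OF int elim] by (simp add: F_def)
  qed
qed

lemma spherical_transform_eq_integral_spherical_neg:
  fixes f :: "('n::{finite,linorder}) cmatrix \<Rightarrow> real"
  assumes f0: "\<And>Z. hermitian Z \<Longrightarrow> 0 \<le> f Z"
    and m: "(\<lambda>Z. ennreal (f Z)) \<in> borel_measurable herm_lborel"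
  shows "spherical_transform f s = (\<integral>Z. spherical_neg s Z \<partial>density herm_lborel (\<lambda>Z. ennreal (f Z)))"
proof -
  have fm: "f \<in> borel_measurable herm_lborel" by (rule borel_measurable_if_ennreal[OF f0 m])
  have sm: "spherical_neg s \<in> borel_measurable herm_lborel" by (rule measurable_from_herm_lborel) measurable
  have "spherical_transform f s = (\<integral>Z. f Z *\<^sub>R spherical_neg s Z \<partial>herm_lborel)"
    unfolding spherical_transform_def
    by (rule Bochner_Integration.integral_cong[OF refl]) (simp add: spherical_function_uminus scaleR_conv_of_real)
  also have "\<dots> = (\<integral>Z. spherical_neg s Z \<partial>density herm_lborel (\<lambda>Z. ennreal (f Z)))"
    by (rule integral_density[symmetric]) (use sm fm f0 in auto)
  finally show ?thesis .
qed

theorem theorem1p1: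
  fixes X Y :: "'w \<Rightarrow> ('n::{finite,linorder}) cmatrix"
    and f\<^sub>X f\<^sub>Y f\<^sub>X\<^sub>Y :: "'n cmatrix \<Rightarrow> real"
  assumes "prob_space M"
    and "prob_space.indep_var M herm_lborel X herm_lborel Y"
    and "\<And>Z. hermitian Z \<Longrightarrow> 0 \<le> f\<^sub>X Z"
    and "\<And>Z. hermitian Z \<Longrightarrow> 0 \<le> f\<^sub>Y Z"
    and "\<And>Z. hermitian Z \<Longrightarrow> 0 \<le> f\<^sub>X\<^sub>Y Z"
    and "distributed M herm_lborel X (\<lambda>Z. ennreal (f\<^sub>X Z))"
    and "distributed M herm_lborel Y (\<lambda>Z. ennreal (f\<^sub>Y Z))"
    and "distributed M herm_lborel (\<lambda>\<omega>. X \<omega> + Y \<omega>) (\<lambda>Z. ennreal (f\<^sub>X\<^sub>Y Z))"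
    and "unitarily_invariant f\<^sub>X"
    and "unitarily_invariant f\<^sub>Y"
  shows "(\<forall>s. spherical_transform f\<^sub>X\<^sub>Y s = spherical_transform f\<^sub>X s * spherical_transform f\<^sub>Y s) \<and>
    (let inversion_formula = (\<lambda>(x :: 'n rvector) (v :: real). \<exists>J.
           has_fourier_integral
             (\<lambda>s :: 'n rvector. spherical_transform f\<^sub>X s * spherical_transform f\<^sub>Y s *
                det ((\<chi> j k. exp (\<i> * complex_of_real (s $ j * x $ k))) :: 'n cmatrix) *
                complex_of_real (vandermonde s)) J \<and>
           complex_of_real v =
             (complex_of_real pi * \<i>) powi (- int (CARD('n) * (CARD('n) - 1) div 2)) /
             ((2 * complex_of_real pi) ^ CARD('n) * fact CARD('n) *
                complex_of_real (vandermonde x)) * J)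
     in (AE Z in herm_lborel. \<forall>x. eigenvalues Z x \<longrightarrow> inversion_formula x (f\<^sub>X\<^sub>Y Z)) \<and>
        (unitarily_invariant f\<^sub>X\<^sub>Y \<longrightarrow>
           (AE x in lborel. inversion_formula x (f\<^sub>X\<^sub>Y (diag_matrix x)))))"
proof -
  let ?N = "herm_lborel :: 'n cmatrix measure"
  let ?\<mu> = "density ?N (\<lambda>Z. ennreal (f\<^sub>X\<^sub>Y Z))"
  interpret M: prob_space M by fact
  have dX: "distr M ?N X = density ?N (\<lambda>Z. ennreal (f\<^sub>X Z))" and mX: "(\<lambda>Z. ennreal (f\<^sub>X Z)) \<in> borel_measurable ?N"
    and Xm: "X \<in> M \<rightarrow>\<^sub>M ?N"
    using assms(6) by (auto simp: distributed_def)
  have dY: "distr M ?N Y = density ?N (\<lambda>Z. ennreal (f\<^sub>Y Z))" and mY: "(\<lambda>Z. ennreal (f\<^sub>Y Z)) \<in> borel_measurable ?N"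
    and Ym: "Y \<in> M \<rightarrow>\<^sub>M ?N"
    using assms(7) by (auto simp: distributed_def)
  have dXY: "distr M ?N (\<lambda>\<omega>. X \<omega> + Y \<omega>) = ?\<mu>" and mXY: "(\<lambda>Z. ennreal (f\<^sub>X\<^sub>Y Z)) \<in> borel_measurable ?N"
    and XYm: "(\<lambda>\<omega>. X \<omega> + Y \<omega>) \<in> M \<rightarrow>\<^sub>M ?N"
    using assms(8) by (auto simp: distributed_def)
  have iX: "invariant_law (distr M ?N X)"
    unfolding dX by (rule invariant_law_density[OF assms(9) mX]) (use M.prob_space_distr[OF Xm] dX in simp)
  have iY: "invariant_law (distr M ?N Y)"
    unfolding dY by (rule invariant_law_density[OF assms(10) mY]) (use M.prob_space_distr[OF Ym] dY in simp)
  have iXY: "invariant_law ?\<mu>"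
    using invariant_law_add[OF assms(1,2) iX iY] unfolding dXY .
  have tX: "spherical_transform f\<^sub>X s = (\<integral>Z. spherical_neg s Z \<partial>distr M ?N X)" for s
    unfolding dX by (rule spherical_transform_eq_integral_spherical_neg[OF assms(3) mX])
  have tY: "spherical_transform f\<^sub>Y s = (\<integral>Z. spherical_neg s Z \<partial>distr M ?N Y)" for s
    unfolding dY by (rule spherical_transform_eq_integral_spherical_neg[OF assms(4) mY])
  have tXY: "spherical_transform f\<^sub>X\<^sub>Y s = (\<integral>Z. spherical_neg s Z \<partial>?\<mu>)" for s
    by (rule spherical_transform_eq_integral_spherical_neg[OF assms(5) mXY])
  have prod: "spherical_transform f\<^sub>X s * spherical_transform f\<^sub>Y s = (\<integral>Z. spherical_neg s Z \<partial>?\<mu>)" for s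
    unfolding tX tY integral_spherical_neg_add[OF assms(1,2) iX iY, symmetric] dXY ..
  \<comment> \<open>The exceptional null set lives on the matrices; below it is transported to the eigenvalues in two ways.\<close>
  have lim: "AE A in lborel. ((\<lambda>\<epsilon>. heat_norm TYPE('n) \<epsilon> * heat_mean ?\<mu> \<epsilon> (herm_of_coords A)) \<longlongrightarrow> f\<^sub>X\<^sub>Y (herm_of_coords A)) (at_right 0)"
    by (rule AE_heat_mean_tendsto_density[OF assms(5) mXY invariant_lawD(1)[OF iXY]])
  define inversion_formula where "inversion_formula x v \<longleftrightarrow> (\<exists>J.
           has_fourier_integral
             (\<lambda>s :: 'n rvector. (\<integral>Z. spherical_neg s Z \<partial>?\<mu>) *
                det ((\<chi> j k. exp (\<i> * complex_of_real (s $ j * x $ k))) :: 'n cmatrix) *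
                complex_of_real (vandermonde s)) J \<and>
           complex_of_real v =
             (complex_of_real pi * \<i>) powi (- int (CARD('n) * (CARD('n) - 1) div 2)) /
             ((2 * complex_of_real pi) ^ CARD('n) * fact CARD('n) *
                complex_of_real (vandermonde x)) * J)" for x :: "'n rvector" and v
  have inversion: "inversion_formula x (f\<^sub>X\<^sub>Y Z)"
    if lim: "((\<lambda>\<epsilon>. heat_norm TYPE('n) \<epsilon> * heat_mean ?\<mu> \<epsilon> Z) \<longlongrightarrow> f\<^sub>X\<^sub>Y Z) (at_right 0)"
      and U: "unitary U" "U ** Z ** conj_transpose U = diag_matrix x" and x: "vandermonde x \<noteq> 0" for U Z x
    unfolding inversion_formula_def
  proof (rule inversion_formula_if_heat_mean_tendsto[OF iXY x])
    show "((\<lambda>\<epsilon>. heat_norm TYPE('n) \<epsilon> * heat_mean ?\<mu> \<epsilon> (diag_matrix x)) \<longlongrightarrow> f\<^sub>X\<^sub>Y Z) (at_right 0)"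
      unfolding U(2)[symmetric] heat_mean_conjugate[OF iXY U(1)] by (rule lim)
  qed
  have "AE Z in ?N. ((\<lambda>\<epsilon>. heat_norm TYPE('n) \<epsilon> * heat_mean ?\<mu> \<epsilon> Z) \<longlongrightarrow> f\<^sub>X\<^sub>Y Z) (at_right 0)"
    using lim by (rule AE_herm_lborelI)
  moreover have "AE Z in ?N. hermitian Z" by (rule AE_I2) simp
  ultimately have matrix: "AE Z in ?N. \<forall>x. eigenvalues Z x \<longrightarrow> inversion_formula x (f\<^sub>X\<^sub>Y Z)"
    using AE_distinct_eigenvalues
  proof eventually_elim
    case (elim Z)
    show ?case
    proof (intro allI impI)
      fix x assume x: "eigenvalues Z x"
      obtain U where "unitary U" "U ** Z ** conj_transpose U = diag_matrix x"
        using diagonalize_with_eigenvalues[OF elim(2) x] by blast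
      then show "inversion_formula x (f\<^sub>X\<^sub>Y Z)" using inversion elim(1,3) x by blast
    qed
  qed
  have diagonal: "AE x in lborel. inversion_formula x (f\<^sub>X\<^sub>Y (diag_matrix x))" if f: "unitarily_invariant f\<^sub>X\<^sub>Y"
  proof -
    \<comment> \<open>For almost every \<open>x\<close> some matrix on the orbit of \<open>x\<close> lies outside the exceptional set \<open>B\<close>, and both the density and its heat
      means are constant on the orbit.\<close>
    obtain B where B: "B \<in> null_sets lborel"
      "{A. \<not> ((\<lambda>\<epsilon>. heat_norm TYPE('n) \<epsilon> * heat_mean ?\<mu> \<epsilon> (herm_of_coords A)) \<longlongrightarrow> f\<^sub>X\<^sub>Y (herm_of_coords A)) (at_right 0)} \<subseteq> B"
      using lim by (auto elim!: AE_E simp: null_sets_def)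
    show ?thesis
      using AE_orbit_avoids_null[OF B(1)] AE_vandermonde_nonzero
    proof eventually_elim
      case (elim x)
      interpret H: prob_space "haar :: 'n cmatrix measure" by (rule prob_space_haar)
      have "AE U in haar. unitary (U :: 'n cmatrix)" by (rule AE_I2) (simp add: space_haar)
      with elim(1) have "AE U in haar. unitary U \<and> herm_coords (U ** diag_matrix x ** conj_transpose U) \<notin> B"
        by eventually_elim simp
      then have "\<exists>U. unitary U \<and> herm_coords (U ** diag_matrix x ** conj_transpose U) \<notin> B"
        by (rule eventually_happens'[rotated]) (rule H.ae_filter_bot)
      then obtain U where U: "unitary U" "herm_coords (U ** diag_matrix x ** conj_transpose U) \<notin> B" by blast
      let ?Z = "U ** diag_matrix x ** conj_transpose U"
      have h: "herm_of_coords (herm_coords ?Z) = ?Z" by (intro herm_of_coords_herm_coords hermitian_conjugate) simp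
      have fZ: "f\<^sub>X\<^sub>Y ?Z = f\<^sub>X\<^sub>Y (diag_matrix x)" using f U(1) by (simp add: unitarily_invariant_def)
      have "((\<lambda>\<epsilon>. heat_norm TYPE('n) \<epsilon> * heat_mean ?\<mu> \<epsilon> (herm_of_coords (herm_coords ?Z)))
          \<longlongrightarrow> f\<^sub>X\<^sub>Y (herm_of_coords (herm_coords ?Z))) (at_right 0)"
        using B(2) U(2) by blast
      then have lim': "((\<lambda>\<epsilon>. heat_norm TYPE('n) \<epsilon> * heat_mean ?\<mu> \<epsilon> (diag_matrix x)) \<longlongrightarrow> f\<^sub>X\<^sub>Y (diag_matrix x)) (at_right 0)"
        unfolding h fZ heat_mean_conjugate[OF iXY U(1)] .
      show ?case
        unfolding inversion_formula_def by (rule inversion_formula_if_heat_mean_tendsto[OF iXY elim(2) lim'])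
    qed
  qed
  show ?thesis
    unfolding Let_def prod tXY inversion_formula_def[symmetric] using matrix diagonal by simp
qed

end
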